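(* Let $\sigma,\tau\in\mathbb{R}$, let $i,j\in\frac12\mathbb{Z}$ with $i-j\in\mathbb{Z}$, put $m=\max(|i|,|j|)$ and let $l$ satisfy $l-m\in\mathbb{Z}_+$. With $$d^l_{i,j}(\tau,\sigma)=\frac{C^{l,j}(\sigma)\,C^{l,i}(\tau)}{C^{i,j}(\sigma)\,C^{i,i}(\tau)}\;\frac{q^{i-l}}{(q^{4l};q^{-2})_{l-i}}$$ the following identities hold in $\mathcal{A}$. (i) If $m=i$, i.e. $-i\le j\le i$: $$b^l_{i,j}(\tau,\sigma)=d^l_{i,j}(\tau,\sigma)\,b^i_{i,j}(\tau,\sigma)\,p^{(i-j,i+j)}_{l-i}(\rho_{\tau,\sigma};q^\tau,q^\sigma\mid q^2).$$ (ii) If $m=j$, i.e. $-j\le i\le j$: $$b^l_{i,j}(\tau,\sigma)=d^l_{j,i}(\sigma,\tau)\,b^j_{i,j}(\tau,\sigma)\,p^{(j-i,i+j)}_{l-j}(\rho_{\tau,\sigma};q^\sigma,q^\tau\mid q^2).$$ (iii) If $m=-i$, i.e. $i\le j\le -i$: $$b^l_{i,j}(\tau,\sigma)=d^l_{-i,-j}(-\tau,-\sigma)\,b^{-i}_{i,j}(\tau,\sigma)\,p^{(j-i,-i-j)}_{l+i}(\rho_{\tau,\sigma};q^{-\tau},q^{-\sigma}\mid q^2).$$ (iv) If $m=-j$, i.e. $j\le i\le -j$: $$b^l_{i,j}(\tau,\sigma)=d^l_{-j,-i}(-\sigma,-\tau)\,b^{-j}_{i,j}(\tau,\sigma)\,p^{(i-j,-i-j)}_{l+j}(\rho_{\tau,\sigma};q^{-\sigma},q^{-\tau}\mid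 q^2).$$
   Context: Fix $0<q<1$; $\mathbb{Z}_+=\{0,1,2,\dots\}$, $\frac12\mathbb{Z}_+=\{0,\frac12,1,\dots\}$. Notation: $(a;p)_k=\prod_{r=0}^{k-1}(1-ap^r)$ for any base $p$, $(a_1,\dots,a_s;p)_k=\prod_r(a_r;p)_k$, $\left[{n\atop k}\right]_{p}=(p^n;p^{-1})_k/(p;p)_k$, and ${}_{r+1}\varphi_r\left({a_1,\dots,a_{r+1}\atop b_1,\dots,b_r};p,z\right)=\sum_{k\ge0}\frac{(a_1,\dots,a_{r+1};p)_k}{(b_1,\dots,b_r,p;p)_k}z^k$; if $p^{-N}$ is a lower parameter and $p^{-n}$, $0\le n\le N$, an upper one, the series is the terminating sum up to $k=n$. Quantum group. $\mathcal{A}=\mathcal{A}_q(SU(2))$ is the complex unital algebra generated by $\alpha,\beta,\gamma,\delta$ with relations $\alpha\beta=q\beta\alpha$, $\alpha\gamma=q\gamma\alpha$, $\beta\delta=q\delta\beta$, $\gamma\delta=q\delta\gamma$, $\beta\gamma=\gamma\beta$, $\alpha\delta-q\beta\gamma=\delta\alpha-q^{-1}\beta\gamma=1$; its comultiplication is $\Delta(\alpha)=\alpha\otimes\alpha+\beta\otimes\gamma$, $\Delta(\beta)=\alpha\otimes\beta+\beta\otimes\delta$, $\Delta(\gamma)=\gamma\otimes\alpha+\delta\otimes\gamma$, $\Delta(\delta)=\gamma\otimes\beta+\delta\otimes\delta$, and its counit is $\varepsilon(\alpha)=\varepsilon(\delta)=1$, $\varepsilon(\beta)=\varepsilon(\gamma)=0$.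 $\mathcal{U}=\mathcal{U}_q(\mathfrak{su}(2))$ is the complex unital algebra generated by $A,B,C,D$ with $AD=DA=1$, $AB=qBA$, $AC=q^{-1}CA$, $BC-CB=(A^2-D^2)/(q-q^{-1})$; $\Delta(A)=A\otimes A$, $\Delta(D)=D\otimes D$, $\Delta(B)=A\otimes B+B\otimes D$, $\Delta(C)=A\otimes C+C\otimes D$; $\varepsilon(A)=\varepsilon(D)=1$, $\varepsilon(B)=\varepsilon(C)=0$. They are in (doubly non-degenerate) duality by the pairing with $\langle XY,\xi\rangle=\langle X\otimes Y,\Delta(\xi)\rangle$, $\langle X,\xi\eta\rangle=\langle\Delta(X),\xi\otimes\eta\rangle$, $\langle 1,\xi\rangle=\varepsilon(\xi)$, $\langle X,1\rangle=\varepsilon(X)$, whose only nonzero values on pairs of generators are $\langle A,\alpha\rangle=\langle D,\delta\rangle=q^{1/2}$, $\langle A,\delta\rangle=\langle D,\alpha\rangle=q^{-1/2}$, $\langle B,\beta\rangle=\langle C,\gamma\rangle=1$. Representations. For $l\in\frac12\mathbb{Z}_+$, $t^l$ is the representation of $\mathcal{U}$ on a $(2l+1)$-dimensional space with orthonormal basis $e^l_n$, $n=-l,-l+1,\dots,l$: $t^l(A)e^l_n=q^{-n}e^l_n$, $t^l(D)e^l_n=q^ne^l_n$, $t^l(B)e^l_n=\frac{\sqrt{(q^{-l+n-1}-q^{l-n+1})(q^{-l-n}-q^{l+n})}}{q^{-1}-q}e^l_{n-1}$, $t^l(C)e^l_n=\frac{\sqrt{(q^{-l+n}-q^{l-n})(q^{-l-n-1}-q^{l+n+1})}}{q^{-1}-q}e^l_{n+1}$.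 The elements $t^l_{n,m}\in\mathcal{A}$ are determined by $\langle X,t^l_{n,m}\rangle=\langle t^l(X)e^l_m,e^l_n\rangle$ for all $X\in\mathcal{U}$ (inner products are linear in the first variable). Vectors. For $\sigma\in\mathbb{R}$, $j,n\in\{-l,-l+1,\dots,l\}$, $$C^{l,j}(\sigma)=q^{l+j}\left[{2l\atop l-j}\right]_{q^2}^{1/2}\Big(\frac{1+q^{-4j-2\sigma}}{1+q^{-2\sigma}}\Big)^{1/2}\Big((-q^{2-2\sigma};q^2)_{l-j}(-q^{2+2\sigma};q^2)_{l+j}\Big)^{-1/2},$$ $$v^{l,j}_n(\sigma)=C^{l,j}(\sigma)\,\mathrm{i}^{\,n-l}q^{\sigma(l-n)}q^{\frac12(l-n)(l-n-1)}\Big(\frac{(q^{4l};q^{-2})_{l-n}}{(q^2;q^2)_{l-n}}\Big)^{1/2}{}_3\varphi_2\left({q^{-2(l-n)},q^{-2(l-j)},-q^{-2l-2j-2\sigma}\atop q^{-4l},0};q^2,q^2\right),$$ with $\mathrm{i}=\sqrt{-1}$. Put $$b^l_{i,j}(\tau,\sigma)=\sum_{n,m=-l}^l v^{l,j}_m(\sigma)\,\overline{v^{l,i}_n(\tau)}\,q^{-m}\,t^l_{n,m}\in\mathcal{A}.$$ The element $\rho_{\tau,\sigma}\in\mathcal{A}$ is $$\rho_{\tau,\sigma}=\tfrac12\big(\alpha^2+\delta^2+q\gamma^2+q^{-1}\beta^2+\mathrm{i}(q^{-\sigma}-q^{\sigma})(q\delta\gamma+\beta\alpha)-\mathrm{i}(q^{-\tau}-q^{\tau})(\delta\beta+q\gamma\alpha)+(q^{-\sigma}-q^\sigma)(q^{-\tau}-q^\tau)\beta\gamma\big).$$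 Askey-Wilson polynomials: for $x=\frac12(z+z^{-1})$, $p_n(x;a,b,c,d\mid q)=a^{-n}(ab,ac,ad;q)_n\,{}_4\varphi_3\left({q^{-n},abcdq^{n-1},az,a/z\atop ab,ac,ad};q,q\right)$, and $$p_n^{(\mu,\nu)}(x;s,t\mid q)=p_n(x;q^{1/2}t/s,\,q^{1/2+\mu}s/t,\,-q^{1/2}/(st),\,-stq^{1/2+\nu}\mid q);$$ $p_n^{(\mu,\nu)}(x;s,t\mid q^2)$ means that $q$ is replaced by $q^2$ in this definition. *)

theory Defs
  imports
    Complex_Main
    "HOL-Algebra.QuotRing"
    "HOL-Library.Poly_Mapping"
    "HOL-Library.Product_Plus"
    "HOL-Computational_Algebra.Polynomial"
begin

section \<open>Algebras given by generators and relations\<close>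

text \<open>
  Words form a monoid under concatenation, written additively because
  \<^type>\<open>poly_mapping\<close> equips the finitely supported functions on an additive (not necessarily
  commutative) monoid with the convolution product. So \<open>'g falg\<close> below is the free complex
  unital algebra on the set \<open>'g\<close> of generators, and \<open>('g list \<times> 'g list) \<Rightarrow>\<^sub>0 complex\<close>, with the
  product monoid of \<open>HOL-Library.Product_Plus\<close>, is its tensor square.
\<close>

instantiation list :: (type) monoid_add
begin
definition zero_list :: "'a list" where "zero_list = []"
definition plus_list :: "'a list \<Rightarrow> 'a list \<Rightarrow> 'a list" where "plus_list = (@)"
instance by standard (simp_all add: zero_list_def plus_list_def)
end

type_synonym 'g falg = "'g list \<Rightarrow>\<^sub>0 complex"
type_synonym 'g falg2 = "('g list \<times> 'g list) \<Rightarrow>\<^sub>0 complex"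

definition scal :: "complex \<Rightarrow> ('m::monoid_add \<Rightarrow>\<^sub>0 complex)" where
  "scal c = Poly_Mapping.single 0 c"

definition gen :: "'g \<Rightarrow> 'g falg" where
  "gen g = Poly_Mapping.single [g] 1"

definition tens :: "'g falg \<Rightarrow> 'g falg \<Rightarrow> 'g falg2" where
  "tens x y = (\<Sum>u\<in>Poly_Mapping.keys x. \<Sum>v\<in>Poly_Mapping.keys y.
     Poly_Mapping.single (u, v) (Poly_Mapping.lookup x u * Poly_Mapping.lookup y v))"

text \<open>
  The algebra homomorphism out of the free algebra that sends each generator \<open>g\<close> to \<open>f g\<close>;
  the argument \<open>s\<close> is the unit map of the complex algebra \<open>'r\<close>.
\<close>

definition falg_hom :: "(complex \<Rightarrow> 'r::ring_1) \<Rightarrow> ('g \<Rightarrow> 'r) \<Rightarrow> 'g falg \<Rightarrow> 'r" where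
  "falg_hom s f x = (\<Sum>w\<in>Poly_Mapping.keys x. s (Poly_Mapping.lookup x w) * prod_list (map f w))"

definition falg_ring :: "'g falg ring" where
  "falg_ring = \<lparr>carrier = UNIV, monoid.mult = (*), one = 1, zero = 0, add = (+)\<rparr>"

text \<open>Relations are given as the elements of the free algebra that are set to zero.\<close>

definition rel_ideal :: "'g falg set \<Rightarrow> 'g falg set" where
  "rel_ideal S = Idl\<^bsub>falg_ring\<^esub> S"

definition presented :: "'g falg set \<Rightarrow> 'g falg set ring" where
  "presented S = falg_ring Quot (rel_ideal S)"

definition cls :: "'g falg set \<Rightarrow> 'g falg \<Rightarrow> 'g falg set" where
  "cls S x = rel_ideal S +>\<^bsub>falg_ring\<^esub> x"


section \<open>The quantum group, the quantized enveloping algebra and their duality\<close>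

datatype agen = Ga | Gb | Gc | Gd
datatype ugen = UA | UB | UC | UD

definition \<alpha> :: "agen falg" where "\<alpha> = gen Ga"
definition \<beta> :: "agen falg" where "\<beta> = gen Gb"
definition \<gamma> :: "agen falg" where "\<gamma> = gen Gc"
definition \<delta> :: "agen falg" where "\<delta> = gen Gd"

definition A_rels :: "real \<Rightarrow> agen falg set" where
  "A_rels q =
    {\<alpha> * \<beta> - scal q * \<beta> * \<alpha>, \<alpha> * \<gamma> - scal q * \<gamma> * \<alpha>,
     \<beta> * \<delta> - scal q * \<delta> * \<beta>, \<gamma> * \<delta> - scal q * \<delta> * \<gamma>,
     \<beta> * \<gamma> - \<gamma> * \<beta>,
     \<alpha> * \<delta> - scal q * \<beta> * \<gamma> - 1, \<delta> * \<alpha> - scal (1 / q) * \<beta> * \<gamma> - 1}"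

definition U_rels :: "real \<Rightarrow> ugen falg set" where
  "U_rels q =
    {gen UA * gen UD - 1, gen UD * gen UA - 1,
     gen UA * gen UB - scal q * gen UB * gen UA,
     gen UA * gen UC - scal (1 / q) * gen UC * gen UA,
     gen UB * gen UC - gen UC * gen UB - scal (1 / (q - 1 / q)) * (gen UA ^ 2 - gen UD ^ 2)}"

definition Aq :: "real \<Rightarrow> agen falg set ring" where
  "Aq q = presented (A_rels q)"

text \<open>
  Comultiplications and counits are written on the free algebras; they respect the relations.
\<close>

fun A_comult_gen :: "agen \<Rightarrow> agen falg2" where
  "A_comult_gen Ga = tens \<alpha> \<alpha> + tens \<beta> \<gamma>"
| "A_comult_gen Gb = tens \<alpha> \<beta> + tens \<beta> \<delta>"
| "A_comult_gen Gc = tens \<gamma> \<alpha> + tens \<delta> \<gamma>"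
| "A_comult_gen Gd = tens \<gamma> \<beta> + tens \<delta> \<delta>"

fun U_comult_gen :: "ugen \<Rightarrow> ugen falg2" where
  "U_comult_gen UA = tens (gen UA) (gen UA)"
| "U_comult_gen UB = tens (gen UA) (gen UB) + tens (gen UB) (gen UD)"
| "U_comult_gen UC = tens (gen UA) (gen UC) + tens (gen UC) (gen UD)"
| "U_comult_gen UD = tens (gen UD) (gen UD)"

definition A_comult :: "agen falg \<Rightarrow> agen falg2" where
  "A_comult = falg_hom scal A_comult_gen"

definition U_comult :: "ugen falg \<Rightarrow> ugen falg2" where
  "U_comult = falg_hom scal U_comult_gen"

definition A_counit :: "agen falg \<Rightarrow> complex" where
  "A_counit = falg_hom id (\<lambda>g. if g = Ga \<or> g = Gd then 1 else 0)"

definition U_counit :: "ugen falg \<Rightarrow> complex" where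
  "U_counit = falg_hom id (\<lambda>g. if g = UA \<or> g = UD then 1 else 0)"

fun gen_pairing :: "real \<Rightarrow> ugen \<Rightarrow> agen \<Rightarrow> complex" where
  "gen_pairing q UA Ga = q powr (1/2)"
| "gen_pairing q UA Gd = q powr (-1/2)"
| "gen_pairing q UD Ga = q powr (-1/2)"
| "gen_pairing q UD Gd = q powr (1/2)"
| "gen_pairing q UB Gb = 1"
| "gen_pairing q UC Gc = 1"
| "gen_pairing q _ _ = 0"

text \<open>The extension of a bilinear pairing \<open>P\<close> to the tensor squares: the value on
  \<open>X \<otimes> Y\<close> and \<open>\<xi> \<otimes> \<eta>\<close> is \<open>P X \<xi> * P Y \<eta>\<close>.\<close>

definition pair2 ::
  "(ugen falg \<Rightarrow> agen falg \<Rightarrow> complex) \<Rightarrow> ugen falg2 \<Rightarrow> agen falg2 \<Rightarrow> complex" where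
  "pair2 P S T = (\<Sum>(u, u')\<in>Poly_Mapping.keys S. \<Sum>(v, v')\<in>Poly_Mapping.keys T.
     Poly_Mapping.lookup S (u, u') * Poly_Mapping.lookup T (v, v') *
     P (Poly_Mapping.single u 1) (Poly_Mapping.single v 1) *
     P (Poly_Mapping.single u' 1) (Poly_Mapping.single v' 1))"

text \<open>
  A bilinear pairing of the two presented algebras is described on representatives, that is,
  as a bilinear pairing of the free algebras that vanishes on the relation ideals.
  The values on generators and the compatibility with the (co)products determine it.
\<close>

definition is_dual_pairing :: "real \<Rightarrow> (ugen falg \<Rightarrow> agen falg \<Rightarrow> complex) \<Rightarrow> bool" where
  "is_dual_pairing q P \<longleftrightarrow>
     (\<forall>X Y \<xi>. P (X + Y) \<xi> = P X \<xi> + P Y \<xi>) \<and>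
     (\<forall>X \<xi> \<eta>. P X (\<xi> + \<eta>) = P X \<xi> + P X \<eta>) \<and>
     (\<forall>c X \<xi>. P (scal c * X) \<xi> = c * P X \<xi>) \<and>
     (\<forall>c X \<xi>. P X (scal c * \<xi>) = c * P X \<xi>) \<and>
     (\<forall>X\<in>rel_ideal (U_rels q). \<forall>\<xi>. P X \<xi> = 0) \<and>
     (\<forall>X. \<forall>\<xi>\<in>rel_ideal (A_rels q). P X \<xi> = 0) \<and>
     (\<forall>X Y \<xi>. P (X * Y) \<xi> = pair2 P (tens X Y) (A_comult \<xi>)) \<and>
     (\<forall>X \<xi> \<eta>. P X (\<xi> * \<eta>) = pair2 P (U_comult X) (tens \<xi> \<eta>)) \<and>
     (\<forall>\<xi>. P 1 \<xi> = A_counit \<xi>) \<and>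
     (\<forall>X. P X 1 = U_counit X) \<and>
     (\<forall>g h. P (gen g) (gen h) = gen_pairing q g h)"

definition pairing :: "real \<Rightarrow> ugen falg \<Rightarrow> agen falg \<Rightarrow> complex" where
  "pairing q = (THE P. is_dual_pairing q P)"


section \<open>The representations and their matrix elements\<close>

text \<open>Spins and weights are real numbers; for \<open>l\<close> a nonnegative half-integer,
  \<open>weights l\<close> is the set of \<open>-l, -l+1, \<dots>, l\<close>.\<close>

definition half_ints :: "real set" where
  "half_ints = {x. 2 * x \<in> \<int>}"

definition weights :: "real \<Rightarrow> real set" where
  "weights l = {n. l - n \<in> \<nat> \<and> l + n \<in> \<nat>}"

text \<open>Only applied to reals that are nonnegative integers.\<close>

abbreviation nn :: "real \<Rightarrow> nat" where
  "nn x \<equiv> nat \<lfloor>x\<rfloor>"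

text \<open>Vectors are given by their coordinates with respect to the basis \<open>ebasis n\<close>,
  \<open>n \<in> weights l\<close>.\<close>

definition ebasis :: "real \<Rightarrow> real \<Rightarrow> complex" where
  "ebasis n = (\<lambda>k. if k = n then 1 else 0)"

definition inner_prod :: "real \<Rightarrow> (real \<Rightarrow> complex) \<Rightarrow> (real \<Rightarrow> complex) \<Rightarrow> complex" where
  "inner_prod l u v = (\<Sum>n\<in>weights l. u n * cnj (v n))"

text \<open>The generator \<open>g\<close> maps \<open>ebasis n\<close> to \<open>trep_coeff q l g n\<close> times \<open>ebasis (n + trep_shift g)\<close>;
  the coefficient vanishes when \<open>n + trep_shift g\<close> falls outside \<open>weights l\<close>.\<close>

fun trep_shift :: "ugen \<Rightarrow> real" where
  "trep_shift UA = 0"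
| "trep_shift UB = -1"
| "trep_shift UC = 1"
| "trep_shift UD = 0"

fun trep_coeff :: "real \<Rightarrow> real \<Rightarrow> ugen \<Rightarrow> real \<Rightarrow> real" where
  "trep_coeff q l UA n = q powr (-n)"
| "trep_coeff q l UD n = q powr n"
| "trep_coeff q l UB n =
     sqrt ((q powr (-l+n-1) - q powr (l-n+1)) * (q powr (-l-n) - q powr (l+n))) / (1/q - q)"
| "trep_coeff q l UC n =
     sqrt ((q powr (-l+n) - q powr (l-n)) * (q powr (-l-n-1) - q powr (l+n+1))) / (1/q - q)"

definition trep_gen :: "real \<Rightarrow> real \<Rightarrow> ugen \<Rightarrow> (real \<Rightarrow> complex) \<Rightarrow> (real \<Rightarrow> complex)" where
  "trep_gen q l g v = (\<lambda>k. \<Sum>n\<in>weights l. v n * trep_coeff q l g n * ebasis (n + trep_shift g) k)"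

definition trep :: "real \<Rightarrow> real \<Rightarrow> ugen falg \<Rightarrow> (real \<Rightarrow> complex) \<Rightarrow> (real \<Rightarrow> complex)" where
  "trep q l X v =
     (\<lambda>k. \<Sum>w\<in>Poly_Mapping.keys X. Poly_Mapping.lookup X w * foldr (trep_gen q l) w v k)"

text \<open>The pairing is non-degenerate, so the functional on the right determines the coset \<open>T\<close>.\<close>

definition tcoef :: "real \<Rightarrow> real \<Rightarrow> real \<Rightarrow> real \<Rightarrow> agen falg set" where
  "tcoef q l n m = (THE T. T \<in> carrier (Aq q) \<and>
     (\<forall>\<xi>\<in>T. \<forall>X. pairing q X \<xi> = inner_prod l (trep q l X (ebasis m)) (ebasis n)))"


section \<open>Basic hypergeometric series and Askey-Wilson polynomials\<close>

definition qpoch :: "'a::field \<Rightarrow> 'a \<Rightarrow> nat \<Rightarrow> 'a" where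
  "qpoch a p k = (\<Prod>r<k. 1 - a * p ^ r)"

definition qbinom :: "nat \<Rightarrow> nat \<Rightarrow> 'a::field \<Rightarrow> 'a" where
  "qbinom n k p = qpoch (p ^ n) (inverse p) k / qpoch p p k"

text \<open>
  With lower parameter \<open>p\<^bsup>-N\<^esup>\<close> and upper parameter \<open>p\<^bsup>-n\<^esup>\<close>, \<open>n \<le> N\<close>, the terms with \<open>n < k \<le> N\<close>
  vanish because of the numerator, and those with \<open>k > N\<close> because \<open>x / 0 = 0\<close>. So the series is the
  terminating sum up to \<open>n\<close>.
\<close>

definition qhyp :: "'a::real_normed_field list \<Rightarrow> 'a list \<Rightarrow> 'a \<Rightarrow> 'a \<Rightarrow> 'a" where
  "qhyp as bs p z =
     suminf (\<lambda>k. (\<Prod>a\<leftarrow>as. qpoch a p k) / ((\<Prod>b\<leftarrow>bs. qpoch b p k) * qpoch p p k) * z ^ k)"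

definition askey_wilson ::
  "nat \<Rightarrow> complex \<Rightarrow> complex \<Rightarrow> complex \<Rightarrow> complex \<Rightarrow> complex \<Rightarrow> complex poly" where
  "askey_wilson n a b c d p = (THE P. \<forall>z. z \<noteq> 0 \<longrightarrow>
     poly P ((z + inverse z) / 2) =
       a powi (- int n) * (qpoch (a*b) p n * qpoch (a*c) p n * qpoch (a*d) p n) *
       qhyp [p powi (- int n), a*b*c*d * p powi (int n - 1), a * z, a / z] [a*b, a*c, a*d] p p)"

text \<open>\<open>aw2 n \<mu> \<nu> s t p\<close> is the polynomial \<open>p\<^sub>n\<^bsup>(\<mu>,\<nu>)\<^esup>(\<sqdot>; s, t | p)\<close>.\<close>

definition aw2 :: "nat \<Rightarrow> real \<Rightarrow> real \<Rightarrow> real \<Rightarrow> real \<Rightarrow> real \<Rightarrow> complex poly" where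
  "aw2 n \<mu> \<nu> s t p = askey_wilson n
     (of_real (p powr (1/2) * t / s))
     (of_real (p powr (1/2 + \<mu>) * s / t))
     (of_real (- (p powr (1/2)) / (s * t)))
     (of_real (- (s * t * p powr (1/2 + \<nu>))))
     (of_real p)"


section \<open>The elements of the quantum group\<close>

definition smulA :: "real \<Rightarrow> complex \<Rightarrow> agen falg set \<Rightarrow> agen falg set" where
  "smulA q c T = cls (A_rels q) (scal c) \<otimes>\<^bsub>Aq q\<^esub> T"

definition polyA :: "real \<Rightarrow> complex poly \<Rightarrow> agen falg set \<Rightarrow> agen falg set" where
  "polyA q P x = (\<Oplus>\<^bsub>Aq q\<^esub>k\<in>{..degree P}. smulA q (coeff P k) (x [^]\<^bsub>Aq q\<^esub> k))"

definition Cc :: "real \<Rightarrow> real \<Rightarrow> real \<Rightarrow> real \<Rightarrow> real" where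
  "Cc q l j \<sigma> = q powr (l + j) * sqrt (qbinom (nn (2*l)) (nn (l - j)) (q^2)) *
     sqrt ((1 + q powr (-4*j - 2*\<sigma>)) / (1 + q powr (-2*\<sigma>))) *
     inverse (sqrt (qpoch (- (q powr (2 - 2*\<sigma>))) (q^2) (nn (l - j)) *
                    qpoch (- (q powr (2 + 2*\<sigma>))) (q^2) (nn (l + j))))"

definition vv :: "real \<Rightarrow> real \<Rightarrow> real \<Rightarrow> real \<Rightarrow> real \<Rightarrow> complex" where
  "vv q l j n \<sigma> = of_real (Cc q l j \<sigma>) * \<i> powi \<lfloor>n - l\<rfloor> * of_real (
     q powr (\<sigma> * (l - n)) * q powr (1/2 * (l - n) * (l - n - 1)) *
     sqrt (qpoch (q powr (4*l)) (q powr (-2)) (nn (l - n)) / qpoch (q^2) (q^2) (nn (l - n))) *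
     qhyp [q powr (-2*(l - n)), q powr (-2*(l - j)), - (q powr (-2*l - 2*j - 2*\<sigma>))]
          [q powr (-4*l), 0] (q^2) (q^2))"

definition b_elt :: "real \<Rightarrow> real \<Rightarrow> real \<Rightarrow> real \<Rightarrow> real \<Rightarrow> real \<Rightarrow> agen falg set" where
  "b_elt q l i j \<tau> \<sigma> = (\<Oplus>\<^bsub>Aq q\<^esub>n\<in>weights l. \<Oplus>\<^bsub>Aq q\<^esub>m\<in>weights l.
     smulA q (vv q l j m \<sigma> * cnj (vv q l i n \<tau>) * of_real (q powr (-m))) (tcoef q l n m))"

definition \<rho> :: "real \<Rightarrow> real \<Rightarrow> real \<Rightarrow> agen falg set" where
  "\<rho> q \<tau> \<sigma> = cls (A_rels q) (scal (1/2) *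
     (\<alpha>^2 + \<delta>^2 + scal q * \<gamma>^2 + scal (1/q) * \<beta>^2
      + scal (\<i> * (q powr (-\<sigma>) - q powr \<sigma>)) * (scal q * \<delta> * \<gamma> + \<beta> * \<alpha>)
      - scal (\<i> * (q powr (-\<tau>) - q powr \<tau>)) * (\<delta> * \<beta> + scal q * \<gamma> * \<alpha>)
      + scal ((q powr (-\<sigma>) - q powr \<sigma>) * (q powr (-\<tau>) - q powr \<tau>)) * \<beta> * \<gamma>))"

definition dd :: "real \<Rightarrow> real \<Rightarrow> real \<Rightarrow> real \<Rightarrow> real \<Rightarrow> real \<Rightarrow> real" where
  "dd q l i j \<tau> \<sigma> = Cc q l j \<sigma> * Cc q l i \<tau> / (Cc q i j \<sigma> * Cc q i i \<tau>) *
     (q powr (i - l) / qpoch (q powr (4*l)) (q powr (-2)) (nn (l - i)))"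

end

theory Submission
  imports Defs
begin

text \<open>
  By non-degeneracy of the duality, an element of \<open>\<A>\<close> is known from its values on the words in
  \<open>A, B, C, D\<close>. The elements \<open>b\<^sup>l\<^sub>i\<^sub>j\<close> and \<open>\<rho>\<^sub>\<tau>\<^sub>,\<^sub>\<sigma>\<close> are eigenvectors of twisted primitive elements
  acting from the left and from the right: for \<open>\<rho>\<^sub>\<tau>\<^sub>,\<^sub>\<sigma>\<close> the eigenvalue equations are those of
  invariant elements, and for \<open>b\<^sup>l\<^sub>i\<^sub>j\<close> they depend on \<open>i, j, \<sigma>, \<tau>\<close> but not on the spin, because the
  vectors \<open>v\<^sup>l\<^sup>,\<^sup>j\<close> satisfy the three-term recurrence of the dual \<open>q\<close>-Krawtchouk polynomials. Hence both
  sides of the theorem satisfy the same pair of eigenvalue equations, and such an element is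
  determined by its restriction to the torus, that is, by its values on the words in \<open>A, D\<close>.

  On the torus point \<open>z = q\<^sup>k\<close> the element \<open>\<rho>\<^sub>\<tau>\<^sub>,\<^sub>\<sigma>\<close> takes the value \<open>(z + z\<^sup>-\<^sup>1) / 2\<close>, and
  \<open>b\<^sup>l\<^sub>i\<^sub>j\<close> becomes a polynomial of degree \<open>2l\<close> in \<open>z\<close> up to a power of \<open>z\<close>. The Casimir element
  acts on \<open>b\<^sup>l\<^sub>i\<^sub>j\<close> by a scalar, and together with the eigenvalue equations this yields a second-order
  \<open>q\<close>-difference equation in \<open>z\<close>, whose polynomial solution of degree at most \<open>2l\<close> is unique up to a
  constant. In each of the four cases an explicit product of linear factors times the Askey-Wilson
  polynomial also solves it, by the Askey-Wilson difference equation. For \<open>l = m\<close> the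
  Askey-Wilson factor is trivial, so the product is the torus value of \<open>b\<^sup>m\<^sub>i\<^sub>j\<close>.
\<close>

text \<open>The pairing, the elements \<open>t^l_{n,m}\<close> and the Askey-Wilson polynomials are
  definite descriptions, so each needs existence and uniqueness before it can be used; the pairing
  is therefore constructed, by letting every generator act through the two-dimensional
  representation. The four cases are one: the radial coefficients are unchanged when (\<sigma>, j)
  and (\<tau>, i) are exchanged and when \<sigma>, \<tau>, i, j are all negated, so it suffices to
  solve for i = m. The linear factors are a gauge factor. The outer coefficients of the radial
  equation contain 1 - q^2 z/a and 1 - q^2 z/c where the Askey-Wilson operator has 1 - bz and 1 -
  dz; as ab and cd are powers of q^2, finite q-shifted factorials convert one into the other. The
  constant d is read off at z = 0: the polynomial of a matrix element, cleared of its normalising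
  constants, starts with 1, while z^n p_n takes the value (q^(4l); q^(-2))_n there, with n = l - m.
  The power q^(m-l) is left over from the weight factors in the definition of b, taken at the
  highest weights l and m.\<close>

section \<open>Linear extension of functions on words\<close>

definition lin :: "('m \<Rightarrow> complex) \<Rightarrow> ('m \<Rightarrow>\<^sub>0 complex) \<Rightarrow> complex" where
  "lin f x = (\<Sum>w\<in>Poly_Mapping.keys x. Poly_Mapping.lookup x w * f w)"

lemma lin_superset:
  assumes "finite K" "Poly_Mapping.keys x \<subseteq> K"
  shows "lin f x = (\<Sum>w\<in>K. Poly_Mapping.lookup x w * f w)"
  unfolding lin_def
  by (rule sum.mono_neutral_left) (use assms in \<open>auto simp: in_keys_iff\<close>)

lemma lin_add: "lin f (x + y) = lin f x + lin f y"
proof -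
  let ?K = "Poly_Mapping.keys x \<union> Poly_Mapping.keys y"
  have "Poly_Mapping.keys (x + y) \<subseteq> ?K" by (rule keys_add)
  then show ?thesis
    by (simp add: lin_superset[of ?K] lookup_add sum.distrib ring_distribs)
qed

lemma lin_single [simp]: "lin f (Poly_Mapping.single w c) = c * f w"
  by (subst lin_superset[of "{w}"]) auto

lemma lin_zero [simp]: "lin f 0 = 0"
  by (simp add: lin_def)

lemma lin_sum: "lin f (\<Sum>a\<in>A. g a) = (\<Sum>a\<in>A. lin f (g a))"
  by (induction A rule: infinite_finite_induct) (simp_all add: lin_add)

lemma poly_mapping_expansion:
  fixes x :: "'m \<Rightarrow>\<^sub>0 'c::comm_monoid_add"
  shows "x = (\<Sum>w\<in>Poly_Mapping.keys x. Poly_Mapping.single w (Poly_Mapping.lookup x w))"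
proof (rule poly_mapping_eqI)
  fix k
  show "Poly_Mapping.lookup x k = Poly_Mapping.lookup (\<Sum>w\<in>Poly_Mapping.keys x. Poly_Mapping.single w (Poly_Mapping.lookup x w)) k"
    by (cases "k \<in> Poly_Mapping.keys x")
       (auto simp: lookup_sum lookup_single when_def in_keys_iff)
qed

lemma poly_mapping_add_induct [case_names single add]:
  fixes x :: "'m \<Rightarrow>\<^sub>0 'c::comm_monoid_add"
  assumes single: "\<And>w c. Q (Poly_Mapping.single w c)"
    and add: "\<And>x y. Q x \<Longrightarrow> Q y \<Longrightarrow> Q (x + y)"
  shows "Q x"
proof -
  have "Q (\<Sum>w\<in>A. Poly_Mapping.single w (Poly_Mapping.lookup x w))" if "finite A" for A
    using that
  proof (induction A)
    case empty
    show ?case using single[of undefined 0] by simp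
  next
    case (insert a A)
    then show ?case by (simp add: single add)
  qed
  then show ?thesis by (subst poly_mapping_expansion) simp
qed

lemma lin_scal: "lin f (scal c * x) = c * lin f x"
  by (induction x rule: poly_mapping_add_induct)
     (simp_all add: scal_def mult_single ring_distribs lin_add mult.assoc)

lemma lin_uminus: "lin f (- x) = - lin f x"
  using lin_add[of f x "- x"] by (simp add: eq_neg_iff_add_eq_0 add.commute)

lemma lin_diff: "lin f (x - y) = lin f x - lin f y"
  using lin_add[of f x "- y"] by (simp add: lin_uminus)

lemma lin_cong: "(\<And>w. f w = g w) \<Longrightarrow> lin f x = lin g x"
  by (simp add: lin_def)

lemma lin_add_fun: "lin (\<lambda>w. f w + g w) x = lin f x + lin g x"
  by (simp add: lin_def ring_distribs sum.distrib)

lemma lin_mult_fun: "lin (\<lambda>w. c * f w) x = c * lin f x"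
  by (simp add: lin_def sum_distrib_left mult.left_commute)

lemma lin_mult_fun_right: "lin (\<lambda>w. f w * c) x = lin f x * c"
  by (simp add: lin_def sum_distrib_right mult.assoc)

lemma lin_diff_fun: "lin (\<lambda>w. f w - g w) x = lin f x - lin g x"
  by (simp add: lin_def ring_distribs sum_subtractf)

lemma lin_zero_fun [simp]: "lin (\<lambda>w. 0) x = 0"
  by (simp add: lin_def)

lemma lin_mult:
  "lin f (x * y) = lin (\<lambda>u. lin (\<lambda>v. f (u + v)) y) x"
proof (induction x rule: poly_mapping_add_induct)
  case (single u c)
  show ?case
    by (induction y rule: poly_mapping_add_induct)
       (simp_all add: mult_single ring_distribs lin_add mult.assoc)
next
  case (add x y)
  then show ?case by (simp add: ring_distribs lin_add)
qed

lemma scal_add: "scal (a + b) = scal a + scal b"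
  by (simp add: scal_def single_add)

lemma scal_mult: "scal (a * b) = scal a * scal b"
  by (simp add: scal_def mult_single)

lemma scal_1 [simp]: "scal 1 = 1"
  by (simp add: scal_def)

lemma scal_0 [simp]: "scal 0 = 0"
  by (simp add: scal_def)

lemma scal_commute: "scal c * x = x * scal c"
  by (induction x rule: poly_mapping_add_induct)
     (simp_all add: scal_def mult_single ring_distribs mult.commute)

lemma scal_left_commute: "x * (scal c * y) = scal c * (x * y)"
  by (metis mult.assoc scal_commute)

lemma scal_uminus: "scal (- c) = - scal c"
  by (simp add: scal_def single_uminus)

lemma single_conv_scal:
  "Poly_Mapping.single w c = scal c * Poly_Mapping.single w 1"
  by (simp add: scal_def mult_single)

subsection \<open>Quotients of the free algebra\<close>

lemma falg_ring_simps [simp]: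
  "carrier falg_ring = UNIV" "x \<otimes>\<^bsub>falg_ring\<^esub> y = x * y" "x \<oplus>\<^bsub>falg_ring\<^esub> y = x + y"
  "\<one>\<^bsub>falg_ring\<^esub> = 1" "\<zero>\<^bsub>falg_ring\<^esub> = 0"
  by (simp_all add: falg_ring_def)

lemma ring_falg_ring: "ring falg_ring"
proof (rule ringI)
  show "abelian_group falg_ring"
    by (rule abelian_groupI) (simp_all add: add_ac, metis add.right_inverse)
  show "monoid falg_ring"
    by (rule monoidI) (auto simp: mult.assoc)
qed (auto simp: ring_distribs)

interpretation falg: ring falg_ring
  by (rule ring_falg_ring)

lemma rel_ideal_ideal: "ideal (rel_ideal S) falg_ring"
  unfolding rel_ideal_def by (rule falg.genideal_ideal) simp

lemma rel_ideal_base: "x \<in> S \<Longrightarrow> x \<in> rel_ideal S"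
  unfolding rel_ideal_def using falg.genideal_self[of S] by auto

lemma rel_ideal_zero [simp]: "0 \<in> rel_ideal S"
  using additive_subgroup.zero_closed[OF ideal.axioms(1)[OF rel_ideal_ideal]] by simp

lemma rel_ideal_add: "x \<in> rel_ideal S \<Longrightarrow> y \<in> rel_ideal S \<Longrightarrow> x + y \<in> rel_ideal S"
  using additive_subgroup.a_closed[OF ideal.axioms(1)[OF rel_ideal_ideal]] by fastforce

lemma rel_ideal_lmult: "x \<in> rel_ideal S \<Longrightarrow> y * x \<in> rel_ideal S"
  using ideal.I_l_closed[OF rel_ideal_ideal, of x S y] by simp

lemma rel_ideal_rmult: "x \<in> rel_ideal S \<Longrightarrow> x * y \<in> rel_ideal S"
  using ideal.I_r_closed[OF rel_ideal_ideal, of x S y] by simp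

lemma rel_ideal_uminus: "x \<in> rel_ideal S \<Longrightarrow> - x \<in> rel_ideal S"
  using rel_ideal_lmult[of x S "-1"] by simp

lemma rel_ideal_diff: "x \<in> rel_ideal S \<Longrightarrow> y \<in> rel_ideal S \<Longrightarrow> x - y \<in> rel_ideal S"
  using rel_ideal_add[of x S "- y"] rel_ideal_uminus[of y S] by simp

text \<open>An induction principle for the generated ideal: such a Q cuts out a two-sided ideal
  containing S, with negatives supplied by multiplication with \<open>-1\<close>.\<close>

lemma rel_ideal_minimal:
  assumes x: "x \<in> rel_ideal S" and S: "\<And>x. x \<in> S \<Longrightarrow> Q x" and zero: "Q 0"
    and add: "\<And>x y. Q x \<Longrightarrow> Q y \<Longrightarrow> Q (x + y)"
    and lmult: "\<And>x y. Q x \<Longrightarrow> Q (y * x)" and rmult: "\<And>x y. Q x \<Longrightarrow> Q (x * y)"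
  shows "Q x"
proof -
  have inv: "\<ominus>\<^bsub>falg_ring\<^esub> a = - a" for a :: "'a falg"
    by (rule falg.minus_equality) auto
  have "subgroup (Collect Q) (add_monoid falg_ring)"
  proof (rule subgroup.intro)
    show "inv\<^bsub>add_monoid falg_ring\<^esub> x \<in> Collect Q" if "x \<in> Collect Q" for x
      using that lmult[of x "-1"] inv[of x] by (simp add: a_inv_def)
  qed (auto simp: zero add)
  then have "ideal (Collect Q) falg_ring"
    by (rule idealI[OF ring_falg_ring]) (auto simp: lmult rmult)
  then have "Idl\<^bsub>falg_ring\<^esub> S \<subseteq> Collect Q"
    by (rule falg.genideal_minimal) (auto simp: S)
  then show ?thesis using x by (auto simp: rel_ideal_def)
qed

lemma cls_eq: "cls S x = (\<lambda>i. i + x) ` rel_ideal S"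
  by (auto simp: cls_def a_r_coset_def' )

lemma cls_self: "x \<in> cls S x"
  using rel_ideal_zero[of S] by (force simp: cls_eq)

lemma cls_mem_iff: "y \<in> cls S x \<longleftrightarrow> y - x \<in> rel_ideal S"
  by (force simp: cls_eq image_iff diff_eq_eq)

lemma cls_eq_iff: "cls S x = cls S y \<longleftrightarrow> x - y \<in> rel_ideal S"
proof
  assume "cls S x = cls S y"
  then show "x - y \<in> rel_ideal S"
    using cls_self[of x S] by (simp add: cls_mem_iff)
next
  assume *: "x - y \<in> rel_ideal S"
  show "cls S x = cls S y"
  proof (rule Set.set_eqI)
    fix z
    show "z \<in> cls S x \<longleftrightarrow> z \<in> cls S y"
      using rel_ideal_add[OF _ *, of "z - x"] rel_ideal_diff[OF _ *, of "z - y"]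
      by (auto simp: cls_mem_iff)
  qed
qed

lemma cls_hom: "cls S \<in> ring_hom falg_ring (presented S)"
  unfolding presented_def cls_def[abs_def] by (rule ideal.rcos_ring_hom[OF rel_ideal_ideal])

lemma ring_presented: "ring (presented S)"
  unfolding presented_def by (rule ideal.quotient_is_ring[OF rel_ideal_ideal])

lemma cls_closed [simp]: "cls S x \<in> carrier (presented S)"
  using ring_hom_closed[OF cls_hom] by simp

lemma carrier_presented: "carrier (presented S) = range (cls S)"
  by (auto simp: presented_def FactRing_def A_RCOSETS_def' cls_def)

lemma cls_mult: "cls S x \<otimes>\<^bsub>presented S\<^esub> cls S y = cls S (x * y)"
  using ring_hom_mult[OF cls_hom, of x y] by simp

lemma cls_add: "cls S x \<oplus>\<^bsub>presented S\<^esub> cls S y = cls S (x + y)"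
  using ring_hom_add[OF cls_hom, of x y] by simp

lemma cls_one: "\<one>\<^bsub>presented S\<^esub> = cls S 1"
  using ring_hom_one[OF cls_hom, of S] by simp

lemma cls_zero: "\<zero>\<^bsub>presented S\<^esub> = cls S 0"
  using ring_hom_zero[OF cls_hom ring_falg_ring ring_presented, of S, symmetric] by simp

lemma cls_pow: "cls S x [^]\<^bsub>presented S\<^esub> (k::nat) = cls S (x ^ k)"
  by (induction k) (simp_all add: cls_one cls_mult power_Suc2 nat_pow_def del: power_Suc)

lemma cls_finsum: "finite K \<Longrightarrow> (\<Oplus>\<^bsub>presented S\<^esub>k\<in>K. cls S (f k)) = cls S (\<Sum>k\<in>K. f k)"
proof (induction K rule: finite_induct)
  case empty
  then show ?case
    using abelian_monoid.finsum_empty[of "presented S"] ring_presented[of S]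
    by (simp add: cls_zero ring.is_abelian_group abelian_group.axioms)
next
  case (insert a K)
  then show ?case
    using abelian_monoid.finsum_insert[of "presented S" K a "\<lambda>k. cls S (f k)"] ring_presented[of S]
    by (simp add: cls_add ring.is_abelian_group abelian_group.axioms)
qed

lemma smulA_cls: "smulA q c (cls (A_rels q) x) = cls (A_rels q) (scal c * x)"
  by (simp add: smulA_def Aq_def cls_mult)

lemma polyA_cls:
  "polyA q P (cls (A_rels q) x) = cls (A_rels q) (\<Sum>k\<le>degree P. scal (coeff P k) * x ^ k)"
  by (simp add: polyA_def Aq_def cls_pow smulA_cls[unfolded Aq_def] cls_finsum)

subsection \<open>The dual algebra: convolution of functionals on words\<close>

type_synonym wfun = "ugen list \<Rightarrow> complex"

text \<open>The product that the comultiplication of U induces on functionals; each clause is the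
  coproduct of the first letter. Arguments are words rather than classes, so the recursion does not
  have to respect the relations; that it does is \<open>urel_conv\<close>.\<close>

fun conv :: "wfun \<Rightarrow> wfun \<Rightarrow> wfun" where
  "conv \<phi> \<psi> [] = \<phi> [] * \<psi> []"
| "conv \<phi> \<psi> (UA # u) = conv (\<lambda>v. \<phi> (UA # v)) (\<lambda>v. \<psi> (UA # v)) u"
| "conv \<phi> \<psi> (UD # u) = conv (\<lambda>v. \<phi> (UD # v)) (\<lambda>v. \<psi> (UD # v)) u"
| "conv \<phi> \<psi> (UB # u) = conv (\<lambda>v. \<phi> (UA # v)) (\<lambda>v. \<psi> (UB # v)) u
                      + conv (\<lambda>v. \<phi> (UB # v)) (\<lambda>v. \<psi> (UD # v)) u"
| "conv \<phi> \<psi> (UC # u) = conv (\<lambda>v. \<phi> (UA # v)) (\<lambda>v. \<psi> (UC # v)) u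
                      + conv (\<lambda>v. \<phi> (UC # v)) (\<lambda>v. \<psi> (UD # v)) u"

lemma ugen_list_induct [case_names Nil A B C D]:
  assumes "Q []" "\<And>u. Q u \<Longrightarrow> Q (UA # u)" "\<And>u. Q u \<Longrightarrow> Q (UB # u)"
    "\<And>u. Q u \<Longrightarrow> Q (UC # u)" "\<And>u. Q u \<Longrightarrow> Q (UD # u)"
  shows "Q u"
proof (induction u)
  case (Cons g u)
  then show ?case using assms by (cases g) auto
qed (rule assms)

lemma conv_zero [simp]: "conv (\<lambda>v. 0) \<psi> u = 0" "conv \<phi> (\<lambda>v. 0) u = 0"
proof -
  show "conv (\<lambda>v. 0) \<psi> u = 0"
    by (induction u arbitrary: \<psi> rule: ugen_list_induct) auto
  show "conv \<phi> (\<lambda>v. 0) u = 0"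
    by (induction u arbitrary: \<phi> rule: ugen_list_induct) auto
qed

lemma conv_add_left: "conv (\<lambda>v. \<phi> v + \<phi>' v) \<psi> u = conv \<phi> \<psi> u + conv \<phi>' \<psi> u"
  by (induction u arbitrary: \<phi> \<phi>' \<psi> rule: ugen_list_induct) (auto simp: ring_distribs)

lemma conv_add_right: "conv \<phi> (\<lambda>v. \<psi> v + \<psi>' v) u = conv \<phi> \<psi> u + conv \<phi> \<psi>' u"
  by (induction u arbitrary: \<phi> \<psi>' \<psi> rule: ugen_list_induct) (auto simp: ring_distribs)

lemma conv_mult_left: "conv (\<lambda>v. c * \<phi> v) \<psi> u = c * conv \<phi> \<psi> u"
  by (induction u arbitrary: \<phi> \<psi> rule: ugen_list_induct) (auto simp: ring_distribs)

lemma conv_mult_right: "conv \<phi> (\<lambda>v. c * \<psi> v) u = c * conv \<phi> \<psi> u"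
  by (induction u arbitrary: \<phi> \<psi> rule: ugen_list_induct) (auto simp: ring_distribs)

lemma conv_divide_left: "conv (\<lambda>v. \<phi> v / c) \<psi> u = conv \<phi> \<psi> u / c"
  using conv_mult_left[of "inverse c"] by (simp add: divide_inverse mult.commute[of _ "inverse c"])

lemma conv_divide_right: "conv \<phi> (\<lambda>v. \<psi> v / c) u = conv \<phi> \<psi> u / c"
  using conv_mult_right[of _ "inverse c"] by (simp add: divide_inverse mult.commute[of _ "inverse c"])

lemma conv_diff_left: "conv (\<lambda>v. \<phi> v - \<phi>' v) \<psi> u = conv \<phi> \<psi> u - conv \<phi>' \<psi> u"
  by (induction u arbitrary: \<phi> \<phi>' \<psi> rule: ugen_list_induct) (auto simp: ring_distribs)

lemma conv_diff_right: "conv \<phi> (\<lambda>v. \<psi> v - \<psi>' v) u = conv \<phi> \<psi> u - conv \<phi> \<psi>' u"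
  by (induction u arbitrary: \<phi> \<psi>' \<psi> rule: ugen_list_induct) (auto simp: ring_distribs)

lemma conv_lin_left: "conv (\<lambda>v. lin (\<lambda>a. F a v) x) \<psi> u = lin (\<lambda>a. conv (F a) \<psi> u) x"
  by (induction x rule: poly_mapping_add_induct) (simp_all add: conv_mult_left lin_add conv_add_left)

lemma conv_lin_right: "conv \<phi> (\<lambda>v. lin (\<lambda>a. F a v) x) u = lin (\<lambda>a. conv \<phi> (F a) u) x"
  by (induction x rule: poly_mapping_add_induct) (simp_all add: conv_mult_right lin_add conv_add_right)

lemma conv_assoc: "conv (conv \<phi> \<psi>) \<chi> = conv \<phi> (conv \<psi> \<chi>)"
proof
  show "conv (conv \<phi> \<psi>) \<chi> u = conv \<phi> (conv \<psi> \<chi>) u" for u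
  by (induction u arbitrary: \<phi> \<psi> \<chi> rule: ugen_list_induct)
     (simp_all add: conv_add_left conv_add_right mult.assoc)
qed

fun eps :: wfun where
  "eps [] = 1"
| "eps (UA # u) = eps u"
| "eps (UB # u) = 0"
| "eps (UC # u) = 0"
| "eps (UD # u) = eps u"

lemma conv_eps_left [simp]: "conv eps \<psi> u = \<psi> u"
  by (induction u arbitrary: \<psi> rule: ugen_list_induct) auto

lemma conv_eps_right [simp]: "conv \<phi> eps u = \<phi> u"
  by (induction u arbitrary: \<phi> rule: ugen_list_induct) auto

lemma conv_snoc:
  "conv \<phi> \<psi> (u @ [UA]) = conv (\<lambda>v. \<phi> (v @ [UA])) (\<lambda>v. \<psi> (v @ [UA])) u"
  "conv \<phi> \<psi> (u @ [UD]) = conv (\<lambda>v. \<phi> (v @ [UD])) (\<lambda>v. \<psi> (v @ [UD])) u"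
  "conv \<phi> \<psi> (u @ [UB]) = conv (\<lambda>v. \<phi> (v @ [UA])) (\<lambda>v. \<psi> (v @ [UB])) u
                      + conv (\<lambda>v. \<phi> (v @ [UB])) (\<lambda>v. \<psi> (v @ [UD])) u"
  "conv \<phi> \<psi> (u @ [UC]) = conv (\<lambda>v. \<phi> (v @ [UA])) (\<lambda>v. \<psi> (v @ [UC])) u
                      + conv (\<lambda>v. \<phi> (v @ [UC])) (\<lambda>v. \<psi> (v @ [UD])) u"
  by (induction u arbitrary: \<phi> \<psi> rule: ugen_list_induct) (simp_all add: conv_add_left conv_add_right)

lemma conv_group_like:
  assumes "set u \<subseteq> {UA, UD}"
  shows "conv \<phi> \<psi> u = \<phi> u * \<psi> u"
  using assms by (induction u arbitrary: \<phi> \<psi> rule: ugen_list_induct) auto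

text \<open>Dual form of the multiplicativity of a coproduct: functionals that split over
  concatenation as finite sums of products have convolutions that split by multiplying the tensors.
  The induction absorbs the letters of u into F and G, while F' and G' stay fixed.\<close>

lemma conv_append_lin:
  assumes "\<And>u v. \<phi> (u @ v) = lin (\<lambda>(a, b). F a u * F' b v) S"
    and "\<And>u v. \<psi> (u @ v) = lin (\<lambda>(c, d). G c u * G' d v) T"
  shows "conv \<phi> \<psi> (u @ v) =
    lin (\<lambda>(a, b). lin (\<lambda>(c, d). conv (F a) (G c) u * conv (F' b) (G' d) v) T) S"
  using assms
proof (induction u arbitrary: \<phi> \<psi> F G rule: ugen_list_induct)
  case Nil
  have "\<phi> = (\<lambda>v. lin (\<lambda>p. F (fst p) [] * F' (snd p) v) S)"
    "\<psi> = (\<lambda>v. lin (\<lambda>p. G (fst p) [] * G' (snd p) v) T)"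
    using Nil(1)[of "[]"] Nil(2)[of "[]"] by (auto simp: case_prod_beta)
  then have "conv \<phi> \<psi> v =
    conv (\<lambda>v. lin (\<lambda>p. F (fst p) [] * F' (snd p) v) S) (\<lambda>v. lin (\<lambda>p. G (fst p) [] * G' (snd p) v) T) v"
    by simp
  then show ?case
    by (simp only: conv_lin_left conv_lin_right conv_mult_left conv_mult_right)
       (simp add: case_prod_beta lin_mult_fun mult_ac flip: lin_mult_fun)
next
  case (A u)
  show ?case
    using A.IH[of "\<lambda>v. \<phi> (UA # v)" "\<lambda>a v. F a (UA # v)" "\<lambda>v. \<psi> (UA # v)" "\<lambda>a v. G a (UA # v)"]
      A.prems(1)[of "UA # _"] A.prems(2)[of "UA # _"] by simp
next
  case (D u)
  show ?case
    using D.IH[of "\<lambda>v. \<phi> (UD # v)" "\<lambda>a v. F a (UD # v)" "\<lambda>v. \<psi> (UD # v)" "\<lambda>a v. G a (UD # v)"]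
      D.prems(1)[of "UD # _"] D.prems(2)[of "UD # _"] by simp
next
  case (B u)
  show ?case
    using B.IH[of "\<lambda>v. \<phi> (UA # v)" "\<lambda>a v. F a (UA # v)" "\<lambda>v. \<psi> (UB # v)" "\<lambda>a v. G a (UB # v)"]
      B.IH[of "\<lambda>v. \<phi> (UB # v)" "\<lambda>a v. F a (UB # v)" "\<lambda>v. \<psi> (UD # v)" "\<lambda>a v. G a (UD # v)"]
      B.prems(1)[of "UA # _"] B.prems(1)[of "UB # _"] B.prems(2)[of "UB # _"] B.prems(2)[of "UD # _"]
    by (simp add: case_prod_beta ring_distribs lin_add_fun)
next
  case (C u)
  show ?case
    using C.IH[of "\<lambda>v. \<phi> (UA # v)" "\<lambda>a v. F a (UA # v)" "\<lambda>v. \<psi> (UC # v)" "\<lambda>a v. G a (UC # v)"]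
      C.IH[of "\<lambda>v. \<phi> (UC # v)" "\<lambda>a v. F a (UC # v)" "\<lambda>v. \<psi> (UD # v)" "\<lambda>a v. G a (UD # v)"]
      C.prems(1)[of "UA # _"] C.prems(1)[of "UC # _"] C.prems(2)[of "UC # _"] C.prems(2)[of "UD # _"]
    by (simp add: case_prod_beta ring_distribs lin_add_fun)
qed

locale quantum =
  fixes q :: real
  assumes q_pos: "0 < q" and q_less_1: "q < 1"
begin

definition h :: complex where "h = of_real (sqrt q)"

lemma h_nonzero [simp]: "h \<noteq> 0"
  using q_pos by (simp add: h_def)

lemma h_mult_h [simp]: "h * h = of_real q"
  using q_pos unfolding h_def by (metis of_real_mult real_sqrt_mult_self abs_of_pos)

lemma h_square: "h ^ 2 = of_real q"
  by (simp add: power2_eq_square)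

lemma q_nonzero [simp]: "q \<noteq> 0"
  using q_pos by simp

lemma kappa_nonzero [simp]: "q - 1 / q \<noteq> 0" "1 / q - q \<noteq> 0" "complex_of_real q - 1 / complex_of_real q \<noteq> 0"
proof -
  have "1 / q > 1" using q_pos q_less_1 by simp
  then have *: "q - 1 / q < 0" using q_less_1 by simp
  then show "q - 1 / q \<noteq> 0" "1 / q - q \<noteq> 0" by auto
  then show "complex_of_real q - 1 / complex_of_real q \<noteq> 0"
    by (metis of_real_1 of_real_diff of_real_divide of_real_eq_0_iff)
qed

section \<open>Functionals on words that factor through U\<close>

definition urel :: "wfun \<Rightarrow> bool" where
  "urel \<phi> \<longleftrightarrow> (\<forall>u v.
     \<phi> (u @ UA # UD # v) = \<phi> (u @ v) \<and> \<phi> (u @ UD # UA # v) = \<phi> (u @ v) \<and>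
     \<phi> (u @ UA # UB # v) = of_real q * \<phi> (u @ UB # UA # v) \<and>
     \<phi> (u @ UC # UA # v) = of_real q * \<phi> (u @ UA # UC # v) \<and>
     \<phi> (u @ UB # UC # v) - \<phi> (u @ UC # UB # v) =
       (1 / (of_real q - 1 / of_real q)) * (\<phi> (u @ UA # UA # v) - \<phi> (u @ UD # UD # v)))"

lemma urelD:
  assumes "urel \<phi>"
  shows "\<phi> (u @ UA # UD # v) = \<phi> (u @ v)" "\<phi> (u @ UD # UA # v) = \<phi> (u @ v)"
    "\<phi> (u @ UA # UB # v) = of_real q * \<phi> (u @ UB # UA # v)"
    "\<phi> (u @ UC # UA # v) = of_real q * \<phi> (u @ UA # UC # v)"
    "\<phi> (u @ UB # UD # v) = of_real q * \<phi> (u @ UD # UB # v)"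
    "\<phi> (u @ UD # UC # v) = of_real q * \<phi> (u @ UC # UD # v)"
    "\<phi> (u @ UB # UC # v) = \<phi> (u @ UC # UB # v) +
       (1 / (of_real q - 1 / of_real q)) * (\<phi> (u @ UA # UA # v) - \<phi> (u @ UD # UD # v))"
proof -
  note * = assms[unfolded urel_def, rule_format]
  show AD: "\<phi> (u @ UA # UD # v) = \<phi> (u @ v)" for u v using * by blast
  show DA: "\<phi> (u @ UD # UA # v) = \<phi> (u @ v)" for u v using * by blast
  show AB: "\<phi> (u @ UA # UB # v) = of_real q * \<phi> (u @ UB # UA # v)" for u v using * by blast
  show CA: "\<phi> (u @ UC # UA # v) = of_real q * \<phi> (u @ UA # UC # v)" for u v using * by blast
  \<comment> \<open>Insert DA = 1 in front, carry A across B, and cancel AD = 1 behind it.\<close>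
  show "\<phi> (u @ UB # UD # v) = of_real q * \<phi> (u @ UD # UB # v)"
    using DA[of u "UB # UD # v"] AB[of "u @ [UD]" "UD # v"] AD[of "u @ [UD, UB]" v] by simp
  show "\<phi> (u @ UD # UC # v) = of_real q * \<phi> (u @ UC # UD # v)"
    using DA[of u "UC # UD # v"] CA[of "u @ [UD]" "UD # v"] AD[of "u @ [UD, UC]" v] by simp
  show "\<phi> (u @ UB # UC # v) = \<phi> (u @ UC # UB # v) +
       (1 / (of_real q - 1 / of_real q)) * (\<phi> (u @ UA # UA # v) - \<phi> (u @ UD # UD # v))"
    using *[of u v] by (simp add: algebra_simps)
qed

lemmas urelD0 = urelD[where u = "[]", simplified]

lemma urel_Cons: "urel \<phi> \<Longrightarrow> urel (\<lambda>v. \<phi> (g # v))"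
  unfolding urel_def by (metis append_Cons)

text \<open>The comultiplication of U respects the relations. The left context is absorbed into the
  two functionals, which keep \<open>urel\<close> by \<open>urel_Cons\<close>, so only relations
  standing at the front of a word are computed.\<close>

lemma urel_conv:
  assumes "urel \<phi>" "urel \<psi>"
  shows "urel (conv \<phi> \<psi>)"
proof -
  have "conv \<phi> \<psi> (u @ UA # UD # v) = conv \<phi> \<psi> (u @ v) \<and> conv \<phi> \<psi> (u @ UD # UA # v) = conv \<phi> \<psi> (u @ v) \<and>
     conv \<phi> \<psi> (u @ UA # UB # v) = of_real q * conv \<phi> \<psi> (u @ UB # UA # v) \<and>
     conv \<phi> \<psi> (u @ UC # UA # v) = of_real q * conv \<phi> \<psi> (u @ UA # UC # v) \<and>
     conv \<phi> \<psi> (u @ UB # UC # v) - conv \<phi> \<psi> (u @ UC # UB # v) =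
       (1 / (of_real q - 1 / of_real q)) * (conv \<phi> \<psi> (u @ UA # UA # v) - conv \<phi> \<psi> (u @ UD # UD # v))"
    for u v
    using assms
  proof (induction u arbitrary: \<phi> \<psi> rule: ugen_list_induct)
    case Nil
    note 1 = urelD0[OF Nil(1)] and 2 = urelD0[OF Nil(2)]
    show ?case
      by (simp add: 1 2 conv_mult_left conv_mult_right conv_divide_left conv_divide_right
          conv_add_left conv_add_right conv_diff_left conv_diff_right add_divide_distrib diff_divide_distrib
          distrib_left)
  next
    case (B u)
    note 1 = B.IH[OF urel_Cons[OF B.prems(1), of UA] urel_Cons[OF B.prems(2), of UB]]
    note 2 = B.IH[OF urel_Cons[OF B.prems(1), of UB] urel_Cons[OF B.prems(2), of UD]]
    show ?case using 1 2 by (simp add: algebra_simps add_divide_distrib diff_divide_distrib)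
  next
    case (C u)
    note 1 = C.IH[OF urel_Cons[OF C.prems(1), of UA] urel_Cons[OF C.prems(2), of UC]]
    note 2 = C.IH[OF urel_Cons[OF C.prems(1), of UC] urel_Cons[OF C.prems(2), of UD]]
    show ?case using 1 2 by (simp add: algebra_simps add_divide_distrib diff_divide_distrib)
  qed (use urel_Cons in simp_all)
  then show ?thesis by (simp add: urel_def)
qed

text \<open>The two-dimensional representation: \<open>pr1 g u\<close> is the entry, at the position
  of g in the matrix with rows (\<alpha>, \<beta>) and (\<gamma>, \<delta>), of the product of the
  matrices of the letters of u. Prefixing a letter multiplies from the left.\<close>

fun pr1 :: "agen \<Rightarrow> wfun" where
  "pr1 Ga [] = 1"
| "pr1 Gb [] = 0"
| "pr1 Gc [] = 0"
| "pr1 Gd [] = 1"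
| "pr1 Ga (UA # u) = h * pr1 Ga u"
| "pr1 Gb (UA # u) = h * pr1 Gb u"
| "pr1 Gc (UA # u) = pr1 Gc u / h"
| "pr1 Gd (UA # u) = pr1 Gd u / h"
| "pr1 Ga (UD # u) = pr1 Ga u / h"
| "pr1 Gb (UD # u) = pr1 Gb u / h"
| "pr1 Gc (UD # u) = h * pr1 Gc u"
| "pr1 Gd (UD # u) = h * pr1 Gd u"
| "pr1 Ga (UB # u) = pr1 Gc u"
| "pr1 Gb (UB # u) = pr1 Gd u"
| "pr1 Gc (UB # u) = 0"
| "pr1 Gd (UB # u) = 0"
| "pr1 Ga (UC # u) = 0"
| "pr1 Gb (UC # u) = 0"
| "pr1 Gc (UC # u) = pr1 Ga u"
| "pr1 Gd (UC # u) = pr1 Gb u"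

fun pr :: "agen list \<Rightarrow> wfun" where
  "pr [] = eps"
| "pr (g # w) = conv (pr1 g) (pr w)"

lemma urel_eps: "urel eps"
proof -
  have "eps (u @ v) = eps u * eps v" for u v
    by (induction u rule: ugen_list_induct) auto
  then show ?thesis by (simp add: urel_def)
qed

lemma urel_pr1: "urel (pr1 g)"
proof -
  have "pr1 g (u @ UA # UD # v) = pr1 g (u @ v) \<and> pr1 g (u @ UD # UA # v) = pr1 g (u @ v) \<and>
     pr1 g (u @ UA # UB # v) = of_real q * pr1 g (u @ UB # UA # v) \<and>
     pr1 g (u @ UC # UA # v) = of_real q * pr1 g (u @ UA # UC # v) \<and>
     pr1 g (u @ UB # UC # v) - pr1 g (u @ UC # UB # v) =
       (1 / (of_real q - 1 / of_real q)) * (pr1 g (u @ UA # UA # v) - pr1 g (u @ UD # UD # v))"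
    for u v
  proof (induction u arbitrary: g rule: ugen_list_induct)
    case Nil
    have hh: "of_real q * x / h = h * x" for x
      using h_mult_h by (simp add: field_simps)
    have hh2: "x / h / h = x / of_real q" for x
      using h_mult_h by (simp add: field_simps)
    have hh3: "h * (h * x) = of_real q * x" for x
      using h_mult_h by (metis mult.assoc)
    have k: "(of_real q * x - x / of_real q) / (of_real q - 1 / of_real q) = x" for x :: complex
      using kappa_nonzero(3) by (simp add: nonzero_divide_eq_eq right_diff_distrib)
    have k': "(x / of_real q - of_real q * x) / (of_real q - 1 / of_real q) = - x" for x :: complex
      using kappa_nonzero(3) by (simp add: nonzero_divide_eq_eq right_diff_distrib)
    show ?case
      by (cases g) (simp_all add: hh hh2 hh3 k k')
  next
    case (A u)
    \<comment> \<open>A leading A multiplies every entry by a scalar, which then factors out of all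
      the relations.\<close>
    obtain c where "\<And>u. pr1 g (UA # u) = c * pr1 g u"
      by (cases g) (auto simp: divide_inverse mult.commute[of _ "inverse h"])
    then show ?case
      using A[of g] by (simp add: mult.left_commute flip: right_diff_distrib)
  next
    case (D u)
    obtain c where "\<And>u. pr1 g (UD # u) = c * pr1 g u"
      by (cases g) (auto simp: divide_inverse mult.commute[of _ "inverse h"])
    then show ?case
      using D[of g] by (simp add: mult.left_commute flip: right_diff_distrib)
  next
    case (B u)
    show ?case by (cases g) (use B[of Gc] B[of Gd] in simp_all)
  next
    case (C u)
    show ?case by (cases g) (use C[of Ga] C[of Gb] in simp_all)
  qed
  then show ?thesis by (simp add: urel_def)
qed

lemma urel_pr: "urel (pr w)"
  by (induction w) (simp_all add: urel_eps urel_pr1 urel_conv)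

lemma pr_singleton [simp]: "pr [g] = pr1 g"
  by (simp add: fun_eq_iff)

lemma pr_append: "pr (w @ w') = conv (pr w) (pr w')"
  by (induction w) (simp_all add: conv_assoc fun_eq_iff[of "conv eps _"])

text \<open>Stripping a letter turns one relation of A into others, hence the joint induction over
  all seven.\<close>

lemma A_rels_pr1:
  "conv (pr1 Ga) (pr1 Gb) u = of_real q * conv (pr1 Gb) (pr1 Ga) u"
  "conv (pr1 Ga) (pr1 Gc) u = of_real q * conv (pr1 Gc) (pr1 Ga) u"
  "conv (pr1 Gb) (pr1 Gd) u = of_real q * conv (pr1 Gd) (pr1 Gb) u"
  "conv (pr1 Gc) (pr1 Gd) u = of_real q * conv (pr1 Gd) (pr1 Gc) u"
  "conv (pr1 Gb) (pr1 Gc) u = conv (pr1 Gc) (pr1 Gb) u"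
  "conv (pr1 Ga) (pr1 Gd) u = of_real q * conv (pr1 Gb) (pr1 Gc) u + eps u"
  "conv (pr1 Gd) (pr1 Ga) u = (1 / of_real q) * conv (pr1 Gb) (pr1 Gc) u + eps u"
proof (induction u rule: ugen_list_induct)
qed (auto simp: conv_mult_left conv_mult_right conv_divide_left conv_divide_right h_square field_simps)

end

subsection \<open>The duality\<close>

lemma falg_hom_superset:
  assumes "finite K" "Poly_Mapping.keys x \<subseteq> K" "s 0 = 0"
  shows "falg_hom s f x = (\<Sum>w\<in>K. s (Poly_Mapping.lookup x w) * prod_list (map f w))"
  unfolding falg_hom_def
  by (rule sum.mono_neutral_left) (use assms in \<open>auto simp: in_keys_iff\<close>)

lemma falg_hom_single:
  "s 0 = 0 \<Longrightarrow> falg_hom s f (Poly_Mapping.single w c) = s c * prod_list (map f w)"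
  by (subst falg_hom_superset[of "{w}"]) auto

lemma falg_hom_add:
  assumes "\<And>a b. s (a + b) = s a + s b"
  shows "falg_hom s f (x + y) = falg_hom s f x + falg_hom s f y"
proof -
  have "s 0 = 0" using assms[of 0 0] by simp
  let ?K = "Poly_Mapping.keys x \<union> Poly_Mapping.keys y"
  have "Poly_Mapping.keys (x + y) \<subseteq> ?K" by (rule keys_add)
  then show ?thesis
    by (simp add: falg_hom_superset[of ?K] \<open>s 0 = 0\<close> lookup_add assms sum.distrib ring_distribs)
qed

lemma lin_falg_hom_scal:
  "lin F (falg_hom scal f x) = lin (\<lambda>w. lin F (prod_list (map f w))) x"
  by (induction x rule: poly_mapping_add_induct)
     (simp_all add: falg_hom_single falg_hom_add scal_add lin_add lin_scal)

lemma falg_hom_id: "falg_hom id f x = lin (\<lambda>w. prod_list (map f w)) x"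
  by (simp add: falg_hom_def lin_def)

lemma lin_tens: "lin f (tens x y) = lin (\<lambda>u. lin (\<lambda>v. f (u, v)) y) x"
  by (simp add: tens_def lin_sum) (simp add: lin_def sum_distrib_left mult.assoc)

lemma tens_single [simp]:
  "tens (Poly_Mapping.single u c) (Poly_Mapping.single v d) = Poly_Mapping.single (u, v) (c * d)"
  by (simp add: tens_def)

lemma single_Cons: "Poly_Mapping.single (g # w) 1 = gen g * Poly_Mapping.single w (1::complex)"
  by (simp add: gen_def mult_single plus_list_def)

lemma single_Nil: "Poly_Mapping.single [] (1::complex) = 1"
  by (simp add: zero_list_def flip: single_one)

lemma lin_one: "lin f 1 = f 0"
  by (simp flip: single_one)

lemma lin_swap: "lin (\<lambda>v. lin (\<lambda>p. F p v) S) x = lin (\<lambda>p. lin (F p) x) S"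
  by (induction x rule: poly_mapping_add_induct)
     (simp_all add: lin_mult_fun lin_add lin_add_fun)

lemma pair2_lin:
  "pair2 P S T = lin (\<lambda>(u, u'). lin (\<lambda>(v, v'). P (Poly_Mapping.single u 1) (Poly_Mapping.single v 1) *
     P (Poly_Mapping.single u' 1) (Poly_Mapping.single v' 1)) T) S"
  by (simp add: pair2_def lin_def case_prod_beta sum_distrib_left mult_ac)

text \<open>Ties the recursion \<open>conv\<close> to the comultiplication of the
  definition.\<close>

lemma conv_eq_lin_U_comult:
  "lin (\<lambda>(a, b). \<phi> a * \<psi> b) (U_comult (Poly_Mapping.single u 1)) = conv \<phi> \<psi> u"
proof (induction u arbitrary: \<phi> \<psi> rule: ugen_list_induct)
  case Nil
  show ?case
    by (simp add: U_comult_def falg_hom_single lin_one zero_prod_def zero_list_def)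
next
  case (A u)
  then show ?case by (simp add: U_comult_def falg_hom_single lin_mult gen_def plus_list_def case_prod_beta)
next
  case (B u)
  from B[of "\<lambda>v. \<phi> (UA # v)" "\<lambda>v. \<psi> (UB # v)"] B[of "\<lambda>v. \<phi> (UB # v)" "\<lambda>v. \<psi> (UD # v)"]
  show ?case by (simp add: U_comult_def falg_hom_single lin_mult gen_def plus_list_def case_prod_beta lin_add)
next
  case (C u)
  from C[of "\<lambda>v. \<phi> (UA # v)" "\<lambda>v. \<psi> (UC # v)"] C[of "\<lambda>v. \<phi> (UC # v)" "\<lambda>v. \<psi> (UD # v)"]
  show ?case by (simp add: U_comult_def falg_hom_single lin_mult gen_def plus_list_def case_prod_beta lin_add)
next
  case (D u)
  then show ?case by (simp add: U_comult_def falg_hom_single lin_mult gen_def plus_list_def case_prod_beta)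
qed

lemma lin_U_comult:
  "lin (\<lambda>(a, b). \<phi> a * \<psi> b) (U_comult X) = lin (\<lambda>u. conv \<phi> \<psi> u) X"
proof -
  have "lin (\<lambda>(a, b). \<phi> a * \<psi> b) (U_comult X) =
    lin (\<lambda>u. lin (\<lambda>(a, b). \<phi> a * \<psi> b) (U_comult (Poly_Mapping.single u 1))) X"
    by (simp add: U_comult_def lin_falg_hom_scal falg_hom_single)
  then show ?thesis by (simp add: conv_eq_lin_U_comult)
qed

lemma A_counit_lin: "A_counit \<xi> = lin (\<lambda>w. if set w \<subseteq> {Ga, Gd} then 1 else 0) \<xi>"
proof -
  have "prod_list (map (\<lambda>g. if g = Ga \<or> g = Gd then 1 else 0) w) = (if set w \<subseteq> {Ga, Gd} then 1 else (0::complex))"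
    for w by (induction w) auto
  then show ?thesis by (simp add: A_counit_def falg_hom_id)
qed

lemma U_counit_lin: "U_counit X = lin eps X"
proof -
  have "prod_list (map (\<lambda>g. if g = UA \<or> g = UD then 1 else 0) u) = eps u"
    for u by (induction u rule: ugen_list_induct) auto
  then show ?thesis by (simp add: U_counit_def falg_hom_id)
qed

text \<open>On words, the axioms of a dual pairing determine all values by induction on the two lengths.\<close>

lemma dual_pairing_unique:
  assumes P: "is_dual_pairing q P" and P': "is_dual_pairing q P'"
  shows "P = P'"
proof -
  have gens: "P (gen g) (Poly_Mapping.single w 1) = P' (gen g) (Poly_Mapping.single w 1)" for g w
  proof (induction w arbitrary: g)
    case Nil
    then show ?case using P P' by (simp add: is_dual_pairing_def single_Nil)
  next
    case (Cons h w)
    \<comment> \<open>A single generator of U against a word: the coproduct of g peels one letter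
      off the word, and its tensor factors are again single generators.\<close>
    have *: "R (gen g) (Poly_Mapping.single (h # w) 1) =
      lin (\<lambda>(u, u'). R (Poly_Mapping.single u 1) (gen h) * R (Poly_Mapping.single u' 1) (Poly_Mapping.single w 1))
         (U_comult_gen g)" if "is_dual_pairing q R" for R
    proof -
      have "R (gen g) (gen h * Poly_Mapping.single w 1) = pair2 R (U_comult (gen g)) (tens (gen h) (Poly_Mapping.single w 1))"
        using that unfolding is_dual_pairing_def by blast
      then show ?thesis
        by (subst single_Cons[of h w]) (simp add: pair2_lin lin_tens case_prod_beta U_comult_def falg_hom_single gen_def)
    qed
    have "P (gen g) (gen h) = P' (gen g) (gen h)" for g h
      using P P' by (simp add: is_dual_pairing_def)
    with Cons show ?case unfolding *[OF P] *[OF P']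
      by (cases g) (simp_all add: gen_def lin_add)
  qed
  have words: "P (Poly_Mapping.single u 1) (Poly_Mapping.single w 1) = P' (Poly_Mapping.single u 1) (Poly_Mapping.single w 1)" for u w
  proof (induction u arbitrary: w)
    case Nil
    then show ?case using P P' by (simp add: is_dual_pairing_def single_Nil)
  next
    case (Cons g u)
    \<comment> \<open>The word in U is peeled by the coproduct of A. Its tensor factors are
      arbitrary words, hence the induction over u keeps w general.\<close>
    have *: "R (Poly_Mapping.single (g # u) 1) \<xi> =
      lin (\<lambda>(v, v'). R (gen g) (Poly_Mapping.single v 1) * R (Poly_Mapping.single u 1) (Poly_Mapping.single v' 1))
         (A_comult \<xi>)" if "is_dual_pairing q R" for R \<xi>
    proof -
      have "R (gen g * Poly_Mapping.single u 1) \<xi> = pair2 R (tens (gen g) (Poly_Mapping.single u 1)) (A_comult \<xi>)"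
        using that unfolding is_dual_pairing_def by blast
      then show ?thesis
        by (subst single_Cons[of g u]) (simp add: pair2_lin lin_tens case_prod_beta gen_def)
    qed
    show ?case unfolding *[OF P] *[OF P'] by (simp add: gens Cons)
  qed
  have "P X \<xi> = P' X \<xi>" for X \<xi>
  proof (induction X rule: poly_mapping_add_induct)
    case (single u c)
    show ?case
    proof (induction \<xi> rule: poly_mapping_add_induct)
      case (single w d)
      have R: "R (Poly_Mapping.single u c) (Poly_Mapping.single w d) =
        c * (d * R (Poly_Mapping.single u 1) (Poly_Mapping.single w 1))" if "is_dual_pairing q R" for R
      proof -
        have "R (scal c * X) \<xi> = c * R X \<xi>" "R X (scal c * \<xi>) = c * R X \<xi>" for c X \<xi>
          using that unfolding is_dual_pairing_def by blast+
        then show ?thesis by (subst (1 2) single_conv_scal) simp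
      qed
      show ?case by (simp only: R[OF P] R[OF P'] words)
    next
      case (add x y)
      then show ?case using P P' by (simp add: is_dual_pairing_def)
    qed
  next
    case (add x y)
    then show ?case using P P' by (simp add: is_dual_pairing_def)
  qed
  then show ?thesis by (simp add: fun_eq_iff)
qed

section \<open>Construction of the pairing\<close>

context quantum
begin

text \<open>\<xi> seen as a functional on words of U; from here on the argument uses it in place of
  the pairing.\<close>

definition ev :: "agen falg \<Rightarrow> wfun" where
  "ev \<xi> u = lin (\<lambda>w. pr w u) \<xi>"

definition pair :: "ugen falg \<Rightarrow> agen falg \<Rightarrow> complex" where
  "pair X \<xi> = lin (ev \<xi>) X"

lemma ev_add: "ev (x + y) u = ev x u + ev y u"
  by (simp add: ev_def lin_add)

lemma ev_diff: "ev (x - y) u = ev x u - ev y u"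
  by (simp add: ev_def lin_diff)

lemma ev_sum: "ev (\<Sum>a\<in>K. f a) u = (\<Sum>a\<in>K. ev (f a) u)"
  by (simp add: ev_def lin_sum)

lemma ev_zero [simp]: "ev 0 u = 0"
  by (simp add: ev_def)

lemma ev_scal: "ev (scal c * x) u = c * ev x u"
  by (simp add: ev_def lin_scal)

lemma ev_single [simp]: "ev (Poly_Mapping.single w c) u = c * pr w u"
  by (simp add: ev_def)

lemma ev_single_one [simp]: "ev (Poly_Mapping.single w 1) = pr w"
  by (simp add: fun_eq_iff)

lemma ev_gen [simp]: "ev (gen g) = pr1 g"
  by (simp add: gen_def fun_eq_iff)

lemma ev_one: "ev 1 = eps"
  by (simp add: ev_def fun_eq_iff lin_one zero_list_def)

lemma ev_scal_one: "ev (scal c) = (\<lambda>u. c * eps u)"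
  using ev_scal[of c 1] by (simp add: ev_one fun_eq_iff)

lemma ev_mult: "ev (x * y) = conv (ev x) (ev y)"
proof
  fix u
  have "ev (x * y) u = lin (\<lambda>w. lin (\<lambda>w'. conv (pr w) (pr w') u) y) x"
    by (simp add: ev_def lin_mult plus_list_def pr_append)
  also have "\<dots> = conv (ev x) (ev y) u"
    by (simp only: ev_def[abs_def] conv_lin_left conv_lin_right)
  finally show "ev (x * y) u = conv (ev x) (ev y) u" .
qed

lemma urel_lin:
  assumes "\<And>w. urel (F w)"
  shows "urel (\<lambda>u. lin (\<lambda>w. F w u) x)"
  unfolding urel_def
  by (intro allI conjI; simp only: urelD[OF assms] lin_add_fun lin_mult_fun lin_diff_fun) simp

lemma urel_ev: "urel (ev \<xi>)"
  unfolding ev_def[abs_def] by (rule urel_lin) (rule urel_pr)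

text \<open>Concatenation in U is dual to the comultiplication of A. For one generator this is the
  product of two-by-two matrices; \<open>conv_append_lin\<close> extends it to products of
  generators.\<close>

lemma pr_comult:
  "pr w (u @ v) = lin (\<lambda>(a, b). pr a u * pr b v) (A_comult (Poly_Mapping.single w 1))"
proof (induction w arbitrary: u v)
  case Nil
  have "eps (u @ v) = eps u * eps v"
    by (induction u rule: ugen_list_induct) auto
  then show ?case
    by (simp add: A_comult_def falg_hom_single lin_one zero_prod_def zero_list_def)
next
  case (Cons g w)
  have g: "pr1 g (u @ v) = lin (\<lambda>(a, b). pr a u * pr b v) (A_comult_gen g)" for u v
  proof (induction u arbitrary: g rule: ugen_list_induct)
    case Nil
    show ?case by (cases g) (auto simp: \<alpha>_def \<beta>_def \<gamma>_def \<delta>_def gen_def lin_add)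
  next
    case (A u)
    show ?case by (cases g; insert A[of g]) (auto simp: \<alpha>_def \<beta>_def \<gamma>_def \<delta>_def gen_def lin_add field_simps)
  next
    case (D u)
    show ?case by (cases g; insert D[of g]) (auto simp: \<alpha>_def \<beta>_def \<gamma>_def \<delta>_def gen_def lin_add field_simps)
  next
    case (B u)
    show ?case by (cases g; insert B[of Gc] B[of Gd]) (auto simp: \<alpha>_def \<beta>_def \<gamma>_def \<delta>_def gen_def lin_add)
  next
    case (C u)
    show ?case by (cases g; insert C[of Ga] C[of Gb]) (auto simp: \<alpha>_def \<beta>_def \<gamma>_def \<delta>_def gen_def lin_add)
  qed
  show ?case
    using conv_append_lin[where F = pr and F' = pr and G = pr and G' = pr, OF g Cons, of u v]
    by (simp add: A_comult_def falg_hom_single lin_mult case_prod_unfold plus_list_def pr_append)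
qed

lemma ev_append:
  "ev \<xi> (u @ v) = lin (\<lambda>(a, b). pr a u * pr b v) (A_comult \<xi>)"
  by (simp add: ev_def pr_comult A_comult_def lin_falg_hom_scal falg_hom_single)

lemma pair_mult_left: "pair (X * Y) \<xi> = pair2 pair (tens X Y) (A_comult \<xi>)"
  by (simp add: pair_def lin_mult plus_list_def ev_append pair2_lin lin_tens case_prod_beta)

lemma pair_mult_right: "pair X (\<xi> * \<eta>) = pair2 pair (U_comult X) (tens \<xi> \<eta>)"
proof -
  have "pair2 pair (U_comult X) (tens \<xi> \<eta>) = lin (\<lambda>(a, b). ev \<xi> a * ev \<eta> b) (U_comult X)"
    by (simp add: pair2_lin pair_def lin_tens lin_mult_fun lin_mult_fun_right flip: ev_def)
  then show ?thesis by (simp add: lin_U_comult pair_def ev_mult)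
qed

lemma pair_add_left: "pair (X + Y) \<xi> = pair X \<xi> + pair Y \<xi>"
  by (simp add: pair_def lin_add)

lemma pair_add_right: "pair X (\<xi> + \<eta>) = pair X \<xi> + pair X \<eta>"
  by (simp add: pair_def ev_add[abs_def] lin_add_fun)

lemma pair_scal_right: "pair X (scal c * \<xi>) = c * pair X \<xi>"
  by (simp add: pair_def ev_scal[abs_def] lin_mult_fun)

lemma ev_A_rels: "x \<in> A_rels q \<Longrightarrow> ev x u = 0"
  unfolding A_rels_def
  by (auto simp: \<alpha>_def \<beta>_def \<gamma>_def \<delta>_def mult.assoc ev_diff ev_scal ev_scal_one ev_mult conv_mult_left conv_divide_left ev_one A_rels_pr1)

lemma pair_U_rels: "X \<in> U_rels q \<Longrightarrow> pair X \<xi> = 0"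
  unfolding U_rels_def
  using urelD0[OF urel_ev[of \<xi>], where v = "[]"]
  by (auto simp: mult.assoc power2_eq_square gen_def mult_single plus_list_def pair_def lin_diff lin_scal
      lin_one zero_list_def)

text \<open>The property carried through the ideal quantifies over all \<xi>, because multiplying
  the left argument replaces \<xi> by the tensor factors of its coproduct.\<close>

lemma pair_rel_ideal_left: "X \<in> rel_ideal (U_rels q) \<Longrightarrow> \<forall>\<xi>. pair X \<xi> = 0"
proof (erule rel_ideal_minimal)
  show "\<forall>\<xi>. pair (y * x) \<xi> = 0" if "\<forall>\<xi>. pair x \<xi> = 0" for x y
  proof
    fix \<xi>
    have *: "lin (pr b) x = 0" for b
      using that[rule_format, of "Poly_Mapping.single b 1"] by (simp add: pair_def)
    have "lin (\<lambda>v. ev \<xi> (u @ v)) x = 0" for u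
      by (simp add: ev_append case_prod_beta lin_swap[of _ "A_comult \<xi>" x] lin_mult_fun *)
    then show "pair (y * x) \<xi> = 0"
      by (simp add: pair_def lin_mult plus_list_def)
  qed
  show "\<forall>\<xi>. pair (x * y) \<xi> = 0" if "\<forall>\<xi>. pair x \<xi> = 0" for x y
  proof
    fix \<xi>
    have *: "lin (pr b) x = 0" for b
      using that[rule_format, of "Poly_Mapping.single b 1"] by (simp add: pair_def)
    have "lin (\<lambda>u. lin (\<lambda>v. ev \<xi> (u @ v)) y) x = 0"
      by (simp add: ev_append case_prod_beta lin_swap[of _ "A_comult \<xi>"] lin_mult_fun lin_mult_fun_right *)
    then show "pair (x * y) \<xi> = 0"
      by (simp add: pair_def lin_mult plus_list_def)
  qed
qed (auto simp: pair_add_left pair_U_rels, simp add: pair_def)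

lemma pair_rel_ideal_right: "\<xi> \<in> rel_ideal (A_rels q) \<Longrightarrow> \<forall>u. ev \<xi> u = 0"
proof (erule rel_ideal_minimal)
  have zero: "ev x = (\<lambda>_. 0)" if "\<forall>u. ev x u = 0" for x
    using that by (simp add: fun_eq_iff)
  show "\<forall>u. ev (y * x) u = 0" "\<forall>u. ev (x * y) u = 0" if "\<forall>u. ev x u = 0" for x y
    by (simp_all add: ev_mult zero[OF that])
qed (simp_all add: ev_A_rels ev_add)

lemma is_dual_pairing_pair: "is_dual_pairing q pair"
  unfolding is_dual_pairing_def
proof (intro conjI allI ballI)
  show "pair (scal c * X) \<xi> = c * pair X \<xi>" for c X \<xi>
    by (simp add: pair_def lin_scal)
  show "pair X \<xi> = 0" if "X \<in> rel_ideal (U_rels q)" for X \<xi>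
    using pair_rel_ideal_left[OF that] by simp
  show "pair X \<xi> = 0" if "\<xi> \<in> rel_ideal (A_rels q)" for X \<xi>
    using pair_rel_ideal_right[OF that] by (simp add: pair_def lin_def)
  have w: "pr w [] = (if set w \<subseteq> {Ga, Gd} then 1 else 0)" for w
  proof (induction w)
    case (Cons g w)
    then show ?case by (cases g) auto
  qed simp
  show "pair 1 \<xi> = A_counit \<xi>" for \<xi>
    by (simp only: pair_def lin_one zero_list_def ev_def A_counit_lin w)
  show "pair X 1 = U_counit X" for X
    by (simp add: pair_def ev_one U_counit_lin)
  have hq: "complex_of_real (q powr (1/2)) = h" "complex_of_real (q powr (-1/2)) = 1 / h"
    using q_pos by (simp_all add: h_def powr_half_sqrt powr_minus_divide)
  show "pair (gen g) (gen k) = gen_pairing q g k" for g k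
    unfolding pair_def gen_def lin_single ev_single_one pr_singleton
    by (cases g; cases k; simp only: pr1.simps gen_pairing.simps hq; simp)
qed (fact pair_add_left pair_add_right pair_scal_right pair_mult_left pair_mult_right)+

lemma pairing_eq: "pairing q = pair"
  unfolding pairing_def using is_dual_pairing_pair dual_pairing_unique by blast

end

subsection \<open>Non-degeneracy of the duality\<close>

text \<open>Powers may be replaced by any polynomial, which can then be chosen to vanish at all
  bases but one.\<close>

lemma exponential_sum_poly:
  fixes c x :: "'w \<Rightarrow> 'a::comm_ring_1"
  assumes "\<And>n. (\<Sum>w\<in>K. c w * x w ^ n) = 0"
  shows "(\<Sum>w\<in>K. c w * poly Q (x w)) = 0"
proof -
  have "(\<Sum>w\<in>K. c w * poly Q (x w)) = (\<Sum>w\<in>K. \<Sum>i\<le>degree Q. coeff Q i * (c w * x w ^ i))"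
    by (simp add: poly_altdef sum_distrib_left mult_ac)
  also have "\<dots> = (\<Sum>i\<le>degree Q. coeff Q i * (\<Sum>w\<in>K. c w * x w ^ i))"
    by (subst sum.swap) (simp add: sum_distrib_left)
  finally show ?thesis using assms by simp
qed

text \<open>The coproduct hands each B, and each C, of the word to exactly one factor, so lower
  bounds on their number add up. The slacks c and c' account for letters already stripped off during
  the induction.\<close>

lemma conv_support:
  assumes "\<And>v. \<phi> v \<noteq> 0 \<Longrightarrow> m \<le> count_list v g + c" "\<And>v. \<psi> v \<noteq> 0 \<Longrightarrow> m' \<le> count_list v g + c'"
    and "g = UB \<or> g = UC" and "conv \<phi> \<psi> u \<noteq> 0"
  shows "m + m' \<le> count_list u g + c + c'"
  using assms
proof (induction u arbitrary: \<phi> \<psi> c c' rule: ugen_list_induct)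
  case Nil
  then show ?case using Nil(1)[of "[]"] Nil(2)[of "[]"] by auto
next
  case (A u)
  have "m + m' \<le> count_list u g + c + c'"
  proof (rule A.IH)
    show "m \<le> count_list v g + c" if "\<phi> (UA # v) \<noteq> 0" for v using A.prems(1)[OF that] A.prems(3) by auto
    show "m' \<le> count_list v g + c'" if "\<psi> (UA # v) \<noteq> 0" for v using A.prems(2)[OF that] A.prems(3) by auto
  qed (use A.prems in auto)
  then show ?case using A.prems(3) by auto
next
  case (D u)
  have "m + m' \<le> count_list u g + c + c'"
  proof (rule D.IH)
    show "m \<le> count_list v g + c" if "\<phi> (UD # v) \<noteq> 0" for v using D.prems(1)[OF that] D.prems(3) by auto
    show "m' \<le> count_list v g + c'" if "\<psi> (UD # v) \<noteq> 0" for v using D.prems(2)[OF that] D.prems(3) by auto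
  qed (use D.prems in auto)
  then show ?case using D.prems(3) by auto
next
  case (B u)
  define e :: nat where "e = (if g = UB then 1 else 0)"
  from B.prems(4) have "conv (\<lambda>v. \<phi> (UA # v)) (\<lambda>v. \<psi> (UB # v)) u \<noteq> 0
    \<or> conv (\<lambda>v. \<phi> (UB # v)) (\<lambda>v. \<psi> (UD # v)) u \<noteq> 0" by auto
  then have "m + m' \<le> count_list u g + c + c' + e"
  proof
    assume 1: "conv (\<lambda>v. \<phi> (UA # v)) (\<lambda>v. \<psi> (UB # v)) u \<noteq> 0"
    have "m + m' \<le> count_list u g + c + (c' + e)"
    proof (rule B.IH)
      show "m \<le> count_list v g + c" if "\<phi> (UA # v) \<noteq> 0" for v using B.prems(1)[OF that] B.prems(3) by auto
      show "m' \<le> count_list v g + (c' + e)" if "\<psi> (UB # v) \<noteq> 0" for v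
        using B.prems(2)[OF that] B.prems(3) by (auto simp: e_def)
    qed (use B.prems 1 in auto)
    then show ?thesis by simp
  next
    assume 2: "conv (\<lambda>v. \<phi> (UB # v)) (\<lambda>v. \<psi> (UD # v)) u \<noteq> 0"
    have "m + m' \<le> count_list u g + (c + e) + c'"
    proof (rule B.IH)
      show "m \<le> count_list v g + (c + e)" if "\<phi> (UB # v) \<noteq> 0" for v
        using B.prems(1)[OF that] B.prems(3) by (auto simp: e_def)
      show "m' \<le> count_list v g + c'" if "\<psi> (UD # v) \<noteq> 0" for v using B.prems(2)[OF that] B.prems(3) by auto
    qed (use B.prems 2 in auto)
    then show ?thesis by simp
  qed
  then show ?case using B.prems(3) by (auto simp: e_def)
next
  case (C u)
  define e :: nat where "e = (if g = UC then 1 else 0)"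
  from C.prems(4) have "conv (\<lambda>v. \<phi> (UA # v)) (\<lambda>v. \<psi> (UC # v)) u \<noteq> 0
    \<or> conv (\<lambda>v. \<phi> (UC # v)) (\<lambda>v. \<psi> (UD # v)) u \<noteq> 0" by auto
  then have "m + m' \<le> count_list u g + c + c' + e"
  proof
    assume 1: "conv (\<lambda>v. \<phi> (UA # v)) (\<lambda>v. \<psi> (UC # v)) u \<noteq> 0"
    have "m + m' \<le> count_list u g + c + (c' + e)"
    proof (rule C.IH)
      show "m \<le> count_list v g + c" if "\<phi> (UA # v) \<noteq> 0" for v using C.prems(1)[OF that] C.prems(3) by auto
      show "m' \<le> count_list v g + (c' + e)" if "\<psi> (UC # v) \<noteq> 0" for v
        using C.prems(2)[OF that] C.prems(3) by (auto simp: e_def)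
    qed (use C.prems 1 in auto)
    then show ?thesis by simp
  next
    assume 2: "conv (\<lambda>v. \<phi> (UC # v)) (\<lambda>v. \<psi> (UD # v)) u \<noteq> 0"
    have "m + m' \<le> count_list u g + (c + e) + c'"
    proof (rule C.IH)
      show "m \<le> count_list v g + (c + e)" if "\<phi> (UC # v) \<noteq> 0" for v
        using C.prems(1)[OF that] C.prems(3) by (auto simp: e_def)
      show "m' \<le> count_list v g + c'" if "\<psi> (UD # v) \<noteq> 0" for v using C.prems(2)[OF that] C.prems(3) by auto
    qed (use C.prems 2 in auto)
    then show ?thesis by simp
  qed
  then show ?case using C.prems(3) by (auto simp: e_def)
qed

section \<open>Positivity and independence of normal words\<close>

definition nonneg :: "complex set" where "nonneg = {x. 0 \<le> Re x \<and> Im x = 0}"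
definition posi :: "complex set" where "posi = {x. 0 < Re x \<and> Im x = 0}"

lemma nonneg_simps:
  "0 \<in> nonneg" "1 \<in> nonneg" "x \<in> nonneg \<Longrightarrow> y \<in> nonneg \<Longrightarrow> x + y \<in> nonneg"
  "x \<in> nonneg \<Longrightarrow> y \<in> nonneg \<Longrightarrow> x * y \<in> nonneg" "x \<in> nonneg \<Longrightarrow> y \<in> nonneg \<Longrightarrow> x / y \<in> nonneg"
  "x \<in> posi \<Longrightarrow> x \<in> nonneg" "x \<in> posi \<Longrightarrow> y \<in> nonneg \<Longrightarrow> x + y \<in> posi" "x \<in> posi \<Longrightarrow> y \<in> nonneg \<Longrightarrow> y + x \<in> posi"
  "1 \<in> posi" "x \<in> posi \<Longrightarrow> y \<in> posi \<Longrightarrow> x * y \<in> posi" "x \<in> posi \<Longrightarrow> y \<in> posi \<Longrightarrow> x / y \<in> posi" "x \<in> posi \<Longrightarrow> x \<noteq> 0"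
  unfolding nonneg_def posi_def by (auto simp: Re_divide Im_divide)

lemma conv_nonneg:
  assumes "\<And>v. \<phi> v \<in> nonneg" "\<And>v. \<psi> v \<in> nonneg"
  shows "conv \<phi> \<psi> u \<in> nonneg"
  using assms by (induction u arbitrary: \<phi> \<psi> rule: ugen_list_induct) (simp_all add: nonneg_simps)

context quantum
begin

lemma h_pos: "h \<in> posi"
  using q_pos by (auto simp: h_def posi_def)

lemma pr1_nonneg: "pr1 g u \<in> nonneg"
  by (induction u arbitrary: g rule: ugen_list_induct; case_tac g) (simp_all add: nonneg_simps h_pos)

lemma pr_nonneg: "pr w u \<in> nonneg"
proof (induction w arbitrary: u)
  case Nil
  show ?case by (induction u rule: ugen_list_induct) (simp_all add: nonneg_simps)
qed (simp add: conv_nonneg pr1_nonneg)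

text \<open>The summand in which every B and every C goes to \<phi>, while the diagonal generator
  only sees A and D, is positive. The remaining summands are nonnegative, so nothing cancels
  it.\<close>

lemma conv_diag_pos:
  assumes "g = Ga \<or> g = Gd" "\<And>v. \<phi> v \<in> nonneg" "\<phi> u \<in> posi"
  shows "conv (pr1 g) \<phi> u \<in> posi"
  using assms
proof (induction u arbitrary: \<phi> rule: ugen_list_induct)
  case (B u)
  have "conv (pr1 g) (\<lambda>v. \<phi> (UB # v)) u \<in> posi"
    using B by auto
  then show ?case
    using B.prems h_pos by (auto simp: conv_mult_left conv_divide_left nonneg_simps conv_nonneg pr1_nonneg)
next
  case (C u)
  have "conv (pr1 g) (\<lambda>v. \<phi> (UC # v)) u \<in> posi"
    using C by auto
  then show ?case
    using C.prems h_pos by (auto simp: conv_mult_left conv_divide_left nonneg_simps conv_nonneg pr1_nonneg)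
qed (auto simp: conv_mult_left conv_divide_left nonneg_simps h_pos)

lemma pr_left_D: "\<exists>c\<in>posi. \<forall>u. pr w (UD # u) = c * pr w u"
proof (induction w)
  case Nil
  show ?case by (rule bexI[of _ 1]) (simp_all add: nonneg_simps)
next
  case (Cons g w)
  then obtain c where c: "c \<in> posi" "\<And>u. pr w (UD # u) = c * pr w u" by auto
  obtain d where d: "d \<in> posi" "\<And>u. pr1 g (UD # u) = d * pr1 g u"
  proof (cases g)
    case Ga
    then show ?thesis by (intro that[of "1 / h"]) (simp_all add: nonneg_simps h_pos)
  next
    case Gb
    then show ?thesis by (intro that[of "1 / h"]) (simp_all add: nonneg_simps h_pos)
  next
    case Gc
    then show ?thesis by (intro that[of h]) (simp_all add: nonneg_simps h_pos)
  next
    case Gd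
    then show ?thesis by (intro that[of h]) (simp_all add: nonneg_simps h_pos)
  qed
  show ?case
    by (rule bexI[of _ "d * c"]) (simp_all add: c d conv_mult_left conv_mult_right nonneg_simps mult.assoc)
qed

text \<open>Weights of the generators under appending the letter A, that is, for the torus action on
  the right.\<close>

fun rweight :: "agen \<Rightarrow> complex" where
  "rweight Ga = h" | "rweight Gb = 1 / h" | "rweight Gc = h" | "rweight Gd = 1 / h"

lemma pr1_snoc_A: "pr1 g (u @ [UA]) = rweight g * pr1 g u"
proof (induction u arbitrary: g rule: ugen_list_induct)
  case Nil
  show ?case by (cases g) simp_all
next
  case (A u)
  then show ?case by (cases g) simp_all
next
  case (B u)
  then show ?case by (cases g) simp_all
next
  case (C u)
  then show ?case by (cases g) simp_all
next
  case (D u)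
  then show ?case by (cases g) simp_all
qed

lemma pr1_snoc:
  "pr1 g (u @ [UA]) = rweight g * pr1 g u"
  "pr1 Ga (u @ [UD]) = pr1 Ga u / h" "pr1 Gb (u @ [UD]) = h * pr1 Gb u"
  "pr1 Gc (u @ [UD]) = pr1 Gc u / h" "pr1 Gd (u @ [UD]) = h * pr1 Gd u"
  "pr1 Ga (u @ [UB]) = 0" "pr1 Gb (u @ [UB]) = pr1 Ga u" "pr1 Gc (u @ [UB]) = 0" "pr1 Gd (u @ [UB]) = pr1 Gc u"
  "pr1 Ga (u @ [UC]) = pr1 Gb u" "pr1 Gb (u @ [UC]) = 0" "pr1 Gc (u @ [UC]) = pr1 Gd u" "pr1 Gd (u @ [UC]) = 0"
proof -
  have "pr1 Ga (u @ [UD]) = pr1 Ga u / h \<and> pr1 Gb (u @ [UD]) = h * pr1 Gb u \<and>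
    pr1 Gc (u @ [UD]) = pr1 Gc u / h \<and> pr1 Gd (u @ [UD]) = h * pr1 Gd u \<and>
    pr1 Ga (u @ [UB]) = 0 \<and> pr1 Gb (u @ [UB]) = pr1 Ga u \<and> pr1 Gc (u @ [UB]) = 0 \<and> pr1 Gd (u @ [UB]) = pr1 Gc u \<and>
    pr1 Ga (u @ [UC]) = pr1 Gb u \<and> pr1 Gb (u @ [UC]) = 0 \<and> pr1 Gc (u @ [UC]) = pr1 Gd u \<and> pr1 Gd (u @ [UC]) = 0"
    by (induction u rule: ugen_list_induct) simp_all
  then show "pr1 Ga (u @ [UD]) = pr1 Ga u / h" "pr1 Gb (u @ [UD]) = h * pr1 Gb u"
    "pr1 Gc (u @ [UD]) = pr1 Gc u / h" "pr1 Gd (u @ [UD]) = h * pr1 Gd u"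
    "pr1 Ga (u @ [UB]) = 0" "pr1 Gb (u @ [UB]) = pr1 Ga u" "pr1 Gc (u @ [UB]) = 0" "pr1 Gd (u @ [UB]) = pr1 Gc u"
    "pr1 Ga (u @ [UC]) = pr1 Gb u" "pr1 Gb (u @ [UC]) = 0" "pr1 Gc (u @ [UC]) = pr1 Gd u" "pr1 Gd (u @ [UC]) = 0"
    by auto
qed (rule pr1_snoc_A)

lemma pr_snoc_A: "pr w (u @ [UA]) = prod_list (map rweight w) * pr w u"
proof (induction w arbitrary: u)
  case Nil
  show ?case by (induction u rule: ugen_list_induct) simp_all
next
  case (Cons g w)
  then show ?case by (simp add: conv_snoc pr1_snoc conv_mult_left conv_mult_right)
qed

lemma pr_append_A: "pr w (u @ replicate n UA) = prod_list (map rweight w) ^ n * pr w u"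
proof (induction n arbitrary: u)
  case (Suc n)
  have "u @ replicate (Suc n) UA = (u @ [UA]) @ replicate n UA" by simp
  then show ?case using Suc[of "u @ [UA]"] by (simp only: pr_snoc_A) (simp add: mult_ac)
qed simp

text \<open>A basis of Poincare-Birkhoff-Witt type. \<alpha> and \<delta> never occur together,
  since \<alpha>\<delta> and \<delta>\<alpha> reduce to 1 plus a multiple of
  \<beta>\<gamma>.\<close>

definition normal_words :: "agen list set" where
  "normal_words = {replicate a Gb @ replicate b Gc @ replicate k g | a b k g. g = Ga \<or> g = Gd}"

text \<open>Giving each B to a \<beta> and each C to a \<gamma> produces a positive summand, and no
  summand is negative.\<close>

lemma pr_normal_pos:
  assumes "g = Ga \<or> g = Gd"
  shows "pr (replicate a Gb @ replicate b Gc @ replicate k g) (replicate a UB @ replicate b UC) \<in> posi"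
proof (induction a)
  case 0
  show ?case
  proof (simp, induction b)
    case 0
    show ?case using assms by (induction k) (auto simp: nonneg_simps)
  next
    case (Suc b)
    let ?w = "replicate b Gc @ replicate k g"
    let ?u = "replicate b UC"
    obtain c where "c \<in> posi" "\<And>u. pr ?w (UD # u) = c * pr ?w u" using pr_left_D by blast
    then have "conv (pr1 Ga) (\<lambda>v. pr ?w (UD # v)) ?u \<in> posi"
      using Suc by (simp add: conv_mult_right nonneg_simps conv_diag_pos pr_nonneg)
    moreover have "conv (\<lambda>v. pr1 Gc v / h) (\<lambda>v. pr ?w (UC # v)) ?u \<in> nonneg"
      by (intro conv_nonneg nonneg_simps pr1_nonneg pr_nonneg h_pos)
    ultimately show ?case by (simp add: nonneg_simps)
  qed
next
  case (Suc a)
  let ?w = "replicate a Gb @ replicate b Gc @ replicate k g"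
  let ?u = "replicate a UB @ replicate b UC"
  obtain c where "c \<in> posi" "\<And>u. pr ?w (UD # u) = c * pr ?w u" using pr_left_D by blast
  then have "conv (pr1 Gd) (\<lambda>v. pr ?w (UD # v)) ?u \<in> posi"
    using Suc by (simp add: conv_mult_right nonneg_simps conv_diag_pos pr_nonneg)
  moreover have "conv (\<lambda>v. h * pr1 Gb v) (\<lambda>v. pr ?w (UB # v)) ?u \<in> nonneg"
    by (intro conv_nonneg nonneg_simps pr1_nonneg pr_nonneg h_pos)
  ultimately show ?case by (simp add: nonneg_simps)
qed

lemma pr_support:
  "pr w u \<noteq> 0 \<Longrightarrow> count_list w Gb \<le> count_list u UB"
  "pr w u \<noteq> 0 \<Longrightarrow> count_list w Gc \<le> count_list u UC"
proof -
  \<comment> \<open>Weight count: the excess of letters B over letters C is 1 where \<beta> is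
    nonzero, -1 where \<gamma> is, and 0 for the diagonal entries.\<close>
  have 1: "(pr1 Gb u \<noteq> 0 \<longrightarrow> count_list u UB = Suc (count_list u UC)) \<and> (pr1 Ga u \<noteq> 0 \<longrightarrow> count_list u UB = count_list u UC) \<and>
     (pr1 Gd u \<noteq> 0 \<longrightarrow> count_list u UB = count_list u UC) \<and> (pr1 Gc u \<noteq> 0 \<longrightarrow> count_list u UC = Suc (count_list u UB))" for u
    by (induction u rule: ugen_list_induct) auto
  have B: "pr1 g u \<noteq> 0 \<Longrightarrow> count_list [g] Gb \<le> count_list u UB + 0"
   and C: "pr1 g u \<noteq> 0 \<Longrightarrow> count_list [g] Gc \<le> count_list u UC + 0" for g u
  proof -
    have "pr1 Gb u \<noteq> 0 \<Longrightarrow> 1 \<le> count_list u UB" "pr1 Gc u \<noteq> 0 \<Longrightarrow> 1 \<le> count_list u UC"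
      using 1[of u] by linarith+
    then show "pr1 g u \<noteq> 0 \<Longrightarrow> count_list [g] Gb \<le> count_list u UB + 0"
      "pr1 g u \<noteq> 0 \<Longrightarrow> count_list [g] Gc \<le> count_list u UC + 0"
      by (cases g; simp)+
  qed
  show "count_list w Gb \<le> count_list u UB" if "pr w u \<noteq> 0"
    using that
  proof (induction w arbitrary: u)
    case (Cons g w)
    show ?case
      using conv_support[OF B[of g], where \<psi> = "pr w" and c' = 0 and m' = "count_list w Gb" and u = u] Cons by auto
  qed simp
  show "count_list w Gc \<le> count_list u UC" if "pr w u \<noteq> 0"
    using that
  proof (induction w arbitrary: u)
    case (Cons g w)
    show ?case
      using conv_support[OF C[of g], where \<psi> = "pr w" and c' = 0 and m' = "count_list w Gc" and u = u] Cons by auto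
  qed simp
qed

lemma h_power_inj: "h ^ m = h ^ n \<Longrightarrow> m = n"
proof -
  assume "h ^ m = h ^ n"
  then have "sqrt q ^ m = sqrt q ^ n" unfolding h_def by (metis of_real_eq_iff of_real_power)
  moreover have "0 < sqrt q" "sqrt q < 1" using q_pos q_less_1 by auto
  ultimately show "m = n" by (metis linorder_neqE_nat order_less_irrefl power_strict_decreasing)
qed

text \<open>Once the powers of \<beta> and \<gamma> are fixed, the tail contributes a power of h,
  with positive exponents for \<alpha> and negative ones for \<delta>, and h is not a root of
  unity.\<close>

lemma rweight_normal:
  assumes w: "w \<in> normal_words" "w' \<in> normal_words" and
    cnt: "count_list w Gb = count_list w' Gb" "count_list w Gc = count_list w' Gc"
    and eq: "prod_list (map rweight w) = prod_list (map rweight w')"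
  shows "w = w'"
proof -
  have count: "count_list (replicate n x) y = (if x = y then n else 0)" for n and x y :: agen
    by (induction n) auto
  obtain a b k g where 1: "w = replicate a Gb @ replicate b Gc @ replicate k g" "g = Ga \<or> g = Gd"
    using w(1) by (auto simp: normal_words_def)
  obtain a' b' k' g' where 2: "w' = replicate a' Gb @ replicate b' Gc @ replicate k' g'" "g' = Ga \<or> g' = Gd"
    using w(2) by (auto simp: normal_words_def)
  have [simp]: "a' = a" "b' = b"
    using cnt 1 2 by (auto simp: count)
  have "rweight g ^ k = rweight g' ^ k'"
    using eq by (auto simp: 1 2 prod_list_replicate)
  moreover have "k = 0 \<and> k' = 0" if "h ^ k = (1 / h) ^ k'" for k k'
    using h_power_inj[of "k + k'" 0] that by (simp add: power_divide nonzero_eq_divide_eq power_add)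
  moreover have "k = k'" if "(1 / h) ^ k = (1 / h) ^ k'"
    using that h_power_inj[of k k'] by (simp add: power_divide)
  ultimately have "k = k' \<and> (k = 0 \<or> g = g')"
    using 1(2) 2(2) h_power_inj[of k k'] by (elim disjE) (simp_all, metis+)
  then show ?thesis using 1 2 by auto
qed

text \<open>Evaluate at the words B^a C^b A^n, where a and b are the exponents of a word of y with a
  + b minimal. Support bounds and minimality leave only words with exactly these exponents; they
  have distinct right weights, so the exponential sum in n separates them.\<close>

lemma normal_words_independent:
  assumes keys: "Poly_Mapping.keys y \<subseteq> normal_words" and zero: "\<And>u. ev y u = 0"
  shows "y = 0"
proof (rule ccontr)
  assume "y \<noteq> 0"
  let ?K = "Poly_Mapping.keys y"
  let ?f = "\<lambda>w. count_list w Gb + count_list w Gc"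
  have "?K \<noteq> {}" using \<open>y \<noteq> 0\<close> by simp
  then obtain w0 where w0: "w0 \<in> ?K" "\<And>w. w \<in> ?K \<Longrightarrow> ?f w0 \<le> ?f w"
    using that[OF arg_min_if_finite(1)[of ?K ?f] arg_min_least[of ?K _ ?f]] by simp
  then obtain a b k g where 0: "w0 = replicate a Gb @ replicate b Gc @ replicate k g" "g = Ga \<or> g = Gd"
    using keys by (auto simp: normal_words_def)
  have count: "count_list (replicate n x) y = (if x = y then n else 0)" for n and x y :: 'z
    by (induction n) auto
  have f0: "count_list w0 Gb = a" "count_list w0 Gc = b"
    using 0 by (auto simp: count)
  let ?u = "replicate a UB @ replicate b UC"
  let ?x = "\<lambda>w. prod_list (map rweight w)"
  let ?c = "\<lambda>w. Poly_Mapping.lookup y w * pr w ?u"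
  have "(\<Sum>w\<in>?K. ?c w * ?x w ^ n) = 0" for n
    using zero[of "?u @ replicate n UA"]
    by (simp add: ev_def lin_def pr_append_A mult_ac del: append_assoc)
  note sum0 = exponential_sum_poly[OF this]
  \<comment> \<open>Vanishes at every occurring weight except that of \<open>w0\<close>.\<close>
  define Q where "Q = (\<Prod>z\<in>?x ` ?K - {?x w0}. [:- z, 1:])"
  have single: "?c w * poly Q (?x w) = (if w = w0 then ?c w0 * poly Q (?x w0) else 0)" if w: "w \<in> ?K" for w
  proof (cases "w = w0 \<or> pr w ?u = 0")
    case False
    then have "count_list w Gb \<le> a" "count_list w Gc \<le> b"
      using pr_support[of w ?u] by (auto simp: count)
    then have "count_list w Gb = a" "count_list w Gc = b"
      using w0(2)[OF w] f0 by auto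
    then have "?x w \<noteq> ?x w0"
      using rweight_normal[of w w0] False w w0(1) keys f0 by auto
    then have "poly Q (?x w) = 0"
      using w by (auto simp: Q_def poly_prod intro!: prod_zero bexI[of _ "?x w"])
    then show ?thesis using False by simp
  qed auto
  have "(\<Sum>w\<in>?K. ?c w * poly Q (?x w)) = (\<Sum>w\<in>?K. if w = w0 then ?c w0 * poly Q (?x w0) else 0)"
    by (rule sum.cong[OF refl single])
  also have "\<dots> = ?c w0 * poly Q (?x w0)"
    using w0(1) by simp
  finally have "?c w0 * poly Q (?x w0) = 0"
    using sum0[of Q] by simp
  moreover have "poly Q (?x w0) \<noteq> 0"
    by (auto simp: Q_def poly_prod)
  moreover have "pr w0 ?u \<noteq> 0"
    using pr_normal_pos[OF 0(2)] 0(1) nonneg_simps(12) by blast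
  ultimately show False using w0(1) by (simp add: in_keys_iff)
qed

section \<open>Normal words span the quantum group\<close>

abbreviation eqA :: "agen falg \<Rightarrow> agen falg \<Rightarrow> bool" (infix "\<approx>" 50) where
  "x \<approx> y \<equiv> x - y \<in> rel_ideal (A_rels q)"

lemma eqA_refl [simp]: "x \<approx> x"
  by (simp add: rel_ideal_zero)

lemma eqA_trans [trans]: "x \<approx> y \<Longrightarrow> y \<approx> z \<Longrightarrow> x \<approx> z"
  using rel_ideal_add[of "x - y" _ "y - z"] by simp

lemma eqA_sym: "x \<approx> y \<Longrightarrow> y \<approx> x"
  using rel_ideal_uminus[of "x - y"] by simp

lemma eqA_add: "x \<approx> y \<Longrightarrow> x' \<approx> y' \<Longrightarrow> x + x' \<approx> y + y'"
  using rel_ideal_add[of "x - y" _ "x' - y'"] by (simp add: algebra_simps)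

lemma eqA_mult: "x \<approx> y \<Longrightarrow> x' \<approx> y' \<Longrightarrow> x * x' \<approx> y * y'"
  using rel_ideal_add[OF rel_ideal_rmult[of "x - y" _ x'] rel_ideal_lmult[of "x' - y'" _ y]]
  by (simp add: algebra_simps)

definition qcomm :: "agen falg \<Rightarrow> agen falg \<Rightarrow> complex \<Rightarrow> bool" where
  "qcomm x y c \<longleftrightarrow> x * y \<approx> scal c * (y * x)"

lemma qcomm_mult:
  assumes "qcomm x y c" "qcomm x y' c'"
  shows "qcomm x (y * y') (c * c')"
proof -
  have "x * y * y' \<approx> scal c * (y * x) * y'"
    by (rule eqA_mult[OF assms(1)[unfolded qcomm_def] eqA_refl])
  also have "scal c * (y * x) * y' = scal c * y * (x * y')"
    by (simp add: mult.assoc)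
  also have "scal c * y * (x * y') \<approx> scal c * y * (scal c' * (y' * x))"
    by (rule eqA_mult[OF eqA_refl assms(2)[unfolded qcomm_def]])
  also have "scal c * y * (scal c' * (y' * x)) = scal (c * c') * (y * y' * x)"
    by (simp only: mult.assoc scal_mult scal_left_commute[of y])
  finally show ?thesis by (simp add: qcomm_def mult.assoc)
qed

lemma qcomm_power: "qcomm x y c \<Longrightarrow> qcomm x (y ^ n) (c ^ n)"
  by (induction n) (auto intro: qcomm_mult simp: qcomm_def[of _ 1])

lemma qcomm_gens:
  "qcomm \<alpha> \<beta> q" "qcomm \<alpha> \<gamma> q" "qcomm \<delta> \<beta> (1 / of_real q)" "qcomm \<delta> \<gamma> (1 / of_real q)" "qcomm \<gamma> \<beta> 1" "qcomm \<beta> \<gamma> 1"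
proof -
  have A: "x - y \<in> A_rels q \<Longrightarrow> x \<approx> y" for x y by (rule rel_ideal_base)
  show "qcomm \<alpha> \<beta> q" "qcomm \<alpha> \<gamma> q"
    unfolding qcomm_def by (rule A; simp add: A_rels_def mult.assoc)+
  have *: "qcomm \<delta> y (1 / of_real q)" if "y * \<delta> \<approx> scal q * (\<delta> * y)" for y
  proof -
    have "scal (-1 / q) * (y * \<delta> - scal q * (\<delta> * y)) \<in> rel_ideal (A_rels q)"
      by (rule rel_ideal_lmult) (rule that)
    also have "scal (-1 / q) * (y * \<delta> - scal q * (\<delta> * y)) = \<delta> * y - scal (1 / q) * (y * \<delta>)"
      by (simp add: right_diff_distrib scal_uminus flip: mult.assoc scal_mult)
    finally show ?thesis by (simp add: qcomm_def)
  qed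
  show "qcomm \<delta> \<beta> (1 / of_real q)" "qcomm \<delta> \<gamma> (1 / of_real q)"
    by (rule *, rule A; simp add: A_rels_def mult.assoc)+
  have "\<beta> * \<gamma> - \<gamma> * \<beta> \<in> rel_ideal (A_rels q)"
    by (rule rel_ideal_base) (simp add: A_rels_def)
  from rel_ideal_uminus[OF this] this show "qcomm \<gamma> \<beta> 1" "qcomm \<beta> \<gamma> 1"
    by (simp_all add: qcomm_def)
qed

definition spanned :: "agen falg \<Rightarrow> bool" where
  "spanned x \<longleftrightarrow> (\<exists>y. Poly_Mapping.keys y \<subseteq> normal_words \<and> x \<approx> y)"

lemma spanned_cong: "y \<approx> x \<Longrightarrow> spanned x \<Longrightarrow> spanned y"
  unfolding spanned_def by (metis eqA_trans)

lemma spanned_add: "spanned x \<Longrightarrow> spanned y \<Longrightarrow> spanned (x + y)"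
  unfolding spanned_def by (metis eqA_add keys_add subset_trans Un_least)

lemma spanned_scal: "spanned x \<Longrightarrow> spanned (scal c * x)"
proof -
  assume "spanned x"
  then obtain y where y: "Poly_Mapping.keys y \<subseteq> normal_words" "x \<approx> y" by (auto simp: spanned_def)
  have "Poly_Mapping.keys (scal c * y) \<subseteq> normal_words"
    using keys_mult[of "scal c" y] y(1) by (fastforce simp: scal_def split: if_splits)
  moreover have "scal c * x \<approx> scal c * y"
    by (rule eqA_mult) (use y in auto)
  ultimately show ?thesis by (auto simp: spanned_def)
qed

lemma gen_power: "gen g ^ n = Poly_Mapping.single (replicate n g) 1"
  by (induction n) (simp_all add: single_Cons single_Nil)

lemma spanned_normal:
  assumes "g = Ga \<or> g = Gd"
  shows "spanned (\<beta> ^ a * \<gamma> ^ b * gen g ^ k)"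
proof -
  have "\<beta> ^ a * \<gamma> ^ b * gen g ^ k = Poly_Mapping.single (replicate a Gb @ replicate b Gc @ replicate k g) 1"
    by (simp add: \<beta>_def \<gamma>_def gen_power mult_single plus_list_def)
  moreover have "replicate a Gb @ replicate b Gc @ replicate k g \<in> normal_words"
    using assms by (auto simp: normal_words_def)
  ultimately show ?thesis unfolding spanned_def
    by (metis eqA_refl keys_single empty_subsetI insert_subset zero_neq_one)
qed

text \<open>The diagonal generator moves across the \<beta> and \<gamma> at the price of a scalar.
  If it then meets its opposite, the pair becomes 1 plus a multiple of \<beta>\<gamma>, which
  shortens the tail by one and leaves two normal words.\<close>

lemma spanned_lmult_diag:
  assumes comm: "qcomm (gen g) (\<beta> ^ a * \<gamma> ^ b) c"
    and inv: "gen g * gen g' \<approx> scal d * (\<beta> * \<gamma>) + 1"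
    and g: "g = Ga \<and> g' = Gd \<or> g = Gd \<and> g' = Ga" and k: "g'' = g \<or> g'' = g'"
  shows "spanned (gen g * (\<beta> ^ a * \<gamma> ^ b * gen g'' ^ k))"
proof -
  have "gen g * (\<beta> ^ a * \<gamma> ^ b) * gen g'' ^ k \<approx> scal c * (\<beta> ^ a * \<gamma> ^ b * gen g) * gen g'' ^ k"
    using comm unfolding qcomm_def by (rule eqA_mult) simp
  then have *: "gen g * (\<beta> ^ a * \<gamma> ^ b * gen g'' ^ k) \<approx> scal c * (\<beta> ^ a * \<gamma> ^ b * (gen g * gen g'' ^ k))"
    by (simp only: mult.assoc)
  have "spanned (\<beta> ^ a * \<gamma> ^ b * (gen g * gen g'' ^ k))"
  proof (cases "g'' = g \<or> k = 0")
    case True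
    then show ?thesis
      using spanned_normal[of g a b "Suc k"] spanned_normal[of g a b 1] g by auto
  next
    case False
    then obtain k' where k: "g'' = g'" "k = Suc k'" using k by (cases k) auto
    have "\<beta> ^ a * \<gamma> ^ b * (gen g * gen g' * gen g' ^ k') \<approx> \<beta> ^ a * \<gamma> ^ b * ((scal d * (\<beta> * \<gamma>) + 1) * gen g' ^ k')"
      using inv by (intro eqA_mult) simp_all
    also have "\<beta> ^ a * \<gamma> ^ b * ((scal d * (\<beta> * \<gamma>) + 1) * gen g' ^ k') =
      scal d * (\<beta> ^ a * (\<gamma> ^ b * \<beta>) * \<gamma> * gen g' ^ k') + \<beta> ^ a * \<gamma> ^ b * gen g' ^ k'"
      by (simp add: distrib_left distrib_right mult.assoc scal_left_commute)
    \<comment> \<open>The new \<beta> still stands behind \<gamma>^b and has to be carried to the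
      other letters \<beta>.\<close>
    also have "scal d * (\<beta> ^ a * (\<gamma> ^ b * \<beta>) * \<gamma> * gen g' ^ k') + \<beta> ^ a * \<gamma> ^ b * gen g' ^ k' \<approx>
      scal d * (\<beta> ^ a * (\<beta> * \<gamma> ^ b) * \<gamma> * gen g' ^ k') + \<beta> ^ a * \<gamma> ^ b * gen g' ^ k'"
      using eqA_sym[OF qcomm_power[OF qcomm_gens(6), of b, unfolded qcomm_def]]
      by (intro eqA_add[OF _ eqA_refl] eqA_mult[OF eqA_refl, of _ _ "scal d"] eqA_mult[OF _ eqA_refl]
          eqA_mult[OF eqA_refl, of _ _ "\<beta> ^ a"]) simp
    also have "\<beta> ^ a * (\<beta> * \<gamma> ^ b) * \<gamma> = \<beta> ^ Suc a * \<gamma> ^ Suc b"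
      by (simp add: mult.assoc power_Suc2 del: power_Suc)
    finally have "\<beta> ^ a * \<gamma> ^ b * (gen g * gen g' * gen g' ^ k') \<approx>
      scal d * (\<beta> ^ Suc a * \<gamma> ^ Suc b * gen g' ^ k') + \<beta> ^ a * \<gamma> ^ b * gen g' ^ k'" .
    moreover have "spanned (scal d * (\<beta> ^ Suc a * \<gamma> ^ Suc b * gen g' ^ k') + \<beta> ^ a * \<gamma> ^ b * gen g' ^ k')"
      using g by (intro spanned_add spanned_scal spanned_normal) auto
    ultimately show ?thesis unfolding k by (simp add: mult.assoc spanned_cong)
  qed
  then show ?thesis by (rule spanned_cong[OF * spanned_scal])
qed

lemma spanned_lmult_normal:
  assumes g: "g = Ga \<or> g = Gd"
  shows "spanned (gen g' * (\<beta> ^ a * \<gamma> ^ b * gen g ^ k))"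
proof (cases g')
  case Gb
  then show ?thesis using spanned_normal[OF g, of "Suc a" b k] by (simp add: \<beta>_def mult.assoc)
next
  case Gc
  have "\<gamma> * \<beta> ^ a \<approx> \<beta> ^ a * \<gamma>"
    using qcomm_power[OF qcomm_gens(5), of a] by (simp add: qcomm_def)
  then have "\<gamma> * \<beta> ^ a * (\<gamma> ^ b * gen g ^ k) \<approx> \<beta> ^ a * \<gamma> * (\<gamma> ^ b * gen g ^ k)"
    by (rule eqA_mult) simp
  then have "gen g' * (\<beta> ^ a * \<gamma> ^ b * gen g ^ k) \<approx> \<beta> ^ a * \<gamma> ^ Suc b * gen g ^ k"
    using Gc by (simp add: \<gamma>_def mult.assoc)
  then show ?thesis
    by (rule spanned_cong) (rule spanned_normal[OF g])
next
  case Ga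
  show ?thesis
    unfolding Ga
  proof (rule spanned_lmult_diag)
    show "qcomm (gen Ga) (\<beta> ^ a * \<gamma> ^ b) (of_real q ^ a * of_real q ^ b)"
      unfolding \<alpha>_def[symmetric] by (intro qcomm_mult qcomm_power qcomm_gens)
    have "\<alpha> * \<delta> - (scal q * (\<beta> * \<gamma>) + 1) \<in> rel_ideal (A_rels q)"
      by (rule rel_ideal_base) (simp add: A_rels_def mult.assoc diff_diff_eq)
    then show "gen Ga * gen Gd \<approx> scal q * (\<beta> * \<gamma>) + 1" by (simp add: \<alpha>_def \<delta>_def)
  qed (use g in auto)
next
  case Gd
  show ?thesis
    unfolding Gd
  proof (rule spanned_lmult_diag)
    show "qcomm (gen Gd) (\<beta> ^ a * \<gamma> ^ b) ((1 / of_real q) ^ a * (1 / of_real q) ^ b)"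
      unfolding \<delta>_def[symmetric] by (intro qcomm_mult qcomm_power qcomm_gens)
    have "\<delta> * \<alpha> - (scal (1 / q) * (\<beta> * \<gamma>) + 1) \<in> rel_ideal (A_rels q)"
      by (rule rel_ideal_base) (simp add: A_rels_def mult.assoc diff_diff_eq)
    then show "gen Gd * gen Ga \<approx> scal (1 / q) * (\<beta> * \<gamma>) + 1" by (simp add: \<alpha>_def \<delta>_def)
  qed (use g in auto)
qed

lemma spanned_lmult: "spanned x \<Longrightarrow> spanned (gen g * x)"
proof -
  have *: "Poly_Mapping.keys y \<subseteq> normal_words \<Longrightarrow> spanned (gen g * y)" for y
  proof -
    assume y: "Poly_Mapping.keys y \<subseteq> normal_words"
    have "spanned (gen g * (\<Sum>w\<in>K. Poly_Mapping.single w (Poly_Mapping.lookup y w)))"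
      if "finite K" "K \<subseteq> normal_words" for K
      using that
    proof (induction K)
      case empty
      then show ?case by (auto simp: spanned_def intro!: exI[of _ 0] rel_ideal_zero)
    next
      case (insert w K)
      obtain a b k g' where w: "w = replicate a Gb @ replicate b Gc @ replicate k g'" "g' = Ga \<or> g' = Gd"
        using insert.prems by (auto simp: normal_words_def)
      have "\<beta> ^ a * \<gamma> ^ b * gen g' ^ k = Poly_Mapping.single w 1"
        by (simp add: w \<beta>_def \<gamma>_def gen_power mult_single plus_list_def)
      then have "spanned (scal (Poly_Mapping.lookup y w) * (gen g * Poly_Mapping.single w 1))"
        using spanned_scal spanned_lmult_normal[OF w(2)] by metis
      also have "scal (Poly_Mapping.lookup y w) * (gen g * Poly_Mapping.single w 1) =
        gen g * Poly_Mapping.single w (Poly_Mapping.lookup y w)"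
        by (subst (2) single_conv_scal) (simp add: scal_left_commute)
      finally show ?case using insert by (simp add: distrib_left spanned_add)
    qed
    from this[of "Poly_Mapping.keys y"] y show ?thesis
      by (simp flip: poly_mapping_expansion)
  qed
  assume "spanned x"
  then obtain y where y: "Poly_Mapping.keys y \<subseteq> normal_words" "x \<approx> y"
    by (auto simp: spanned_def)
  then show ?thesis
    by (intro spanned_cong[OF _ *[OF y(1)]] eqA_mult) auto
qed

lemma spanned_all: "spanned x"
proof (induction x rule: poly_mapping_add_induct)
  case (single w c)
  have "spanned (Poly_Mapping.single w 1)"
  proof (induction w)
    case Nil
    show ?case using spanned_normal[of Ga 0 0 0] by (simp add: single_Nil)
  next
    case (Cons g w)
    then show ?case unfolding single_Cons by (rule spanned_lmult)
  qed
  then show ?case by (subst single_conv_scal) (rule spanned_scal)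
qed (rule spanned_add)

text \<open>The difference is congruent to a combination of normal words, and such a combination is
  zero as soon as its functional is.\<close>

theorem pairing_nondegenerate:
  assumes "\<And>u. ev x u = ev y u"
  shows "x \<approx> y"
proof -
  obtain z where z: "Poly_Mapping.keys z \<subseteq> normal_words" "x - y \<approx> z"
    using spanned_all[of "x - y"] by (auto simp: spanned_def)
  have "ev z u = 0" for u
    using pair_rel_ideal_right[OF z(2), rule_format, of u] assms[of u] by (simp add: ev_diff)
  then have "z = 0" by (rule normal_words_independent[OF z(1)])
  with z(2) show ?thesis by simp
qed

lemma cls_eqI:
  assumes "\<And>u. ev x u = ev y u"
  shows "cls (A_rels q) x = cls (A_rels q) y"
  using pairing_nondegenerate[OF assms] by (simp add: cls_eq_iff)

end

subsection \<open>Uniqueness of functionals with prescribed restriction to the torus\<close>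

text \<open>A filtration degree: the relations of U exchange letters up to a scalar and up to words
  in which this number is smaller by two.\<close>

definition level :: "ugen list \<Rightarrow> nat" where
  "level w = count_list w UB + count_list w UC"

lemma level_simps [simp]:
  "level [] = 0" "level (UA # w) = level w" "level (UD # w) = level w"
  "level (UB # w) = Suc (level w)" "level (UC # w) = Suc (level w)"
  by (simp_all add: level_def)

lemma level_append [simp]: "level (u @ v) = level u + level v"
  by (simp add: level_def)

lemma level_replicate_A [simp]: "level (replicate n UA) = 0"
  by (induction n) simp_all

lemma level_0: "level w = 0 \<Longrightarrow> set w \<subseteq> {UA, UD}"
  by (induction w rule: ugen_list_induct) auto

text \<open>A polynomial having all the bases as roots has nonzero constant term, which expresses
  the value at exponent 0 through the values at positive exponents.\<close>

lemma exponential_sum_zero: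
  fixes c x :: "'w \<Rightarrow> 'a::field"
  assumes "\<And>n. (\<Sum>w\<in>K. c w * x w ^ Suc n) = 0" "\<And>w. w \<in> K \<Longrightarrow> x w \<noteq> 0" "finite K"
  shows "(\<Sum>w\<in>K. c w) = 0"
proof -
  define Q where "Q = (\<Prod>z\<in>x ` K. [:- z, 1:])"
  have Q0: "poly Q 0 \<noteq> 0" using assms(2,3) by (auto simp: Q_def poly_prod)
  obtain a R where QR: "Q = pCons a R" by (cases Q)
  have "(\<Sum>w\<in>K. (c w * x w) * poly R (x w)) = 0"
    by (rule exponential_sum_poly) (use assms(1) in \<open>simp add: mult_ac\<close>)
  moreover have "a * c w + c w * x w * poly R (x w) = 0" if "w \<in> K" for w
  proof -
    have "poly Q (x w) = 0" using that assms(3) by (auto simp: Q_def poly_prod intro!: prod_zero bexI[of _ "x w"])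
    then have "c w * poly Q (x w) = 0" by simp
    then show ?thesis by (simp add: QR algebra_simps)
  qed
  then have "(\<Sum>w\<in>K. a * c w + c w * x w * poly R (x w)) = 0"
    by simp
  ultimately have "a * (\<Sum>w\<in>K. c w) = 0"
    by (simp add: sum.distrib sum_distrib_left)
  moreover have "a \<noteq> 0" using Q0 QR by simp
  ultimately show ?thesis by simp
qed

context quantum
begin

text \<open>\<open>qex g x\<close> is the scalar picked up when g is carried leftwards over x, up to
  words of lower level.\<close>

fun qex :: "ugen \<Rightarrow> ugen \<Rightarrow> complex" where
  "qex UB UA = of_real q" | "qex UB UD = 1 / of_real q"
| "qex UC UA = 1 / of_real q" | "qex UC UD = of_real q"
| "qex _ _ = 1"

lemma swap_letters:
  assumes "urel \<psi>" "g = UB \<or> g = UC" and low: "\<And>w. level w < level (u @ x # g # v) \<Longrightarrow> \<psi> w = 0"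
  shows "\<psi> (u @ x # g # v) = qex g x * \<psi> (u @ g # x # v)"
  using assms(2)
proof
  assume g: "g = UB"
  show ?thesis
    using low[of "u @ UA # UA # v"] low[of "u @ UD # UD # v"]
    by (cases x) (simp_all add: g urelD[OF assms(1)])
next
  assume g: "g = UC"
  show ?thesis
    using low[of "u @ UA # UA # v"] low[of "u @ UD # UD # v"]
    by (cases x) (simp_all add: g urelD[OF assms(1)])
qed

lemma move_front:
  assumes "urel \<psi>" "g = UB \<or> g = UC" and low: "\<And>w. level w < level (u @ Y @ g # v) \<Longrightarrow> \<psi> w = 0"
  shows "\<psi> (u @ Y @ g # v) = prod_list (map (qex g) Y) * \<psi> (u @ g # Y @ v)"
  using low
proof (induction Y arbitrary: u)
  case (Cons x Y)
  have lev: "level (x # w) = level [x] + level w" "level (g # w) = Suc (level w)" for w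
    using level_append[of "[x]" w] assms(2) by auto
  have "\<psi> (u @ (x # Y) @ g # v) = \<psi> ((u @ [x]) @ Y @ g # v)" by simp
  also have "\<dots> = prod_list (map (qex g) Y) * \<psi> ((u @ [x]) @ g # Y @ v)"
    by (rule Cons.IH) (use Cons.prems in simp)
  also have "(u @ [x]) @ g # Y @ v = u @ x # g # (Y @ v)" by simp
  also have "\<psi> \<dots> = qex g x * \<psi> (u @ g # x # (Y @ v))"
    by (rule swap_letters[OF assms(1,2)])
       (use Cons.prems in \<open>simp add: lev(1)[of "_ # _"] lev(1)[of "_ @ _"] lev(2)\<close>)
  finally show ?case by (simp add: mult_ac)
qed simp

lemma qex_nonzero: "qex g x \<noteq> 0"
  by (cases g; cases x) simp_all

text \<open>Up to lower level any B or C can be carried to the front of a word, so it is enough to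
  pass the vanishing on to words that begin with one.\<close>

lemma level_induction:
  assumes "urel \<psi>" and zero: "\<And>u. set u \<subseteq> {UA, UD} \<Longrightarrow> \<psi> u = 0"
    and step: "\<And>Y. (\<And>w. level w \<le> level Y \<Longrightarrow> \<psi> w = 0) \<Longrightarrow> \<psi> (UB # Y) = 0 \<and> \<psi> (UC # Y) = 0"
  shows "\<psi> w = 0"
proof (induction "level w" arbitrary: w rule: less_induct)
  case less
  show ?case
  proof (cases "level w = 0")
    case True
    then show ?thesis using zero level_0 by blast
  next
    case False
    then have "\<exists>g\<in>set w. g = UB \<or> g = UC"
      by (induction w rule: ugen_list_induct) auto
    then obtain Y g v where w: "w = Y @ g # v" "g = UB \<or> g = UC"
      using split_list by metis
    have "\<psi> ([] @ Y @ g # v) = prod_list (map (qex g) Y) * \<psi> ([] @ g # Y @ v)"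
      by (rule move_front[OF assms(1) w(2)]) (use less w in simp)
    moreover have "\<psi> (g # Y @ v) = 0"
      using step[of "Y @ v"] less w by (metis level_append level_simps(4,5) less_Suc_eq_le add_Suc_right)
    ultimately show ?thesis using w by simp
  qed
qed

lemma ev_append_A:
  "ev \<xi> (u @ replicate n UA) =
    (\<Sum>w\<in>Poly_Mapping.keys \<xi>. Poly_Mapping.lookup \<xi> w * pr w u * prod_list (map rweight w) ^ n)"
  by (simp add: ev_def lin_def pr_append_A mult_ac)

lemma rweight_nonzero: "prod_list (map rweight w) \<noteq> 0"
proof (induction w)
  case (Cons g w)
  then show ?case by (cases g) auto
qed simp

text \<open>The twisted primitive elements and the numbers \<open>s\<close>, \<open>e\<close> below play the role of
  \<open>X\<^sub>\<sigma>\<close> and of its eigenvalue; modulo words with fewer letters \<open>B\<close>, \<open>C\<close> they identify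
  \<open>C\<close> with \<open>q B\<close> on either side of a word, and moving the letter across the word changes
  this relation unless the word has torus weight one. The weight one case follows since
  \<open>k \<mapsto> \<langle>u A\<^sup>k, \<xi>\<rangle>\<close> is an exponential sum.\<close>

definition right_spherical :: "complex \<Rightarrow> complex \<Rightarrow> wfun \<Rightarrow> bool" where
  "right_spherical s e \<psi> \<longleftrightarrow>
    (\<forall>Y. \<i> * h * \<psi> (Y @ [UB]) - \<i> / h * \<psi> (Y @ [UC]) - s * \<psi> (Y @ [UA]) + e * \<psi> (Y @ [UD]) = 0)"

definition left_spherical :: "complex \<Rightarrow> complex \<Rightarrow> wfun \<Rightarrow> bool" where
  "left_spherical s e \<psi> \<longleftrightarrow>
    (\<forall>Y. \<i> * h * \<psi> (UB # Y) - \<i> / h * \<psi> (UC # Y) - s * \<psi> (UA # Y) + e * \<psi> (UD # Y) = 0)"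

lemma h_relation:
  assumes "\<i> * h * b - \<i> / h * c = 0"
  shows "c = of_real q * b"
proof -
  have "\<i> * h * (\<i> * h * b - \<i> / h * c) = 0" using assms by simp
  then have "- (h * h) * b + c = 0" by (simp add: algebra_simps)
  then show ?thesis by (simp add: add_eq_0_iff2)
qed

theorem spherical_zero:
  assumes zero: "\<And>u. set u \<subseteq> {UA, UD} \<Longrightarrow> ev \<xi> u = 0"
    and right: "right_spherical s e (ev \<xi>)" and left: "left_spherical s' e' (ev \<xi>)"
  shows "ev \<xi> u = 0"
proof (rule level_induction[OF urel_ev zero])
  fix Y
  assume low: "\<And>w. level w \<le> level Y \<Longrightarrow> ev \<xi> w = 0"
  let ?P = "\<lambda>Y. prod_list (map (qex UB) Y)"
  have PC: "prod_list (map (qex UC) Y) * ?P Y = 1" for Y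
  proof (induction Y)
    case (Cons x Y)
    have "qex UC x * qex UB x = 1" by (cases x) simp_all
    moreover have "prod_list (map (qex UC) (x # Y)) * ?P (x # Y) =
      (qex UC x * qex UB x) * (prod_list (map (qex UC) Y) * ?P Y)" by (simp add: mult_ac)
    ultimately show ?case using Cons by simp
  qed simp
  \<comment> \<open>The terms with A and D have the level of Z, where the functional already
    vanishes; only B and C survive in the left equation.\<close>
  have C: "ev \<xi> (UC # Z) = of_real q * ev \<xi> (UB # Z)" if Z: "level Z = level Y" for Z
    using left[unfolded left_spherical_def, rule_format, of Z] low[of "UA # Z"] low[of "UD # Z"] Z
    by (intro h_relation) simp
  \<comment> \<open>Carrying B and C across Z multiplies by mutually inverse scalars. The relations
    C = q B at both ends are then compatible only if the value is zero or the scalar has square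
    one.\<close>
  have *: "ev \<xi> (UB # Z) = 0 \<or> ?P Z * ?P Z = 1" if Z: "level Z = level Y" for Z
  proof -
    have "ev \<xi> (Z @ [UC]) = of_real q * ev \<xi> (Z @ [UB])"
      using right[unfolded right_spherical_def, rule_format, of Z] low[of "Z @ [UA]"] low[of "Z @ [UD]"] Z
      by (intro h_relation) simp
    moreover have "ev \<xi> ([] @ Z @ g # []) = prod_list (map (qex g) Z) * ev \<xi> ([] @ g # Z @ [])"
      if "g = UB \<or> g = UC" for g
      by (rule move_front[OF urel_ev that]) (use that low Z in auto)
    ultimately have "prod_list (map (qex UC) Z) * ev \<xi> (UC # Z) = of_real q * (?P Z * ev \<xi> (UB # Z))"
      by simp
    then have e: "prod_list (map (qex UC) Z) * ev \<xi> (UC # Z) = of_real q * (?P Z * ev \<xi> (UB # Z))" .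
    have "ev \<xi> (UC # Z) = (prod_list (map (qex UC) Z) * ?P Z) * ev \<xi> (UC # Z)"
      using PC by simp
    also have "\<dots> = ?P Z * (prod_list (map (qex UC) Z) * ev \<xi> (UC # Z))"
      by (simp only: mult_ac)
    also have "\<dots> = of_real q * ((?P Z * ?P Z) * ev \<xi> (UB # Z))"
      unfolding e by (simp only: mult_ac)
    finally have "of_real q * ev \<xi> (UB # Z) = of_real q * ((?P Z * ?P Z) * ev \<xi> (UB # Z))"
      using C[OF Z] by simp
    then show ?thesis by simp
  qed
  have "ev \<xi> (UB # Y) = 0"
  proof (cases "?P Y * ?P Y = 1")
    case True
    \<comment> \<open>Appended letters A keep the level and make the square of the scalar a positive
      power of q, so these values vanish. As \<xi> is a finite combination of words, they form an
      exponential sum in n, and the missing exponent follows.\<close>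
    have "ev \<xi> ((UB # Y) @ replicate (Suc n) UA) = 0" for n
    proof -
      let ?Z = "Y @ replicate (Suc n) UA"
      have "?P ?Z = ?P Y * of_real q ^ Suc n"
        by (simp add: prod_list_replicate)
      then have "?P ?Z * ?P ?Z = (?P Y * ?P Y) * (of_real (q ^ Suc n) * of_real (q ^ Suc n))"
        by simp
      also have "\<dots> = of_real (q ^ Suc n * q ^ Suc n)"
        using True by simp
      finally have P: "?P ?Z * ?P ?Z = of_real (q ^ Suc n * q ^ Suc n)" .
      have "q ^ Suc n * q ^ Suc n < 1"
        using q_pos q_less_1 power_Suc_less_one[of q "n + Suc n"] by (simp only: power_add[symmetric] add_Suc)
      then have "?P ?Z * ?P ?Z \<noteq> 1"
        unfolding P by (metis of_real_1 of_real_eq_iff less_irrefl)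
      then show ?thesis using *[of ?Z] by simp
    qed
    then have "(\<Sum>w\<in>Poly_Mapping.keys \<xi>. Poly_Mapping.lookup \<xi> w * pr w (UB # Y)) = 0"
      unfolding ev_append_A
      by (rule exponential_sum_zero[where x = "\<lambda>w. prod_list (map rweight w)"])
         (simp_all only: rweight_nonzero finite_keys not_False_eq_True)
    then show ?thesis by (simp add: ev_def lin_def)
  next
    case False
    then show ?thesis using *[of Y] by simp
  qed
  then show "ev \<xi> (UB # Y) = 0 \<and> ev \<xi> (UC # Y) = 0"
    using C[of Y] by simp
qed

end

subsection \<open>Matrix elements\<close>

lemma weights_eq:
  assumes "2 * l = real N"
  shows "weights l = (\<lambda>x. l - real x) ` {..N}"
proof (rule Set.set_eqI)
  fix n
  show "n \<in> weights l \<longleftrightarrow> n \<in> (\<lambda>x. l - real x) ` {..N}"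
  proof
    assume "n \<in> weights l"
    then obtain x y where xy: "l - n = real x" "l + n = real y"
      by (auto simp: weights_def Nats_def)
    then have "real x + real y = real N" using assms by simp
    then have "x \<le> N" by linarith
    then show "n \<in> (\<lambda>x. l - real x) ` {..N}"
      using xy by (intro image_eqI[of _ _ x]) auto
  next
    assume "n \<in> (\<lambda>x. l - real x) ` {..N}"
    then obtain x where x: "n = l - real x" "x \<le> N" by auto
    then have "l + n = real (N - x)" using assms by (simp add: of_nat_diff)
    then show "n \<in> weights l" using x by (simp add: weights_def)
  qed
qed

lemma finite_weights [simp]: "2 * l = real N \<Longrightarrow> finite (weights l)"
  by (simp add: weights_eq)

locale spin = quantum +
  fixes l :: real and N :: nat
  assumes l: "2 * l = real N"
begin

lemma fin [simp]: "finite (weights l)"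
  using finite_weights[OF l] .

lemma weightsD: "n \<in> weights l \<Longrightarrow> - l \<le> n \<and> n \<le> l"
  using l by (auto simp: weights_eq[OF l])

lemma l_weight [simp]: "l \<in> weights l"
  by (auto simp: weights_eq[OF l] intro: image_eqI[of _ _ 0])

lemma weight_pred: "n \<in> weights l \<Longrightarrow> n \<noteq> - l \<Longrightarrow> n - 1 \<in> weights l"
proof -
  assume "n \<in> weights l" "n \<noteq> - l"
  then obtain x where "n = l - real x" "x \<le> N" by (auto simp: weights_eq[OF l])
  moreover from this \<open>n \<noteq> - l\<close> have "x \<noteq> N" using l by auto
  ultimately show ?thesis by (auto simp: weights_eq[OF l] intro!: image_eqI[of _ _ "Suc x"])
qed

lemma weight_succ: "n \<in> weights l \<Longrightarrow> n \<noteq> l \<Longrightarrow> n + 1 \<in> weights l"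
proof -
  assume "n \<in> weights l" "n \<noteq> l"
  then obtain x where "n = l - real x" "x \<le> N" "x \<noteq> 0" by (auto simp: weights_eq[OF l])
  then show ?thesis by (auto simp: weights_eq[OF l] intro!: image_eqI[of _ _ "x - 1"])
qed

definition supp :: "(real \<Rightarrow> complex) \<Rightarrow> bool" where
  "supp v \<longleftrightarrow> (\<forall>k. k \<notin> weights l \<longrightarrow> v k = 0)"

abbreviation T :: "ugen \<Rightarrow> (real \<Rightarrow> complex) \<Rightarrow> (real \<Rightarrow> complex)" where
  "T \<equiv> trep_gen q l"

lemma trep_gen_eq:
  assumes "supp v"
  shows "T g v k = v (k - trep_shift g) * of_real (trep_coeff q l g (k - trep_shift g))"
proof -
  have "T g v k = (\<Sum>n\<in>weights l. if n = k - trep_shift g then v n * of_real (trep_coeff q l g n) else 0)"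
    unfolding trep_gen_def ebasis_def by (intro sum.cong) auto
  also have "\<dots> = v (k - trep_shift g) * of_real (trep_coeff q l g (k - trep_shift g))"
    using assms by (simp add: supp_def)
  finally show ?thesis .
qed

lemma trep_coeff_end:
  "trep_coeff q l UB (- l) = 0" "trep_coeff q l UC l = 0"
  by simp_all

lemma supp_trep: "supp v \<Longrightarrow> supp (T g v)"
  unfolding supp_def
proof (intro allI impI)
  fix k
  assume v: "\<forall>k. k \<notin> weights l \<longrightarrow> v k = 0" and k: "k \<notin> weights l"
  have eq: "T g v k = v (k - trep_shift g) * of_real (trep_coeff q l g (k - trep_shift g))"
    using trep_gen_eq v by (simp add: supp_def)
  show "T g v k = 0"
  proof (cases g)
    case UB
    have "v (k + 1) = 0 \<or> k + 1 = - l"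
      using weight_pred[of "k + 1"] k v by auto
    then show ?thesis using UB eq trep_coeff_end(1) by (auto simp del: trep_coeff.simps)
  next
    case UC
    have "v (k - 1) = 0 \<or> k - 1 = l"
      using weight_succ[of "k - 1"] k v by auto
    then show ?thesis using UC eq trep_coeff_end(2) by (auto simp del: trep_coeff.simps)
  qed (use v k eq in auto)
qed

lemma trep_lin:
  "T g (\<lambda>k. c * v k) = (\<lambda>k. c * T g v k)"
  "T g (\<lambda>k. v k + v' k) = (\<lambda>k. T g v k + T g v' k)"
  by (simp_all add: trep_gen_def fun_eq_iff sum_distrib_left sum.distrib algebra_simps)

lemma foldr_trep_lin:
  "foldr T u (\<lambda>k. c * v k) = (\<lambda>k. c * foldr T u v k)"
  "foldr T u (\<lambda>k. v k + v' k) = (\<lambda>k. foldr T u v k + foldr T u v' k)"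
  by (induction u) (simp_all add: trep_lin)

lemma foldr_trep_sum:
  "foldr T u (\<lambda>k. \<Sum>a\<in>K. c a * v a k) = (\<lambda>k. \<Sum>a\<in>K. c a * foldr T u (v a) k)"
proof (induction K rule: infinite_finite_induct)
  case empty
  show ?case using foldr_trep_lin(1)[of u 0 "\<lambda>_. 0"] by simp
next
  case (insert a K)
  then show ?case by (simp add: foldr_trep_lin)
next
  case (infinite K)
  show ?case using foldr_trep_lin(1)[of u 0 "\<lambda>_. 0"] infinite by simp
qed

lemma supp_foldr: "supp v \<Longrightarrow> supp (foldr T u v)"
  by (induction u) (simp_all add: supp_trep)

lemma powr_mono_q: "a \<le> b \<Longrightarrow> q powr b \<le> q powr a"
  using q_pos q_less_1 powr_mono_both'[of a b q q] by (simp add: powr_mono')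

text \<open>B and C act by mutually transposed matrices.\<close>

lemma trep_coeff_BC: "trep_coeff q l UB (n + 1) = trep_coeff q l UC n"
  by (simp add: algebra_simps)

text \<open>The range is where both factors under the root are nonnegative. It includes n = -l-1 and
  n = l, where the radicand vanishes, so that the extreme weights need no separate
  treatment.\<close>

lemma trep_coeff_C_square:
  assumes "- l - 1 \<le> n" "n \<le> l"
  shows "trep_coeff q l UC n * trep_coeff q l UC n =
    (q powr (-2*l-1) + q powr (2*l+1) - q powr (2*n+1) - q powr (-2*n-1)) / (1/q - q)\<^sup>2"
proof -
  let ?X = "(q powr (-l+n) - q powr (l-n)) * (q powr (-l-n-1) - q powr (l+n+1))"
  have "0 \<le> ?X" using assms by (intro mult_nonneg_nonneg) (auto intro!: powr_mono_q)
  then have "trep_coeff q l UC n * trep_coeff q l UC n = ?X / (1/q - q)\<^sup>2"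
    by (simp add: power2_eq_square)
  also have "?X = q powr (-2*l-1) + q powr (2*l+1) - q powr (2*n+1) - q powr (-2*n-1)"
  proof -
    have "q powr (-l+n) * q powr (-l-n-1) = q powr (-2*l-1)" "q powr (-l+n) * q powr (l+n+1) = q powr (2*n+1)"
      "q powr (l-n) * q powr (-l-n-1) = q powr (-2*n-1)" "q powr (l-n) * q powr (l+n+1) = q powr (2*l+1)"
      by (simp_all flip: powr_add)
    then show ?thesis by (simp add: left_diff_distrib right_diff_distrib)
  qed
  finally show ?thesis .
qed

lemma trep_BC:
  assumes "supp v"
  shows "T UB (T UC v) k = of_real ((q powr (-2*l-1) + q powr (2*l+1) - q powr (2*k+1) - q powr (-2*k-1)) / (1/q - q)\<^sup>2) * v k"
    "T UC (T UB v) k = of_real ((q powr (-2*l-1) + q powr (2*l+1) - q powr (2*k-1) - q powr (-2*k+1)) / (1/q - q)\<^sup>2) * v k"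
proof -
  have 1: "T UB (T UC v) k = v k * (of_real (trep_coeff q l UC k) * of_real (trep_coeff q l UB (k + 1)))"
    using assms by (simp add: trep_gen_eq supp_trep del: trep_coeff.simps)
  have 2: "T UC (T UB v) k = v k * (of_real (trep_coeff q l UB k) * of_real (trep_coeff q l UC (k - 1)))"
    using assms by (simp add: trep_gen_eq supp_trep del: trep_coeff.simps)
  show "T UB (T UC v) k = of_real ((q powr (-2*l-1) + q powr (2*l+1) - q powr (2*k+1) - q powr (-2*k-1)) / (1/q - q)\<^sup>2) * v k"
  proof (cases "k \<in> weights l")
    case True
    then show ?thesis
      unfolding 1 trep_coeff_BC of_real_mult[symmetric] using weightsD[OF True]
      by (subst trep_coeff_C_square) auto
  qed (use 1 assms in \<open>simp add: supp_def\<close>)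
  show "T UC (T UB v) k = of_real ((q powr (-2*l-1) + q powr (2*l+1) - q powr (2*k-1) - q powr (-2*k+1)) / (1/q - q)\<^sup>2) * v k"
  proof (cases "k \<in> weights l")
    case True
    have B: "trep_coeff q l UB k = trep_coeff q l UC (k - 1)"
      using trep_coeff_BC[of "k - 1"] by (simp del: trep_coeff.simps)
    have e: "2 * (k - 1) + 1 = 2 * k - 1" "-2 * (k - 1) - 1 = -2 * k + 1" by simp_all
    show ?thesis
      unfolding 2 B of_real_mult[symmetric] using weightsD[OF True] trep_coeff_C_square[of "k - 1", unfolded e]
      by (simp del: trep_coeff.simps)
  qed (use 2 assms in \<open>simp add: supp_def\<close>)
qed

lemma trep_relations:
  assumes "supp v"
  shows "T UA (T UD v) = v" "T UD (T UA v) = v"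
    "T UA (T UB v) = (\<lambda>k. of_real q * T UB (T UA v) k)"
    "T UC (T UA v) = (\<lambda>k. of_real q * T UA (T UC v) k)"
    "T UB (T UC v) = (\<lambda>k. T UC (T UB v) k + 1 / (of_real q - 1 / of_real q) * (T UA (T UA v) k + (-1) * T UD (T UD v) k))"
proof -
  have pq: "q powr (x + 1) = q * q powr x" "q powr (x - 1) = q powr x / q" "q powr (1 - x) = q / q powr x" for x
    using q_pos by (simp_all add: powr_add powr_diff)
  show "T UA (T UD v) = v" "T UD (T UA v) = v"
    using q_pos assms by (auto simp: fun_eq_iff trep_gen_eq supp_trep simp flip: powr_add of_real_mult)
  show "T UA (T UB v) = (\<lambda>k. of_real q * T UB (T UA v) k)"
    using q_pos assms
    by (auto simp: fun_eq_iff trep_gen_eq supp_trep powr_minus pq divide_inverse simp del: trep_coeff.simps(3))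
  show "T UC (T UA v) = (\<lambda>k. of_real q * T UA (T UC v) k)"
    using q_pos assms
    by (auto simp: fun_eq_iff trep_gen_eq supp_trep powr_minus pq divide_inverse simp del: trep_coeff.simps(4))
  show "T UB (T UC v) = (\<lambda>k. T UC (T UB v) k + 1 / (of_real q - 1 / of_real q) * (T UA (T UA v) k + (-1) * T UD (T UD v) k))"
  proof
    fix k
    define a where "a = q powr (2 * k)"
    have a: "a > 0" using q_pos by (simp add: a_def)
    have p: "q powr (2*k+1) = q * a" "q powr (-2*k-1) = 1 / (q * a)" "q powr (2*k-1) = a / q"
        "q powr (-2*k+1) = q / a"
      using q_pos by (simp_all add: a_def powr_add powr_diff powr_minus divide_simps)
    have p': "q powr (-k) * q powr (-k) = 1 / a" "q powr k * q powr k = a"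
      using q_pos by (simp_all add: a_def powr_minus_divide flip: powr_add)
    let ?\<kappa> = "1 / q - q"
    have \<kappa>: "?\<kappa> \<noteq> 0" by (rule kappa_nonzero)
    have "(X - Y * ?\<kappa>) / ?\<kappa>\<^sup>2 = X / ?\<kappa>\<^sup>2 + 1 / (q - 1 / q) * Y" for X Y
    proof -
      have "1 / (q - 1 / q) = - (1 / ?\<kappa>)" by (metis minus_diff_eq minus_divide_right)
      moreover have "(X - Y * ?\<kappa>) / ?\<kappa>\<^sup>2 = X / ?\<kappa>\<^sup>2 - Y / ?\<kappa>"
        using \<kappa> by (simp only: diff_divide_distrib power2_eq_square) simp
      ultimately show ?thesis by simp
    qed
    moreover have "c - q * a - 1 / (q * a) = (c - a / q - q / a) - (1 / a - a) * ?\<kappa>" for c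
      using a by (simp add: field_simps)
    ultimately have *: "(c - q * a - 1 / (q * a)) / ?\<kappa>\<^sup>2 = (c - a / q - q / a) / ?\<kappa>\<^sup>2 + 1 / (q - 1 / q) * (1 / a - a)" for c
      by metis
    have AD: "T UA (T UA v) k = of_real (1 / a) * v k" "T UD (T UD v) k = of_real a * v k"
      using assms p' by (simp_all add: trep_gen_eq supp_trep mult.assoc flip: of_real_mult)
    show "T UB (T UC v) k = T UC (T UB v) k + 1 / (of_real q - 1 / of_real q) * (T UA (T UA v) k + (-1) * T UD (T UD v) k)"
      unfolding trep_BC[OF assms] AD p * by (simp add: distrib_right left_diff_distrib diff_divide_distrib)
  qed
qed

lemma urel_foldr:
  assumes "supp v"
  shows "urel (\<lambda>u. foldr T u v k)"
  unfolding urel_def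
  by (intro allI conjI)
     (simp_all only: foldr_append foldr.simps comp_apply trep_relations[OF supp_foldr[OF assms]] foldr_trep_lin,
      simp)

lemma supp_ebasis: "m \<in> weights l \<Longrightarrow> supp (ebasis m)"
  by (auto simp: supp_def ebasis_def)

text \<open>The highest weight matrix element is \<open>\<delta>\<^bsup>2l\<^esup>\<close>.\<close>

lemma highest_weight_element: "foldr T u (ebasis l) l = pr (replicate N Gd) u"
proof -
  let ?\<psi> = "\<lambda>u. foldr T u (ebasis l) l - pr (replicate N Gd) u"
  \<comment> \<open>The functional and \<delta>^(2l) both vanish on words with a leading B and on
    words with a trailing C, which together with the torus values drives the level
    induction.\<close>
  have B0: "T UB v l = 0" if "supp v" for v
    using that trep_gen_eq[OF that, of UB l] weightsD[of "l + 1"] by (auto simp: supp_def)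
  have C0: "T UC (ebasis l) = (\<lambda>k. 0 * ebasis l k)"
  proof
    fix k
    show "T UC (ebasis l) k = 0 * ebasis l k"
      using trep_coeff_end(2) trep_gen_eq[OF supp_ebasis[OF l_weight], of UC k]
      by (cases "k - 1 = l") (simp_all add: ebasis_def del: trep_coeff.simps)
  qed
  have prB: "pr (replicate n Gd) (UB # u) = (if n = 0 then 0 else 0)" for n u
  proof (induction n arbitrary: u)
    case (Suc n)
    have "(\<lambda>v. pr (replicate n Gd) (UB # v)) = (\<lambda>v. 0)" using Suc by auto
    then show ?case by simp
  qed simp
  have prC: "pr (replicate n Gd) (u @ [UC]) = 0" for n u
  proof (induction n arbitrary: u)
    case 0
    show ?case by (induction u rule: ugen_list_induct) auto
  next
    case (Suc n)
    have "(\<lambda>v. pr (replicate n Gd) (v @ [UC])) = (\<lambda>v. 0)" using Suc by auto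
    then show ?case by (simp add: conv_snoc pr1_snoc)
  qed
  have "urel ?\<psi>"
  proof -
    have "urel \<phi> \<Longrightarrow> urel \<psi> \<Longrightarrow> urel (\<lambda>u. \<phi> u - \<psi> u)" for \<phi> \<psi>
      unfolding urel_def by (simp add: algebra_simps)
    then show ?thesis using urel_foldr[OF supp_ebasis[OF l_weight]] urel_pr by blast
  qed
  moreover have "?\<psi> u = 0" if "set u \<subseteq> {UA, UD}" for u
  proof -
    have hN: "complex_of_real (q powr (- l)) = (1 / h) ^ N"
    proof -
      have "sqrt q ^ N = q powr l"
      proof -
        have "real N / 2 = l" using l by simp
        then show ?thesis
          using q_pos by (simp add: powr_half_sqrt[symmetric] powr_powr powr_realpow[symmetric])
      qed
      then have "h ^ N = of_real (q powr l)" by (simp add: h_def flip: of_real_power)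
      then show ?thesis by (simp add: powr_minus divide_inverse power_inverse)
    qed
    have hN': "complex_of_real (q powr l) = h ^ N"
      using hN by (simp add: powr_minus power_divide field_simps)
    have diagA: "T UA (\<lambda>k. c * ebasis l k) = (\<lambda>k. ((1 / h) ^ N * c) * ebasis l k)" for c
      unfolding trep_lin using trep_gen_eq[OF supp_ebasis[OF l_weight], of UA]
      by (auto simp: fun_eq_iff ebasis_def hN)
    have diagD: "T UD (\<lambda>k. c * ebasis l k) = (\<lambda>k. (h ^ N * c) * ebasis l k)" for c
      unfolding trep_lin using trep_gen_eq[OF supp_ebasis[OF l_weight], of UD]
      by (auto simp: fun_eq_iff ebasis_def hN')
    have prA: "pr (replicate n Gd) (UA # u) = (1 / h) ^ n * pr (replicate n Gd) u" for n u
    proof (induction n arbitrary: u)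
      case (Suc n)
      show ?case
        by (simp only: replicate_Suc pr.simps conv.simps pr1.simps Suc conv_mult_right conv_divide_left) simp
    qed simp
    have prD: "pr (replicate n Gd) (UD # u) = h ^ n * pr (replicate n Gd) u" for n u
      by (induction n arbitrary: u) (simp_all add: conv_mult_left conv_mult_right)
    have pr0: "pr (replicate n Gd) [] = 1" for n by (induction n) simp_all
    have "foldr T u (ebasis l) = (\<lambda>k. pr (replicate N Gd) u * ebasis l k)"
      using that
      by (induction u rule: ugen_list_induct) (auto simp: diagA diagD prA prD pr0)
    then show ?thesis by (simp add: ebasis_def)
  qed
  moreover have "?\<psi> (UB # Y) = 0 \<and> ?\<psi> (UC # Y) = 0" if low: "\<And>w. level w \<le> level Y \<Longrightarrow> ?\<psi> w = 0" for Y
  proof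
    show "?\<psi> (UB # Y) = 0"
      using B0[OF supp_foldr[OF supp_ebasis[OF l_weight]]] prB by simp
    \<comment> \<open>What is known concerns a trailing C; carrying it to the front costs only a
      nonzero scalar.\<close>
    have "?\<psi> ([] @ Y @ UC # []) = prod_list (map (qex UC) Y) * ?\<psi> ([] @ UC # Y @ [])"
      by (rule move_front) (use \<open>urel ?\<psi>\<close> low in auto)
    moreover have "?\<psi> (Y @ [UC]) = 0"
      using foldr_trep_lin(1)[of Y 0 "ebasis l"] by (simp add: prC C0)
    moreover have "prod_list (map (qex UC) Y) \<noteq> 0"
      by (induction Y) (simp_all add: qex_nonzero)
    ultimately show "?\<psi> (UC # Y) = 0" by simp
  qed
  ultimately have "?\<psi> u = 0" by (rule level_induction)
  then show ?thesis by simp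
qed

lemma powr_strict_q: "a < b \<Longrightarrow> q powr b < q powr a"
  using q_pos q_less_1 by (simp add: powr_less_mono')

lemma trep_coeff_C_pos: "- l \<le> n \<Longrightarrow> n < l \<Longrightarrow> 0 < trep_coeff q l UC n"
proof -
  assume n: "- l \<le> n" "n < l"
  have "1 < 1 / q" using q_pos q_less_1 by simp
  then have "0 < 1 / q - q" using q_less_1 by linarith
  moreover have "0 < (q powr (-l+n) - q powr (l-n)) * (q powr (-l-n-1) - q powr (l+n+1))"
    using n by (intro mult_pos_pos) (auto intro!: powr_strict_q)
  ultimately show ?thesis by simp
qed

text \<open>All coefficients met on the way down from the highest weight are nonzero. With
  \<open>raise_coord\<close> this reaches every matrix element from the highest one.\<close>

lemma lower_highest: "x \<le> N \<Longrightarrow> \<exists>c. c \<noteq> 0 \<and> foldr T (replicate x UB) (ebasis l) = (\<lambda>k. c * ebasis (l - real x) k)"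
proof (induction x)
  case 0
  show ?case by (auto intro!: exI[of _ 1])
next
  case (Suc x)
  then obtain c where c: "c \<noteq> 0" "foldr T (replicate x UB) (ebasis l) = (\<lambda>k. c * ebasis (l - real x) k)" by auto
  let ?n = "l - real x - 1"
  have nz: "trep_coeff q l UB (?n + 1) \<noteq> 0"
    unfolding trep_coeff_BC using trep_coeff_C_pos[of ?n] Suc.prems l by (simp del: trep_coeff.simps)
  have "supp (ebasis (l - real x))"
    using Suc.prems by (intro supp_ebasis) (auto simp: weights_eq[OF l])
  then have "T UB (ebasis (l - real x)) = (\<lambda>k. trep_coeff q l UB (?n + 1) * ebasis ?n k)"
    using trep_gen_eq[of "ebasis (l - real x)" UB]
    by (auto simp: fun_eq_iff ebasis_def simp del: trep_coeff.simps)
  then have "foldr T (replicate (Suc x) UB) (ebasis l) = (\<lambda>k. (c * trep_coeff q l UB (?n + 1)) * ebasis ?n k)"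
    by (simp only: replicate_Suc foldr.simps comp_apply c(2) trep_lin(1) mult.assoc)
  moreover have "?n = l - real (Suc x)" by simp
  ultimately show ?case
    using c(1) nz by (metis mult_eq_0_iff of_real_eq_0_iff)
qed

text \<open>The dual of \<open>lower_highest\<close>: powers of C bring any chosen coordinate to the
  top.\<close>

lemma raise_coord:
  assumes "x \<le> N"
  shows "\<exists>c. c \<noteq> 0 \<and> (\<forall>v. supp v \<longrightarrow> foldr T (replicate x UC) v l = c * v (l - real x))"
  using assms
proof (induction x)
  case 0
  show ?case by (auto intro!: exI[of _ 1])
next
  case (Suc x)
  then obtain c where c: "c \<noteq> 0" "\<And>v. supp v \<Longrightarrow> foldr T (replicate x UC) v l = c * v (l - real x)" by auto
  let ?n = "l - real x - 1"
  have nz: "trep_coeff q l UC ?n \<noteq> 0"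
    using trep_coeff_C_pos[of ?n] Suc.prems l by (simp del: trep_coeff.simps)
  have "foldr T (replicate (Suc x) UC) v l = c * trep_coeff q l UC ?n * v ?n" if v: "supp v" for v
  proof -
    have "foldr T (replicate (Suc x) UC) v l = foldr T (replicate x UC @ [UC]) v l"
      by (simp only: replicate_append_same replicate_Suc)
    also have "\<dots> = c * T UC v (l - real x)"
      using c(2)[OF supp_trep[OF v, of UC]] by simp
    finally show ?thesis using v by (simp add: trep_gen_eq algebra_simps del: trep_coeff.simps)
  qed
  moreover have "?n = l - real (Suc x)" by simp
  ultimately show ?case
    using c(1) nz by (metis mult_eq_0_iff of_real_eq_0_iff)
qed

text \<open>Translating \<delta>^(2l) on one side by a power of C and on the other by a power of B
  gives a nonzero multiple of the wanted functional, and translates of representable functionals are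
  representable by the coproduct of A.\<close>

lemma matrix_element_representable:
  assumes n: "n \<in> weights l" and m: "m \<in> weights l"
  shows "\<exists>\<xi>. \<forall>u. ev \<xi> u = foldr T u (ebasis m) n"
proof -
  obtain x y where xy: "n = l - real x" "x \<le> N" "m = l - real y" "y \<le> N"
    using n m by (auto simp: weights_eq[OF l])
  obtain c where c: "c \<noteq> 0" "foldr T (replicate y UB) (ebasis l) = (\<lambda>k. c * ebasis m k)"
    using lower_highest[OF xy(4)] xy by auto
  obtain d where d: "d \<noteq> 0" "\<And>v. supp v \<Longrightarrow> foldr T (replicate x UC) v l = d * v n"
    using raise_coord[OF xy(2)] xy by auto
  let ?\<xi>0 = "Poly_Mapping.single (replicate N Gd) 1 :: agen falg"
  have 0: "ev ?\<xi>0 u = foldr T u (ebasis l) l" for u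
    by (simp add: highest_weight_element)
  \<comment> \<open>Apply v to the first tensor factor of the coproduct of \<xi> and keep the
    second.\<close>
  have left: "\<exists>\<xi>'. \<forall>u. ev \<xi>' u = ev \<xi> (v @ u)" for \<xi> v
  proof -
    define \<xi>' where "\<xi>' = (\<Sum>p\<in>Poly_Mapping.keys (A_comult \<xi>).
      Poly_Mapping.single (snd p) (Poly_Mapping.lookup (A_comult \<xi>) p * pr (fst p) v))"
    have "ev \<xi>' u = ev \<xi> (v @ u)" for u
      unfolding ev_append by (simp add: \<xi>'_def ev_sum lin_def case_prod_unfold mult.assoc)
    then show ?thesis by blast
  qed
  have right: "\<exists>\<xi>'. \<forall>u. ev \<xi>' u = ev \<xi> (u @ v)" for \<xi> v
  proof -
    define \<xi>' where "\<xi>' = (\<Sum>p\<in>Poly_Mapping.keys (A_comult \<xi>).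
      Poly_Mapping.single (fst p) (Poly_Mapping.lookup (A_comult \<xi>) p * pr (snd p) v))"
    have "ev \<xi>' u = ev \<xi> (u @ v)" for u
      unfolding ev_append by (simp add: \<xi>'_def ev_sum lin_def case_prod_unfold mult_ac)
    then show ?thesis by blast
  qed
  obtain \<xi>1 where 1: "\<And>u. ev \<xi>1 u = ev ?\<xi>0 (replicate x UC @ u)" using left by blast
  obtain \<xi>2 where 2: "\<And>u. ev \<xi>2 u = ev \<xi>1 (u @ replicate y UB)" using right by blast
  have "ev (scal (1 / (c * d)) * \<xi>2) u = foldr T u (ebasis m) n" for u
  proof -
    have "ev \<xi>2 u = foldr T (replicate x UC) (foldr T u (\<lambda>k. c * ebasis m k)) l"
      by (simp only: 1 2 0 foldr_append comp_apply c(2))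
    also have "\<dots> = d * (c * foldr T u (ebasis m) n)"
      unfolding foldr_trep_lin(1) using d(2)[OF supp_foldr[OF supp_ebasis[OF m]], of u] by simp
    finally show ?thesis using c d by (simp add: ev_scal)
  qed
  then show ?thesis by blast
qed

lemma inner_prod_ebasis: "n \<in> weights l \<Longrightarrow> inner_prod l v (ebasis n) = v n"
  by (simp add: inner_prod_def ebasis_def if_distrib[of cnj] if_distrib[of "\<lambda>x. _ * x"] cong: if_cong)

text \<open>The definite description is well defined: \<open>matrix_element_representable\<close>
  provides a class, and non-degeneracy makes it the only one.\<close>

lemma tcoef_representative:
  assumes n: "n \<in> weights l" and m: "m \<in> weights l"
  shows "\<exists>\<xi>. tcoef q l n m = cls (A_rels q) \<xi> \<and> (\<forall>u. ev \<xi> u = foldr T u (ebasis m) n)"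
proof -
  obtain \<xi> where \<xi>: "\<And>u. ev \<xi> u = foldr T u (ebasis m) n"
    using matrix_element_representable[OF n m] by blast
  have rhs: "inner_prod l (trep q l X (ebasis m)) (ebasis n) = lin (\<lambda>u. foldr T u (ebasis m) n) X" for X
    unfolding inner_prod_ebasis[OF n] by (simp add: trep_def lin_def)
  have "tcoef q l n m = cls (A_rels q) \<xi>"
    unfolding tcoef_def rhs pairing_eq
  proof (rule the_equality)
    have "ev \<eta> u = ev \<xi> u" if "\<eta> \<in> cls (A_rels q) \<xi>" for \<eta> u
      using pair_rel_ideal_right[of "\<eta> - \<xi>"] that by (simp add: cls_mem_iff ev_diff)
    then show "cls (A_rels q) \<xi> \<in> carrier (Aq q) \<and>
      (\<forall>\<eta>\<in>cls (A_rels q) \<xi>. \<forall>X. pair X \<eta> = lin (\<lambda>u. foldr T u (ebasis m) n) X)"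
      using \<xi> by (auto simp: Aq_def pair_def intro: lin_cong)
  next
    fix S
    assume S: "S \<in> carrier (Aq q) \<and> (\<forall>\<eta>\<in>S. \<forall>X. pair X \<eta> = lin (\<lambda>u. foldr T u (ebasis m) n) X)"
    then obtain \<eta> where \<eta>: "S = cls (A_rels q) \<eta>" by (auto simp: Aq_def carrier_presented)
    have "pair (Poly_Mapping.single u 1) \<eta> = ev \<eta> u" for u by (simp add: pair_def)
    then have "ev \<eta> u = ev \<xi> u" for u
      using S[THEN conjunct2, rule_format, of \<eta> "Poly_Mapping.single u 1"] \<xi> by (simp add: \<eta> cls_self)
    then show "S = cls (A_rels q) \<xi>" unfolding \<eta> by (rule cls_eqI)
  qed
  then show ?thesis using \<xi> by blast
qed

end

subsection \<open>Eigenvectors of the twisted primitive elements\<close>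

lemma qpoch_0 [simp]: "qpoch a p 0 = 1"
  by (simp add: qpoch_def)

lemma qpoch_Suc: "qpoch a p (Suc k) = qpoch a p k * (1 - a * p ^ k)"
  by (simp add: qpoch_def)

lemma qpoch_Suc_left: "qpoch a p (Suc k) = (1 - a) * qpoch (a * p) p k"
  unfolding qpoch_def by (subst prod.lessThan_Suc_shift) (simp add: mult.assoc)

lemma qpoch_eq_0: "a * p ^ r = 1 \<Longrightarrow> r < k \<Longrightarrow> qpoch a p k = 0"
  by (auto simp: qpoch_def)

lemma qpoch_nonzero: "(\<And>r. r < k \<Longrightarrow> a * p ^ r \<noteq> 1) \<Longrightarrow> qpoch a p k \<noteq> 0"
  by (auto simp: qpoch_def)

lemma qpoch_zero_left [simp]: "qpoch 0 p k = 1"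
  by (simp add: qpoch_def)

text \<open>The terminating 3phi2 of the vectors, with A for q^(-2x) and PN for the N-th power of p
  as independent quantities, so that the recurrence becomes an identity of rational functions. The
  lower parameter 0 contributes the factor 1.\<close>

definition kraw :: "'a::field \<Rightarrow> 'a \<Rightarrow> 'a \<Rightarrow> 'a \<Rightarrow> nat \<Rightarrow> 'a \<Rightarrow> 'a" where
  "kraw p PN y D N A = (\<Sum>m\<le>N. qpoch A p m * (qpoch y p m * qpoch D p m) / (qpoch (inverse PN) p m * qpoch p p m) * p ^ m)"

text \<open>The three-term recurrence of the dual \<open>q\<close>-Krawtchouk polynomials, valid for all \<open>A\<close> as the
  sum is extended to \<open>m \<le> N\<close>: multiplication by the eigenvalue maps the \<open>m\<close>-th product
  \<open>(y, D; p)\<^sub>m\<close> to a combination of the \<open>m\<close>-th and the \<open>(m + 1)\<close>-st one.\<close>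

lemma kraw_recurrence:
  fixes p A y D PN c :: "'a::field"
  assumes nz: "p \<noteq> 0" "A \<noteq> 0" "y \<noteq> 0" "PN \<noteq> 0" "c \<noteq> 0"
    and D: "D = - inverse (c * PN * y)"
    and last: "qpoch y p (Suc N) = 0"
    and g: "\<And>m. m \<le> N \<Longrightarrow> qpoch (inverse PN) p m \<noteq> 0" "\<And>m. m \<le> N \<Longrightarrow> qpoch p p m \<noteq> 0"
  shows "(1 - 1 / A) * kraw p PN y D N (A * p) + c * (1 / A - PN) * kraw p PN y D N (A / p)
      + (1 - c) / A * kraw p PN y D N A = (1 / y - c * PN * y) * kraw p PN y D N A"
proof -
  define u where "u m = qpoch y p m * qpoch D p m" for m
  define w where "w m = p ^ m / (qpoch (inverse PN) p m * qpoch p p m)" for m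
  have kraw: "kraw p PN y D N B = (\<Sum>m\<le>N. qpoch B p m * w m * u m)" for B
    by (simp add: kraw_def u_def w_def mult_ac)
  have u_Suc: "(1 / y - c * PN * y) * u m = (p ^ m - c * PN / p ^ m) * u m + c * PN / p ^ m * u (Suc m)" for m
  proof -
    have u: "u (Suc m) = u m * ((1 - y * p ^ m) * (1 - D * p ^ m))"
      by (simp add: u_def qpoch_Suc mult_ac)
    have k: "1 / y - c * PN * y = p ^ m - c * PN / p ^ m + c * PN / p ^ m * ((1 - y * p ^ m) * (1 - D * p ^ m))"
      using nz by (simp add: D field_simps)
    have "(a + b * e) * v = a * v + b * (v * e)" for a b e v :: 'a
      by (simp add: algebra_simps)
    then show ?thesis unfolding u k .
  qed
  \<comment> \<open>The share that index m receives from index m - 1.\<close>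
  define f where "f m = (if m = 0 then 0 else qpoch A p (m - 1) * w (m - 1) * (c * PN / p ^ (m - 1)) * u m)" for m
  have "(1 / y - c * PN * y) * kraw p PN y D N A = (\<Sum>m\<le>N. qpoch A p m * w m * ((1 / y - c * PN * y) * u m))"
    by (simp add: kraw sum_distrib_left mult_ac)
  also have "\<dots> = (\<Sum>m\<le>N. qpoch A p m * w m * (p ^ m - c * PN / p ^ m) * u m + f (Suc m))"
    unfolding u_Suc by (intro sum.cong) (simp_all add: f_def algebra_simps)
  also have "\<dots> = (\<Sum>m\<le>N. qpoch A p m * w m * (p ^ m - c * PN / p ^ m) * u m) + (\<Sum>m\<le>N. f (Suc m))"
    by (rule sum.distrib)
  also have "(\<Sum>m\<le>N. f (Suc m)) = (\<Sum>m\<le>Suc N. f m)"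
    by (subst sum.atMost_Suc_shift) (simp add: f_def)
  \<comment> \<open>The share leaving the top index N is zero by \<open>last\<close>, so the shifted
    sum stays within the range.\<close>
  also have "\<dots> = (\<Sum>m\<le>N. f m)"
    using last by (simp add: f_def u_def)
  also have "(\<Sum>m\<le>N. qpoch A p m * w m * (p ^ m - c * PN / p ^ m) * u m) + (\<Sum>m\<le>N. f m) =
    (\<Sum>m\<le>N. qpoch A p m * w m * (p ^ m - c * PN / p ^ m) * u m + f m)"
    by (simp add: sum.distrib)
  also have "\<dots> = (\<Sum>m\<le>N. (1 - 1 / A) * (qpoch (A * p) p m * w m * u m) + c * (1 / A - PN) * (qpoch (A / p) p m * w m * u m)
      + (1 - c) / A * (qpoch A p m * w m * u m))"
  proof (rule sum.cong)
    fix m assume "m \<in> {..N}"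
    show "qpoch A p m * w m * (p ^ m - c * PN / p ^ m) * u m + f m =
      (1 - 1 / A) * (qpoch (A * p) p m * w m * u m) + c * (1 / A - PN) * (qpoch (A / p) p m * w m * u m)
      + (1 - c) / A * (qpoch A p m * w m * u m)"
    proof (cases m)
      case 0
      then show ?thesis using nz by (simp add: f_def w_def field_simps)
    next
      case (Suc k)
      define z where "z = p ^ k"
      define Q where "Q = qpoch A p k"
      have z: "z \<noteq> 0" using nz by (simp add: z_def)
      have m: "m \<le> N" "k \<le> N" using \<open>m \<in> {..N}\<close> Suc by auto
      have 1: "qpoch A p m = Q * (1 - A * z)" by (simp add: Suc qpoch_Suc Q_def z_def)
      have 2: "(1 - 1 / A) * qpoch (A * p) p m = - (1 / A) * (Q * (1 - A * z) * (1 - A * p * z))"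
      proof -
        have "(1 - A) * qpoch (A * p) p m = qpoch A p m * (1 - A * p ^ m)"
          by (simp only: flip: qpoch_Suc_left qpoch_Suc)
        then have "(1 - A) * qpoch (A * p) p m = Q * (1 - A * z) * (1 - A * p * z)"
          unfolding 1 by (simp add: Suc z_def mult_ac)
        moreover have "1 - 1 / A = - (1 / A) * (1 - A)" using nz by (simp add: field_simps)
        ultimately show ?thesis by (simp only: mult.assoc)
      qed
      have 3: "qpoch (A / p) p m = (1 - A / p) * Q"
        unfolding Suc qpoch_Suc_left Q_def using nz by simp
      have 4: "w k = w m * ((1 - z / PN) * (1 - p * z) / p)"
      proof -
        have "qpoch (inverse PN) p m = qpoch (inverse PN) p k * (1 - z / PN)"
          by (simp add: Suc qpoch_Suc z_def divide_inverse mult_ac)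
        moreover have "qpoch p p m = qpoch p p k * (1 - p * z)"
          by (simp add: Suc qpoch_Suc z_def mult_ac)
        ultimately have "1 - z / PN \<noteq> 0" "1 - p * z \<noteq> 0"
            "w m = p * z / (qpoch (inverse PN) p k * (1 - z / PN) * (qpoch p p k * (1 - p * z)))"
          using g(1)[OF m(1)] g(2)[OF m(1)] by (auto simp: w_def Suc z_def)
        moreover have "w k = z / (qpoch (inverse PN) p k * qpoch p p k)"
          by (simp add: w_def z_def)
        ultimately show ?thesis using nz by simp
      qed
      have fm: "f m = Q * (w m * ((1 - z / PN) * (1 - p * z) / p)) * (c * PN / z) * u m"
        unfolding 4[symmetric] by (simp add: f_def Suc Q_def z_def)
      \<comment> \<open>The recurrence for the single index m, after the common factor
        \<open>Q * w m * u m\<close> has been taken out.\<close>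
      have key: "(1 - A * z) * (p * z - c * PN / (p * z)) + (1 - z / PN) * (1 - p * z) / p * (c * PN / z) =
        - (1 / A) * ((1 - A * z) * (1 - A * p * z)) + c * (1 / A - PN) * (1 - A / p) + (1 - c) / A * (1 - A * z)"
        using nz z by (simp add: field_simps)
      have pm: "p ^ m = p * z" by (simp add: Suc z_def)
      have lhs: "Q * X1 * W * X2 * U + Q * (W * X3) * X4 * U = Q * W * U * (X1 * X2 + X3 * X4)"
        for X1 X2 X3 X4 W U :: 'a by (simp add: algebra_simps)
      have rhs: "Q * W * U * (a * (X1 * X2) + b * X3 + d * X1) =
          a * (Q * X1 * X2) * (W * U) + b * (X3 * Q * W * U) + d * (Q * X1 * W * U)"
        for X1 X2 X3 W U a b d :: 'a by (simp add: algebra_simps)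
      have "qpoch A p m * w m * (p ^ m - c * PN / p ^ m) * u m + f m = Q * w m * u m *
        ((1 - A * z) * (p * z - c * PN / (p * z)) + (1 - z / PN) * (1 - p * z) / p * (c * PN / z))"
        unfolding 1 fm pm by (rule lhs)
      also have "\<dots> = ((1 - 1 / A) * qpoch (A * p) p m) * (w m * u m) + c * (1 / A - PN) * (qpoch (A / p) p m * w m * u m)
          + (1 - c) / A * (qpoch A p m * w m * u m)"
        unfolding key rhs 2 3 1 ..
      also have "((1 - 1 / A) * qpoch (A * p) p m) * (w m * u m) = (1 - 1 / A) * (qpoch (A * p) p m * w m * u m)"
        by (simp only: mult.assoc)
      finally show ?thesis .
    qed
  qed simp
  also have "\<dots> = (1 - 1 / A) * kraw p PN y D N (A * p) + c * (1 / A - PN) * kraw p PN y D N (A / p)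
      + (1 - c) / A * kraw p PN y D N A"
    by (simp add: kraw sum.distrib sum_distrib_left)
  finally show ?thesis by simp
qed

section \<open>The vectors as dual q-Krawtchouk functions\<close>

context spin
begin

definition PP where "PP = q\<^sup>2"

lemma PP: "0 < PP" "PP < 1"
  using q_pos q_less_1 by (simp_all add: PP_def power_less_one_iff)

lemma PP_powr: "q powr (2 * real k) = PP ^ k"
  using powr_realpow[OF q_pos, of "2 * k"] by (simp add: PP_def power_mult)

text \<open>The real factor of the coordinates of the vectors, freed from the constant C and from
  the powers of \<i>.\<close>

definition rr :: "real \<Rightarrow> real \<Rightarrow> real \<Rightarrow> real" where
  "rr j \<sigma> n = q powr (\<sigma> * (l - n)) * q powr (1/2 * (l - n) * (l - n - 1)) *
     sqrt (qpoch (q powr (4*l)) (q powr (-2)) (nn (l - n)) / qpoch (q^2) (q^2) (nn (l - n))) *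
     qhyp [q powr (-2*(l - n)), q powr (-2*(l - j)), - (q powr (-2*l - 2*j - 2*\<sigma>))]
          [q powr (-4*l), 0] (q^2) (q^2)"

lemma vv_rr: "vv q l j n \<sigma> = of_real (Cc q l j \<sigma>) * \<i> powi \<lfloor>n - l\<rfloor> * of_real (rr j \<sigma> n)"
  by (simp add: vv_def rr_def)

definition ww :: "real \<Rightarrow> nat \<Rightarrow> real" where
  "ww \<sigma> x = q powr (\<sigma> * real x) * q powr (1/2 * real x * (real x - 1)) *
     sqrt (qpoch (q powr (4*l)) (q powr (-2)) x / qpoch (q^2) (q^2) x)"

definition kk :: "real \<Rightarrow> real \<Rightarrow> real \<Rightarrow> real" where
  "kk j \<sigma> A = kraw PP (q powr (4*l)) (q powr (-2*(l - j))) (- (q powr (-2*l - 2*j - 2*\<sigma>))) N A"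

text \<open>The upper parameter q^(-2x) ends the series at x \<le> N, so it agrees with the finite
  sum up to N.\<close>

lemma rr_eq:
  assumes "x \<le> N"
  shows "rr j \<sigma> (l - real x) = ww \<sigma> x * kk j \<sigma> (q powr (-2 * real x))"
proof -
  let ?A = "q powr (-2 * real x)"
  have "?A * PP ^ x = 1" using q_pos by (simp flip: PP_powr powr_add)
  then have zero: "qpoch ?A PP m = 0" if "m \<notin> {..N}" for m
    using that assms by (intro qpoch_eq_0[of _ _ x]) auto
  have "qhyp [?A, q powr (-2*(l - j)), - (q powr (-2*l - 2*j - 2*\<sigma>))] [q powr (-4*l), 0] PP PP = kk j \<sigma> ?A"
  proof -
    have i: "q powr (-4*l) = inverse (q powr (4*l))" by (simp add: powr_minus)
    show ?thesis
      unfolding qhyp_def kk_def kraw_def i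
    proof (subst suminf_finite[of "{..N}"])
      show "(\<Prod>a\<leftarrow>[?A, y, d]. qpoch a PP m) / e * PP ^ m = 0" if "m \<notin> {..N}" for m y d e
        using zero[OF that] by (simp only: list.map prod_list.Cons mult_zero_left div_0)
    qed simp_all
  qed
  then show ?thesis by (simp add: rr_def ww_def PP_def)
qed

lemma qpoch_P_pos: "0 < qpoch (q\<^sup>2) (q\<^sup>2) x"
  unfolding qpoch_def PP_def[symmetric]
proof (rule prod_pos)
  fix r show "0 < 1 - PP * PP ^ r"
    using power_Suc_less_one[of PP r] PP by simp
qed

lemma ww_Suc: "ww \<sigma> (Suc x) = ww \<sigma> x * q powr (\<sigma> + real x) *
    (sqrt (1 - q powr (4*l - 2 * real x)) / sqrt (1 - q powr (2 * real x + 2)))"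
proof -
  have e: "q powr (4 * l) * (q powr (-2)) ^ x = q powr (4 * l - 2 * real x)"
    using q_pos by (simp add: powr_realpow[symmetric] powr_powr mult.commute flip: powr_add)
  have f: "q\<^sup>2 * (q\<^sup>2) ^ x = q powr (2 * real x + 2)"
    using PP_powr[of "Suc x"] by (simp add: PP_def algebra_simps)
  have g: "q powr (\<sigma> * real (Suc x)) * q powr (1/2 * real (Suc x) * (real (Suc x) - 1)) =
    q powr (\<sigma> * real x) * q powr (1/2 * real x * (real x - 1)) * q powr (\<sigma> + real x)"
  proof -
    have "\<sigma> * real (Suc x) + 1/2 * real (Suc x) * (real (Suc x) - 1) =
      \<sigma> * real x + 1/2 * real x * (real x - 1) + (\<sigma> + real x)" by (simp add: field_simps)
    then show ?thesis by (simp only: powr_add[symmetric])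
  qed
  show ?thesis
    unfolding ww_def g qpoch_Suc e f by (simp add: real_sqrt_mult real_sqrt_divide mult_ac)
qed

text \<open>Factored in x = l - n, so that the radicals match those in the ratio
  \<open>ww_Suc\<close> of consecutive weights.\<close>

lemma trep_coeff_C_eq: "trep_coeff q l UC (l - real x) =
   q powr (-l - 1/2) * sqrt (1 - q powr (2 * real x)) * sqrt (1 - q powr (4*l - 2 * real x + 2)) / (1/q - q)"
proof -
  have "(q powr (-l + (l - real x)) - q powr (l - (l - real x))) *
      (q powr (-l - (l - real x) - 1) - q powr (l + (l - real x) + 1)) =
    q powr (-2*l - 1) * ((1 - q powr (2 * real x)) * (1 - q powr (4*l - 2 * real x + 2)))"
    by (simp add: left_diff_distrib right_diff_distrib flip: powr_add) (simp add: algebra_simps)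
  moreover have "sqrt (q powr (-2*l - 1)) = q powr (-l - 1/2)"
    using q_pos by (simp add: powr_half_sqrt[symmetric] powr_powr algebra_simps)
  ultimately show ?thesis
    by (simp add: real_sqrt_mult mult.assoc)
qed

text \<open>The radicals of the representation and of the weight ratio combine into the rational
  coefficients of \<open>kraw_recurrence\<close>.\<close>

lemma rr_equation:
  assumes n: "n \<in> weights l" and j: "j \<in> weights l"
  shows "q powr (1/2) * trep_coeff q l UB (n + 1) * q powr (-n - 1) * rr j \<sigma> (n + 1)
    + q powr (-1/2) * trep_coeff q l UC (n - 1) * q powr (-n + 1) * rr j \<sigma> (n - 1)
    + (q powr (-\<sigma>) - q powr \<sigma>) / (1/q - q) * q powr (-2*n) * rr j \<sigma> n
    = (q powr (-\<sigma> - 2*j) - q powr (\<sigma> + 2*j)) / (1/q - q) * rr j \<sigma> n"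
proof -
  obtain x where x: "n = l - real x" "x \<le> N" using n by (auto simp: weights_eq[OF l])
  obtain k where k: "j = l - real k" "k \<le> N" using j by (auto simp: weights_eq[OF l])
  let ?A = "q powr (-2 * real x)"
  have A1: "q powr (-2 * real (Suc x)) = ?A / PP"
  proof -
    have "-2 * real (Suc x) = -2 * real x - 2" by simp
    then show ?thesis using q_pos by (simp only: powr_diff PP_def powr_numeral)
  qed
  have up: "trep_coeff q l UC (n - 1) * rr j \<sigma> (n - 1) =
      q powr (\<sigma> + real x - l - 1/2) * (1 - q powr (4*l - 2 * real x)) / (1/q - q) * ww \<sigma> x * kk j \<sigma> (?A / PP)"
  \<comment> \<open>Below the lowest weight \<open>rr_eq\<close> does not apply, but both
    coefficients are zero there.\<close>
  proof (cases "x = N")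
    case True
    have "n - 1 = l - real (Suc x)" "4*l - 2 * real (Suc x) + 2 = 0" using x True l by simp_all
    then have "trep_coeff q l UC (n - 1) = 0"
      using q_pos by (simp only: trep_coeff_C_eq) simp
    moreover have z: "4*l - 2 * real x = 0" using True l by simp
    ultimately show ?thesis using q_pos unfolding z by (simp del: trep_coeff.simps)
  next
    case False
    have n1: "n - 1 = l - real (Suc x)" using x by simp
    have ge: "q powr (2 * real x + 2) < 1" using powr_strict_q[of 0 "2 * real x + 2"] q_pos by simp
    have "0 \<le> 4*l - 2 * real x" using x l by simp
    then have "q powr (4*l - 2 * real x) \<le> q powr 0" by (intro powr_mono_q)
    then have sq: "sqrt (1 - q powr (4*l - 2 * real x)) * sqrt (1 - q powr (4*l - 2 * real x)) = 1 - q powr (4*l - 2 * real x)"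
      using q_pos by simp
    have e: "2 * real (Suc x) = 2 * real x + 2" "4*l - 2 * real (Suc x) + 2 = 4*l - 2 * real x" by simp_all
    have "q powr (-l - 1/2) * q powr (\<sigma> + real x) = q powr (\<sigma> + real x - l - 1/2)"
      by (simp add: algebra_simps flip: powr_add)
    moreover have "trep_coeff q l UC (n - 1) * rr j \<sigma> (n - 1) =
       (q powr (-l - 1/2) * q powr (\<sigma> + real x)) * (sqrt (1 - q powr (4*l - 2 * real x)) * sqrt (1 - q powr (4*l - 2 * real x))) / (1/q - q) * ww \<sigma> x * kk j \<sigma> (?A / PP)"
      unfolding n1 trep_coeff_C_eq e using rr_eq[of "Suc x" j \<sigma>] False x ge
      by (simp only: A1 ww_Suc) simp
    ultimately show ?thesis unfolding sq by simp
  qed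
  have down: "trep_coeff q l UB (n + 1) * rr j \<sigma> (n + 1) =
      q powr (- \<sigma> - real x - l + 1/2) * (1 - q powr (2 * real x)) / (1/q - q) * ww \<sigma> x * kk j \<sigma> (?A * PP)"
  proof (cases x)
    case 0
    have "trep_coeff q l UB (n + 1) = 0"
      unfolding trep_coeff_BC using trep_coeff_end(2) 0 x by simp
    then show ?thesis using q_pos by (simp add: 0 del: trep_coeff.simps)
  next
    case (Suc y)
    have n1: "n + 1 = l - real y" using x Suc by simp
    have A2: "q powr (-2 * real y) = ?A * PP"
    proof -
      have "-2 * real y = -2 * real x + 2" by (simp add: Suc)
      then show ?thesis using q_pos by (simp only: powr_add PP_def powr_numeral)
    qed
    have "4*l - 2 * real y > 0" using x l Suc by simp
    then have "q powr (4*l - 2 * real y) < q powr 0" by (intro powr_strict_q)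
    then have pos: "sqrt (1 - q powr (4*l - 2 * real y)) > 0" using q_pos by simp
    have "q powr (2 * real y + 2) < 1" using powr_strict_q[of 0 "2 * real y + 2"] q_pos by simp
    then have pos2: "sqrt (1 - q powr (2 * real y + 2)) > 0"
      and sq: "sqrt (1 - q powr (2 * real y + 2)) * sqrt (1 - q powr (2 * real y + 2)) = 1 - q powr (2 * real x)"
      by (simp_all add: Suc algebra_simps)
    have e: "2 * real x = 2 * real y + 2" "4*l - (2 * real y + 2) + 2 = 4*l - 2 * real y" by (simp_all add: Suc)
    have w: "ww \<sigma> y = ww \<sigma> x * q powr (- \<sigma> - real y) * (sqrt (1 - q powr (2 * real y + 2)) / sqrt (1 - q powr (4*l - 2 * real y)))"
      using pos pos2 q_pos unfolding Suc ww_Suc by (simp add: powr_minus powr_diff powr_add field_simps)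
    have "q powr (-l - 1/2) * q powr (- \<sigma> - real y) = q powr (- \<sigma> - real x - l + 1/2)"
      by (simp add: Suc algebra_simps flip: powr_add)
    moreover have "trep_coeff q l UB (n + 1) * rr j \<sigma> (n + 1) =
      (q powr (-l - 1/2) * q powr (- \<sigma> - real y)) * (sqrt (1 - q powr (2 * real y + 2)) * sqrt (1 - q powr (2 * real y + 2))) / (1/q - q)
        * ww \<sigma> x * kk j \<sigma> (?A * PP)"
    proof -
      have gen: "a * s1 * s2 / K * (W * e * (s1 / s2) * k) = (a * e) * (s1 * s1) / K * W * k"
        if "s2 \<noteq> 0" for a s1 s2 K W e k :: real using that by simp
      have R: "rr j \<sigma> (l - real y) = ww \<sigma> y * kk j \<sigma> (q powr (-2 * real y))"
        using rr_eq[of y j \<sigma>] x(2) Suc by simp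
      show ?thesis
        unfolding trep_coeff_BC unfolding n1 unfolding x(1) trep_coeff_C_eq e R A2 w
        by (intro gen) (use pos in simp)
    qed
    ultimately show ?thesis unfolding sq by simp
  qed
  have mid: "rr j \<sigma> n = ww \<sigma> x * kk j \<sigma> ?A"
    unfolding x(1) by (rule rr_eq[OF x(2)])
  \<comment> \<open>\<open>kraw_recurrence\<close> with c = q^(2\<sigma>), PN = q^(4l) and y =
    q^(-2(l-j)); y ends its own factorial after l - j steps, which is the hypothesis
    \<open>last\<close>.\<close>
  have rec: "(1 - 1 / ?A) * kk j \<sigma> (?A * PP) + q powr (2*\<sigma>) * (1 / ?A - q powr (4*l)) * kk j \<sigma> (?A / PP)
      + (1 - q powr (2*\<sigma>)) / ?A * kk j \<sigma> ?A =
      (1 / q powr (-2*(l - j)) - q powr (2*\<sigma>) * q powr (4*l) * q powr (-2*(l - j))) * kk j \<sigma> ?A"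
    unfolding kk_def
  proof (rule kraw_recurrence)
    show "- (q powr (-2*l - 2*j - 2*\<sigma>)) = - inverse (q powr (2*\<sigma>) * q powr (4*l) * q powr (-2*(l - j)))"
    proof -
      have "-2*l - 2*j - 2*\<sigma> = - (2*\<sigma> + 4*l + (-2*(l - j)))" by (simp add: algebra_simps)
      then show ?thesis by (simp only: powr_minus powr_add)
    qed
    have "q powr (-2*(l - j)) * PP ^ k = 1" using q_pos k by (simp flip: PP_powr powr_add)
    then show "qpoch (q powr (-2*(l - j))) PP (Suc N) = 0"
      using k by (intro qpoch_eq_0[of _ _ k]) auto
    show "qpoch (inverse (q powr (4*l))) PP m \<noteq> 0" if "m \<le> N" for m
    proof (rule qpoch_nonzero)
      fix r assume "r < m"
      then have "2 * real r < 4 * l" using that l by simp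
      have "inverse (q powr (4*l)) * PP ^ r = q powr (2 * real r - 4*l)"
        using q_pos by (simp add: powr_diff powr_minus divide_inverse flip: PP_powr)
      moreover have "q powr 0 < q powr (2 * real r - 4*l)"
        by (rule powr_strict_q) (use \<open>2 * real r < 4 * l\<close> in simp)
      ultimately show "inverse (q powr (4*l)) * PP ^ r \<noteq> 1" using q_pos by simp
    qed
    show "qpoch PP PP m \<noteq> 0" for m using qpoch_P_pos[of m] by (simp add: PP_def)
  qed (use q_pos PP in auto)
  \<comment> \<open>The factor common to the four terms of the equation.\<close>
  define g where "g = q powr (-2*l - \<sigma>) / (1/q - q) * ww \<sigma> x"
  have A': "1 / ?A = q powr (2 * real x)" using q_pos by (simp add: powr_minus_divide)
  have nx: "real x = l - n" using x by simp
  have kkA: "rr j \<sigma> n = ww \<sigma> x * kk j \<sigma> ?A" by (rule mid)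
  have "q powr (1/2) * trep_coeff q l UB (n + 1) * q powr (-n - 1) * rr j \<sigma> (n + 1)
     = (q powr (1/2) * q powr (-n - 1)) * (trep_coeff q l UB (n + 1) * rr j \<sigma> (n + 1))"
    by (simp only: mult_ac)
  also have "\<dots> = (q powr (1/2) * q powr (-n - 1) * q powr (- \<sigma> - real x - l + 1/2)) / (1/q - q) * ww \<sigma> x
      * ((1 - q powr (2 * real x)) * kk j \<sigma> (?A * PP))"
    unfolding down by simp
  also have "q powr (1/2) * q powr (-n - 1) * q powr (- \<sigma> - real x - l + 1/2) = q powr (-2*l - \<sigma>)"
    unfolding nx by (simp flip: powr_add)
  finally have t1: "q powr (1/2) * trep_coeff q l UB (n + 1) * q powr (-n - 1) * rr j \<sigma> (n + 1)
     = g * ((1 - 1 / ?A) * kk j \<sigma> (?A * PP))"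
    unfolding A' g_def .
  have "q powr (-1/2) * trep_coeff q l UC (n - 1) * q powr (-n + 1) * rr j \<sigma> (n - 1)
     = (q powr (-1/2) * q powr (-n + 1)) * (trep_coeff q l UC (n - 1) * rr j \<sigma> (n - 1))"
    by (simp only: mult_ac)
  also have "\<dots> = (q powr (-1/2) * q powr (-n + 1) * q powr (\<sigma> + real x - l - 1/2)) * (1 - q powr (4*l - 2 * real x)) / (1/q - q) * ww \<sigma> x
      * kk j \<sigma> (?A / PP)"
    unfolding up by simp
  also have "q powr (-1/2) * q powr (-n + 1) * q powr (\<sigma> + real x - l - 1/2) = q powr (-2*l - \<sigma>) * q powr (2 * \<sigma> + 2 * real x)"
    unfolding nx by (simp flip: powr_add)
  also have "q powr (-2*l - \<sigma>) * q powr (2 * \<sigma> + 2 * real x) * (1 - q powr (4*l - 2 * real x)) =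
      q powr (-2*l - \<sigma>) * (q powr (2 * \<sigma>) * (q powr (2 * real x) - q powr (4*l)))"
    by (simp add: right_diff_distrib flip: powr_add) (simp add: add.commute)
  finally have t2: "q powr (-1/2) * trep_coeff q l UC (n - 1) * q powr (-n + 1) * rr j \<sigma> (n - 1)
     = g * (q powr (2*\<sigma>) * (1 / ?A - q powr (4*l)) * kk j \<sigma> (?A / PP))"
    unfolding A' g_def by (simp add: mult_ac del: trep_coeff.simps)
  have "(q powr (-\<sigma>) - q powr \<sigma>) * q powr (-2*n) = q powr (-2*l - \<sigma>) * ((1 - q powr (2*\<sigma>)) * q powr (2 * real x))"
    unfolding nx by (simp add: left_diff_distrib right_diff_distrib flip: powr_add)
  then have t3: "(q powr (-\<sigma>) - q powr \<sigma>) / (1/q - q) * q powr (-2*n) * rr j \<sigma> n =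
      g * ((1 - q powr (2*\<sigma>)) / ?A * kk j \<sigma> ?A)"
    unfolding kkA g_def using A' by (simp add: divide_inverse)
  have "q powr (-\<sigma> - 2*j) - q powr (\<sigma> + 2*j) =
      q powr (-2*l - \<sigma>) * (1 / q powr (-2*(l - j)) - q powr (2*\<sigma>) * q powr (4*l) * q powr (-2*(l - j)))"
    using q_pos by (simp add: right_diff_distrib powr_minus_divide[symmetric] flip: powr_add)
  then have t4: "(q powr (-\<sigma> - 2*j) - q powr (\<sigma> + 2*j)) / (1/q - q) * rr j \<sigma> n =
      g * ((1 / q powr (-2*(l - j)) - q powr (2*\<sigma>) * q powr (4*l) * q powr (-2*(l - j))) * kk j \<sigma> ?A)"
    unfolding kkA g_def by simp
  show ?thesis unfolding t1 t2 t3 t4 rec[symmetric] by (simp only: distrib_left)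
qed

end

subsection \<open>The elements of the quantum group as spherical functionals\<close>

text \<open>The radial part of the Casimir element. All denominators are cleared, so that the equation
  holds at every point \<open>z = q\<^sup>k\<close>.\<close>

definition al :: "complex \<Rightarrow> complex \<Rightarrow> complex \<Rightarrow> complex \<Rightarrow> complex" where
  "al q S S' z = - ((1 - (q*z)^2)^2 + S * S' * ((q*z)^3 + q*z) - (S^2 + S'^2) * (q*z)^2) / q * (1 - (z/q)^2)"

definition ga :: "complex \<Rightarrow> complex \<Rightarrow> complex \<Rightarrow> complex \<Rightarrow> complex" where
  "ga q E E' z = - q * ((1 - (z/q)^2)^2 + E * E' * ((z/q)^3 + z/q) - (E^2 + E'^2) * (z/q)^2) * (1 - (q*z)^2)"

definition be :: "complex \<Rightarrow> complex \<Rightarrow> complex \<Rightarrow> complex \<Rightarrow> complex \<Rightarrow> complex \<Rightarrow> complex \<Rightarrow> complex" where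
  "be q Q S S' E E' z = Q * (1 - z^2) * (1 - (q*z)^2) * (1 - (z/q)^2)
     + z * (S' - q*z*S) * (E - q*z*E') * (1 - (z/q)^2)
     - z * (z/q*E - E') * (S - z/q*S') * (1 - (q*z)^2)"

text \<open>Fp, F0, Fm are three neighbouring torus values, and Cp, Cm are auxiliary values to be
  eliminated. They are determined only up to the factors q z - 1/(q z) and z/q - q/z, so the main
  equation is multiplied by z ((q z)^2 - 1) ((z/q)^2 - 1) before they are substituted.\<close>

lemma radial_algebra:
  fixes z q :: complex
  assumes qn: "q \<noteq> 0" and z: "z \<noteq> 0" and k: "\<kappa> \<noteq> 0" "\<kappa> = 1 / q - q"
    and X: "X = (Q * F0 - q * Fm - Fp / q) / \<kappa>^2"
    and G: "G = (Fp - Fm) / \<kappa>"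
    and star: "- (z - 1/z) * X - z * G + (S'/\<kappa> / (q*z) - S/\<kappa>) * Cp + (E/\<kappa> - E'/\<kappa> * q/z) * Cm = 0"
    and Cp: "Cp * (q*z - 1/(q*z)) = (S/\<kappa> - q*z*(S'/\<kappa>)) * Fp - (E/\<kappa> - q*z*(E'/\<kappa>)) * F0"
    and Cm: "Cm * (z/q - q/z) = (S/\<kappa> - z/q*(S'/\<kappa>)) * F0 - (E/\<kappa> - z/q*(E'/\<kappa>)) * Fm"
  shows "al q S S' z * Fp + be q Q S S' E E' z * F0 + ga q E E' z * Fm = 0"
proof -
  define Cp' where "Cp' = \<kappa> * Cp"
  define Cm' where "Cm' = \<kappa> * Cm"
  have cleared: "\<kappa> * C * (w^2 - 1) = w * ((S - w*S') * a - (E - w*E') * b)"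
    if w: "w \<noteq> 0" and C: "C * (w - 1/w) = (S/\<kappa> - w*(S'/\<kappa>)) * a - (E/\<kappa> - w*(E'/\<kappa>)) * b" for C w a b
  proof -
    have "S/\<kappa> - w*(S'/\<kappa>) = (S - w*S') / \<kappa>" "E/\<kappa> - w*(E'/\<kappa>) = (E - w*E') / \<kappa>"
      by (simp_all add: diff_divide_distrib)
    then have "\<kappa> * (C * (w - 1/w)) = (S - w*S') * a - (E - w*E') * b"
      unfolding C using k(1) by (simp add: right_diff_distrib)
    moreover have "\<kappa> * C * (w^2 - 1) = w * (\<kappa> * (C * (w - 1/w)))"
      using w by (simp add: field_simps power2_eq_square)
    ultimately show ?thesis by simp
  qed
  have Cp: "Cp' * ((q*z)^2 - 1) = q*z*((S - q*z*S') * Fp - (E - q*z*E') * F0)"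
    unfolding Cp'_def by (rule cleared) (use z qn Cp in simp_all)
  have Cm: "Cm' * ((z/q)^2 - 1) = z/q*((S - z/q*S') * F0 - (E - z/q*E') * Fm)"
    unfolding Cm'_def by (rule cleared) (use z qn Cm in simp_all)
  have "\<kappa>^2 * (- (z - 1/z) * X - z * G + (S'/\<kappa> / (q*z) - S/\<kappa>) * Cp + (E/\<kappa> - E'/\<kappa> * q/z) * Cm) = 0"
    unfolding star by simp
  moreover have "\<kappa>^2 * X = Q * F0 - q * Fm - Fp / q" "\<kappa>^2 * G = \<kappa> * (Fp - Fm)"
    using k by (simp_all add: X G power2_eq_square)
  moreover have "\<kappa>^2 * ((S'/\<kappa> / (q*z) - S/\<kappa>) * Cp) = (S'/(q*z) - S) * Cp'"
    "\<kappa>^2 * ((E/\<kappa> - E'/\<kappa> * q/z) * Cm) = (E - E' * q/z) * Cm'"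
    using k(1) by (simp_all add: Cp'_def Cm'_def field_simps power2_eq_square)
  ultimately have star: "- (z - 1/z) * (Q * F0 - q * Fm - Fp / q) - z * (\<kappa> * (Fp - Fm))
      + (S'/(q*z) - S) * Cp' + (E - E' * q/z) * Cm' = 0"
    by (simp add: distrib_left right_diff_distrib mult.left_commute) 
  let ?w = "(q*z)^2 - 1" and ?v = "(z/q)^2 - 1"
  have "z * ?w * ?v * (- (z - 1/z) * (Q * F0 - q * Fm - Fp / q) - z * (\<kappa> * (Fp - Fm))) +
      z * (S'/(q*z) - S) * (Cp' * ?w) * ?v + z * (E - E' * q/z) * (Cm' * ?v) * ?w =
     z * ?w * ?v * (- (z - 1/z) * (Q * F0 - q * Fm - Fp / q) - z * (\<kappa> * (Fp - Fm))
      + (S'/(q*z) - S) * Cp' + (E - E' * q/z) * Cm')"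
    by (simp add: algebra_simps)
  also have "\<dots> = 0" unfolding star by simp
  finally have "z * ?w * ?v * (- (z - 1/z) * (Q * F0 - q * Fm - Fp / q) - z * (\<kappa> * (Fp - Fm))) +
      z * (S'/(q*z) - S) * (q*z*((S - q*z*S') * Fp - (E - q*z*E') * F0)) * ?v
      + z * (E - E' * q/z) * (z/q*((S - z/q*S') * F0 - (E - z/q*E') * Fm)) * ?w = 0"
    unfolding Cp Cm .
  moreover have "al q S S' z * Fp + be q Q S S' E E' z * F0 + ga q E E' z * Fm =
     z * ?w * ?v * (- (z - 1/z) * (Q * F0 - q * Fm - Fp / q) - z * (\<kappa> * (Fp - Fm))) +
      z * (S'/(q*z) - S) * (q*z*((S - q*z*S') * Fp - (E - q*z*E') * F0)) * ?v
      + z * (E - E' * q/z) * (z/q*((S - z/q*S') * F0 - (E - z/q*E') * Fm)) * ?w"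
  proof -
    have "z * (z - 1/z) = z^2 - 1" using z by (simp add: field_simps power2_eq_square)
    moreover have "z * (S'/(q*z) - S) * (q*z) = z * (S' - q*z*S)" "z * (E - E' * q/z) * (z/q) = z * (z/q*E - E')"
      using z qn by (simp_all add: field_simps)
    moreover have "(z^2 - 1) / q - z^2 * \<kappa> = ?w / q" "(z^2 - 1) * q + z^2 * \<kappa> = q * ?v"
      using qn by (simp_all add: k(2) field_simps power2_eq_square)
    moreover have expand: "z * W * V * (- d * (Q * F0 - q * Fm - Fp / q) - z * (\<kappa> * (Fp - Fm))) +
        z * e1 * (w * (A * Fp - B * F0)) * V + z * e2 * (v * (C * F0 - D * Fm)) * W =
      (W * V * ((z * d) / q - z^2 * \<kappa>) + (z * e1 * w) * A * V) * Fp
      + (- (z * d) * Q * W * V - (z * e1 * w) * B * V + (z * e2 * v) * C * W) * F0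
      + (W * V * ((z * d) * q + z^2 * \<kappa>) - (z * e2 * v) * D * W) * Fm" for W V d e1 e2 A B C D w v
      using qn by (simp add: field_simps power2_eq_square)
    ultimately have "z * ?w * ?v * (- (z - 1/z) * (Q * F0 - q * Fm - Fp / q) - z * (\<kappa> * (Fp - Fm))) +
      z * (S'/(q*z) - S) * (q*z*((S - q*z*S') * Fp - (E - q*z*E') * F0)) * ?v
      + z * (E - E' * q/z) * (z/q*((S - z/q*S') * F0 - (E - z/q*E') * Fm)) * ?w =
      (?w * ?v * (?w / q) + z * (S' - q*z*S) * (S - q*z*S') * ?v) * Fp
      + (- (z^2 - 1) * Q * ?w * ?v - z * (S' - q*z*S) * (E - q*z*E') * ?v + z * (z/q*E - E') * (S - z/q*S') * ?w) * F0
      + (?w * ?v * (q * ?v) - z * (z/q*E - E') * (E - z/q*E') * ?w) * Fm"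
      by (simp only:)
    moreover have "al q S S' z = ?w * ?v * (?w / q) + z * (S' - q*z*S) * (S - q*z*S') * ?v"
    proof -
      have "- ((1 - w^2)^2 + S * S' * (w^3 + w) - (S^2 + S'^2) * w^2) / q * (1 - V) =
        (w^2 - 1) * (V - 1) * ((w^2 - 1) / q) + (w / q) * (S' - w*S) * (S - w*S') * (V - 1)" for w V
        using qn by (simp add: field_simps power2_eq_square power3_eq_cube)
      from this[of "q * z" "(z/q)^2"] show ?thesis
        unfolding al_def using qn by simp
    qed
    moreover have "ga q E E' z = ?w * ?v * (q * ?v) - z * (z/q*E - E') * (E - z/q*E') * ?w"
    proof -
      define v where "v = z / q"
      have "z = q * v" using qn by (simp add: v_def)
      then show ?thesis unfolding ga_def v_def[symmetric]
        by (simp add: algebra_simps power2_eq_square power3_eq_cube)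
    qed
    moreover have "be q Q S S' E E' z = - (z^2 - 1) * Q * ?w * ?v - z * (S' - q*z*S) * (E - q*z*E') * ?v + z * (z/q*E - E') * (S - z/q*S') * ?w"
    proof -
      have "Q * (1 - d) * (1 - w) * (1 - v) + a * (1 - v) - b * (1 - w) =
        - (d - 1) * Q * (w - 1) * (v - 1) - a * (v - 1) + b * (w - 1)" for d w v a b :: complex
        by (simp add: algebra_simps)
      then show ?thesis unfolding be_def .
    qed
    ultimately show ?thesis by (simp only:)
  qed
  ultimately show ?thesis by simp
qed

section \<open>Torus words and the radial equation\<close>

context quantum
begin

text \<open>A^k for every integer k, with D serving as the inverse of A; it is the torus point z =
  q^k.\<close>

definition tw :: "int \<Rightarrow> ugen list" where
  "tw k = (if 0 \<le> k then replicate (nat k) UA else replicate (nat (- k)) UD)"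

lemma tw_0 [simp]: "tw 0 = []"
  by (simp add: tw_def)

lemma tw_torus: "set (tw k) \<subseteq> {UA, UD}"
  by (auto simp: tw_def)

lemma tw_A:
  assumes "urel \<phi>"
  shows "\<phi> (u @ UA # tw k @ v) = \<phi> (u @ tw (k + 1) @ v)"
proof (cases "0 \<le> k")
  case True
  then have "tw (k + 1) = UA # tw k" by (simp add: tw_def nat_add_distrib flip: replicate_Suc)
  then show ?thesis by simp
next
  case False
  define m where "m = nat (- k - 1)"
  have "tw k = UD # replicate m UD"
    using False by (simp add: tw_def m_def nat_diff_distrib flip: replicate_Suc)
  moreover have "tw (k + 1) = replicate m UD"
    using False by (auto simp: tw_def m_def)
  ultimately show ?thesis by (simp add: urelD[OF assms])
qed

lemma tw_D:
  assumes "urel \<phi>"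
  shows "\<phi> (u @ UD # tw k @ v) = \<phi> (u @ tw (k - 1) @ v)"
  using tw_A[OF assms, of "u @ [UD]" "k - 1" v] urelD(2)[OF assms, of u "tw (k - 1) @ v"] by simp

lemma replicate_move:
  assumes "urel \<phi>"
  shows "\<phi> (u @ replicate n UA @ UB # v) = of_real q ^ n * \<phi> (u @ UB # replicate n UA @ v)"
    "\<phi> (u @ replicate n UD @ UB # v) = (1 / of_real q) ^ n * \<phi> (u @ UB # replicate n UD @ v)"
    "\<phi> (u @ replicate n UA @ UC # v) = (1 / of_real q) ^ n * \<phi> (u @ UC # replicate n UA @ v)"
    "\<phi> (u @ replicate n UD @ UC # v) = of_real q ^ n * \<phi> (u @ UC # replicate n UD @ v)"
proof -
  have *: "\<phi> (u @ replicate n x @ g # v) = c ^ n * \<phi> (u @ g # replicate n x @ v)"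
    if "\<And>u v. \<phi> (u @ x # g # v) = c * \<phi> (u @ g # x # v)" for c x g
  proof (induction n arbitrary: u)
    case (Suc n)
    have "\<phi> (u @ replicate (Suc n) x @ g # v) = \<phi> ((u @ [x]) @ replicate n x @ g # v)" by simp
    also have "\<dots> = c ^ n * \<phi> (u @ x # g # replicate n x @ v)" unfolding Suc by simp
    finally show ?case unfolding that by simp
  qed simp
  show "\<phi> (u @ replicate n UA @ UB # v) = of_real q ^ n * \<phi> (u @ UB # replicate n UA @ v)"
    "\<phi> (u @ replicate n UD @ UB # v) = (1 / of_real q) ^ n * \<phi> (u @ UB # replicate n UD @ v)"
    "\<phi> (u @ replicate n UA @ UC # v) = (1 / of_real q) ^ n * \<phi> (u @ UC # replicate n UA @ v)"
    "\<phi> (u @ replicate n UD @ UC # v) = of_real q ^ n * \<phi> (u @ UC # replicate n UD @ v)"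
    by (rule *; simp add: urelD[OF assms])+
qed

lemma tw_move:
  assumes "urel \<phi>"
  shows "\<phi> (u @ tw k @ UB # v) = of_real q powi k * \<phi> (u @ UB # tw k @ v)"
    "\<phi> (u @ tw k @ UC # v) = of_real q powi (- k) * \<phi> (u @ UC # tw k @ v)"
  using replicate_move[OF assms]
  by (simp_all add: tw_def power_int_def power_divide divide_inverse power_inverse)

lemma torus_value:
  assumes "urel \<phi>" "set u \<subseteq> {UA, UD}"
  shows "\<phi> (v @ u) = \<phi> (v @ tw (int (count_list u UA) - int (count_list u UD)))"
  using assms(2)
proof (induction u arbitrary: v rule: ugen_list_induct)
  case (A u)
  have "\<phi> ((v @ [UA]) @ u) = \<phi> ((v @ [UA]) @ tw (int (count_list u UA) - int (count_list u UD)))"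
    by (rule A.IH) (use A.prems in simp)
  moreover have "int (count_list (UA # u) UA) - int (count_list (UA # u) UD) = int (count_list u UA) - int (count_list u UD) + 1"
    by simp
  ultimately show ?case
    using tw_A[OF assms(1), of v "int (count_list u UA) - int (count_list u UD)" "[]"] by (simp only: append_Nil2 append_assoc append_Cons append_Nil)
next
  case (D u)
  have "\<phi> ((v @ [UD]) @ u) = \<phi> ((v @ [UD]) @ tw (int (count_list u UA) - int (count_list u UD)))"
    by (rule D.IH) (use D.prems in simp)
  moreover have "int (count_list (UD # u) UA) - int (count_list (UD # u) UD) = int (count_list u UA) - int (count_list u UD) - 1"
    by simp
  ultimately show ?case
    using tw_D[OF assms(1), of v "int (count_list u UA) - int (count_list u UD)" "[]"] by (simp only: append_Nil2 append_assoc append_Cons append_Nil)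
qed auto

lemma torus_zero:
  assumes "urel \<phi>" "set u \<subseteq> {UA, UD}" "\<And>k. \<phi> (tw k) = 0"
  shows "\<phi> u = 0"
  using torus_value[OF assms(1,2), of "[]"] assms(3) by simp

abbreviation qc :: complex where "qc \<equiv> complex_of_real q"
abbreviation \<kappa> :: complex where "\<kappa> \<equiv> 1 / qc - qc"

lemma kappa_complex [simp]: "\<kappa> \<noteq> 0"
  using kappa_nonzero(3) by (metis right_minus_eq)

lemma cancel_kappa: "x / \<kappa> * (\<kappa> * y) = x * y"
proof -
  have "x / c * (c * y) = x * y" if "c \<noteq> 0" for c using that by simp
  then show ?thesis using kappa_complex .
qed

text \<open>Both eigenvalue equations are applied to C A^k and the value at CC A^k is eliminated. Of
  what remains, B C A^k is given by the Casimir element, C B A^k by the commutator, and C A^(k+1), C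
  A^(k-1) by the eigenvalue equations at A^(k+1), A^(k-1).\<close>

lemma radial_equation:
  assumes u: "urel \<phi>" and right: "right_spherical (S / \<kappa>) (E / \<kappa>) \<phi>" and left: "left_spherical (S' / \<kappa>) (E' / \<kappa>) \<phi>"
    and casimir: "\<phi> (UB # UC # tw k) = (Q * \<phi> (tw k) - qc * \<phi> (tw (k - 2)) - \<phi> (tw (k + 2)) / qc) / \<kappa>^2"
  shows "al qc S S' (qc powi k) * \<phi> (tw (k + 2)) + be qc Q S S' E E' (qc powi k) * \<phi> (tw k)
    + ga qc E E' (qc powi k) * \<phi> (tw (k - 2)) = 0"
proof -
  define z where "z = qc powi k"
  have z: "z \<noteq> 0" by (simp add: z_def)
  have zm: "qc powi (- k) = 1 / z" by (simp add: z_def power_int_minus divide_inverse)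
  let ?c = "\<lambda>k. \<i> / h * \<phi> (UC # tw k)" and ?F = "\<lambda>k. \<phi> (tw k)"
  note A = tw_A[OF u, where v = "[]", simplified] and D = tw_D[OF u, where v = "[]", simplified]
  have snoc: "\<phi> (v @ tw k @ [UA]) = \<phi> (v @ tw (k + 1))" "\<phi> (v @ tw k @ [UD]) = \<phi> (v @ tw (k - 1))" for v k
  proof -
    have "int (count_list (tw k) UA) - int (count_list (tw k) UD) = k"
    proof -
      have "count_list (replicate n x) y = (if x = y then n else 0)" for n and x y :: ugen
        by (induction n) auto
      then show ?thesis by (simp add: tw_def)
    qed
    then show "\<phi> (v @ tw k @ [UA]) = \<phi> (v @ tw (k + 1))" "\<phi> (v @ tw k @ [UD]) = \<phi> (v @ tw (k - 1))"
      using torus_value[OF u, of "tw k @ [UA]" v] torus_value[OF u, of "tw k @ [UD]" v] tw_torus[of k]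
      by (simp_all add: algebra_simps)
  qed
  \<comment> \<open>Left and right equation at the same torus word; moving B and C across it brings
    in w and 1/w, and the value at B is eliminated.\<close>
  have c: "?c k * (w - 1 / w) = (S / \<kappa> - w * (S' / \<kappa>)) * ?F (k + 1) - (E / \<kappa> - w * (E' / \<kappa>)) * ?F (k - 1)"
    if w: "w = qc powi k" for k w
  proof -
    have w0: "w \<noteq> 0" "qc powi (- k) = 1 / w" by (simp_all add: w power_int_minus divide_inverse)
    have "\<i> * h * \<phi> (UB # tw k) - ?c k - S' / \<kappa> * ?F (k + 1) + E' / \<kappa> * ?F (k - 1) = 0"
      using left[unfolded left_spherical_def, rule_format, of "tw k"] A[of "[]" k] D[of "[]" k] by simp
    then have l: "\<i> * h * \<phi> (UB # tw k) = ?c k + S' / \<kappa> * ?F (k + 1) - E' / \<kappa> * ?F (k - 1)"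
      by (simp only: diff_eq_eq add_eq_0_iff2 eq_diff_eq) (simp add: algebra_simps)
    have "\<i> * h * (w * \<phi> (UB # tw k)) - \<i> / h * (1 / w * \<phi> (UC # tw k)) - S / \<kappa> * ?F (k + 1) + E / \<kappa> * ?F (k - 1) = 0"
      using right[unfolded right_spherical_def, rule_format, of "tw k"] tw_move[OF u, of "[]" k "[]"]
        snoc[of "[]" k] w0(2) by (simp add: w mult.commute)
    moreover have "\<i> * h * (w * \<phi> (UB # tw k)) = w * (\<i> * h * \<phi> (UB # tw k))"
      "\<i> / h * (1 / w * \<phi> (UC # tw k)) = ?c k * (1 / w)" by (simp_all only: mult_ac)
    ultimately have "w * (?c k + S' / \<kappa> * ?F (k + 1) - E' / \<kappa> * ?F (k - 1)) - ?c k * (1 / w)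
        - S / \<kappa> * ?F (k + 1) + E / \<kappa> * ?F (k - 1) = 0"
      unfolding l by simp
    moreover have "w * (C + s' * a - e' * b) - C * (1 / w) - s * a + e * b =
        C * (w - 1 / w) - ((s - w * s') * a - (e - w * e') * b)" for C s s' e e' a b
      by (simp add: algebra_simps)
    ultimately show ?thesis by (simp only: right_minus_eq)
  qed
  define X where "X = \<phi> (UB # UC # tw k)"
  define G where "G = (?F (k + 2) - ?F (k - 2)) / \<kappa>"
  \<comment> \<open>The commutator of B and C turns into a difference of torus values at distance
    two.\<close>
  have CB: "\<phi> (UC # UB # tw k) = X + G"
  proof -
    have "\<phi> (UA # UA # tw k) = ?F (k + 2)" "\<phi> (UD # UD # tw k) = ?F (k - 2)"
      using A[of "[UA]" k] A[of "[]" "k + 1"] D[of "[UD]" k] D[of "[]" "k - 1"] by (simp_all add: add.commute)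
    then have "X = \<phi> (UC # UB # tw k) + 1 / (qc - 1 / qc) * (?F (k + 2) - ?F (k - 2))"
      using urelD(7)[OF u, of "[]" "tw k"] by (simp add: X_def)
    moreover have "1 / (qc - 1 / qc) = - (1 / \<kappa>)" by (metis minus_diff_eq minus_divide_right)
    ultimately show ?thesis by (simp add: G_def)
  qed
  have m: "\<phi> (UA # UC # tw k) = 1 / qc * \<phi> (UC # tw (k + 1))" "\<phi> (UD # UC # tw k) = qc * \<phi> (UC # tw (k - 1))"
  proof -
    have "\<phi> (UC # UA # tw k) = qc * \<phi> (UA # UC # tw k)" using urelD(4)[OF u, of "[]"] by simp
    then show "\<phi> (UA # UC # tw k) = 1 / qc * \<phi> (UC # tw (k + 1))"
      using A[of "[UC]" k] by (simp add: field_simps)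
    show "\<phi> (UD # UC # tw k) = qc * \<phi> (UC # tw (k - 1))"
      using urelD(6)[OF u, of "[]" "tw k"] D[of "[UC]" k] by simp
  qed
  have "\<i> * h * X - \<i> / h * \<phi> (UC # UC # tw k) - S' / \<kappa> * (1 / qc * \<phi> (UC # tw (k + 1))) + E' / \<kappa> * (qc * \<phi> (UC # tw (k - 1))) = 0"
    using left[unfolded left_spherical_def, rule_format, of "UC # tw k"] m by (simp add: X_def)
  then have 3: "\<i> / h * \<phi> (UC # UC # tw k) =
     \<i> * h * X - S' / \<kappa> * (1 / qc * \<phi> (UC # tw (k + 1))) + E' / \<kappa> * (qc * \<phi> (UC # tw (k - 1)))"
    by (simp only: diff_eq_eq add_eq_0_iff2 eq_diff_eq) (simp add: algebra_simps)
  have "\<i> * h * (z * \<phi> (UC # UB # tw k)) - \<i> / h * (1 / z * \<phi> (UC # UC # tw k))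
      - S / \<kappa> * \<phi> (UC # tw (k + 1)) + E / \<kappa> * \<phi> (UC # tw (k - 1)) = 0"
    using right[unfolded right_spherical_def, rule_format, of "UC # tw k"] tw_move[OF u, of "[UC]" k "[]"]
      snoc[of "[UC]" k] zm by (simp add: z_def mult.commute)
  then have "\<i> / h * (\<i> * h * (z * (X + G)) - 1 / z * (\<i> * h * X - S' / \<kappa> * (1 / qc * \<phi> (UC # tw (k + 1))) + E' / \<kappa> * (qc * \<phi> (UC # tw (k - 1))))
      - S / \<kappa> * \<phi> (UC # tw (k + 1)) + E / \<kappa> * \<phi> (UC # tw (k - 1))) = 0"
    unfolding 3[symmetric] CB by (simp add: mult_ac)
  moreover have "i / h' * (i * h' * (z * (X + G)) - 1 / z * (i * h' * X - s' * (1 / qc * cp) + e' * (qc * cm)) - s * cp + e * cm) =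
     - (z - 1 / z) * X - z * G + (s' / (qc * z) - s) * (i / h' * cp) + (e - e' * qc / z) * (i / h' * cm)"
    if "i * i = -1" "h' \<noteq> 0" for i h' s s' e e' cp cm
  proof -
    have eq: "i / h' * (i * h' * a) = - a" for a using that by (simp add: field_simps)
    have "i / h' * (1 / z * (i * h' * X)) = 1 / z * (i / h' * (i * h' * X))"
      by (rule mult.left_commute)
    then have 1: "i / h' * (i * h' * (z * (X + G))) = - (z * (X + G))" "i / h' * (1 / z * (i * h' * X)) = - (1 / z * X)"
      unfolding eq by simp_all
    have "i / h' * (i * h' * (z * (X + G)) - 1 / z * (i * h' * X - s' * (1 / qc * cp) + e' * (qc * cm)) - s * cp + e * cm)
      = i / h' * (i * h' * (z * (X + G))) - i / h' * (1 / z * (i * h' * X)) + (s' / (qc * z) - s) * (i / h' * cp) + (e - e' * qc / z) * (i / h' * cm)"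
      using z that(2) by (simp add: field_simps)
    then show ?thesis unfolding 1 by (simp add: algebra_simps)
  qed
  ultimately have star: "- (z - 1 / z) * X - z * G + (S' / \<kappa> / (qc * z) - S / \<kappa>) * ?c (k + 1) + (E / \<kappa> - E' / \<kappa> * qc / z) * ?c (k - 1) = 0"
    using h_nonzero by (metis (no_types) complex_i_mult_minus i_squared)
  have zp: "qc * z = qc powi (k + 1)" "z / qc = qc powi (k - 1)"
    by (simp_all add: z_def power_int_add power_int_diff)
  show ?thesis
    unfolding z_def[symmetric]
  proof (rule radial_algebra[OF _ z kappa_complex refl _ G_def star])
    show "X = (Q * \<phi> (tw k) - qc * \<phi> (tw (k - 2)) - \<phi> (tw (k + 2)) / qc) / \<kappa>^2"
      using casimir by (simp add: X_def)
    show "?c (k + 1) * (qc * z - 1 / (qc * z)) = (S / \<kappa> - qc * z * (S' / \<kappa>)) * ?F (k + 2) - (E / \<kappa> - qc * z * (E' / \<kappa>)) * ?F k"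
      using c[OF zp(1)] by (simp add: add.commute)
    have "1 / (z / qc) = qc / z" by simp
    then show "?c (k - 1) * (z / qc - qc / z) = (S / \<kappa> - z / qc * (S' / \<kappa>)) * ?F k - (E / \<kappa> - z / qc * (E' / \<kappa>)) * ?F (k - 2)"
      using c[OF zp(2)] by (simp only: diff_add_cancel diff_diff_eq one_add_one)
  qed simp
qed

section \<open>Products with invariant elements, and the element \<rho>\<close>

lemma add_diff_combine:
  fixes a1 :: "'a::ring"
  shows "a1 - b1 = s * A - s * D \<Longrightarrow> a2 - b2 = s * D - e * B \<Longrightarrow> a1 + a2 - (b1 + b2) - s * A + e * B = 0"
  by (auto simp: diff_eq_eq)

lemma diff_combine:
  fixes c :: "'a::ring"
  shows "s * (x - y) = c \<Longrightarrow> d = c \<Longrightarrow> d - s * x + s * y = 0"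
  by (auto simp: right_diff_distrib)

text \<open>X = \<i> h B - (\<i>/h) C - s (A - D) satisfies \<Delta>(X) = A \<otimes> X + X
  \<otimes> D. A right factor annihilated by X therefore leaves the equation of the left factor
  intact: the cross terms A \<otimes> D cancel.\<close>

lemma conv_right_spherical:
  assumes "right_spherical s e \<phi>" "right_spherical s s \<psi>"
  shows "right_spherical s e (conv \<phi> \<psi>)"
  unfolding right_spherical_def
proof
  fix Y
  have \<psi>: "\<i> * h * \<psi> (v @ [UB]) - \<i> / h * \<psi> (v @ [UC]) = s * \<psi> (v @ [UA]) - s * \<psi> (v @ [UD])" for v
    using assms(2)[unfolded right_spherical_def, rule_format, of v] by (simp add: algebra_simps)
  have \<phi>: "\<i> * h * \<phi> (v @ [UB]) - \<i> / h * \<phi> (v @ [UC]) = s * \<phi> (v @ [UA]) - e * \<phi> (v @ [UD])" for v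
    using assms(1)[unfolded right_spherical_def, rule_format, of v] by (simp add: algebra_simps)
  let ?A = "\<lambda>v. \<phi> (v @ [UA])" and ?D = "\<lambda>v. \<psi> (v @ [UD])"
  have 1: "\<i> * h * conv ?A (\<lambda>v. \<psi> (v @ [UB])) Y - \<i> / h * conv ?A (\<lambda>v. \<psi> (v @ [UC])) Y =
    s * conv ?A (\<lambda>v. \<psi> (v @ [UA])) Y - s * conv ?A ?D Y"
    by (simp only: conv_mult_right[symmetric] conv_diff_right[symmetric] \<psi>)
  have 2: "\<i> * h * conv (\<lambda>v. \<phi> (v @ [UB])) ?D Y - \<i> / h * conv (\<lambda>v. \<phi> (v @ [UC])) ?D Y =
    s * conv ?A ?D Y - e * conv (\<lambda>v. \<phi> (v @ [UD])) ?D Y"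
    by (simp only: conv_mult_left[symmetric] conv_diff_left[symmetric] \<phi>)
  show "\<i> * h * conv \<phi> \<psi> (Y @ [UB]) - \<i> / h * conv \<phi> \<psi> (Y @ [UC]) - s * conv \<phi> \<psi> (Y @ [UA]) + e * conv \<phi> \<psi> (Y @ [UD]) = 0"
    unfolding conv_snoc distrib_left by (rule add_diff_combine[OF 1 2])
qed

lemma conv_left_spherical:
  assumes "left_spherical s e \<phi>" "left_spherical s s \<psi>"
  shows "left_spherical s e (conv \<phi> \<psi>)"
  unfolding left_spherical_def
proof
  fix Y
  have \<psi>: "\<i> * h * \<psi> (UB # v) - \<i> / h * \<psi> (UC # v) = s * \<psi> (UA # v) - s * \<psi> (UD # v)" for v
    using assms(2)[unfolded left_spherical_def, rule_format, of v] by (simp add: algebra_simps)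
  have \<phi>: "\<i> * h * \<phi> (UB # v) - \<i> / h * \<phi> (UC # v) = s * \<phi> (UA # v) - e * \<phi> (UD # v)" for v
    using assms(1)[unfolded left_spherical_def, rule_format, of v] by (simp add: algebra_simps)
  let ?A = "\<lambda>v. \<phi> (UA # v)" and ?D = "\<lambda>v. \<psi> (UD # v)"
  have 1: "\<i> * h * conv ?A (\<lambda>v. \<psi> (UB # v)) Y - \<i> / h * conv ?A (\<lambda>v. \<psi> (UC # v)) Y =
    s * conv ?A (\<lambda>v. \<psi> (UA # v)) Y - s * conv ?A ?D Y"
    by (simp only: conv_mult_right[symmetric] conv_diff_right[symmetric] \<psi>)
  have 2: "\<i> * h * conv (\<lambda>v. \<phi> (UB # v)) ?D Y - \<i> / h * conv (\<lambda>v. \<phi> (UC # v)) ?D Y =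
    s * conv ?A ?D Y - e * conv (\<lambda>v. \<phi> (UD # v)) ?D Y"
    by (simp only: conv_mult_left[symmetric] conv_diff_left[symmetric] \<phi>)
  show "\<i> * h * conv \<phi> \<psi> (UB # Y) - \<i> / h * conv \<phi> \<psi> (UC # Y) - s * conv \<phi> \<psi> (UA # Y) + e * conv \<phi> \<psi> (UD # Y) = 0"
    unfolding conv.simps distrib_left by (rule add_diff_combine[OF 1 2])
qed

text \<open>A representative of the element \<open>\<rho>\<^sub>\<tau>\<^sub>,\<^sub>\<sigma>\<close>, with \<open>S = q\<^bsup>-\<sigma>\<^esup> - q\<^bsup>\<sigma>\<^esup>\<close> and \<open>S' = q\<^bsup>-\<tau>\<^esup> - q\<^bsup>\<tau>\<^esup>\<close>.\<close>

definition rho_rep :: "complex \<Rightarrow> complex \<Rightarrow> agen falg" where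
  "rho_rep S' S = scal (1/2) *
     (\<alpha>^2 + \<delta>^2 + scal q * \<gamma>^2 + scal (1/q) * \<beta>^2
      + scal (\<i> * S) * (scal q * \<delta> * \<gamma> + \<beta> * \<alpha>)
      - scal (\<i> * S') * (\<delta> * \<beta> + scal q * \<gamma> * \<alpha>)
      + scal (S * S') * \<beta> * \<gamma>)"

lemma rho_cls: "\<rho> q \<tau> \<sigma> = cls (A_rels q) (rho_rep (q powr (-\<tau>) - q powr \<tau>) (q powr (-\<sigma>) - q powr \<sigma>))"
  by (simp add: \<rho>_def rho_rep_def)

lemma ev_rho: "ev (rho_rep S' S) u = 1/2 * (conv (pr1 Ga) (pr1 Ga) u + conv (pr1 Gd) (pr1 Gd) u
    + qc * conv (pr1 Gc) (pr1 Gc) u + 1 / qc * conv (pr1 Gb) (pr1 Gb) u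
    + \<i> * S * (qc * conv (pr1 Gd) (pr1 Gc) u + conv (pr1 Gb) (pr1 Ga) u)
    - \<i> * S' * (conv (pr1 Gd) (pr1 Gb) u + qc * conv (pr1 Gc) (pr1 Ga) u)
    + S * S' * conv (pr1 Gb) (pr1 Gc) u)"
  by (simp only: rho_rep_def mult.assoc ev_scal ev_add ev_diff power2_eq_square)
     (simp add: ev_mult \<alpha>_def \<beta>_def \<gamma>_def \<delta>_def)

lemma rho_torus: "set u \<subseteq> {UA, UD} \<Longrightarrow> ev (rho_rep S' S) u = 1/2 * (pr1 Ga u ^ 2 + pr1 Gd u ^ 2)"
proof -
  assume u: "set u \<subseteq> {UA, UD}"
  then have "pr1 Gb u = 0" "pr1 Gc u = 0"
    by (induction u rule: ugen_list_induct) auto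
  then show ?thesis by (simp add: ev_rho conv_group_like[OF u] power2_eq_square)
qed

lemma h_cancel:
  "h * (h * x) = qc * x" "x / h / h = x / qc" "h * (x / h) = x" "h * x / h = x" "x / (h * h) = x / qc"
  by (simp_all flip: mult.assoc)

lemmas pr1_normalize = conv_mult_left conv_mult_right conv_divide_left conv_divide_right A_rels_pr1 h_cancel

lemma rho_right: "right_spherical (S / \<kappa>) (S / \<kappa>) (ev (rho_rep S' S))"
  unfolding right_spherical_def
proof
  fix Y
  let ?p = "\<lambda>x y. conv (pr1 x) (pr1 y) Y" and ?r = "ev (rho_rep S' S)"
  \<comment> \<open>The difference of the translates by A and D is \<kappa> Z, and the combination
    of B and C is S Z; the invariance equation compares the two.\<close>
  define Z where "Z = 1/2 * (?p Gd Gd - ?p Ga Ga - qc * ?p Gc Gc + ?p Gb Gb / qc - \<i> * S' * (?p Gd Gb - qc * ?p Gc Ga))"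
  have 1: "?r (Y @ [UA]) - ?r (Y @ [UD]) = \<kappa> * Z"
    unfolding ev_rho conv_snoc pr1_snoc rweight.simps Z_def
    by (simp add: pr1_normalize) (simp add: field_simps)
  have 2: "\<i> * h * ?r (Y @ [UB]) - \<i> / h * ?r (Y @ [UC]) = S * Z"
    unfolding ev_rho conv_snoc pr1_snoc rweight.simps Z_def
    by (simp add: pr1_normalize) (simp add: field_simps, simp add: h_cancel(1) algebra_simps)
  have "S / \<kappa> * (?r (Y @ [UA]) - ?r (Y @ [UD])) = S * Z"
    unfolding 1 by (rule cancel_kappa)
  then show "\<i> * h * ?r (Y @ [UB]) - \<i> / h * ?r (Y @ [UC]) - S / \<kappa> * ?r (Y @ [UA]) + S / \<kappa> * ?r (Y @ [UD]) = 0"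
    by (rule diff_combine) (rule 2)
qed

lemma rho_left: "left_spherical (S' / \<kappa>) (S' / \<kappa>) (ev (rho_rep S' S))"
  unfolding left_spherical_def
proof
  fix Y
  let ?p = "\<lambda>x y. conv (pr1 x) (pr1 y) Y" and ?r = "ev (rho_rep S' S)"
  define Z where "Z = 1/2 * (?p Gd Gd - ?p Ga Ga + qc * ?p Gc Gc - ?p Gb Gb / qc + \<i> * S * (qc * ?p Gd Gc - ?p Gb Ga))"
  have 1: "?r (UA # Y) - ?r (UD # Y) = \<kappa> * Z"
    unfolding ev_rho conv.simps pr1.simps Z_def
    by (simp add: pr1_normalize) (simp add: field_simps)
  have 2: "\<i> * h * ?r (UB # Y) - \<i> / h * ?r (UC # Y) = S' * Z"
    unfolding ev_rho conv.simps pr1.simps Z_def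
    by (simp add: pr1_normalize) (simp add: field_simps, simp add: h_cancel(1) algebra_simps)
  have "S' / \<kappa> * (?r (UA # Y) - ?r (UD # Y)) = S' * Z"
    unfolding 1 by (rule cancel_kappa)
  then show "\<i> * h * ?r (UB # Y) - \<i> / h * ?r (UC # Y) - S' / \<kappa> * ?r (UA # Y) + S' / \<kappa> * ?r (UD # Y) = 0"
    by (rule diff_combine) (rule 2)
qed

definition SS :: "real \<Rightarrow> complex" where "SS \<sigma> = of_real (q powr (-\<sigma>) - q powr \<sigma>)"

lemma SS_kappa: "SS \<sigma> / \<kappa> = of_real ((q powr (-\<sigma>) - q powr \<sigma>) / (1/q - q))"
  by (simp add: SS_def)

end

subsection \<open>The elements \<open>b\<^sup>l\<^sub>i\<^sub>j\<close>\<close>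

context spin
begin

text \<open>This is the vector \<open>v^{l,j}\<close> after the action of A: the factor q^(-m) in
  the definition of b is the eigenvalue of A.\<close>

definition avec :: "real \<Rightarrow> real \<Rightarrow> real \<Rightarrow> complex" where
  "avec j \<sigma> k = (if k \<in> weights l then vv q l j k \<sigma> * of_real (q powr (-k)) else 0)"

definition bfun :: "real \<Rightarrow> real \<Rightarrow> real \<Rightarrow> real \<Rightarrow> wfun" where
  "bfun i j \<tau> \<sigma> u = (\<Sum>n\<in>weights l. foldr T u (avec j \<sigma>) n * cnj (vv q l i n \<tau>))"

lemma supp_avec: "supp (avec j \<sigma>)"
  by (simp add: supp_def avec_def)

lemma avec_expand: "avec j \<sigma> = (\<lambda>k. \<Sum>m\<in>weights l. (vv q l j m \<sigma> * of_real (q powr (-m))) * ebasis m k)"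
proof
  fix k
  have "(\<Sum>m\<in>weights l. (vv q l j m \<sigma> * of_real (q powr (-m))) * ebasis m k) =
    (\<Sum>m\<in>weights l. if m = k then vv q l j m \<sigma> * of_real (q powr (-m)) else 0)"
    by (intro sum.cong) (auto simp: ebasis_def)
  then show "avec j \<sigma> k = (\<Sum>m\<in>weights l. (vv q l j m \<sigma> * of_real (q powr (-m))) * ebasis m k)"
    by (simp add: avec_def)
qed

lemma Aq_finsum_cong:
  assumes "finite K" "\<And>k. k \<in> K \<Longrightarrow> f k = cls (A_rels q) (g k)"
  shows "(\<Oplus>\<^bsub>Aq q\<^esub>k\<in>K. f k) = cls (A_rels q) (\<Sum>k\<in>K. g k)"
proof -
  interpret R: ring "presented (A_rels q)" by (rule ring_presented)
  have "(\<Oplus>\<^bsub>Aq q\<^esub>k\<in>K. f k) = (\<Oplus>\<^bsub>Aq q\<^esub>k\<in>K. cls (A_rels q) (g k))"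
    unfolding Aq_def by (rule R.finsum_cong') (use assms in auto)
  then show ?thesis using assms(1) by (simp add: Aq_def cls_finsum)
qed

lemma b_elt_representative:
  "\<exists>\<xi>. b_elt q l i j \<tau> \<sigma> = cls (A_rels q) \<xi> \<and> (\<forall>u. ev \<xi> u = bfun i j \<tau> \<sigma> u)"
proof -
  have "\<forall>p\<in>weights l \<times> weights l. \<exists>\<xi>. tcoef q l (fst p) (snd p) = cls (A_rels q) \<xi> \<and>
      (\<forall>u. ev \<xi> u = foldr T u (ebasis (snd p)) (fst p))"
    using tcoef_representative by auto
  then obtain t where t: "\<And>n m. n \<in> weights l \<Longrightarrow> m \<in> weights l \<Longrightarrow> tcoef q l n m = cls (A_rels q) (t (n, m))"
      "\<And>n m u. n \<in> weights l \<Longrightarrow> m \<in> weights l \<Longrightarrow> ev (t (n, m)) u = foldr T u (ebasis m) n"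
    by (auto simp: bchoice_iff)
  let ?c = "\<lambda>n m. vv q l j m \<sigma> * cnj (vv q l i n \<tau>) * of_real (q powr (-m))"
  let ?\<xi> = "\<Sum>n\<in>weights l. \<Sum>m\<in>weights l. scal (?c n m) * t (n, m)"
  have "b_elt q l i j \<tau> \<sigma> = cls (A_rels q) ?\<xi>"
    unfolding b_elt_def by (intro Aq_finsum_cong) (auto simp: t smulA_cls)
  moreover have "ev ?\<xi> u = bfun i j \<tau> \<sigma> u" for u
  proof -
    have "ev ?\<xi> u = (\<Sum>n\<in>weights l. \<Sum>m\<in>weights l. ?c n m * foldr T u (ebasis m) n)"
      by (simp add: ev_sum ev_scal t)
    also have "\<dots> = (\<Sum>n\<in>weights l. (\<Sum>m\<in>weights l. (vv q l j m \<sigma> * of_real (q powr (-m))) * foldr T u (ebasis m) n) * cnj (vv q l i n \<tau>))"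
      by (simp add: sum_distrib_left sum_distrib_right mult_ac)
    also have "\<dots> = bfun i j \<tau> \<sigma> u"
      unfolding bfun_def avec_expand foldr_trep_sum ..
    finally show ?thesis .
  qed
  ultimately show ?thesis by blast
qed

lemma i_powi_shift:
  "\<i> powi \<lfloor>n + 1 - l\<rfloor> = \<i> powi \<lfloor>n - l\<rfloor> * \<i>" "\<i> powi \<lfloor>n - 1 - l\<rfloor> = - (\<i> powi \<lfloor>n - l\<rfloor> * \<i>)"
proof -
  have "\<lfloor>n + 1 - l\<rfloor> = \<lfloor>n - l\<rfloor> + 1" "\<lfloor>n - 1 - l\<rfloor> = \<lfloor>n - l\<rfloor> - 1"
    by linarith+
  then show "\<i> powi \<lfloor>n + 1 - l\<rfloor> = \<i> powi \<lfloor>n - l\<rfloor> * \<i>" "\<i> powi \<lfloor>n - 1 - l\<rfloor> = - (\<i> powi \<lfloor>n - l\<rfloor> * \<i>)"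
    by (simp_all add: power_int_add power_int_diff divide_inverse)
qed

text \<open>The phases supply a factor \<i> or -\<i> at the neighbouring weights. Together with the
  coefficients \<i> and -\<i> of B and C they produce the real signs of
  \<open>rr_equation\<close>.\<close>

lemma vv_equation:
  assumes n: "n \<in> weights l" and j: "j \<in> weights l"
  shows "\<i> * h * (vv q l j (n + 1) \<sigma> * of_real (q powr (-n - 1)) * of_real (trep_coeff q l UB (n + 1)))
    - \<i> / h * (vv q l j (n - 1) \<sigma> * of_real (q powr (-n + 1)) * of_real (trep_coeff q l UC (n - 1)))
    - of_real ((q powr (-\<sigma>) - q powr \<sigma>) / (1/q - q)) * (vv q l j n \<sigma> * of_real (q powr (-2*n)))
    + of_real ((q powr (-(\<sigma> + 2*j)) - q powr (\<sigma> + 2*j)) / (1/q - q)) * vv q l j n \<sigma> = 0"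
proof -
  let ?c = "of_real (Cc q l j \<sigma>) * \<i> powi \<lfloor>n - l\<rfloor>"
  have hq: "h = of_real (q powr (1/2))" "1 / h = of_real (q powr (-1/2))"
    using q_pos by (simp_all add: h_def powr_half_sqrt powr_minus_divide)
  let ?B = "of_real (q powr (1/2) * trep_coeff q l UB (n + 1) * q powr (-n - 1) * rr j \<sigma> (n + 1)) :: complex"
  let ?C = "of_real (q powr (-1/2) * trep_coeff q l UC (n - 1) * q powr (-n + 1) * rr j \<sigma> (n - 1)) :: complex"
  let ?s = "of_real ((q powr (-\<sigma>) - q powr \<sigma>) / (1/q - q) * q powr (-2*n) * rr j \<sigma> n) :: complex"
  let ?e = "of_real ((q powr (-(\<sigma> + 2*j)) - q powr (\<sigma> + 2*j)) / (1/q - q) * rr j \<sigma> n) :: complex"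
  have "?B + ?C + ?s = ?e"
  proof -
    have "- \<sigma> - 2 * j = - (\<sigma> + 2 * j)" by simp
    then show ?thesis unfolding of_real_add[symmetric] using rr_equation[OF n j, of \<sigma>] by (simp only:)
  qed
  moreover have "\<i> * h * (vv q l j (n + 1) \<sigma> * of_real (q powr (-n - 1)) * of_real (trep_coeff q l UB (n + 1))) = - ?c * ?B"
  proof -
    have "\<i> * hh * (a * (b * \<i>) * r * y * t) = - (a * b) * (hh * t * y * r)" for hh a b r y t :: complex
      by (simp add: algebra_simps)
    then show ?thesis unfolding vv_rr i_powi_shift hq of_real_mult .
  qed
  moreover have "\<i> / h * (vv q l j (n - 1) \<sigma> * of_real (q powr (-n + 1)) * of_real (trep_coeff q l UC (n - 1))) = ?c * ?C"
  proof -
    have "\<i> * hh * (a * (- (b * \<i>)) * r * y * t) = (a * b) * (hh * t * y * r)" for hh a b r y t :: complex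
      by (simp add: algebra_simps)
    moreover have e: "\<i> / h = \<i> * of_real (q powr (-1/2))" unfolding hq(2)[symmetric] by simp
    ultimately show ?thesis unfolding vv_rr i_powi_shift e of_real_mult by (simp only:)
  qed
  moreover have "of_real ((q powr (-\<sigma>) - q powr \<sigma>) / (1/q - q)) * (vv q l j n \<sigma> * of_real (q powr (-2*n))) = ?c * ?s"
    unfolding vv_rr of_real_mult by (simp only: mult_ac)
  moreover have "of_real ((q powr (-(\<sigma> + 2*j)) - q powr (\<sigma> + 2*j)) / (1/q - q)) * vv q l j n \<sigma> = ?c * ?e"
    unfolding vv_rr of_real_mult by (simp only: mult_ac)
  moreover have "- c * b - c * d - c * s + c * e = 0" if "b + d + s = e" for b c d s e :: complex
    using that by (auto simp: algebra_simps)
  ultimately show ?thesis by metis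
qed

text \<open>Trailing letters act on \<open>avec\<close> before the rest of the word does, so the
  claim is the equation for this vector, checked coordinate by coordinate.\<close>

lemma bfun_right:
  assumes j: "j \<in> weights l"
  shows "right_spherical (SS \<sigma> / \<kappa>) (SS (\<sigma> + 2*j) / \<kappa>) (bfun i j \<tau> \<sigma>)"
  unfolding right_spherical_def
proof
  fix Y
  let ?a = "avec j \<sigma>" and ?s = "SS \<sigma> / \<kappa>" and ?e = "SS (\<sigma> + 2*j) / \<kappa>"
  have zero: "\<i> * h * T UB ?a k + (- (\<i> / h)) * T UC ?a k + (- ?s) * T UA ?a k + ?e * T UD ?a k = 0 * ?a k" for k
  proof (cases "k \<in> weights l")
    case True
    have B: "T UB ?a k = vv q l j (k + 1) \<sigma> * of_real (q powr (-k - 1)) * of_real (trep_coeff q l UB (k + 1))"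
    proof (cases "k + 1 \<in> weights l")
      case False
      then have "k = l" using weight_succ True by blast
      then have "trep_coeff q l UB (k + 1) = 0" unfolding trep_coeff_BC using trep_coeff_end by simp
      then show ?thesis by (simp add: trep_gen_eq[OF supp_avec] del: trep_coeff.simps)
    qed (simp add: trep_gen_eq[OF supp_avec] avec_def del: trep_coeff.simps)
    have C: "T UC ?a k = vv q l j (k - 1) \<sigma> * of_real (q powr (-k + 1)) * of_real (trep_coeff q l UC (k - 1))"
    proof (cases "k - 1 \<in> weights l")
      case False
      then have "k = - l" using weight_pred True by blast
      then have "trep_coeff q l UC (k - 1) = 0" using trep_coeff_BC[of "k - 1"] trep_coeff_end(1) by simp
      then show ?thesis by (simp add: trep_gen_eq[OF supp_avec] del: trep_coeff.simps)
    qed (simp add: trep_gen_eq[OF supp_avec] avec_def del: trep_coeff.simps)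
    have "q powr (-k) * q powr (-k) = q powr (-2*k)" "q powr (-k) * q powr k = 1"
      using q_pos by (simp_all flip: powr_add)
    then have A: "T UA ?a k = vv q l j k \<sigma> * of_real (q powr (-2*k))" and D: "T UD ?a k = vv q l j k \<sigma>"
      using True by (simp_all add: trep_gen_eq[OF supp_avec] avec_def mult.assoc flip: of_real_mult)
    have "a * x + (- b) * y + (- c) * z + d * v = 0 * t" if "a * x - b * y - c * z + d * v = 0"
      for a b c d x y z v t :: complex using that by simp
    then show ?thesis
      unfolding A B C D SS_kappa using vv_equation[OF True j, of \<sigma>] .
  next
    case False
    then show ?thesis using supp_trep[OF supp_avec] by (simp add: supp_def avec_def)
  qed
  have "\<i> * h * foldr T Y (T UB ?a) n + (- (\<i> / h)) * foldr T Y (T UC ?a) n + (- ?s) * foldr T Y (T UA ?a) n + ?e * foldr T Y (T UD ?a) n = 0" for n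
  proof -
    have "foldr T Y (\<lambda>k. \<i> * h * T UB ?a k + (- (\<i> / h)) * T UC ?a k + (- ?s) * T UA ?a k + ?e * T UD ?a k) n = foldr T Y (\<lambda>k. 0 * ?a k) n"
      unfolding zero ..
    then show ?thesis unfolding foldr_trep_lin by simp
  qed
  then have "(\<Sum>n\<in>weights l. (\<i> * h * foldr T Y (T UB ?a) n + (- (\<i> / h)) * foldr T Y (T UC ?a) n + (- ?s) * foldr T Y (T UA ?a) n + ?e * foldr T Y (T UD ?a) n) * cnj (vv q l i n \<tau>)) = 0"
    by simp
  moreover have "(a * x + (- b) * y + (- c) * z + d * v) * f = a * (x * f) - b * (y * f) - c * (z * f) + d * (v * f)" for f a b c d x y z v :: complex
    by (simp add: algebra_simps)
  ultimately show "\<i> * h * bfun i j \<tau> \<sigma> (Y @ [UB]) - \<i> / h * bfun i j \<tau> \<sigma> (Y @ [UC]) - ?s * bfun i j \<tau> \<sigma> (Y @ [UA]) + ?e * bfun i j \<tau> \<sigma> (Y @ [UD]) = 0"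
    unfolding bfun_def sum_distrib_left foldr_append foldr.simps comp_apply id_apply
    by (simp only: sum.distrib[symmetric] sum_subtractf[symmetric])
qed

text \<open>Summation by parts, transferring B and C to the covector; the boundary terms carry
  vanishing coefficients.\<close>

lemma sum_trep_shift:
  assumes f: "supp f"
  shows "(\<Sum>n\<in>weights l. T UB f n * w n) = (\<Sum>n\<in>weights l. f n * (of_real (trep_coeff q l UB n) * w (n - 1)))"
    "(\<Sum>n\<in>weights l. T UC f n * w n) = (\<Sum>n\<in>weights l. f n * (of_real (trep_coeff q l UC n) * w (n + 1)))"
proof -
  show "(\<Sum>n\<in>weights l. T UB f n * w n) = (\<Sum>n\<in>weights l. f n * (of_real (trep_coeff q l UB n) * w (n - 1)))"
  proof (rule sum.reindex_bij_witness_not_neutral[where i = "\<lambda>n. n - 1" and j = "\<lambda>n. n + 1"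
        and S' = "{n \<in> weights l. n + 1 \<notin> weights l}" and T' = "{n \<in> weights l. n - 1 \<notin> weights l}"])
    show "T UB f n * w n = 0" if "n \<in> {n \<in> weights l. n + 1 \<notin> weights l}" for n
      using that f by (simp add: trep_gen_eq supp_def)
    show "f n * (of_real (trep_coeff q l UB n) * w (n - 1)) = 0" if "n \<in> {n \<in> weights l. n - 1 \<notin> weights l}" for n
      using that weight_pred[of n] trep_coeff_end(1) by force
  qed (use f in \<open>auto simp: trep_gen_eq simp del: trep_coeff.simps\<close>)
  show "(\<Sum>n\<in>weights l. T UC f n * w n) = (\<Sum>n\<in>weights l. f n * (of_real (trep_coeff q l UC n) * w (n + 1)))"
  proof (rule sum.reindex_bij_witness_not_neutral[where i = "\<lambda>n. n + 1" and j = "\<lambda>n. n - 1"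
        and S' = "{n \<in> weights l. n - 1 \<notin> weights l}" and T' = "{n \<in> weights l. n + 1 \<notin> weights l}"])
    show "T UC f n * w n = 0" if "n \<in> {n \<in> weights l. n - 1 \<notin> weights l}" for n
      using that f by (simp add: trep_gen_eq supp_def)
    show "f n * (of_real (trep_coeff q l UC n) * w (n + 1)) = 0" if "n \<in> {n \<in> weights l. n + 1 \<notin> weights l}" for n
      using that weight_succ[of n] trep_coeff_end(2) by force
  qed (use f in \<open>auto simp: trep_gen_eq simp del: trep_coeff.simps\<close>)
qed

text \<open>A leading letter is transferred to the covector \<open>v^{l,i}\<close>, where B and C
  exchange roles. The resulting relation is the conjugate of \<open>vv_equation\<close> multiplied
  by q^n.\<close>

lemma bfun_left:
  assumes i: "i \<in> weights l"
  shows "left_spherical (SS \<tau> / \<kappa>) (SS (\<tau> + 2*i) / \<kappa>) (bfun i j \<tau> \<sigma>)"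
  unfolding left_spherical_def
proof
  fix Y
  define f where "f = foldr T Y (avec j \<sigma>)"
  have f: "supp f" unfolding f_def by (rule supp_foldr[OF supp_avec])
  let ?w = "\<lambda>n. cnj (vv q l i n \<tau>)" and ?s = "SS \<tau> / \<kappa>" and ?e = "SS (\<tau> + 2*i) / \<kappa>"
  have b: "bfun i j \<tau> \<sigma> (g # Y) = (\<Sum>n\<in>weights l. T g f n * ?w n)" for g
    by (simp add: bfun_def f_def)
  have A: "bfun i j \<tau> \<sigma> (UA # Y) = (\<Sum>n\<in>weights l. f n * (of_real (q powr (-n)) * ?w n))"
    and D: "bfun i j \<tau> \<sigma> (UD # Y) = (\<Sum>n\<in>weights l. f n * (of_real (q powr n) * ?w n))"
    by (simp_all add: b trep_gen_eq[OF f] mult.assoc)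
  have zero: "\<i> * h * (of_real (trep_coeff q l UB n) * ?w (n - 1)) - \<i> / h * (of_real (trep_coeff q l UC n) * ?w (n + 1))
      - ?s * (of_real (q powr (-n)) * ?w n) + ?e * (of_real (q powr n) * ?w n) = 0" if n: "n \<in> weights l" for n
  proof -
    have eq: "trep_coeff q l UB (n + 1) = trep_coeff q l UC n" "trep_coeff q l UC (n - 1) = trep_coeff q l UB n"
      using trep_coeff_BC[of n] trep_coeff_BC[of "n - 1"] by (simp_all del: trep_coeff.simps)
    have cj: "cnj h = h" by (simp add: h_def)
    have "cnj (\<i> * h * (vv q l i (n + 1) \<tau> * of_real (q powr (-n - 1)) * of_real (trep_coeff q l UB (n + 1)))
    - \<i> / h * (vv q l i (n - 1) \<tau> * of_real (q powr (-n + 1)) * of_real (trep_coeff q l UC (n - 1)))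
    - of_real ((q powr (-\<tau>) - q powr \<tau>) / (1/q - q)) * (vv q l i n \<tau> * of_real (q powr (-2*n)))
    + of_real ((q powr (-(\<tau> + 2*i)) - q powr (\<tau> + 2*i)) / (1/q - q)) * vv q l i n \<tau>) = cnj 0"
      using vv_equation[OF n i, of \<tau>] by (rule arg_cong)
    then have 1: "- (\<i> * h * (?w (n + 1) * of_real (q powr (-n - 1)) * of_real (trep_coeff q l UC n)))
    + \<i> / h * (?w (n - 1) * of_real (q powr (-n + 1)) * of_real (trep_coeff q l UB n))
    - ?s * (?w n * of_real (q powr (-2*n))) + ?e * ?w n = 0"
      unfolding SS_kappa eq by (simp add: cj del: trep_coeff.simps)
    define y where "y = complex_of_real (q powr n)"
    have pp: "q powr (2 * n) = q powr n * q powr n"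
      using powr_add[of q n n] by simp
    have y: "of_real (q powr (-n - 1)) = 1 / (qc * y)" "of_real (q powr (-n + 1)) = qc / y"
       "of_real (q powr (-2*n)) = 1 / (y * y)" "of_real (q powr (-n)) = 1 / y" "y \<noteq> 0"
      using q_pos by (simp_all add: y_def powr_minus powr_add powr_diff field_simps flip: of_real_mult of_real_divide)
        (simp_all add: mult.commute[of n 2] pp)
    have "y * (- (\<i> * h * (w1 * (1 / (qc * y)) * t1)) + \<i> / h * (w2 * (qc / y) * t2) - s * (w * (1 / (y * y))) + e * w) =
      \<i> * h * (t2 * w2) - \<i> / h * (t1 * w1) - s * (1 / y * w) + e * (y * w)" for w1 t1 w2 t2 s w e
    proof -
      have "qc = h * h" by simp
      then show ?thesis using y(5) by (simp add: field_simps del: h_mult_h)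
    qed
    from this[of "?w (n + 1)" "of_real (trep_coeff q l UC n)" "?w (n - 1)" "of_real (trep_coeff q l UB n)" ?s "?w n" ?e]
    show ?thesis using 1 unfolding y y_def[symmetric] by simp
  qed
  have "(\<Sum>n\<in>weights l. f n * (\<i> * h * (of_real (trep_coeff q l UB n) * ?w (n - 1)) - \<i> / h * (of_real (trep_coeff q l UC n) * ?w (n + 1))
      - ?s * (of_real (q powr (-n)) * ?w n) + ?e * (of_real (q powr n) * ?w n))) = 0"
    using zero by (intro sum.neutral) (simp del: trep_coeff.simps)
  moreover have "f * (a * x - b * y - c * z + d * v) = a * (f * x) - b * (f * y) - c * (f * z) + d * (f * v)" for f a b c d x y z v :: complex
    by (simp add: algebra_simps)
  ultimately show "\<i> * h * bfun i j \<tau> \<sigma> (UB # Y) - \<i> / h * bfun i j \<tau> \<sigma> (UC # Y) - ?s * bfun i j \<tau> \<sigma> (UA # Y) + ?e * bfun i j \<tau> \<sigma> (UD # Y) = 0"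
    unfolding b[of UB] b[of UC] sum_trep_shift[OF f] A D sum_distrib_left
    by (simp only: sum.distrib[symmetric] sum_subtractf[symmetric])
qed

lemma urel_bfun: "urel (bfun i j \<tau> \<sigma>)"
  using urel_ev b_elt_representative[of i j \<tau> \<sigma>] by (metis ext)

lemma foldr_tw: "supp v \<Longrightarrow> foldr T (tw k) v n = of_real (q powr (- n * of_int k)) * v n"
proof -
  assume v: "supp v"
  have "foldr T (replicate m UA) v n = of_real (q powr (- n * real m)) * v n" for m
  proof (induction m)
    case (Suc m)
    have "foldr T (replicate (Suc m) UA) v n = foldr T (replicate m UA) v n * of_real (q powr (- n))"
      using trep_gen_eq[OF supp_foldr[OF v, of "replicate m UA"], of UA n] by simp
    moreover have "q powr (- n * real (Suc m)) = q powr (- n * real m) * q powr (-n)"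
      by (simp add: algebra_simps flip: powr_add)
    ultimately show ?case using Suc by simp
  qed (use q_pos in simp)
  moreover have "foldr T (replicate m UD) v n = of_real (q powr (n * real m)) * v n" for m
  proof (induction m)
    case (Suc m)
    have "foldr T (replicate (Suc m) UD) v n = foldr T (replicate m UD) v n * of_real (q powr n)"
      using trep_gen_eq[OF supp_foldr[OF v, of "replicate m UD"], of UD n] by simp
    moreover have "q powr (n * real (Suc m)) = q powr (n * real m) * q powr n"
      by (simp add: algebra_simps flip: powr_add)
    ultimately show ?case using Suc by simp
  qed (use q_pos in simp)
  ultimately show ?thesis by (simp add: tw_def)
qed

lemma bfun_torus:
  "bfun i j \<tau> \<sigma> (tw k) = of_real (Cc q l j \<sigma> * Cc q l i \<tau>) *
    (\<Sum>n\<in>weights l. of_real (q powr (-n) * (rr j \<sigma> n * rr i \<tau> n) * q powr (- n * of_int k)))"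
proof -
  \<comment> \<open>The phases of the two vectors cancel, so torus values are sums of real
    terms.\<close>
  have 1: "\<i> powi z * cnj (\<i> powi z) = 1" for z
  proof -
    have "norm (\<i> powi z) = 1" by (simp add: norm_power_int)
    then show ?thesis using complex_norm_square[of "\<i> powi z"] by (simp only:) simp
  qed
  have "foldr T (tw k) (avec j \<sigma>) n * cnj (vv q l i n \<tau>) = of_real (Cc q l j \<sigma> * Cc q l i \<tau>) *
     of_real (q powr (-n) * (rr j \<sigma> n * rr i \<tau> n) * q powr (- n * of_int k))" if "n \<in> weights l" for n
  proof -
    have "x * (c * p * r * y) * (c' * p' * r') = (p * p') * ((c * c') * (y * (r * r') * x))" for x c p r y c' p' r' :: complex
      by (simp only: mult_ac)
    then have "foldr T (tw k) (avec j \<sigma>) n * cnj (vv q l i n \<tau>) =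
      (\<i> powi \<lfloor>n - l\<rfloor> * cnj (\<i> powi \<lfloor>n - l\<rfloor>)) * ((of_real (Cc q l j \<sigma>) * of_real (Cc q l i \<tau>)) *
       (of_real (q powr (-n)) * (of_real (rr j \<sigma> n) * of_real (rr i \<tau> n)) * of_real (q powr (- n * of_int k))))"
      unfolding foldr_tw[OF supp_avec] avec_def vv_rr using that by simp
    then show ?thesis unfolding 1 by simp
  qed
  then show ?thesis by (simp add: bfun_def sum_distrib_left)
qed

text \<open>BC is diagonal on weight vectors, and the factors q^(2n) and q^(-2n) in its entry amount
  to shifting the torus word by -2 and by 2.\<close>

lemma bfun_casimir:
  "bfun i j \<tau> \<sigma> (UB # UC # tw k) = (of_real (q powr (-2*l-1) + q powr (2*l+1)) * bfun i j \<tau> \<sigma> (tw k)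
     - qc * bfun i j \<tau> \<sigma> (tw (k - 2)) - bfun i j \<tau> \<sigma> (tw (k + 2)) / qc) / \<kappa>^2"
proof -
  have "foldr T (UB # UC # tw k) (avec j \<sigma>) n = (of_real (q powr (-2*l-1) + q powr (2*l+1)) * foldr T (tw k) (avec j \<sigma>) n
     - qc * foldr T (tw (k - 2)) (avec j \<sigma>) n - foldr T (tw (k + 2)) (avec j \<sigma>) n / qc) / \<kappa>^2" for n
  proof -
    let ?f = "foldr T (tw k) (avec j \<sigma>)"
    have e: "q powr (- n * of_int (k - 2)) = q powr (2 * n) * q powr (- n * of_int k)"
      "q powr (- n * of_int (k + 2)) = q powr (-2 * n) * q powr (- n * of_int k)"
      by (simp_all add: algebra_simps flip: powr_add)
    have m: "foldr T (tw (k - 2)) (avec j \<sigma>) n = of_real (q powr (2 * n)) * ?f n"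
      "foldr T (tw (k + 2)) (avec j \<sigma>) n = of_real (q powr (-2 * n)) * ?f n"
      unfolding foldr_tw[OF supp_avec] e by simp_all
    have "q powr (2 * n + 1) = q * q powr (2 * n)" "q powr (-2 * n - 1) = q powr (-2 * n) / q"
      using q_pos by (simp_all add: powr_add powr_diff)
    then have "T UB (T UC ?f) n = of_real ((q powr (-2*l-1) + q powr (2*l+1) - q * q powr (2*n) - q powr (-2*n) / q) / (1/q - q)\<^sup>2) * ?f n"
      using trep_BC(1)[OF supp_foldr[OF supp_avec], of "tw k" j \<sigma> n] by simp
    then show ?thesis unfolding m by (simp add: left_diff_distrib distrib_right)
  qed
  then show ?thesis
    by (simp only: bfun_def) (simp add: sum_subtractf sum_distrib_left sum_distrib_right left_diff_distrib sum_divide_distrib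
        diff_divide_distrib mult.assoc)
qed

lemma bfun_radial:
  assumes "i \<in> weights l" "j \<in> weights l"
  shows "al qc (SS \<sigma>) (SS \<tau>) (qc powi k) * bfun i j \<tau> \<sigma> (tw (k + 2))
    + be qc (of_real (q powr (-2*l-1) + q powr (2*l+1))) (SS \<sigma>) (SS \<tau>) (SS (\<sigma> + 2*j)) (SS (\<tau> + 2*i)) (qc powi k) * bfun i j \<tau> \<sigma> (tw k)
    + ga qc (SS (\<sigma> + 2*j)) (SS (\<tau> + 2*i)) (qc powi k) * bfun i j \<tau> \<sigma> (tw (k - 2)) = 0"
  by (rule radial_equation[OF urel_bfun bfun_right[OF assms(2)] bfun_left[OF assms(1)] bfun_casimir])

end

subsection \<open>Askey-Wilson polynomials\<close>

text \<open>(az, a/z; p)_k as a polynomial in x = (z + 1/z)/2.\<close>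

definition aw_basis :: "complex \<Rightarrow> complex \<Rightarrow> nat \<Rightarrow> complex poly" where
  "aw_basis a p k = (\<Prod>r<k. [:1 + (a * p ^ r)^2, - 2 * (a * p ^ r):])"

definition aw_coeff :: "nat \<Rightarrow> complex \<Rightarrow> complex \<Rightarrow> complex \<Rightarrow> complex \<Rightarrow> complex \<Rightarrow> nat \<Rightarrow> complex" where
  "aw_coeff n a b c d p k = qpoch (p powi (- int n)) p k * qpoch (a*b*c*d * p powi (int n - 1)) p k /
     (qpoch (a*b) p k * qpoch (a*c) p k * qpoch (a*d) p k * qpoch p p k) * p ^ k"

lemma aw_basis_eval:
  assumes "z \<noteq> 0"
  shows "poly (aw_basis a p k) ((z + inverse z) / 2) = qpoch (a * z) p k * qpoch (a / z) p k"
proof -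
  have gen: "poly [:1 + c^2, - 2 * c:] ((z + inverse z) / 2) = (1 - c * z) * (1 - c / z)" for c
    using assms by (simp add: field_simps power2_eq_square)
  have "poly [:1 + (a * p ^ r)^2, - 2 * (a * p ^ r):] ((z + inverse z) / 2) = (1 - a * z * p ^ r) * (1 - a / z * p ^ r)" for r
  proof -
    have e: "a * p ^ r * z = a * z * p ^ r" "a * p ^ r / z = a / z * p ^ r" by (simp_all add: mult_ac)
    show ?thesis unfolding gen e ..
  qed
  then show ?thesis by (simp add: aw_basis_def poly_prod qpoch_def prod.distrib)
qed

text \<open>A polynomial is thus determined by its values at (z + 1/z)/2, which makes the
  description of the Askey-Wilson polynomial unique.\<close>

lemma joukowski_surj: "\<exists>z::complex. z \<noteq> 0 \<and> (z + inverse z) / 2 = x"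
proof -
  let ?z = "x + csqrt (x^2 - 1)"
  have "?z * (x - csqrt (x^2 - 1)) = x^2 - (csqrt (x^2 - 1))^2"
    by (simp add: algebra_simps power2_eq_square)
  also have "\<dots> = 1" by (simp only: power2_csqrt) simp
  finally have 1: "?z * (x - csqrt (x^2 - 1)) = 1" .
  then have "?z \<noteq> 0" by auto
  moreover have "inverse ?z = x - csqrt (x^2 - 1)" using 1 by (rule inverse_unique)
  ultimately show ?thesis by (intro exI[of _ ?z]) simp
qed

lemma askey_wilson_eval:
  assumes p: "p \<noteq> 0" and z: "z \<noteq> 0"
  shows "poly (askey_wilson n a b c d p) ((z + inverse z) / 2) =
    a powi (- int n) * (qpoch (a*b) p n * qpoch (a*c) p n * qpoch (a*d) p n) *
    (\<Sum>k\<le>n. aw_coeff n a b c d p k * (qpoch (a * z) p k * qpoch (a / z) p k))"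
proof -
  let ?c = "a powi (- int n) * (qpoch (a*b) p n * qpoch (a*c) p n * qpoch (a*d) p n)"
  define P where "P = smult ?c (\<Sum>k\<le>n. smult (aw_coeff n a b c d p k) (aw_basis a p k))"
  have P: "poly P ((z + inverse z) / 2) = ?c * (\<Sum>k\<le>n. aw_coeff n a b c d p k * (qpoch (a * z) p k * qpoch (a / z) p k))"
    if "z \<noteq> 0" for z
    by (simp add: P_def poly_sum aw_basis_eval[OF that])
  have "p powi (- int n) * p ^ n = 1" using p by (simp add: power_int_minus)
  then have zero: "qpoch (p powi (- int n)) p k = 0" if "k \<notin> {..n}" for k
    using that by (intro qpoch_eq_0[of _ _ n]) auto
  have hyp: "qhyp [p powi (- int n), a*b*c*d * p powi (int n - 1), a * z, a / z] [a*b, a*c, a*d] p p =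
    (\<Sum>k\<le>n. aw_coeff n a b c d p k * (qpoch (a * z) p k * qpoch (a / z) p k))" for z
    unfolding qhyp_def
  proof (subst suminf_finite[of "{..n}"])
    show "(\<Prod>x\<leftarrow>[p powi (- int n), u, v, w]. qpoch x p k) / e * p ^ k = 0" if "k \<notin> {..n}" for k u v w e
      using zero[OF that] by (simp only: list.map prod_list.Cons mult_zero_left div_0)
  qed (simp_all add: aw_coeff_def mult_ac)
  have "askey_wilson n a b c d p = P"
    unfolding askey_wilson_def hyp
  proof (rule the_equality)
    show "\<forall>z. z \<noteq> 0 \<longrightarrow> poly P ((z + inverse z) / 2) = ?c * (\<Sum>k\<le>n. aw_coeff n a b c d p k * (qpoch (a * z) p k * qpoch (a / z) p k))"
      using P by blast
    fix P'
    assume P': "\<forall>z. z \<noteq> 0 \<longrightarrow> poly P' ((z + inverse z) / 2) = ?c * (\<Sum>k\<le>n. aw_coeff n a b c d p k * (qpoch (a * z) p k * qpoch (a / z) p k))"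
    have "poly P' x = poly P x" for x
    proof -
      obtain z where "z \<noteq> 0" "(z + inverse z) / 2 = x" using joukowski_surj[of x] by blast
      then show ?thesis using P[of z] P'[rule_format, of z] by simp
    qed
    then have "poly P' = poly P" by (rule ext)
    then show "P' = P" by (simp only: poly_eq_poly_eq_iff)
  qed
  then show ?thesis using P[OF z] by simp
qed

definition awA :: "complex \<Rightarrow> complex \<Rightarrow> complex \<Rightarrow> complex \<Rightarrow> complex \<Rightarrow> complex \<Rightarrow> complex" where
  "awA a b c d p z = (1 - a*z) * (1 - b*z) * (1 - c*z) * (1 - d*z) / ((1 - z^2) * (1 - p * z^2))"

text \<open>The Askey-Wilson operator is bidiagonal in the basis \<open>(az, a/z; p)\<^sub>k\<close>.\<close>

lemma aw_operator_basis:
  fixes z p a b c d :: complex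
  defines "\<phi> \<equiv> \<lambda>k z. qpoch (a * z) p k * qpoch (a / z) p k"
  assumes nz: "z \<noteq> 0" "p \<noteq> 0" and den: "z^2 \<noteq> 1" "p * z^2 \<noteq> 1" "z^2 \<noteq> p"
  shows "awA a b c d p z * (\<phi> (Suc k) (p*z) - \<phi> (Suc k) z) + awA a b c d p (1/z) * (\<phi> (Suc k) (z/p) - \<phi> (Suc k) z) =
    (1 / p ^ Suc k - 1) * (1 - a*b*c*d * p ^ k) * \<phi> (Suc k) z
    - (1 / p ^ Suc k - 1) * ((1 - a*b * p^k) * (1 - a*c * p^k) * (1 - a*d * p^k)) * \<phi> k z"
proof -
  define x where "x = p ^ k"
  have x: "x \<noteq> 0" using nz by (simp add: x_def)
  define C where "C = - (a * (1 - p * x) / p)"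
  \<comment> \<open>One half of the operator; the other arises from it by replacing z with 1/z,
    under which the basis is invariant. The difference of the basis elements carries the factor 1 -
    p y^2, which cancels one denominator.\<close>
  have half: "awA a b c d p y * (\<phi> (Suc k) (p*y) - \<phi> (Suc k) y) =
      \<phi> k y * (C * ((1 - b*y) * (1 - c*y) * (1 - d*y) * (1 - a*x*y) / (y * (1 - y^2))))"
    if y: "y \<noteq> 0" "y^2 \<noteq> 1" "p * y^2 \<noteq> 1" for y
  proof -
    define M where "M = qpoch (a * p * y) p k * qpoch (a / y) p k"
    have 1: "\<phi> (Suc k) (p*y) = M * ((1 - a*p*x*y) * (1 - a/(p*y)))"
    proof -
      have "qpoch (a / (p*y)) p (Suc k) = (1 - a/(p*y)) * qpoch (a / y) p k"
        using nz by (simp add: qpoch_Suc_left)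
      moreover have "qpoch (a * (p*y)) p (Suc k) = qpoch (a * p * y) p k * (1 - a*p*x*y)"
        by (simp add: qpoch_Suc x_def mult_ac)
      ultimately show ?thesis by (simp add: \<phi>_def M_def mult_ac)
    qed
    have 2: "\<phi> (Suc k) y = M * ((1 - a*y) * (1 - a*x/y))"
    proof -
      have "qpoch (a*y) p (Suc k) = (1 - a*y) * qpoch (a * p * y) p k"
        by (simp add: qpoch_Suc_left mult_ac)
      moreover have "qpoch (a/y) p (Suc k) = qpoch (a/y) p k * (1 - a*x/y)"
        by (simp add: qpoch_Suc x_def)
      ultimately show ?thesis by (simp add: \<phi>_def M_def mult_ac)
    qed
    have 3: "(1 - a*y) * M = \<phi> k y * (1 - a*x*y)"
    proof -
      have "(1 - a*y) * qpoch (a * p * y) p k = qpoch (a*y) p k * (1 - a*x*y)"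
        using qpoch_Suc_left[of "a*y" p k] qpoch_Suc[of "a*y" p k] by (simp add: x_def mult_ac)
      then show ?thesis by (simp add: \<phi>_def M_def mult.assoc[symmetric] mult.commute[of _ "qpoch (a / y) p k"])
    qed
    have "(1 - a*p*x*y) * (1 - a/(p*y)) - (1 - a*y) * (1 - a*x/y) = C * (1 - p*y^2) / y"
      using y nz by (simp add: C_def field_simps power2_eq_square)
    then have "\<phi> (Suc k) (p*y) - \<phi> (Suc k) y = M * (C * (1 - p*y^2) / y)"
      unfolding 1 2 by (simp only: right_diff_distrib[symmetric])
    moreover have "(1 - a*y) * B * D * E / (Y * Z) * (M * (C * Z / y)) = ((1 - a*y) * M) * (C * (B * D * E) / (y * Y))"
      if "Z \<noteq> 0" for B D E Y Z
      using that by (simp add: mult_ac)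
    moreover have "1 - p*y^2 \<noteq> 0" using y by simp
    ultimately have "awA a b c d p y * (\<phi> (Suc k) (p*y) - \<phi> (Suc k) y) =
       ((1 - a*y) * M) * (C * ((1 - b*y) * (1 - c*y) * (1 - d*y)) / (y * (1 - y^2)))"
      unfolding awA_def by (simp only:) (simp add: mult_ac)
    then show ?thesis unfolding 3 by simp
  qed
  have sym: "\<phi> k (1/z) = \<phi> k z" for k z by (simp add: \<phi>_def mult.commute)
  have "awA a b c d p (1/z) * (\<phi> (Suc k) (p*(1/z)) - \<phi> (Suc k) (1/z)) =
      \<phi> k (1/z) * (C * ((1 - b*(1/z)) * (1 - c*(1/z)) * (1 - d*(1/z)) * (1 - a*x*(1/z)) / ((1/z) * (1 - (1/z)^2))))"
    by (rule half) (use nz den in \<open>auto simp: power_divide divide_eq_eq\<close>)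
  moreover have "\<phi> (Suc k) (p*(1/z)) = \<phi> (Suc k) (z/p)"
    using sym[of "Suc k" "z/p"] by simp
  ultimately have h2: "awA a b c d p (1/z) * (\<phi> (Suc k) (z/p) - \<phi> (Suc k) z) =
      \<phi> k z * (C * ((1 - b/z) * (1 - c/z) * (1 - d/z) * (1 - a*x/z) / ((1/z) * (1 - 1/z^2))))"
    unfolding sym by (simp add: power_divide)
  \<comment> \<open>Over the common denominator z (1 - z^2) the numerators combine to a multiple of
    1 - z^2, and what is left is linear in z + 1/z.\<close>
  have poly4: "(1 - b*z) * (1 - c*z) * (1 - d*z) * (1 - e*z) / (z * (1 - z^2)) +
      (1 - b/z) * (1 - c/z) * (1 - d/z) * (1 - e/z) / ((1/z) * (1 - 1/z^2)) =
      (1 - b*c*d*e) * (z + 1/z) - (b + c + d + e - (b*c*d + b*c*e + b*d*e + c*d*e))" for e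
  proof -
    have z1: "1 - z^2 \<noteq> 0" using den by simp
    have "(1/z) * (1 - 1/z^2) = - (1 - z^2) / z^3"
      using nz by (simp add: field_simps power2_eq_square power3_eq_cube)
    moreover have "(1 - b/z) * (1 - c/z) * (1 - d/z) * (1 - e/z) = (z - b) * (z - c) * (z - d) * (z - e) / z^4"
      using nz by (simp add: field_simps power4_eq_xxxx)
    ultimately have "(1 - b/z) * (1 - c/z) * (1 - d/z) * (1 - e/z) / ((1/z) * (1 - 1/z^2)) =
       - ((z - b) * (z - c) * (z - d) * (z - e)) / (z * (1 - z^2))"
      using nz z1 by (simp add: field_simps power3_eq_cube power4_eq_xxxx)
    then have "(1 - b*z) * (1 - c*z) * (1 - d*z) * (1 - e*z) / (z * (1 - z^2)) +
      (1 - b/z) * (1 - c/z) * (1 - d/z) * (1 - e/z) / ((1/z) * (1 - 1/z^2)) =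
      ((1 - b*z) * (1 - c*z) * (1 - d*z) * (1 - e*z) - (z - b) * (z - c) * (z - d) * (z - e)) / (z * (1 - z^2))"
      by (simp add: diff_divide_distrib)
    also have "(1 - b*z) * (1 - c*z) * (1 - d*z) * (1 - e*z) - (z - b) * (z - c) * (z - d) * (z - e) =
       ((1 - b*c*d*e) * (z^2 + 1) - (b + c + d + e - (b*c*d + b*c*e + b*d*e + c*d*e)) * z) * (1 - z^2)"
      by (simp add: algebra_simps power2_eq_square)
    also have "\<dots> / (z * (1 - z^2)) = ((1 - b*c*d*e) * (z^2 + 1) - (b + c + d + e - (b*c*d + b*c*e + b*d*e + c*d*e)) * z) / z"
      using z1 by simp
    also have "\<dots> = (1 - b*c*d*e) * (z + 1/z) - (b + c + d + e - (b*c*d + b*c*e + b*d*e + c*d*e))"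
      using nz by (simp add: field_simps power2_eq_square)
    finally show ?thesis .
  qed
  have "awA a b c d p z * (\<phi> (Suc k) (p*z) - \<phi> (Suc k) z) + awA a b c d p (1/z) * (\<phi> (Suc k) (z/p) - \<phi> (Suc k) z) =
    \<phi> k z * (C * ((1 - b*c*d*(a*x)) * (z + 1/z) - (b + c + d + a*x - (b*c*d + b*c*(a*x) + b*d*(a*x) + c*d*(a*x)))))"
    unfolding half[OF nz(1) den(1,2)] h2 poly4[symmetric] by (simp only: distrib_left)
  also have "C * ((1 - b*c*d*(a*x)) * (z + 1/z) - (b + c + d + a*x - (b*c*d + b*c*(a*x) + b*d*(a*x) + c*d*(a*x)))) =
     (1 / (p * x) - 1) * (1 - a*b*c*d * x) * ((1 - a*x*z) * (1 - a*x/z)) - (1 / (p * x) - 1) * ((1 - a*b * x) * (1 - a*c * x) * (1 - a*d * x))"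
  proof -
    have "(1 - a*x*z) * (1 - a*x/z) = 1 + (a*x)^2 - a*x*(z + 1/z)"
      using nz by (simp add: field_simps power2_eq_square)
    moreover have "C * (E * u - e) = (1 / (p * x) - 1) * E * (1 + (a*x)^2 - a*x*u) - (1 / (p * x) - 1) * (E * (1 + (a*x)^2) - a*x*e)" for E u e
      using nz x by (simp add: C_def field_simps power2_eq_square)
    moreover have "(1 - b*c*d*(a*x)) * (1 + (a*x)^2) - a*x*(b + c + d + a*x - (b*c*d + b*c*(a*x) + b*d*(a*x) + c*d*(a*x))) =
      (1 - a*b * x) * (1 - a*c * x) * (1 - a*d * x)"
      by (simp add: algebra_simps power2_eq_square)
    moreover have "1 - b*c*d*(a*x) = 1 - a*b*c*d * x" by (simp add: mult_ac)
    ultimately show ?thesis by metis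
  qed
  also have "\<phi> k z * ((1 / (p * x) - 1) * (1 - a*b*c*d * x) * ((1 - a*x*z) * (1 - a*x/z)) - (1 / (p * x) - 1) * ((1 - a*b * x) * (1 - a*c * x) * (1 - a*d * x))) =
    (1 / (p * x) - 1) * (1 - a*b*c*d * x) * (\<phi> k z * ((1 - a*x*z) * (1 - a*x/z))) - (1 / (p * x) - 1) * ((1 - a*b * x) * (1 - a*c * x) * (1 - a*d * x)) * \<phi> k z"
  proof -
    have "F * (A * B * C - A * D) = A * B * (F * C) - A * D * F" for A B C D F :: complex
      by (simp add: algebra_simps)
    then show ?thesis .
  qed
  also have "\<phi> k z * ((1 - a*x*z) * (1 - a*x/z)) = \<phi> (Suc k) z"
    by (simp add: \<phi>_def qpoch_Suc x_def mult_ac)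
  finally show ?thesis by (simp add: x_def)
qed

definition aw_sum :: "nat \<Rightarrow> complex \<Rightarrow> complex \<Rightarrow> complex \<Rightarrow> complex \<Rightarrow> complex \<Rightarrow> complex \<Rightarrow> complex" where
  "aw_sum n a b c d p z = (\<Sum>k\<le>n. aw_coeff n a b c d p k * (qpoch (a * z) p k * qpoch (a / z) p k))"

text \<open>In the bidiagonal basis the eigenvalue equation becomes a two-term recurrence for the
  coefficients, with right-hand side f k (e k - e n). The hypergeometric coefficients satisfy it,
  and it breaks off at k = n.\<close>

lemma aw_difference_equation:
  fixes z p a b c d :: complex
  assumes nz: "z \<noteq> 0" "p \<noteq> 0" and den: "z^2 \<noteq> 1" "p * z^2 \<noteq> 1" "z^2 \<noteq> p"
    and low: "\<And>k. k \<le> n \<Longrightarrow> qpoch (a*b) p k \<noteq> 0" "\<And>k. k \<le> n \<Longrightarrow> qpoch (a*c) p k \<noteq> 0"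
      "\<And>k. k \<le> n \<Longrightarrow> qpoch (a*d) p k \<noteq> 0" "\<And>k. k \<le> n \<Longrightarrow> qpoch p p k \<noteq> 0"
  shows "awA a b c d p z * (aw_sum n a b c d p (p*z) - aw_sum n a b c d p z) +
      awA a b c d p (1/z) * (aw_sum n a b c d p (z/p) - aw_sum n a b c d p z) =
    (1 / p ^ n - 1) * (1 - a*b*c*d * p ^ n / p) * aw_sum n a b c d p z"
proof -
  define \<phi> where "\<phi> k z = qpoch (a * z) p k * qpoch (a / z) p k" for k z
  define f where "f = aw_coeff n a b c d p"
  define e where "e k = (1 / p ^ k - 1) * (1 - a*b*c*d * p ^ k / p)" for k
  define g where "g k = (if k = 0 then 0 else f k * ((1 / p ^ k - 1) * ((1 - a*b * p^(k-1)) * (1 - a*c * p^(k-1)) * (1 - a*d * p^(k-1)))) * \<phi> (k - 1) z)" for k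
  have sum: "aw_sum n a b c d p y = (\<Sum>k\<le>n. f k * \<phi> k y)" for y
    by (simp add: aw_sum_def f_def \<phi>_def)
  have step: "awA a b c d p z * (f k * \<phi> k (p*z) - f k * \<phi> k z) + awA a b c d p (1/z) * (f k * \<phi> k (z/p) - f k * \<phi> k z) =
     f k * e k * \<phi> k z - g k" for k
  proof (cases k)
    case 0
    then show ?thesis by (simp add: e_def g_def \<phi>_def)
  next
    case (Suc j)
    have "awA a b c d p z * (f k * \<phi> k (p*z) - f k * \<phi> k z) + awA a b c d p (1/z) * (f k * \<phi> k (z/p) - f k * \<phi> k z) =
      f k * (awA a b c d p z * (\<phi> k (p*z) - \<phi> k z) + awA a b c d p (1/z) * (\<phi> k (z/p) - \<phi> k z))"
      by (simp add: algebra_simps)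
    also have "awA a b c d p z * (\<phi> k (p*z) - \<phi> k z) + awA a b c d p (1/z) * (\<phi> k (z/p) - \<phi> k z) =
      (1 / p ^ Suc j - 1) * (1 - a*b*c*d * p ^ j) * \<phi> (Suc j) z
    - (1 / p ^ Suc j - 1) * ((1 - a*b * p^j) * (1 - a*c * p^j) * (1 - a*d * p^j)) * \<phi> j z"
      unfolding Suc \<phi>_def by (rule aw_operator_basis[OF nz den])
    also have "f k * \<dots> = f k * e k * \<phi> k z - g k"
    proof -
      have "a*b*c*d * p ^ k / p = a*b*c*d * p ^ j" using nz Suc by simp
      then show ?thesis by (simp add: e_def g_def Suc algebra_simps)
    qed
    finally show ?thesis .
  qed
  have "awA a b c d p z * (aw_sum n a b c d p (p*z) - aw_sum n a b c d p z) +
      awA a b c d p (1/z) * (aw_sum n a b c d p (z/p) - aw_sum n a b c d p z) = (\<Sum>k\<le>n. f k * e k * \<phi> k z - g k)"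
    unfolding sum sum_subtractf[symmetric] sum_distrib_left sum.distrib[symmetric]
    by (intro sum.cong refl step)
  also have "\<dots> = (\<Sum>k\<le>n. f k * e k * \<phi> k z) - (\<Sum>k\<le>n. g k)"
    by (rule sum_subtractf)
  also have "(\<Sum>k\<le>n. g k) = (\<Sum>k<n. g (Suc k))"
  proof -
    have "(\<Sum>k\<le>n. g k) = (\<Sum>k<Suc n. g k)" by (simp add: lessThan_Suc_atMost)
    also have "\<dots> = g 0 + (\<Sum>k<n. g (Suc k))" by (rule sum.lessThan_Suc_shift)
    finally show ?thesis by (simp add: g_def)
  qed
  \<comment> \<open>The term k = n may be included since its factor e n - e n is zero.\<close>
  also have "\<dots> = (\<Sum>k\<le>n. f k * (e k - e n) * \<phi> k z)"
  proof -
    have "g (Suc k) = f k * (e k - e n) * \<phi> k z" if k: "k < n" for k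
    proof -
      define x y where "x = p ^ k" and "y = p ^ n"
      have xy: "x \<noteq> 0" "y \<noteq> 0" using nz by (simp_all add: x_def y_def)
      have pn: "p powi (- int n) = 1 / y" "p powi (int n - 1) = y / p"
        using nz by (simp_all add: y_def power_int_minus power_int_diff divide_inverse)
      have l: "1 - a*b*x \<noteq> 0" "1 - a*c*x \<noteq> 0" "1 - a*d*x \<noteq> 0" "1 - p*x \<noteq> 0"
        using low(1)[of "Suc k"] low(2)[of "Suc k"] low(3)[of "Suc k"] low(4)[of "Suc k"] k
        by (auto simp: qpoch_Suc x_def)
      have "f (Suc k) = f k * ((1 - x / y) * (1 - a*b*c*d * y * x / p) * p / ((1 - a*b*x) * (1 - a*c*x) * (1 - a*d*x) * (1 - p*x)))"
        unfolding f_def aw_coeff_def pn qpoch_Suc by (simp add: x_def[symmetric] mult_ac)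
      moreover have "u * (A * B * p / (C * D * E * F)) * (F / (p * x) * (C * D * E)) = u * (A * B / x)"
        if "C \<noteq> 0" "D \<noteq> 0" "E \<noteq> 0" "F \<noteq> 0" for u A B C D E F :: complex
        using that nz xy by (simp add: field_simps)
      moreover have "1 / p ^ Suc k - 1 = (1 - p*x) / (p * x)"
        using nz by (simp add: x_def field_simps)
      ultimately have "f (Suc k) * ((1 / p ^ Suc k - 1) * ((1 - a*b*x) * (1 - a*c*x) * (1 - a*d*x))) =
         f k * ((1 - x / y) * (1 - a*b*c*d * y * x / p) / x)"
        using l by (simp only:) 
      moreover have "(1 - x / y) * (1 - a*b*c*d * y * x / p) / x = e k - e n"
        unfolding e_def x_def[symmetric] y_def[symmetric] using xy nz by (simp add: field_simps)
      ultimately have "f (Suc k) * ((1 / p ^ Suc k - 1) * ((1 - a*b*x) * (1 - a*c*x) * (1 - a*d*x))) = f k * (e k - e n)"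
        by (simp only:)
      then show ?thesis unfolding g_def x_def[symmetric] by (simp add: x_def[symmetric])
    qed
    then have "(\<Sum>k<n. g (Suc k)) = (\<Sum>k<n. f k * (e k - e n) * \<phi> k z)" by simp
    also have "\<dots> = (\<Sum>k\<le>n. f k * (e k - e n) * \<phi> k z)"
      by (simp add: lessThan_Suc_atMost[symmetric])
    finally show ?thesis .
  qed
  also have "(\<Sum>k\<le>n. f k * e k * \<phi> k z) - (\<Sum>k\<le>n. f k * (e k - e n) * \<phi> k z) = e n * (\<Sum>k\<le>n. f k * \<phi> k z)"
    by (simp add: sum_subtractf[symmetric] sum_distrib_left algebra_simps)
  finally show ?thesis by (simp add: sum e_def)
qed

subsection \<open>The radial equation and the Askey-Wilson equation\<close>

text \<open>At w = 1 and w = -1 the left-hand side equals the product of the four linear factors, so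
  the difference is divisible by 1 - w^2; the last bracket is the quotient.\<close>

lemma radial_factor:
  fixes s t T U w :: complex
  assumes "s \<noteq> 0" "t \<noteq> 0" "T \<noteq> 0" "U \<noteq> 0" "w \<noteq> 0"
  shows "(1/s - s - w * (1/t - t)) * (1/T - T - w * (1/U - U)) =
    s / (U * w) * ((1 - t/s * w) * (1 + w / (t*s)) * (1 - U/T * w) * (1 + T*U * w)) +
    (1 - w^2) * (U/s * w - s / (U * w) + ((1/s - s) * (1/T - T) + s/U * (t/s - 1/(t*s) + U/T - T*U)))"
  using assms by (simp add: field_simps power2_eq_square)

text \<open>\<open>radial_factor\<close> is applied at w = q z and at w = q/z. The two remainders
  contain the same constant K, which cancels, and the rest combines with Q into the Askey-Wilson
  eigenvalue for y = p^n, p = q^2.\<close>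

lemma be_eq:
  fixes s t T U q z y :: complex
  assumes nz: "s \<noteq> 0" "t \<noteq> 0" "T \<noteq> 0" "U \<noteq> 0" "q \<noteq> 0" "z \<noteq> 0" "y \<noteq> 0"
  defines "M \<equiv> U / s" and "a \<equiv> q * t / s" and "c \<equiv> - q / (t * s)" and "b \<equiv> q * U / T" and "d \<equiv> - q * T * U"
  shows "be q (1 / (q*M*y) + q*M*y) (1/t - t) (1/s - s) (1/T - T) (1/U - U) z =
    1 / (q*M) * ((1 - a*z) * (1 - b*z) * (1 - c*z) * (1 - d*z) * (1 - (z/q)^2)
      + z^4 / q^2 * ((1 - a/z) * (1 - b/z) * (1 - c/z) * (1 - d/z)) * (1 - (q*z)^2)
      + (1/y - 1) * (1 - a*b*c*d * y / q^2) * ((1 - z^2) * (1 - (q*z)^2) * (1 - (z/q)^2)))"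
proof -
  define K where "K = (1/s - s) * (1/T - T) + s/U * (t/s - 1/(t*s) + U/T - T*U)"
  define w v where "w = q * z" and "v = z / q"
  have wv: "w \<noteq> 0" "v \<noteq> 0" using nz by (simp_all add: w_def v_def)
  have M: "M \<noteq> 0" using nz by (simp add: M_def)
  have zv: "z = q * v" using nz by (simp add: v_def)
  let ?P = "(1 - a*z) * (1 - b*z) * (1 - c*z) * (1 - d*z)" and ?R = "(1 - a/z) * (1 - b/z) * (1 - c/z) * (1 - d/z)"
  have 1: "(1/s - s - w * (1/t - t)) * (1/T - T - w * (1/U - U)) =
      1 / (M * w) * ?P + (1 - w^2) * (M * w - 1 / (M * w) + K)"
  proof -
    have "t/s * w = a * z" "1 + w / (t*s) = 1 - c * z" "U/T * w = b * z" "1 + T*U*w = 1 - d * z"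
      by (simp_all add: a_def b_def c_def d_def w_def mult_ac)
    moreover have "s / (U * w) = 1 / (M * w)" using nz by (simp add: M_def)
    ultimately show ?thesis
      unfolding radial_factor[OF nz(1-4) wv(1)] by (simp add: M_def K_def mult_ac)
  qed
  have 2: "(v * (1/T - T) - (1/U - U)) * (1/t - t - v * (1/s - s)) =
     - (v^2 * (v / M * ?R)) - (v^2 - 1) * (M / v - v / M + K)"
  proof -
    have iv: "1 / v \<noteq> 0" using wv by simp
    have "t/s * (1/v) = a / z" "1 + (1/v) / (t*s) = 1 - c / z" "U/T * (1/v) = b / z" "1 + T*U*(1/v) = 1 - d / z"
      using nz by (simp_all add: a_def b_def c_def d_def zv mult_ac)
    moreover have "s / (U * (1/v)) = v / M" using nz by (simp add: M_def)
    ultimately have "(1/s - s - (1/v) * (1/t - t)) * (1/T - T - (1/v) * (1/U - U)) =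
      v / M * ?R + (1 - (1/v)^2) * (M / v - v / M + K)"
      unfolding radial_factor[OF nz(1-4) iv] by (simp add: M_def K_def mult_ac)
    moreover have "(v * e - e') * (S - v * S') = - (v^2 * ((S' - (1/v) * S) * (e - (1/v) * e')))" for e e' S S'
      using wv by (simp add: field_simps power2_eq_square)
    moreover have "v^2 * (X + (1 - (1/v)^2) * Y) = v^2 * X + (v^2 - 1) * Y" for X Y
      using wv by (simp add: field_simps power2_eq_square)
    ultimately show ?thesis by simp
  qed
  have "be q (1 / (q*M*y) + q*M*y) (1/t - t) (1/s - s) (1/T - T) (1/U - U) z =
     (1 / (q*M*y) + q*M*y) * (1 - z^2) * (1 - w^2) * (1 - v^2)
     + z * ((1/s - s - w * (1/t - t)) * (1/T - T - w * (1/U - U))) * (1 - v^2)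
     - z * ((v * (1/T - T) - (1/U - U)) * (1/t - t - v * (1/s - s))) * (1 - w^2)"
    by (simp add: be_def w_def v_def mult.assoc)
  also have "\<dots> = (1 / (q*M*y) + q*M*y) * (1 - z^2) * (1 - w^2) * (1 - v^2)
     + z * (1 / (M * w) * ?P + (1 - w^2) * (M * w - 1 / (M * w) + K)) * (1 - v^2)
     - z * (- (v^2 * (v / M * ?R)) - (v^2 - 1) * (M / v - v / M + K)) * (1 - w^2)"
    unfolding 1 2 ..
  also have "\<dots> = (z / (M * w)) * ?P * (1 - v^2) + (z * v^3 / M) * ?R * (1 - w^2)
     + (z * (M * w) - z / (M * w) - z * M / v + z * v / M + (1 - z^2) * (1 / (q*M*y) + q*M*y)) * ((1 - w^2) * (1 - v^2))"
  proof -
    have gen: "Q * D * W * V + z * (i1 * P + W * (g + K)) * V - z * (- (x * (i2 * R)) - (- V) * (g' + K)) * W =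
      (z * i1) * P * V + (z * (x * i2)) * R * W + (z * g - z * g' + D * Q) * (W * V)" for Q D W V P R g g' x i1 i2 :: complex
      by (simp add: algebra_simps)
    have e: "v^2 - 1 = - (1 - v^2)" by simp
    have "z * (1 / (M * w)) = z / (M * w)" "z * (v^2 * (v / M)) = z * v^3 / M"
      "z * (M * w - 1 / (M * w)) - z * (M / v - v / M) + (1 - z^2) * (1 / (q*M*y) + q*M*y) =
        z * (M * w) - z / (M * w) - z * M / v + z * v / M + (1 - z^2) * (1 / (q*M*y) + q*M*y)"
      by (simp_all add: power2_eq_square power3_eq_cube right_diff_distrib)
    then show ?thesis unfolding e gen by (simp only:)
  qed
  also have "z / (M * w) = 1 / (q*M)" using nz by (simp add: w_def)
  also have "z * v^3 / M = 1 / (q*M) * (z^4 / q^2)"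
    using nz by (simp add: v_def power_divide power3_eq_cube power4_eq_xxxx power2_eq_square mult_ac)
  also have "z * (M * w) - 1 / (q*M) - z * M / v + z * v / M + (1 - z^2) * (1 / (q*M*y) + q*M*y) =
     1 / (q*M) * ((1/y - 1) * (1 - a*b*c*d * y / q^2) * (1 - z^2))"
  proof -
    have "a*b*c*d / q^2 = q^2 * M^2"
      using nz by (simp add: a_def b_def c_def d_def M_def field_simps power2_eq_square)
    then have g: "a*b*c*d * y / q^2 = q^2 * M^2 * y" by (metis times_divide_eq_left)
    have e1: "z * (M * w) - 1 / (q*M) - z * M / v + z * v / M = - (1 - z^2) * (M * q + 1 / (M * q))"
      using nz M by (simp add: w_def v_def field_simps power2_eq_square)
    have e2: "- (M * q + 1 / (M * q)) + (1 / (q*M*y) + q*M*y) = 1 / (q*M) * ((1/y - 1) * (1 - q^2 * M^2 * y))"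
      using nz M by (simp add: field_simps power2_eq_square)
    have e3: "- D * Y + D * Z = (- Y + Z) * D" for D Y Z :: complex by (simp add: algebra_simps)
    show ?thesis unfolding g e1 e3 e2 by (simp only: mult.assoc)
  qed
  finally show ?thesis by (simp add: w_def v_def distrib_left mult_ac)
qed

text \<open>The quartic in w = q z has the roots t/s, s/t, -ts and -1/(ts).\<close>

lemma al_eq:
  fixes s t q z :: complex
  assumes nz: "s \<noteq> 0" "t \<noteq> 0" "q \<noteq> 0" "z \<noteq> 0"
  defines "a \<equiv> q * t / s" and "c \<equiv> - q / (t * s)"
  shows "al q (1/t - t) (1/s - s) z = - (1 / q) * ((1 - q^2*z/a) * (1 - a*z) * (1 - q^2*z/c) * (1 - c*z)) * (1 - (z/q)^2)"
proof -
  define w where "w = q * z"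
  have "q^2*z/a = w * s / t" "a*z = w * t / s" "q^2*z/c = - (w * t * s)" "c * z = - w / (t * s)"
    using nz by (simp_all add: a_def c_def w_def field_simps power2_eq_square)
  moreover have "(1 - w^2)^2 + (1/t - t) * (1/s - s) * (w^3 + w) - ((1/t - t)^2 + (1/s - s)^2) * w^2 =
     (1 - w * s / t) * (1 - w * t / s) * (1 - - (w * t * s)) * (1 - - w / (t * s))"
    using nz by (simp add: field_simps power2_eq_square power3_eq_cube)
  ultimately show ?thesis by (simp add: al_def w_def)
qed

lemma ga_eq:
  fixes T U q z :: complex
  assumes nz: "T \<noteq> 0" "U \<noteq> 0" "q \<noteq> 0" "z \<noteq> 0"
  defines "b \<equiv> q * U / T" and "d \<equiv> - q * T * U"
  shows "ga q (1/T - T) (1/U - U) z =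
    - (z^4 / q^3) * ((1 - b/z) * (1 - q^2/(b*z)) * (1 - d/z) * (1 - q^2/(d*z))) * (1 - (q*z)^2)"
proof -
  define v where "v = z / q"
  have v: "v \<noteq> 0" "z = q * v" using nz by (simp_all add: v_def)
  have "b / z = U / (T * v)" "q^2/(b*z) = T / (U * v)" "d / z = - (T * U) / v" "q^2/(d*z) = - 1 / (T * U * v)"
    using nz v(1) by (simp_all add: b_def d_def v(2) field_simps power2_eq_square)
  moreover have "(1 - v^2)^2 + (1/T - T) * (1/U - U) * (v^3 + v) - ((1/T - T)^2 + (1/U - U)^2) * v^2 =
     v^4 * ((1 - U / (T * v)) * (1 - T / (U * v)) * (1 - - (T * U) / v) * (1 - - 1 / (T * U * v)))"
    using nz v(1) by (simp add: field_simps power2_eq_square power3_eq_cube power4_eq_xxxx)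
  moreover have "z^4 / q^3 = q * v^4" using nz by (simp add: v(2) field_simps power3_eq_cube power4_eq_xxxx)
  ultimately show ?thesis by (simp add: ga_def v_def mult.assoc)
qed

text \<open>A gauge transformation: conjugation by the two factorials G1, G2 replaces 1 - p z/a by 1
  - b z and 1 - p z/c by 1 - d z. Then the radial equation is the Askey-Wilson equation times a
  common factor. In the application s, t, T, U are q to the powers \<tau>, \<sigma>, \<sigma> + 2j,
  \<tau> + 2m.\<close>

lemma aw_radial:
  fixes s t T U q z :: complex
  assumes nz: "s \<noteq> 0" "t \<noteq> 0" "T \<noteq> 0" "U \<noteq> 0" "q \<noteq> 0" "z \<noteq> 0"
  defines "p \<equiv> q^2" and "M \<equiv> U / s" and "a \<equiv> q * t / s" and "c \<equiv> - q / (t * s)" and "b \<equiv> q * U / T" and "d \<equiv> - q * T * U"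
  assumes n1: "U * t / (s * T) = p ^ n1" and n2: "T * U / (t * s) = p ^ n2"
    and den: "z^2 \<noteq> 1" "p * z^2 \<noteq> 1" "z^2 \<noteq> p"
    and low: "\<And>k. k \<le> n \<Longrightarrow> qpoch (a*b) p k \<noteq> 0" "\<And>k. k \<le> n \<Longrightarrow> qpoch (a*c) p k \<noteq> 0"
      "\<And>k. k \<le> n \<Longrightarrow> qpoch (a*d) p k \<noteq> 0" "\<And>k. k \<le> n \<Longrightarrow> qpoch p p k \<noteq> 0"
  defines "F \<equiv> \<lambda>z. qpoch (p * z / a) p n1 * qpoch (p * z / c) p n2 * aw_sum n a b c d p z"
  shows "al q (1/t - t) (1/s - s) z * (F (p * z) / M)
    + be q (1 / (q*M*p^n) + q*M*p^n) (1/t - t) (1/s - s) (1/T - T) (1/U - U) z * F z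
    + ga q (1/T - T) (1/U - U) z * (M * F (z / p)) = 0"
proof -
  define G1 G2 where "G1 z = qpoch (p * z / a) p n1" and "G2 z = qpoch (p * z / c) p n2" for z
  define f where "f = aw_sum n a b c d p"
  have F: "F z = G1 z * G2 z * f z" for z by (simp add: F_def G1_def G2_def f_def)
  have nz': "p \<noteq> 0" "M \<noteq> 0" "a \<noteq> 0" "c \<noteq> 0" "b \<noteq> 0" "d \<noteq> 0"
    using nz by (simp_all add: p_def M_def a_def b_def c_def d_def)
  have ab: "p * p ^ n1 = a * b" "p * p ^ n2 = c * d"
  proof -
    have "a * b = p * (U * t / (s * T))" "c * d = p * (T * U / (t * s))"
      using nz by (simp_all add: p_def a_def b_def c_def d_def power2_eq_square)
    then show "p * p ^ n1 = a * b" "p * p ^ n2 = c * d" by (simp_all only: n1 n2)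
  qed
  have step: "(1 - x) * qpoch (x * p) p k = qpoch x p k * (1 - x * p ^ k)" for x k
    using qpoch_Suc_left[of x p k] qpoch_Suc[of x p k] by simp
  \<comment> \<open>Shifting the argument of the factorial drops its first factor and adds the one
    with p z/a p^n1 = b z, since ab = p^(n1+1).\<close>
  have up1: "(1 - p*z/a) * G1 (p*z) = G1 z * (1 - b*z)"
  proof -
    have "p*z/a * p ^ n1 = (p * p ^ n1) * z / a" by simp
    also have "\<dots> = b * z" unfolding ab using nz' by simp
    finally show ?thesis using step[of "p*z/a" n1] by (simp add: G1_def mult_ac)
  qed
  have up2: "(1 - p*z/c) * G2 (p*z) = G2 z * (1 - d*z)"
  proof -
    have "p*z/c * p ^ n2 = (p * p ^ n2) * z / c" by simp
    also have "\<dots> = d * z" unfolding ab using nz' by simp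
    finally show ?thesis using step[of "p*z/c" n2] by (simp add: G2_def mult_ac)
  qed
  \<comment> \<open>The inverse shift, written in 1/z to match the last coefficient of the radial
    equation.\<close>
  have dn1: "(1 - p/(b*z)) * G1 (z/p) = p/(a*b) * (1 - a/z) * G1 z"
  proof -
    have e: "z/a * p ^ n1 = b * z / p"
    proof -
      have "z/a * p ^ n1 = (p * p ^ n1) * z / (a * p)" using nz' by simp
      then show ?thesis unfolding ab using nz' by simp
    qed
    have "(1 - z/a) * G1 z = G1 (z/p) * (1 - b*z/p)"
      using step[of "z/a" n1] e nz' by (simp add: G1_def mult_ac)
    moreover have "1 - p/(b*z) = - (p/(b*z)) * (1 - b*z/p)" "p/(a*b) * (1 - a/z) = - (p/(b*z)) * (1 - z/a)"
      using nz' nz by (simp_all add: field_simps)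
    ultimately show ?thesis by (simp only: mult.assoc) (simp add: mult_ac)
  qed
  have dn2: "(1 - p/(d*z)) * G2 (z/p) = p/(c*d) * (1 - c/z) * G2 z"
  proof -
    have e: "z/c * p ^ n2 = d * z / p"
    proof -
      have "z/c * p ^ n2 = (p * p ^ n2) * z / (c * p)" using nz' by simp
      then show ?thesis unfolding ab using nz' by simp
    qed
    have "(1 - z/c) * G2 z = G2 (z/p) * (1 - d*z/p)"
      using step[of "z/c" n2] e nz' by (simp add: G2_def mult_ac)
    moreover have "1 - p/(d*z) = - (p/(d*z)) * (1 - d*z/p)" "p/(c*d) * (1 - c/z) = - (p/(d*z)) * (1 - z/c)"
      using nz' nz by (simp_all add: field_simps)
    ultimately show ?thesis by (simp only: mult.assoc) (simp add: mult_ac)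
  qed
  let ?P = "(1 - a*z) * (1 - b*z) * (1 - c*z) * (1 - d*z)" and ?R = "(1 - a/z) * (1 - b/z) * (1 - c/z) * (1 - d/z)"
  have wz: "(q*z)^2 = p * z^2" "(z/q)^2 = z^2 / p" by (simp_all add: p_def power_mult_distrib power_divide)
  define \<Lambda> where "\<Lambda> = (1 - z^2) * (1 - (q*z)^2) * (1 - (z/q)^2)"
  define A A' where "A = awA a b c d p z" and "A' = awA a b c d p (1/z)"
  have P: "?P * (1 - (z/q)^2) = A * \<Lambda>"
    unfolding A_def awA_def \<Lambda>_def wz using den nz' by (simp add: nonzero_eq_divide_eq)
  have R: "z^4 / q^2 * ?R * (1 - (q*z)^2) = A' * \<Lambda>"
  proof -
    have "(1 - (1/z)^2) * (1 - p * (1/z)^2) = (p / z^4) * ((1 - z^2) * (1 - (z/q)^2))"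
      unfolding wz using nz nz' by (simp add: field_simps power2_eq_square power4_eq_xxxx)
    then have "A' = ?R / ((p / z^4) * ((1 - z^2) * (1 - (z/q)^2)))"
      unfolding A'_def awA_def by simp
    moreover have "(1 - z^2) * (1 - (z/q)^2) \<noteq> 0" unfolding wz using den nz' by (auto simp: eq_divide_eq)
    ultimately have e: "A' * ((1 - z^2) * (1 - (z/q)^2)) = z^4 / p * ?R"
      using nz nz' by simp
    have "A' * \<Lambda> = A' * ((1 - z^2) * (1 - (z/q)^2)) * (1 - (q*z)^2)"
      by (simp only: \<Lambda>_def mult_ac)
    then show ?thesis unfolding e by (simp add: p_def)
  qed
  \<comment> \<open>The common factor by which the radial equation exceeds the Askey-Wilson
    equation.\<close>
  define \<kappa> where "\<kappa> = 1 / (q*M) * \<Lambda> * (G1 z * G2 z)"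
  have "al q (1/t - t) (1/s - s) z * (F (p * z) / M) =
     - (1 / (q*M)) * ((1 - a*z) * (1 - c*z) * ((1 - p*z/a) * G1 (p*z)) * ((1 - p*z/c) * G2 (p*z)) * (1 - (z/q)^2)) * f (p*z)"
    unfolding al_eq[OF nz(1,2,5,6)] F a_def[symmetric] c_def[symmetric] p_def[symmetric] by (simp add: mult_ac)
  also have "\<dots> = - (1 / (q*M)) * (?P * (1 - (z/q)^2)) * (G1 z * G2 z) * f (p*z)"
    unfolding up1 up2 by (simp only: mult_ac)
  finally have 1: "al q (1/t - t) (1/s - s) z * (F (p * z) / M) = - \<kappa> * (A * f (p*z))"
    unfolding P \<kappa>_def by (simp add: mult_ac)
  have "ga q (1/T - T) (1/U - U) z * (M * F (z / p)) =
     - (z^4 / q^3 * M) * ((1 - b/z) * (1 - d/z) * ((1 - p/(b*z)) * G1 (z/p)) * ((1 - p/(d*z)) * G2 (z/p)) * (1 - (q*z)^2)) * f (z/p)"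
    unfolding ga_eq[OF nz(3,4,5,6)] F b_def[symmetric] d_def[symmetric] p_def[symmetric] by (simp add: mult_ac)
  also have "\<dots> = - (z^4 / q^3 * M * (p/(a*b) * (p/(c*d)))) * (?R * (1 - (q*z)^2)) * (G1 z * G2 z) * f (z/p)"
  proof -
    have "- k * (X1 * X2 * (u1 * y1 * g1) * (u2 * y2 * g2) * W) * e = - (k * (u1 * u2)) * ((y1 * X1 * y2 * X2) * W) * (g1 * g2) * e"
      for k X1 X2 u1 y1 g1 u2 y2 g2 W e :: complex by (simp add: algebra_simps)
    then show ?thesis unfolding dn1 dn2 .
  qed
  also have "z^4 / q^3 * M * (p/(a*b) * (p/(c*d))) = 1 / (q*M) * (z^4 / q^2)"
    using nz by (simp add: p_def M_def a_def b_def c_def d_def field_simps power2_eq_square power3_eq_cube)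
  also have "- (1 / (q*M) * (z^4 / q^2)) * (?R * (1 - (q*z)^2)) * (G1 z * G2 z) * f (z/p) =
     - (1 / (q*M)) * (z^4 / q^2 * ?R * (1 - (q*z)^2)) * (G1 z * G2 z) * f (z/p)"
    by (simp only: mult.assoc minus_mult_left)
  finally have 2: "ga q (1/T - T) (1/U - U) z * (M * F (z / p)) = - \<kappa> * (A' * f (z/p))"
    unfolding R \<kappa>_def by (simp add: mult_ac)
  define e where "e = (1/p^n - 1) * (1 - a*b*c*d * p^n / q^2)"
  have "be q (1 / (q*M*p^n) + q*M*p^n) (1/t - t) (1/s - s) (1/T - T) (1/U - U) z =
     1 / (q*M) * (?P * (1 - (z/q)^2) + z^4 / q^2 * ?R * (1 - (q*z)^2) + e * \<Lambda>)"
    unfolding e_def \<Lambda>_def M_def a_def b_def c_def d_def by (rule be_eq) (use nz nz'(1) in auto)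
  then have 3: "be q (1 / (q*M*p^n) + q*M*p^n) (1/t - t) (1/s - s) (1/T - T) (1/U - U) z * F z = \<kappa> * ((A + A' + e) * f z)"
    unfolding P R F \<kappa>_def by (simp add: algebra_simps add_divide_distrib)
  have "A * (f (p*z) - f z) + A' * (f (z/p) - f z) = e * f z"
    unfolding A_def A'_def f_def e_def p_def[symmetric]
    by (rule aw_difference_equation[OF nz(6) nz'(1) den low])
  then have "\<kappa> * (A * (f (p*z) - f z) + A' * (f (z/p) - f z) - e * f z) = 0" by simp
  then show ?thesis unfolding 1 2 3 by (simp add: algebra_simps)
qed

section \<open>Polynomials in the torus variable\<close>

definition lin_prod :: "complex \<Rightarrow> complex \<Rightarrow> nat \<Rightarrow> complex poly" where
  "lin_prod a p k = (\<Prod>r<k. [:1, - (a * p ^ r):])"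

definition root_prod :: "complex \<Rightarrow> complex \<Rightarrow> nat \<Rightarrow> complex poly" where
  "root_prod a p k = (\<Prod>r<k. [:- (a * p ^ r), 1:])"

lemma poly_lin_prod: "poly (lin_prod a p k) z = qpoch (a * z) p k"
  by (simp add: lin_prod_def poly_prod qpoch_def mult_ac)

lemma poly_root_prod: "z \<noteq> 0 \<Longrightarrow> poly (root_prod a p k) z = z ^ k * qpoch (a / z) p k"
proof -
  assume "z \<noteq> 0"
  then have "z - a * p ^ r = z * (1 - a / z * p ^ r)" for r by (simp add: field_simps)
  then show ?thesis by (simp add: root_prod_def poly_prod qpoch_def prod.distrib)
qed

lemma degree_prod_le: "(\<And>r. r < k \<Longrightarrow> degree (f r) \<le> 1) \<Longrightarrow> degree (\<Prod>r<k. f r) \<le> k"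
proof (induction k)
  case (Suc k)
  then have "degree (\<Prod>r<k. f r) \<le> k" "degree (f k) \<le> 1" by auto
  then show ?case using degree_mult_le[of "\<Prod>r<k. f r" "f k"] by simp
qed simp

lemma degree_lin_prod: "degree (lin_prod a p k) \<le> k"
  unfolding lin_prod_def by (rule degree_prod_le) simp

lemma degree_root_prod: "degree (root_prod a p k) \<le> k"
  unfolding root_prod_def by (rule degree_prod_le) simp

text \<open>\<open>z\<^sup>n p\<^sub>n((z + z\<^sup>-\<^sup>1) / 2)\<close> as a polynomial in \<open>z\<close>.\<close>

definition aw_laurent :: "nat \<Rightarrow> complex \<Rightarrow> complex \<Rightarrow> complex \<Rightarrow> complex \<Rightarrow> complex \<Rightarrow> complex poly" where
  "aw_laurent n a b c d p = smult (a powi (- int n) * (qpoch (a*b) p n * qpoch (a*c) p n * qpoch (a*d) p n))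
     (\<Sum>k\<le>n. smult (aw_coeff n a b c d p k) (lin_prod a p k * root_prod a p k * monom 1 (n - k)))"

lemma aw_laurent_aw_sum:
  assumes "z \<noteq> 0"
  shows "poly (aw_laurent n a b c d p) z =
    (a powi (- int n) * (qpoch (a*b) p n * qpoch (a*c) p n * qpoch (a*d) p n)) * (z ^ n * aw_sum n a b c d p z)"
proof -
  have "z ^ k * z ^ (n - k) = z ^ n" if "k \<le> n" for k using that by (simp flip: power_add)
  then have "(\<Sum>k\<le>n. aw_coeff n a b c d p k * (qpoch (a * z) p k * (z ^ k * qpoch (a / z) p k) * z ^ (n - k))) = z ^ n * aw_sum n a b c d p z"
    unfolding aw_sum_def sum_distrib_left by (intro sum.cong) (auto simp: mult_ac)
  then show ?thesis
    using assms by (simp add: aw_laurent_def poly_sum poly_lin_prod poly_root_prod poly_monom)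
qed

lemma degree_aw_laurent: "degree (aw_laurent n a b c d p) \<le> 2 * n"
  unfolding aw_laurent_def
proof (rule order_trans[OF degree_smult_le], rule degree_sum_le)
  fix k assume k: "k \<in> {..n}"
  have "degree (lin_prod a p k * root_prod a p k * monom 1 (n - k)) \<le> (k + k) + (n - k)"
    using degree_lin_prod[of a p k] degree_root_prod[of a p k] degree_monom_le[of "1::complex" "n - k"]
    by (intro order_trans[OF degree_mult_le] add_mono) (auto intro: order_trans[OF degree_mult_le])
  then show "degree (smult (aw_coeff n a b c d p k) (lin_prod a p k * root_prod a p k * monom 1 (n - k))) \<le> 2 * n"
    using k order_trans[OF degree_smult_le] by fastforce
qed simp

text \<open>The factors are taken in reverse order, and p^n and the powers p^r are distributed over
  them.\<close>

lemma qpoch_power_minus: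
  fixes p :: "'a::field"
  assumes "p \<noteq> 0"
  shows "qpoch (p powi (- int n)) p n * p ^ n * (\<Prod>r<n. - (p ^ r)) = qpoch p p n"
proof -
  have "qpoch (p powi (- int n)) p n = (\<Prod>r<n. 1 - 1 / p ^ Suc (n - Suc r) )"
    unfolding qpoch_def
  proof (intro prod.cong refl)
    fix r assume "r \<in> {..<n}"
    then have "Suc (n - Suc r) + r = n" by simp
    then have "p ^ n = p ^ Suc (n - Suc r) * p ^ r" by (metis power_add)
    then show "1 - p powi (- int n) * p ^ r = 1 - 1 / p ^ Suc (n - Suc r)"
      using assms by (simp add: power_int_minus divide_simps del: power_Suc)
  qed
  also have "\<dots> = (\<Prod>r<n. 1 - 1 / p ^ Suc r)"
    by (rule prod.nat_diff_reindex)
  finally have e: "qpoch (p powi (- int n)) p n = (\<Prod>r<n. 1 - 1 / p ^ Suc r)" .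
  have "(\<Prod>r<n. f r) * p ^ n * (\<Prod>r<n. g r) = (\<Prod>r<n. f r * p * g r)" for f g :: "nat \<Rightarrow> 'a"
    by (simp add: prod.distrib)
  then have "qpoch (p powi (- int n)) p n * p ^ n * (\<Prod>r<n. - (p ^ r)) = (\<Prod>r<n. (1 - 1 / p ^ Suc r) * p * - (p ^ r))"
    unfolding e .
  also have "\<dots> = qpoch p p n"
    unfolding qpoch_def using assms by (intro prod.cong) (auto simp: field_simps)
  finally show ?thesis .
qed

text \<open>At z = 0 only the top term k = n survives, as the others carry a positive power of
  z.\<close>

lemma poly_aw_laurent_0:
  assumes nz: "p \<noteq> 0" "a \<noteq> 0" and low: "qpoch (a*b) p n \<noteq> 0" "qpoch (a*c) p n \<noteq> 0" "qpoch (a*d) p n \<noteq> 0" "qpoch p p n \<noteq> 0"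
  shows "poly (aw_laurent n a b c d p) 0 = qpoch (a*b*c*d * p powi (int n - 1)) p n"
proof -
  have R: "poly (root_prod a p k) 0 = a ^ k * (\<Prod>r<k. - (p ^ r))" for k
    by (induction k) (simp_all add: root_prod_def mult_ac)
  have L: "poly (lin_prod a p k) 0 = 1" for k by (simp add: poly_lin_prod)
  have "(\<Sum>k\<le>n. aw_coeff n a b c d p k * (a ^ k * (\<Prod>r<k. - (p ^ r)) * poly (monom 1 (n - k)) 0)) =
      (\<Sum>k\<le>n. if k = n then aw_coeff n a b c d p n * (a ^ n * (\<Prod>r<n. - (p ^ r))) else 0)"
    by (intro sum.cong) (auto simp: poly_monom power_0_left)
  then have "poly (aw_laurent n a b c d p) 0 = (a powi (- int n) * (qpoch (a*b) p n * qpoch (a*c) p n * qpoch (a*d) p n)) *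
      (aw_coeff n a b c d p n * (a ^ n * (\<Prod>r<n. - (p ^ r))))"
    by (simp add: aw_laurent_def poly_sum R L)
  also have "\<dots> = (a powi (- int n) * a ^ n) * ((qpoch (p powi (- int n)) p n * p ^ n * (\<Prod>r<n. - (p ^ r))) / qpoch p p n)
       * qpoch (a*b*c*d * p powi (int n - 1)) p n"
    unfolding aw_coeff_def using low by (simp add: mult_ac)
  also have "a powi (- int n) * a ^ n = 1" using nz by (simp add: power_int_minus)
  finally show ?thesis unfolding qpoch_power_minus[OF nz(1)] using low by simp
qed

section \<open>Symmetries of the radial equation\<close>

lemma be_swap: "be q Q S S' E E' z = be q Q S' S E' E z"
proof -
  have "R + z * (S' - w*S) * (E - w*E') * (1 - v^2) - z * (v*E - E') * (S - v*S') * (1 - w^2) =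
     R + z * (S - w*S') * (E' - w*E) * (1 - v^2) - z * (v*E' - E) * (S' - v*S) * (1 - w^2)" for R w v
    by (simp add: algebra_simps power2_eq_square)
  then show ?thesis unfolding be_def .
qed

lemma al_swap: "al q S S' z = al q S' S z"
  by (simp add: al_def add.commute mult.commute[of S S'])

lemma ga_swap: "ga q E E' z = ga q E' E z"
  by (simp add: ga_def add.commute mult.commute[of E E'])

lemma radial_neg:
  "al q (- S) (- S') z = al q S S' z" "ga q (- E) (- E') z = ga q E E' z"
  "be q Q (- S) (- S') (- E) (- E') z = be q Q S S' E E' z"
proof -
  have "z * (- S' - w * (- S)) * (- E - w * (- E')) * V = z * (S' - w * S) * (E - w * E') * V"
    "z * (v * (- E) - (- E')) * (- S - v * (- S')) * V = z * (v * E - E') * (S - v * S') * V" for w v V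
    by (simp_all add: algebra_simps)
  then show "be q Q (- S) (- S') (- E) (- E') z = be q Q S S' E E' z"
    unfolding be_def by (simp only:)
qed (simp_all add: al_def ga_def)

section \<open>Uniqueness of polynomial solutions and the polynomial of a matrix element\<close>

context spin
begin

text \<open>The indicial equation at \<open>z = 0\<close> of the radial equation excludes all exponents
  between \<open>1\<close> and \<open>2l\<close>.\<close>

lemma radial_unique:
  fixes D :: "complex poly"
  assumes deg: "degree D \<le> N" and D0: "poly D 0 = 0"
    and rad: "\<And>k. 2 \<le> k \<Longrightarrow> al qc S S' (qc ^ k) * (poly D (qc^2 * qc^k) / of_real (q powr (2*l)))
      + be qc (of_real (q powr (-2*l-1) + q powr (2*l+1))) S S' E E' (qc ^ k) * poly D (qc ^ k)
      + ga qc E E' (qc ^ k) * (of_real (q powr (2*l)) * poly D (qc^k / qc^2)) = 0"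
  shows "D = 0"
proof (rule ccontr)
  assume "D \<noteq> 0"
  define x where "x = order 0 D"
  obtain D' where D': "D = [:- 0, 1:] ^ x * D'" "\<not> [:- 0, 1:] dvd D'"
    using order_decomp[OF \<open>D \<noteq> 0\<close>, of 0] by (auto simp: x_def)
  have x: "1 \<le> x" "x \<le> N"
    using D0 \<open>D \<noteq> 0\<close> order_root[of D 0] order_degree[OF \<open>D \<noteq> 0\<close>, of 0] deg by (auto simp: x_def)
  have D'0: "poly D' 0 \<noteq> 0" using D'(2) by (simp add: dvd_iff_poly_eq_0)
  have pD: "poly D z = z ^ x * poly D' z" for z by (simp add: D'(1))
  define c where "c = complex_of_real (q powr (2*l))"
  have c: "c \<noteq> 0" using q_pos by (simp add: c_def)
  define Q where "Q = complex_of_real (q powr (-2*l-1) + q powr (2*l+1))"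
  \<comment> \<open>The radial equation divided by z^x. It is continuous at 0 and vanishes along z =
    q^k, so its value at 0 is the indicial equation for x.\<close>
  define f where "f z = al qc S S' z * ((qc^2)^x * poly D' (qc^2 * z) / c)
      + be qc Q S S' E E' z * poly D' z + ga qc E E' z * (c * (poly D' (z / qc^2) / (qc^2)^x))" for z
  have f0: "f (qc ^ k) = 0" if "2 \<le> k" for k
  proof -
    have "qc ^ k \<noteq> 0" by simp
    have "Z * (A * (P * u / c) + B * v + G * (c * (w / P))) = A * (P * Z * u / c) + B * (Z * v) + G * (c * (Z / P * w))"
      for Z A P u B v G w by (simp add: algebra_simps)
    then have "(qc^k)^x * f (qc^k) = 0"
      using rad[OF that] unfolding pD c_def[symmetric] Q_def[symmetric] f_def power_mult_distrib power_divide by (simp only:)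
    then show ?thesis by simp
  qed
  have al: "isCont (\<lambda>z. al qc S S' z) 0" and be: "isCont (\<lambda>z. be qc Q S S' E E' z) 0" and ga: "isCont (\<lambda>z. ga qc E E' z) 0"
    unfolding al_def be_def ga_def
    by (rule isCont_diff isCont_add isCont_mult isCont_minus isCont_divide isCont_power continuous_const continuous_ident, simp)+
  have pc: "isCont (\<lambda>z. poly D' (e * z)) 0" for e
    by (rule isCont_o2[where g = "poly D'"]) (auto intro: isCont_mult)
  have "isCont f 0"
    unfolding f_def
    using c al be ga pc[of "qc^2"] pc[of 1] pc[of "1 / qc^2"]
    by (intro isCont_add isCont_mult isCont_divide continuous_const) simp_all
  moreover have "(\<lambda>k. qc ^ k) \<longlonglongrightarrow> 0"
    by (rule LIMSEQ_power_zero) (use q_pos q_less_1 in simp)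
  ultimately have "(\<lambda>k. f (qc ^ k)) \<longlonglongrightarrow> f 0"
    by (rule isCont_tendsto_compose)
  moreover have "eventually (\<lambda>k. f (qc ^ k) = 0) sequentially"
    using f0 by (auto intro: eventually_sequentiallyI[of 2])
  then have "(\<lambda>k. f (qc ^ k)) \<longlonglongrightarrow> 0" by (rule tendsto_eventually)
  ultimately have "f 0 = 0" by (rule LIMSEQ_unique)
  then have "(- (1 / qc) * ((qc^2)^x / c) + Q - qc * (c / (qc^2)^x)) * poly D' 0 = 0"
    by (simp add: f_def al_def be_def ga_def algebra_simps)
  then have "- (1 / qc) * ((qc^2)^x / c) + Q - qc * (c / (qc^2)^x) = 0"
    using D'0 by simp
  moreover have "(qc^2)^x = of_real (q powr (2 * real x))"
    using PP_powr[of x] by (simp add: PP_def)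
  ultimately have "complex_of_real (- (1 / q) * (q powr (2 * real x) / q powr (2*l)) + (q powr (-2*l-1) + q powr (2*l+1)) - q * (q powr (2*l) / q powr (2 * real x))) = 0"
    by (simp add: c_def Q_def)
  then have eq: "- (1 / q) * (q powr (2 * real x) / q powr (2*l)) + (q powr (-2*l-1) + q powr (2*l+1)) - q * (q powr (2*l) / q powr (2 * real x)) = 0"
    by (simp only: of_real_eq_0_iff)
  \<comment> \<open>The indicial equation reads y + 1/y = V + 1/V. Its solutions V = y and V = 1/y
    mean x = 0 and x = 2l + 1, both outside 1, ..., 2l.\<close>
  define y V where "y = q powr (2*l+1)" and "V = q powr (2*l+1 - 2 * real x)"
  have yV: "y > 0" "V > 0" using q_pos by (simp_all add: y_def V_def)
  have "(1 / q) * (q powr (2 * real x) / q powr (2*l)) = 1 / V" "q * (q powr (2*l) / q powr (2 * real x)) = V"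
    "q powr (-2*l-1) = 1 / y"
    using q_pos by (simp_all add: V_def y_def powr_add powr_diff powr_minus field_simps)
  then have "1 / y + y = 1 / V + V" using eq by (simp add: y_def)
  then have "(y - V) * (y * V - 1) = 0" using yV by (simp add: field_simps)
  then have "y = V \<or> y * V = 1" by simp
  moreover have "y < V" unfolding y_def V_def using x by (intro powr_strict_q) simp
  moreover have "y * V \<noteq> 1"
  proof -
    have "2*l + 1 + (2*l + 1 - 2 * real x) = 4*l + 2 - 2 * real x" by simp
    then have "y * V = q powr (4*l + 2 - 2 * real x)" by (simp only: y_def V_def powr_add[symmetric])
    moreover have "0 < 4*l + 2 - 2 * real x" using x l by linarith
    then have "q powr (4*l + 2 - 2 * real x) < q powr 0" by (rule powr_strict_q)
    ultimately show ?thesis using q_pos by simp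
  qed
  ultimately show False by simp
qed

text \<open>The torus values summed from the highest weight downwards, with the normalising
  constants and the power z^(-l) removed (\<open>bfun_BP\<close>).\<close>

definition BP :: "real \<Rightarrow> real \<Rightarrow> real \<Rightarrow> real \<Rightarrow> complex poly" where
  "BP i j \<tau> \<sigma> = (\<Sum>x\<le>N. monom (of_real (q powr real x * (rr j \<sigma> (l - real x) * rr i \<tau> (l - real x)))) x)"

lemma degree_BP: "degree (BP i j \<tau> \<sigma>) \<le> N"
  unfolding BP_def by (rule degree_sum_le) (auto intro: order_trans[OF degree_monom_le])

text \<open>At the highest weight the series reduces to its first term; this normalises the constant
  term of \<open>BP\<close> to 1.\<close>

lemma rr_top: "rr j \<sigma> l = 1"
proof -
  have "qpoch 1 PP m = (if m = 0 then 1 else 0)" for m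
    by (cases m) (auto intro: qpoch_eq_0[of _ _ 0])
  then have "kraw PP PN y D N 1 = (\<Sum>m\<le>N. if m = 0 then 1 else 0)" for PN y D
    unfolding kraw_def by (intro sum.cong) auto
  then have "kk j \<sigma> 1 = 1" by (simp add: kk_def)
  then show ?thesis using rr_eq[of 0 j \<sigma>] q_pos by (simp add: ww_def)
qed

lemma BP_0: "poly (BP i j \<tau> \<sigma>) 0 = 1"
proof -
  have "poly (BP i j \<tau> \<sigma>) 0 = (\<Sum>x\<le>N. if x = 0 then 1 else 0)"
    unfolding BP_def poly_sum using q_pos by (intro sum.cong) (auto simp: poly_monom rr_top)
  then show ?thesis by simp
qed

lemma bfun_BP:
  "bfun i j \<tau> \<sigma> (tw k) = of_real (Cc q l j \<sigma> * Cc q l i \<tau> * q powr (- l) * q powr (- l * of_int k)) * poly (BP i j \<tau> \<sigma>) (qc powi k)"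
proof -
  have inj: "inj_on (\<lambda>x. l - real x) {..N}" by (auto simp: inj_on_def)
  have "q powr (- (l - real x)) * R * q powr (- (l - real x) * of_int k) =
      (q powr (- l) * q powr (- l * of_int k)) * (q powr real x * R * (q powi k) ^ x)" for x R
  proof -
    have "(q powi k) ^ x = q powr (of_int k * real x)"
      using q_pos by (simp add: powr_powr[symmetric] powr_real_of_int' powr_realpow)
    moreover have "q powr (- (l - real x)) * q powr (- (l - real x) * of_int k) = q powr (- l) * q powr (- l * of_int k) * q powr real x * q powr (of_int k * real x)"
      by (simp add: algebra_simps flip: powr_add)
    ultimately show ?thesis by (simp add: mult_ac)
  qed
  then have "bfun i j \<tau> \<sigma> (tw k) = of_real (Cc q l j \<sigma> * Cc q l i \<tau>) * (\<Sum>x\<le>N. of_real ((q powr (- l) * q powr (- l * of_int k)) * (q powr real x * (rr j \<sigma> (l - real x) * rr i \<tau> (l - real x)) * (q powi k) ^ x)))"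
    unfolding bfun_torus weights_eq[OF l] sum.reindex[OF inj] comp_def by (simp only:)
  also have "\<dots> = of_real (Cc q l j \<sigma> * Cc q l i \<tau> * q powr (- l) * q powr (- l * of_int k)) * poly (BP i j \<tau> \<sigma>) (qc powi k)"
    by (simp add: BP_def poly_sum poly_monom sum_distrib_left mult_ac)
  finally show ?thesis .
qed

lemma qpoch_neg_pos: "0 \<le> x \<Longrightarrow> 0 < qpoch (- x) (q^2) k"
  unfolding qpoch_def by (rule prod_pos) (use q_pos in \<open>auto intro!: add_pos_nonneg mult_nonneg_nonneg\<close>)

lemma nn_of_nat [simp]: "nn (real k) = k"
  by simp

lemma qbinom_eq:
  assumes "k \<le> n"
  shows "qbinom n k (q^2) = qpoch (q^2) (q^2) n / (qpoch (q^2) (q^2) k * qpoch (q^2) (q^2) (n - k))"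
proof -
  have "qpoch ((q^2)^n) (inverse (q^2)) k * qpoch (q^2) (q^2) (n - k) = qpoch (q^2) (q^2) n"
    using assms
  proof (induction k)
    case (Suc k)
    have "(q^2)^n * inverse (q^2) ^ k = (q^2)^(n - k)"
      using Suc.prems by (simp add: power_inverse power_diff divide_inverse)
    moreover have "qpoch (q^2) (q^2) (n - k) = qpoch (q^2) (q^2) (n - Suc k) * (1 - (q^2)^(n - k))"
      using Suc.prems qpoch_Suc[of "q^2" "q^2" "n - Suc k"] by (simp add: Suc_diff_Suc flip: power_Suc)
    ultimately show ?case using Suc by (simp add: qpoch_Suc mult_ac)
  qed simp
  then show ?thesis using qpoch_P_pos[of "n - k"] qpoch_P_pos[of k] by (simp add: qbinom_def field_simps)
qed

lemma Cc_pos: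
  assumes j: "j \<in> weights l"
  shows "0 < Cc q l j \<sigma>"
proof -
  obtain k where k: "j = l - real k" "k \<le> N" using j by (auto simp: weights_eq[OF l])
  have e: "2 * l = real N" "l - j = real k" using l k by simp_all
  have "0 < qbinom (nn (2*l)) (nn (l - j)) (q^2)"
    unfolding e nn_of_nat qbinom_eq[OF k(2)] using qpoch_P_pos by simp
  moreover have "0 < (1 + q powr (-4*j - 2*\<sigma>)) / (1 + q powr (-2*\<sigma>))"
    by (intro divide_pos_pos add_pos_nonneg) auto
  moreover have "0 < qpoch (- (q powr (2 - 2*\<sigma>))) (q^2) (nn (l - j)) * qpoch (- (q powr (2 + 2*\<sigma>))) (q^2) (nn (l + j))"
    by (intro mult_pos_pos qpoch_neg_pos) auto
  ultimately show ?thesis unfolding Cc_def using q_pos by (intro mult_pos_pos) auto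
qed

text \<open>Lets the constants of the two cases with negative extreme weight be compared with those
  of the positive ones.\<close>

lemma Cc_neg:
  assumes j: "j \<in> weights l"
  shows "Cc q l (- j) (- \<sigma>) = Cc q l j \<sigma>"
proof -
  obtain k where k: "j = l - real k" "k \<le> N" using j by (auto simp: weights_eq[OF l])
  have e: "2 * l = real N" "l - j = real k" "l + j = real (N - k)" "l - - j = real (N - k)" "l + - j = real k"
    using l k by (simp_all add: of_nat_diff)
  have b: "qbinom N (N - k) (q^2) = qbinom N k (q^2)"
    using k(2) by (simp add: qbinom_eq mult.commute)
  \<comment> \<open>The extracted factor q^(2j) turns the prefactor q^(l-j) into q^(l+j).\<close>
  have s: "sqrt ((1 + q powr (-4 * - j - 2 * - \<sigma>)) / (1 + q powr (-2 * - \<sigma>))) =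
     q powr (2*j) * sqrt ((1 + q powr (-4*j - 2*\<sigma>)) / (1 + q powr (-2*\<sigma>)))"
  proof -
    have "1 + q powr (-4 * - j - 2 * - \<sigma>) = q powr (4*j + 2*\<sigma>) * (1 + q powr (-4*j - 2*\<sigma>))"
      "1 + q powr (-2 * - \<sigma>) = q powr (2*\<sigma>) * (1 + q powr (-2*\<sigma>))"
      using q_pos by (simp_all add: distrib_left add.commute flip: powr_add)
    moreover have "q powr (4*j + 2*\<sigma>) / q powr (2*\<sigma>) = (q powr (2*j))^2"
      using q_pos by (simp add: powr_diff[symmetric] power2_eq_square flip: powr_add)
    ultimately have "(1 + q powr (-4 * - j - 2 * - \<sigma>)) / (1 + q powr (-2 * - \<sigma>)) =
      (q powr (2*j))^2 * ((1 + q powr (-4*j - 2*\<sigma>)) / (1 + q powr (-2*\<sigma>)))"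
      by (metis times_divide_times_eq)
    then show ?thesis by (simp only: real_sqrt_mult real_sqrt_abs) simp
  qed
  have "real k + 2 * j = real (N - k)" using e by linarith
  then have p: "q powr real k * q powr (2*j) = q powr real (N - k)" by (simp flip: powr_add)
  have "Cc q l (- j) (- \<sigma>) = (q powr real k * q powr (2*j)) * sqrt (qbinom N k (q^2)) *
     sqrt ((1 + q powr (-4*j - 2*\<sigma>)) / (1 + q powr (-2*\<sigma>))) *
     inverse (sqrt (qpoch (- (q powr (2 - 2 * - \<sigma>))) (q^2) (N - k) * qpoch (- (q powr (2 + 2 * - \<sigma>))) (q^2) k))"
    unfolding Cc_def s e nn_of_nat b by (simp add: mult_ac)
  also have "\<dots> = Cc q l j \<sigma>"
    unfolding p Cc_def e nn_of_nat by (simp add: mult.commute)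
  finally show ?thesis .
qed

text \<open>The removed power z^(-l) changes under the shifts by q^2 and q^(-2); this is the origin
  of the factors q^(2l) in the outer terms.\<close>

lemma BP_radial:
  assumes i: "i \<in> weights l" and j: "j \<in> weights l"
  shows "al qc (SS \<sigma>) (SS \<tau>) (qc ^ k) * (poly (BP i j \<tau> \<sigma>) (qc^2 * qc^k) / of_real (q powr (2*l)))
      + be qc (of_real (q powr (-2*l-1) + q powr (2*l+1))) (SS \<sigma>) (SS \<tau>) (SS (\<sigma> + 2*j)) (SS (\<tau> + 2*i)) (qc ^ k) * poly (BP i j \<tau> \<sigma>) (qc ^ k)
      + ga qc (SS (\<sigma> + 2*j)) (SS (\<tau> + 2*i)) (qc ^ k) * (of_real (q powr (2*l)) * poly (BP i j \<tau> \<sigma>) (qc^k / qc^2)) = 0"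
proof -
  define K where "K = complex_of_real (Cc q l j \<sigma> * Cc q l i \<tau> * q powr (- l) * q powr (- l * real k))"
  define c where "c = complex_of_real (q powr (2*l))"
  have K: "K \<noteq> 0" using Cc_pos[OF i, of \<tau>] Cc_pos[OF j, of \<sigma>] q_pos by (simp add: K_def)
  have c: "c \<noteq> 0" using q_pos by (simp add: c_def)
  have p: "qc powi int k = qc ^ k" "qc powi (int k + 2) = qc^2 * qc^k" "qc powi (int k - 2) = qc^k / qc^2"
    by (simp_all add: power_int_add power_int_diff mult.commute)
  have e: "q powr (- l * of_int (int k + 2)) = q powr (- l * real k) / q powr (2*l)"
    "q powr (- l * of_int (int k - 2)) = q powr (- l * real k) * q powr (2*l)"
    by (simp_all add: algebra_simps flip: powr_add powr_diff)
  have F: "bfun i j \<tau> \<sigma> (tw (int k)) = K * poly (BP i j \<tau> \<sigma>) (qc ^ k)"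
    "bfun i j \<tau> \<sigma> (tw (int k + 2)) = K * (poly (BP i j \<tau> \<sigma>) (qc^2 * qc^k) / c)"
    "bfun i j \<tau> \<sigma> (tw (int k - 2)) = K * (c * poly (BP i j \<tau> \<sigma>) (qc^k / qc^2))"
    unfolding bfun_BP p e K_def c_def by simp_all
  have "K * (al qc (SS \<sigma>) (SS \<tau>) (qc ^ k) * (poly (BP i j \<tau> \<sigma>) (qc^2 * qc^k) / c)
      + be qc (of_real (q powr (-2*l-1) + q powr (2*l+1))) (SS \<sigma>) (SS \<tau>) (SS (\<sigma> + 2*j)) (SS (\<tau> + 2*i)) (qc ^ k) * poly (BP i j \<tau> \<sigma>) (qc ^ k)
      + ga qc (SS (\<sigma> + 2*j)) (SS (\<tau> + 2*i)) (qc ^ k) * (c * poly (BP i j \<tau> \<sigma>) (qc^k / qc^2))) = 0"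
    using bfun_radial[OF i j, of \<sigma> \<tau> "int k"] unfolding F p(1) by (simp only: distrib_left mult.left_commute[of K])
  then show ?thesis using K unfolding c_def by simp
qed

end

section \<open>The explicit solution of the radial equation\<close>

context quantum
begin

text \<open>All parameters of the explicit solution are of this form up to sign, so relations among
  them become relations among real exponents.\<close>

definition spar :: "real \<Rightarrow> complex" where "spar x = of_real (q powr x)"

lemma spar_simps: "spar x \<noteq> 0" "spar x * spar y = spar (x + y)" "spar x / spar y = spar (x - y)" "1 / spar x = spar (- x)"
  using q_pos by (simp_all add: spar_def powr_add powr_diff powr_minus_divide)

lemma SS_spar: "SS x = 1 / spar x - spar x"
  by (simp add: SS_def spar_def powr_minus_divide)

lemma SS_minus: "SS (- x) = - SS x"
  by (simp add: SS_def)

lemma spar_power: "spar x ^ k = spar (real k * x)"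
  using q_pos by (simp add: spar_def powr_powr mult.commute flip: powr_realpow of_real_power)

lemma spar_0 [simp]: "spar 0 = 1"
  using q_pos by (simp add: spar_def)

lemma spar_eq_iff: "spar x = spar y \<longleftrightarrow> x = y"
  using q_pos q_less_1 by (auto simp: spar_def powr_inj)

lemma qc_spar: "qc = spar 1"
  using q_pos by (simp add: spar_def)

lemma qpoch_of_real: "qpoch (complex_of_real x) (of_real y) k = of_real (qpoch x y k)"
  by (simp add: qpoch_def)

lemma qpoch_spar_nonzero:
  "0 < x \<Longrightarrow> qpoch (spar x) (spar 2) k \<noteq> 0" "qpoch (- spar x) (spar 2) k \<noteq> 0"
proof -
  have p: "spar 2 = of_real (q^2)" using q_pos by (simp add: spar_def)
  have "1 + q powr x * (q^2)^r \<noteq> 0" for r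
    using q_pos by (intro less_imp_neq[symmetric] add_pos_nonneg) auto
  then show "qpoch (- spar x) (spar 2) k \<noteq> 0"
    unfolding p unfolding spar_def of_real_minus[symmetric] qpoch_of_real of_real_eq_0_iff
    by (simp add: qpoch_def)
  assume x: "0 < x"
  have "q powr x * (q^2)^r \<noteq> 1" for r
  proof -
    have "q powr x < 1" using x q_pos q_less_1 powr_less_mono'[of q 0 x] by simp
    moreover have "(q^2)^r \<le> 1" using q_pos q_less_1 by (simp add: power_le_one)
    ultimately have "q powr x * (q^2)^r \<le> q powr x * 1" by (intro mult_left_mono) auto
    then have "q powr x * (q^2)^r < 1" using \<open>q powr x < 1\<close> by linarith
    then show ?thesis by (rule less_imp_neq)
  qed
  then show "qpoch (spar x) (spar 2) k \<noteq> 0"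
    unfolding p unfolding spar_def qpoch_of_real of_real_eq_0_iff
    by (simp add: qpoch_def)
qed

definition awp :: "nat \<Rightarrow> nat \<Rightarrow> nat \<Rightarrow> real \<Rightarrow> real \<Rightarrow> complex poly" where
  "awp n n1 n2 \<tau> \<sigma> = aw_laurent n (spar (1 + \<sigma> - \<tau>)) (spar (1 + \<tau> - \<sigma> + 2 * real n1))
     (- spar (1 - \<sigma> - \<tau>)) (- spar (1 + \<sigma> + \<tau> + 2 * real n2)) (spar 2)"

text \<open>Up to a constant and a power of \<open>z\<close>, the matrix element of lowest spin at the torus point \<open>z\<close>.\<close>

definition ground :: "nat \<Rightarrow> nat \<Rightarrow> real \<Rightarrow> real \<Rightarrow> complex poly" where
  "ground n1 n2 \<tau> \<sigma> = lin_prod (spar (1 - \<sigma> + \<tau>)) (spar 2) n1 * lin_prod (- spar (1 + \<sigma> + \<tau>)) (spar 2) n2"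

text \<open>Origin of the denominator of d: with 2m = n1 + n2 and l = m + n the base point is
  q^(4l). The factorial in q^2 is read backwards to become one in q^(-2).\<close>

lemma awp_0: "poly (awp n n1 n2 \<tau> \<sigma>) 0 =
  of_real (qpoch (q powr (2 * (real n1 + real n2 + 2 * real n))) (q powr (-2)) n)"
proof -
  have "poly (awp n n1 n2 \<tau> \<sigma>) 0 = qpoch (spar (1 + \<sigma> - \<tau>) * spar (1 + \<tau> - \<sigma> + 2 * real n1) *
     (- spar (1 - \<sigma> - \<tau>)) * (- spar (1 + \<sigma> + \<tau> + 2 * real n2)) * spar 2 powi (int n - 1)) (spar 2) n"
    unfolding awp_def
    by (rule poly_aw_laurent_0) (simp_all add: spar_simps qpoch_spar_nonzero)
  also have "spar 2 powi (int n - 1) = spar (2 * real n - 2)"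
    using spar_simps(1)[of 2] by (simp add: power_int_diff spar_power spar_simps mult.commute)
  also have "spar (1 + \<sigma> - \<tau>) * spar (1 + \<tau> - \<sigma> + 2 * real n1) *
     (- spar (1 - \<sigma> - \<tau>)) * (- spar (1 + \<sigma> + \<tau> + 2 * real n2)) * spar (2 * real n - 2) = spar (2 + 2 * real n1 + 2 * real n2 + 2 * real n)"
    by (simp add: spar_simps algebra_simps)
  also have "qpoch (spar (2 + 2 * real n1 + 2 * real n2 + 2 * real n)) (spar 2) n =
      (\<Prod>r<n. 1 - spar (2 * (real n1 + real n2 + 2 * real n)) * spar (-2) ^ (n - Suc r))"
    unfolding qpoch_def spar_power spar_simps
    by (intro prod.cong arg_cong[where f = "\<lambda>x. 1 - spar x"]) (auto simp: of_nat_diff algebra_simps)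
  also have "\<dots> = (\<Prod>r<n. 1 - spar (2 * (real n1 + real n2 + 2 * real n)) * spar (-2) ^ r)"
    by (rule prod.nat_diff_reindex)
  also have "\<dots> = of_real (qpoch (q powr (2 * (real n1 + real n2 + 2 * real n))) (q powr (-2)) n)"
    by (simp add: qpoch_def spar_def)
  finally show ?thesis .
qed

lemma ground_0: "poly (ground n1 n2 \<tau> \<sigma>) 0 = 1"
  by (simp add: ground_def poly_lin_prod)

lemma ground_awp_radial:
  fixes n :: nat and m \<sigma> \<tau> :: real
  assumes jm: "j = m - real n1" "2 * m = real n1 + real n2" and k: "2 \<le> k"
  defines "W \<equiv> ground n1 n2 \<tau> \<sigma> * awp n n1 n2 \<tau> \<sigma>" and "l \<equiv> m + real n"
  shows "al qc (SS \<sigma>) (SS \<tau>) (qc ^ k) * (poly W (qc^2 * qc^k) / of_real (q powr (2*l)))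
      + be qc (of_real (q powr (-2*l-1) + q powr (2*l+1))) (SS \<sigma>) (SS \<tau>) (SS (\<sigma> + 2*j)) (SS (\<tau> + 2*m)) (qc ^ k) * poly W (qc ^ k)
      + ga qc (SS (\<sigma> + 2*j)) (SS (\<tau> + 2*m)) (qc ^ k) * (of_real (q powr (2*l)) * poly W (qc^k / qc^2)) = 0"
proof -
  let ?a = "spar (1 + \<sigma> - \<tau>)" and ?b = "spar (1 + \<tau> - \<sigma> + 2 * real n1)"
  let ?c = "- spar (1 - \<sigma> - \<tau>)" and ?d = "- spar (1 + \<sigma> + \<tau> + 2 * real n2)"
  let ?s = "spar \<tau>" and ?t = "spar \<sigma>" and ?T = "spar (\<sigma> + 2*j)" and ?U = "spar (\<tau> + 2*m)"
  define L where "L = ?a powi (- int n) * (qpoch (?a*?b) (spar 2) n * qpoch (?a*?c) (spar 2) n * qpoch (?a*?d) (spar 2) n)"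
  define F where "F z = qpoch (qc^2 * z / (qc * ?t / ?s)) (qc^2) n1 * qpoch (qc^2 * z / (- qc / (?t * ?s))) (qc^2) n2 *
    aw_sum n (qc * ?t / ?s) (qc * ?U / ?T) (- qc / (?t * ?s)) (- qc * ?T * ?U) (qc^2) z" for z
  have p: "qc^2 = spar 2" by (simp add: qc_spar spar_power)
  have nj: "2*m - 2*j = 2 * real n1" "2*m + 2*j = 2 * real n2" using jm by simp_all
  have abcd: "qc * ?t / ?s = ?a" "qc * ?U / ?T = ?b" "- qc / (?t * ?s) = ?c" "- qc * ?T * ?U = ?d"
    using nj by (simp_all add: qc_spar spar_simps algebra_simps)
  have M: "?U / ?s = spar (2*m)" by (simp add: spar_simps)
  have W: "poly W z = L * (z ^ n * F z)" if "z \<noteq> 0" for z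
  proof -
    have "qc^2 * z / ?a = spar (1 - \<sigma> + \<tau>) * z" "qc^2 * z / ?c = - spar (1 + \<sigma> + \<tau>) * z"
    proof -
      have "spar (1 - \<sigma> + \<tau>) = spar 2 / ?a" "spar (1 + \<sigma> + \<tau>) = spar 2 / spar (1 - \<sigma> - \<tau>)"
        by (simp_all add: spar_simps algebra_simps)
      then show "qc^2 * z / ?a = spar (1 - \<sigma> + \<tau>) * z" "qc^2 * z / ?c = - spar (1 + \<sigma> + \<tau>) * z"
        by (simp_all add: p)
    qed
    then show ?thesis
      unfolding F_def abcd unfolding W_def poly_mult ground_def poly_lin_prod awp_def aw_laurent_aw_sum[OF that] L_def p
      by (simp only: mult_ac)
  qed
  define z where "z = qc ^ k"
  have z: "z = spar (real k)" by (simp add: z_def qc_spar spar_power)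
  have znz: "z \<noteq> 0" "qc^2 * z \<noteq> 0" "z / qc^2 \<noteq> 0" using q_pos by (simp_all add: z_def)
  have Q: "1 / (qc * (?U / ?s) * (qc^2)^n) + qc * (?U / ?s) * (qc^2)^n = of_real (q powr (-2*l-1) + q powr (2*l+1))"
  proof -
    have "qc * (?U / ?s) * (qc^2)^n = spar (2*l + 1)"
      unfolding M p by (simp add: qc_spar spar_simps spar_power l_def algebra_simps)
    then show ?thesis by (simp add: spar_simps) (simp add: spar_def)
  qed
  have "al qc (1/?t - ?t) (1/?s - ?s) z * (F (qc^2 * z) / (?U / ?s))
    + be qc (1 / (qc * (?U / ?s) * (qc^2)^n) + qc * (?U / ?s) * (qc^2)^n) (1/?t - ?t) (1/?s - ?s) (1/?T - ?T) (1/?U - ?U) z * F z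
    + ga qc (1/?T - ?T) (1/?U - ?U) z * ((?U / ?s) * F (z / qc^2)) = 0"
    unfolding F_def
  proof (rule aw_radial)
    show "?U * ?t / (?s * ?T) = (qc^2) ^ n1" "?T * ?U / (?t * ?s) = (qc^2) ^ n2"
      unfolding p using nj by (simp_all add: spar_simps spar_power algebra_simps)
    \<comment> \<open>k = 0 and k = 1 would be zeros of the Askey-Wilson denominators, hence the
      bound k \<ge> 2.\<close>
    show "z\<^sup>2 \<noteq> 1" "qc\<^sup>2 * z\<^sup>2 \<noteq> 1" "z\<^sup>2 \<noteq> qc\<^sup>2"
      unfolding z p spar_power spar_simps spar_0[symmetric] spar_eq_iff using k by auto
    fix k' assume "k' \<le> n"
    show "qpoch (qc * ?t / ?s * (qc * ?U / ?T)) (qc\<^sup>2) k' \<noteq> 0"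
      "qpoch (qc * ?t / ?s * (- qc / (?t * ?s))) (qc\<^sup>2) k' \<noteq> 0"
      "qpoch (qc * ?t / ?s * (- qc * ?T * ?U)) (qc\<^sup>2) k' \<noteq> 0" "qpoch (qc^2) (qc^2) k' \<noteq> 0"
      unfolding abcd p by (simp_all add: spar_simps qpoch_spar_nonzero)
  qed (use znz q_pos in \<open>simp_all add: spar_simps\<close>)
  then have rad: "al qc (SS \<sigma>) (SS \<tau>) z * (F (qc^2 * z) / (?U / ?s))
    + be qc (of_real (q powr (-2*l-1) + q powr (2*l+1))) (SS \<sigma>) (SS \<tau>) (SS (\<sigma> + 2*j)) (SS (\<tau> + 2*m)) z * F z
    + ga qc (SS (\<sigma> + 2*j)) (SS (\<tau> + 2*m)) z * ((?U / ?s) * F (z / qc^2)) = 0"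
    unfolding Q SS_spar[symmetric] .
  define M where "M = ?U / ?s"
  have M0: "M \<noteq> 0" by (simp add: M_def spar_simps)
  \<comment> \<open>The factor z^n in \<open>awp\<close> accounts for the difference between M =
    q^(2m) in the Askey-Wilson form and q^(2l) in the radial equation.\<close>
  have ql: "complex_of_real (q powr (2*l)) = M * (qc^2)^n"
    unfolding M_def M p spar_power spar_simps l_def by (simp add: spar_def algebra_simps)
  have e: "poly W (qc^2 * z) / of_real (q powr (2*l)) = L * z^n * (F (qc^2 * z) / M)"
    "poly W z = L * z^n * F z"
    "of_real (q powr (2*l)) * poly W (z / qc^2) = L * z^n * (M * F (z / qc^2))"
    unfolding ql W[OF znz(1)] W[OF znz(2)] W[OF znz(3)] using q_pos M0
    by (simp_all add: power_mult_distrib power_divide)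
  have comb: "A * (K * X) + B * (K * Y) + C * (K * Z) = 0" if "A * X + B * Y + C * Z = 0" for A B C K X Y Z :: complex
  proof -
    have "A * (K * X) + B * (K * Y) + C * (K * Z) = K * (A * X + B * Y + C * Z)" by (simp add: algebra_simps)
    then show ?thesis using that by simp
  qed
  show ?thesis unfolding z_def[symmetric] e by (rule comb[OF rad[folded M_def]])
qed

end

context spin
begin

text \<open>Both sides solve the same radial equation with degree at most 2l and equal constant
  terms, so \<open>radial_unique\<close> applies to their difference. The primed parameters are the
  image of the original ones under a symmetry of the equation, which lets one statement serve all
  four cases.\<close>

lemma BP_eq_ground_awp:
  assumes i: "i \<in> weights l" and j: "j \<in> weights l"
    and par: "2*m = real n1 + real n2" "l = m + real n" "j' = m - real n1"
    and hal: "\<And>z. al qc (SS \<sigma>) (SS \<tau>) z = al qc (SS \<sigma>') (SS \<tau>') z"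
    and hga: "\<And>z. ga qc (SS (\<sigma> + 2*j)) (SS (\<tau> + 2*i)) z = ga qc (SS (\<sigma>' + 2*j')) (SS (\<tau>' + 2*m)) z"
    and hbe: "\<And>Q z. be qc Q (SS \<sigma>) (SS \<tau>) (SS (\<sigma> + 2*j)) (SS (\<tau> + 2*i)) z =
      be qc Q (SS \<sigma>') (SS \<tau>') (SS (\<sigma>' + 2*j')) (SS (\<tau>' + 2*m)) z"
  shows "ground n1 n2 \<tau>' \<sigma>' * awp n n1 n2 \<tau>' \<sigma>' =
    smult (of_real (qpoch (q powr (4*l)) (q powr (-2)) n)) (BP i j \<tau> \<sigma>)"
proof -
  define W c where "W = ground n1 n2 \<tau>' \<sigma>' * awp n n1 n2 \<tau>' \<sigma>'"
    and "c = complex_of_real (qpoch (q powr (4*l)) (q powr (-2)) n)"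
  have N: "N = n1 + n2 + 2 * n" using par l by linarith
  have l4: "4 * l = 2 * (real n1 + real n2 + 2 * real n)" using par by simp
  have W0: "poly W 0 = c" by (simp add: W_def c_def l4 ground_0 awp_0)
  have "degree W \<le> (n1 + n2) + 2 * n"
    unfolding W_def ground_def awp_def
    by (intro order_trans[OF degree_mult_le] add_mono degree_lin_prod degree_aw_laurent)
  then have dW: "degree W \<le> N" by (simp add: N)
  have R: "A * ((x - d * y) / P) + B * (x' - d * y') + C * (P * (x'' - d * y'')) = 0"
    if "A * (x / P) + B * x' + C * (P * x'') = 0" "A * (y / P) + B * y' + C * (P * y'') = 0"
    for A B C P d x y x' y' x'' y'' :: complex
  proof -
    have "A * ((x - d * y) / P) + B * (x' - d * y') + C * (P * (x'' - d * y'')) =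
      (A * (x / P) + B * x' + C * (P * x'')) - d * (A * (y / P) + B * y' + C * (P * y''))"
      by (simp add: algebra_simps diff_divide_distrib)
    then show ?thesis using that by simp
  qed
  have "W - smult c (BP i j \<tau> \<sigma>) = 0"
  proof (rule radial_unique)
    show "degree (W - smult c (BP i j \<tau> \<sigma>)) \<le> N"
      by (intro degree_diff_le dW order_trans[OF degree_smult_le] degree_BP)
    show "poly (W - smult c (BP i j \<tau> \<sigma>)) 0 = 0" by (simp add: W0 BP_0)
    fix k :: nat assume k: "2 \<le> k"
    note W = ground_awp_radial[OF par(3,1) k, of \<sigma>' \<tau>' n, folded par(2) W_def, folded hal hga hbe]
    show "al qc (SS \<sigma>) (SS \<tau>) (qc ^ k) * (poly (W - smult c (BP i j \<tau> \<sigma>)) (qc^2 * qc^k) / of_real (q powr (2*l)))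
      + be qc (of_real (q powr (-2*l-1) + q powr (2*l+1))) (SS \<sigma>) (SS \<tau>) (SS (\<sigma> + 2*j)) (SS (\<tau> + 2*i)) (qc ^ k) * poly (W - smult c (BP i j \<tau> \<sigma>)) (qc ^ k)
      + ga qc (SS (\<sigma> + 2*j)) (SS (\<tau> + 2*i)) (qc ^ k) * (of_real (q powr (2*l)) * poly (W - smult c (BP i j \<tau> \<sigma>)) (qc^k / qc^2)) = 0"
      unfolding poly_diff poly_smult by (rule R[OF W BP_radial[OF i j]])
  qed
  then show ?thesis by (simp add: W_def c_def)
qed

end

section \<open>From torus values to the identities\<close>

context quantum
begin

lemma aw2_awp:
  assumes "z \<noteq> 0"
  shows "poly (awp n n1 n2 \<tau> \<sigma>) z =
    z ^ n * poly (aw2 n (real n1) (real n2) (q powr \<tau>) (q powr \<sigma>) (q^2)) ((z + inverse z) / 2)"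
proof -
  have q2: "q^2 = q powr 2" using q_pos by simp
  have "complex_of_real ((q^2) powr (1/2) * q powr \<sigma> / q powr \<tau>) = spar (1 + \<sigma> - \<tau>)"
    "complex_of_real ((q^2) powr (1/2 + real n1) * q powr \<tau> / q powr \<sigma>) = spar (1 + \<tau> - \<sigma> + 2 * real n1)"
    "complex_of_real (- ((q^2) powr (1/2)) / (q powr \<tau> * q powr \<sigma>)) = - spar (1 - \<sigma> - \<tau>)"
    "complex_of_real (- (q powr \<tau> * q powr \<sigma> * (q^2) powr (1/2 + real n2))) = - spar (1 + \<sigma> + \<tau> + 2 * real n2)"
    "complex_of_real (q^2) = spar 2"
    unfolding q2 powr_powr spar_def
    using q_pos by (simp_all add: powr_add powr_diff distrib_left)
  note e = this
  show ?thesis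
    unfolding aw2_def awp_def e askey_wilson_eval[OF spar_simps(1) assms] aw_laurent_aw_sum[OF assms] aw_sum_def
    by (rule mult.left_commute)
qed

lemma awp_zero: "awp 0 n1 n2 \<tau> \<sigma> = 1"
  by (simp add: awp_def aw_laurent_def aw_coeff_def lin_prod_def root_prod_def qpoch_def one_pCons)

lemma matrix_element_torus:
  assumes spins: "spin q l N" "spin q m (n1 + n2)"
    and w: "i \<in> weights l" "j \<in> weights l" "i \<in> weights m" "j \<in> weights m"
    and l: "l = m + real n" and j': "j' = m - real n1"
    and hal: "\<And>z. al qc (SS \<sigma>) (SS \<tau>) z = al qc (SS \<sigma>') (SS \<tau>') z"
    and hga: "\<And>z. ga qc (SS (\<sigma> + 2*j)) (SS (\<tau> + 2*i)) z = ga qc (SS (\<sigma>' + 2*j')) (SS (\<tau>' + 2*m)) z"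
    and hbe: "\<And>Q z. be qc Q (SS \<sigma>) (SS \<tau>) (SS (\<sigma> + 2*j)) (SS (\<tau> + 2*i)) z =
      be qc Q (SS \<sigma>') (SS \<tau>') (SS (\<sigma>' + 2*j')) (SS (\<tau>' + 2*m)) z"
    and C: "Cc q l j' \<sigma>' * Cc q l m \<tau>' = Cc q l j \<sigma> * Cc q l i \<tau>"
      "Cc q m j' \<sigma>' * Cc q m m \<tau>' = Cc q m j \<sigma> * Cc q m i \<tau>"
  shows "spin.bfun q l i j \<tau> \<sigma> (tw k) = of_real (dd q l m j' \<tau>' \<sigma>') * (spin.bfun q m i j \<tau> \<sigma> (tw k) *
     poly (aw2 n (m - j') (m + j') (q powr \<tau>') (q powr \<sigma>') (q^2)) ((qc powi k + inverse (qc powi k)) / 2))"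
proof -
  interpret L: spin q l N by (rule spins)
  interpret M: spin q m "n1 + n2" by (rule spins)
  have m2: "2 * m = real n1 + real n2" using M.l by simp
  define z where "z = qc powi k"
  define P where "P = poly (aw2 n (m - j') (m + j') (q powr \<tau>') (q powr \<sigma>') (q^2)) ((z + inverse z) / 2)"
  define \<Lambda> where "\<Lambda> = qpoch (q powr (4*l)) (q powr (-2)) n"
  have z0: "z \<noteq> 0" using q_pos by (simp add: z_def)
  have mj: "m - j' = real n1" "m + j' = real n2" using j' m2 by simp_all
  \<comment> \<open>The spin m itself, where n = 0 and the Askey-Wilson factor is 1; this identifies
    the product of linear factors.\<close>
  have "ground n1 n2 \<tau>' \<sigma>' = M.BP i j \<tau> \<sigma>"
    using M.BP_eq_ground_awp[OF w(3,4) m2 _ j' hal hga hbe, of 0] by (simp add: awp_zero qpoch_def)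
  then have "M.BP i j \<tau> \<sigma> * awp n n1 n2 \<tau>' \<sigma>' = smult (of_real \<Lambda>) (L.BP i j \<tau> \<sigma>)"
    using L.BP_eq_ground_awp[OF w(1,2) m2 l j' hal hga hbe] by (simp add: \<Lambda>_def)
  then have BP: "poly (M.BP i j \<tau> \<sigma>) z * (z ^ n * P) = of_real \<Lambda> * poly (L.BP i j \<tau> \<sigma>) z"
    unfolding P_def mj aw2_awp[OF z0, symmetric] by (metis poly_mult poly_smult)
  have "q powr (4*l) * (q powr (-2)) ^ r \<noteq> 1" if "r < n" for r
  proof -
    have "q powr (4*l) * (q powr (-2)) ^ r = q powr (4*l - 2 * real r)"
      using q_pos by (simp add: powr_powr flip: powr_realpow powr_add)
    also have "\<dots> < q powr 0" using that l m2 by (intro L.powr_strict_q) simp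
    finally show ?thesis using q_pos by simp
  qed
  then have \<Lambda>0: "\<Lambda> \<noteq> 0" by (simp add: \<Lambda>_def qpoch_def)
  have C0: "Cc q m j \<sigma> * Cc q m i \<tau> \<noteq> 0" using M.Cc_pos[OF w(3), of \<tau>] M.Cc_pos[OF w(4), of \<sigma>] by simp
  have nn: "nn (l - m) = n" by (simp add: l)
  have D: "dd q l m j' \<tau>' \<sigma>' = Cc q l j \<sigma> * Cc q l i \<tau> / (Cc q m j \<sigma> * Cc q m i \<tau>) * (q powr (m - l) / \<Lambda>)"
    unfolding dd_def nn C \<Lambda>_def ..
  have zn: "z ^ n = of_real (q powr (real n * of_int k))"
  proof -
    have "q powi k = q powr (of_int k)" using q_pos by (simp add: powr_real_of_int')
    then have "(q powi k) ^ n = q powr (real n * of_int k)"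
      using q_pos by (simp add: powr_powr mult.commute flip: powr_realpow)
    then show ?thesis unfolding z_def by (simp flip: of_real_power_int of_real_power)
  qed
  have E: "q powr (- l) * q powr (- l * of_int k) * q powr (real n * of_int k) =
    q powr (m - l) * (q powr (- m) * q powr (- m * of_int k))"
    unfolding l by (simp add: algebra_simps flip: powr_add)
  define cl cm where "cl = Cc q l j \<sigma> * Cc q l i \<tau>" and "cm = Cc q m j \<sigma> * Cc q m i \<tau>"
  define x y g where "x = q powr (- l) * q powr (- l * of_int k)" and "y = q powr (- m) * q powr (- m * of_int k)"
    and "g = q powr (m - l)"
  \<comment> \<open>z^n compensates the different powers z^(-l) and z^(-m); the factor q^(m-l) of
    the constant d remains.\<close>
  have E': "complex_of_real x * z ^ n = of_real g * of_real y"
    using E unfolding zn x_def y_def g_def by (simp only: of_real_mult[symmetric])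
  have fin: "cl * x * bl = cl / cm * (g / la) * (cm * y * bm * P)"
    if "bm * (zn * P) = la * bl" "x * zn = g * y" "zn \<noteq> 0" "la \<noteq> 0" "cm \<noteq> 0" for cl cm x y zn bl bm la g P :: complex
  proof -
    have "cl / cm * (g / la) * (cm * y * bm * P) = cl * (g * y) * bm * P / la" using that by (simp add: field_simps)
    also have "\<dots> = cl * x * (bm * (zn * P)) / la" unfolding that(2)[symmetric] by (simp add: mult_ac)
    finally show ?thesis unfolding that(1) using that by simp
  qed
  have "of_real cl * of_real x * poly (L.BP i j \<tau> \<sigma>) z =
    of_real cl / of_real cm * (of_real g / of_real \<Lambda>) * (of_real cm * of_real y * poly (M.BP i j \<tau> \<sigma>) z * P)"
    by (rule fin[OF BP E']) (use z0 \<Lambda>0 C0 in \<open>simp_all add: cm_def\<close>)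
  then show ?thesis
    unfolding L.bfun_BP M.bfun_BP D z_def[symmetric] P_def[symmetric] cl_def[symmetric] cm_def[symmetric]
    by (simp add: cl_def[symmetric] cm_def[symmetric] x_def y_def g_def mult_ac)
qed

lemma pr1_tw: "pr1 Ga (tw k) ^ 2 = qc powi k" "pr1 Gd (tw k) ^ 2 = inverse (qc powi k)"
proof -
  have "pr1 Ga (replicate n UA) = h ^ n" "pr1 Gd (replicate n UA) = inverse h ^ n"
    "pr1 Ga (replicate n UD) = inverse h ^ n" "pr1 Gd (replicate n UD) = h ^ n" for n
    by (induction n) (simp_all add: divide_inverse mult.commute)
  moreover have "(h ^ n)^2 = qc ^ n" "(inverse h ^ n)^2 = inverse (qc ^ n)" for n
  proof -
    show "(h ^ n)^2 = qc ^ n" by (metis h_square power_mult mult.commute)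
    then show "(inverse h ^ n)^2 = inverse (qc ^ n)" by (simp add: power_inverse)
  qed
  ultimately show "pr1 Ga (tw k) ^ 2 = qc powi k" "pr1 Gd (tw k) ^ 2 = inverse (qc powi k)"
    by (auto simp: tw_def power_int_def power_inverse)
qed

lemma right_spherical_lincomb:
  assumes "right_spherical s e \<phi>" "\<And>k. k \<in> K \<Longrightarrow> right_spherical s e (\<psi> k)"
  shows "right_spherical s e (\<lambda>u. \<phi> u - C * (\<Sum>k\<in>K. c k * \<psi> k u))"
  unfolding right_spherical_def
proof
  fix Y
  have 1: "\<i> * h * \<phi> (Y @ [UB]) - \<i> / h * \<phi> (Y @ [UC]) - s * \<phi> (Y @ [UA]) + e * \<phi> (Y @ [UD]) = 0"
    using assms(1) by (simp add: right_spherical_def)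
  have "(\<Sum>k\<in>K. c k * (\<i> * h * \<psi> k (Y @ [UB]) - \<i> / h * \<psi> k (Y @ [UC]) - s * \<psi> k (Y @ [UA]) + e * \<psi> k (Y @ [UD]))) = (\<Sum>k\<in>K. 0)"
    using assms(2) by (intro sum.cong) (auto simp: right_spherical_def)
  then have 2: "\<i> * h * (\<Sum>k\<in>K. c k * \<psi> k (Y @ [UB])) - \<i> / h * (\<Sum>k\<in>K. c k * \<psi> k (Y @ [UC]))
      - s * (\<Sum>k\<in>K. c k * \<psi> k (Y @ [UA])) + e * (\<Sum>k\<in>K. c k * \<psi> k (Y @ [UD])) = 0"
    by (simp add: sum_distrib_left sum.distrib sum_subtractf ring_distribs mult_ac)
  have "x - C * x' = 0" if "x = 0" "x' = 0" for x x' :: complex using that by simp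
  from this[OF 1 2] show "\<i> * h * (\<phi> (Y @ [UB]) - C * (\<Sum>k\<in>K. c k * \<psi> k (Y @ [UB])))
      - \<i> / h * (\<phi> (Y @ [UC]) - C * (\<Sum>k\<in>K. c k * \<psi> k (Y @ [UC])))
      - s * (\<phi> (Y @ [UA]) - C * (\<Sum>k\<in>K. c k * \<psi> k (Y @ [UA])))
      + e * (\<phi> (Y @ [UD]) - C * (\<Sum>k\<in>K. c k * \<psi> k (Y @ [UD]))) = 0"
    by (simp add: algebra_simps)
qed

lemma left_spherical_lincomb:
  assumes "left_spherical s e \<phi>" "\<And>k. k \<in> K \<Longrightarrow> left_spherical s e (\<psi> k)"
  shows "left_spherical s e (\<lambda>u. \<phi> u - C * (\<Sum>k\<in>K. c k * \<psi> k u))"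
  unfolding left_spherical_def
proof
  fix Y
  have 1: "\<i> * h * \<phi> (UB # Y) - \<i> / h * \<phi> (UC # Y) - s * \<phi> (UA # Y) + e * \<phi> (UD # Y) = 0"
    using assms(1) by (simp add: left_spherical_def)
  have "(\<Sum>k\<in>K. c k * (\<i> * h * \<psi> k (UB # Y) - \<i> / h * \<psi> k (UC # Y) - s * \<psi> k (UA # Y) + e * \<psi> k (UD # Y))) = (\<Sum>k\<in>K. 0)"
    using assms(2) by (intro sum.cong) (auto simp: left_spherical_def)
  then have 2: "\<i> * h * (\<Sum>k\<in>K. c k * \<psi> k (UB # Y)) - \<i> / h * (\<Sum>k\<in>K. c k * \<psi> k (UC # Y))
      - s * (\<Sum>k\<in>K. c k * \<psi> k (UA # Y)) + e * (\<Sum>k\<in>K. c k * \<psi> k (UD # Y)) = 0"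
    by (simp add: sum_distrib_left sum.distrib sum_subtractf ring_distribs mult_ac)
  have "x - C * x' = 0" if "x = 0" "x' = 0" for x x' :: complex using that by simp
  from this[OF 1 2] show "\<i> * h * (\<phi> (UB # Y) - C * (\<Sum>k\<in>K. c k * \<psi> k (UB # Y)))
      - \<i> / h * (\<phi> (UC # Y) - C * (\<Sum>k\<in>K. c k * \<psi> k (UC # Y)))
      - s * (\<phi> (UA # Y) - C * (\<Sum>k\<in>K. c k * \<psi> k (UA # Y)))
      + e * (\<phi> (UD # Y) - C * (\<Sum>k\<in>K. c k * \<psi> k (UD # Y))) = 0"
    by (simp add: algebra_simps)
qed

text \<open>Right multiplication by the invariant element \<rho> preserves both eigenvalue equations
  of b, so the difference of the two sides satisfies them too, and \<open>spherical_zero\<close>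
  reduces the identity to torus words.\<close>

lemma b_elt_eqI:
  assumes spins: "spin q l N" "spin q m N'"
    and w: "i \<in> weights l" "j \<in> weights l" "i \<in> weights m" "j \<in> weights m"
    and torus: "\<And>k. spin.bfun q l i j \<tau> \<sigma> (tw k) =
      C * (spin.bfun q m i j \<tau> \<sigma> (tw k) * poly P ((qc powi k + inverse (qc powi k)) / 2))"
  shows "b_elt q l i j \<tau> \<sigma> = smulA q C (b_elt q m i j \<tau> \<sigma> \<otimes>\<^bsub>Aq q\<^esub> polyA q P (\<rho> q \<tau> \<sigma>))"
proof -
  interpret L: spin q l N by (rule spins)
  interpret M: spin q m N' by (rule spins)
  obtain \<xi> where \<xi>: "b_elt q l i j \<tau> \<sigma> = cls (A_rels q) \<xi>" "ev \<xi> = L.bfun i j \<tau> \<sigma>"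
    using L.b_elt_representative by blast
  obtain \<eta> where \<eta>: "b_elt q m i j \<tau> \<sigma> = cls (A_rels q) \<eta>" "ev \<eta> = M.bfun i j \<tau> \<sigma>"
    using M.b_elt_representative by blast
  define R where "R = rho_rep (SS \<tau>) (SS \<sigma>)"
  define \<zeta> where "\<zeta> = scal C * (\<eta> * (\<Sum>k\<le>degree P. scal (coeff P k) * R ^ k))"
  have R: "\<rho> q \<tau> \<sigma> = cls (A_rels q) R" by (simp add: rho_cls R_def SS_def)
  have rhs: "smulA q C (b_elt q m i j \<tau> \<sigma> \<otimes>\<^bsub>Aq q\<^esub> polyA q P (\<rho> q \<tau> \<sigma>)) = cls (A_rels q) \<zeta>"
    unfolding \<eta> R polyA_cls by (simp add: Aq_def cls_mult smulA_cls \<zeta>_def)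
  have "\<zeta> = scal C * (\<Sum>k\<le>degree P. scal (coeff P k) * (\<eta> * R ^ k))"
    unfolding \<zeta>_def sum_distrib_left[of \<eta>] scal_left_commute[of \<eta>] ..
  then have ev_\<zeta>: "ev (\<xi> - \<zeta>) = (\<lambda>u. ev \<xi> u - C * (\<Sum>k\<le>degree P. coeff P k * ev (\<eta> * R ^ k) u))"
    by (simp add: fun_eq_iff ev_diff ev_scal ev_sum)
  have "right_spherical (SS \<sigma> / \<kappa>) (SS (\<sigma> + 2*j) / \<kappa>) (ev (\<eta> * R ^ k))" for k
  proof (induction k)
    case 0
    then show ?case by (simp add: \<eta> M.bfun_right w)
  next
    case (Suc k)
    then show ?case
      by (simp only: power_Suc2 mult.assoc[symmetric] ev_mult[of "\<eta> * R ^ k"]) (rule conv_right_spherical, auto simp: R_def rho_right)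
  qed
  then have right: "right_spherical (SS \<sigma> / \<kappa>) (SS (\<sigma> + 2*j) / \<kappa>) (ev (\<xi> - \<zeta>))"
    unfolding ev_\<zeta> by (intro right_spherical_lincomb) (simp_all add: \<xi> L.bfun_right w)
  have "left_spherical (SS \<tau> / \<kappa>) (SS (\<tau> + 2*i) / \<kappa>) (ev (\<eta> * R ^ k))" for k
  proof (induction k)
    case 0
    then show ?case by (simp add: \<eta> M.bfun_left w)
  next
    case (Suc k)
    then show ?case
      by (simp only: power_Suc2 mult.assoc[symmetric] ev_mult[of "\<eta> * R ^ k"]) (rule conv_left_spherical, auto simp: R_def rho_left)
  qed
  then have left: "left_spherical (SS \<tau> / \<kappa>) (SS (\<tau> + 2*i) / \<kappa>) (ev (\<xi> - \<zeta>))"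
    unfolding ev_\<zeta> by (intro left_spherical_lincomb) (simp_all add: \<xi> L.bfun_left w)
  have "ev (\<xi> - \<zeta>) (tw k) = 0" for k
  proof -
    \<comment> \<open>Torus words are group-like, so evaluation there is multiplicative and the
      polynomial in \<rho> becomes the polynomial in its value.\<close>
    have "ev (\<eta> * R ^ r) (tw k) = ev \<eta> (tw k) * ev R (tw k) ^ r" for r
      by (induction r) (simp_all add: power_Suc2 ev_mult[of "\<eta> * R ^ r" for r] conv_group_like[OF tw_torus] mult.assoc[symmetric] del: power_Suc)
    then have "(\<Sum>r\<le>degree P. coeff P r * ev (\<eta> * R ^ r) (tw k)) = ev \<eta> (tw k) * poly P (ev R (tw k))"
      by (simp add: poly_altdef sum_distrib_left mult_ac)
    moreover have "ev R (tw k) = (qc powi k + inverse (qc powi k)) / 2"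
      by (simp add: R_def rho_torus[OF tw_torus] pr1_tw)
    ultimately show ?thesis
      by (simp add: ev_\<zeta> \<xi> \<eta> torus)
  qed
  then have "ev (\<xi> - \<zeta>) u = 0" if "set u \<subseteq> {UA, UD}" for u
    using torus_zero[OF urel_ev that] by blast
  then have "ev (\<xi> - \<zeta>) u = 0" for u
    by (rule spherical_zero[OF _ right left])
  then have "cls (A_rels q) \<xi> = cls (A_rels q) \<zeta>"
    by (intro cls_eqI) (simp add: ev_diff)
  then show ?thesis unfolding rhs \<xi> .
qed

end

theorem theorem7p5:
  fixes q \<sigma> \<tau> i j l m :: real
  assumes q: "0 < q" "q < 1"
    and ij: "i \<in> half_ints" "j \<in> half_ints" "i - j \<in> \<int>"
    and m: "m = max \<bar>i\<bar> \<bar>j\<bar>"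
    and l: "l - m \<in> \<nat>"
  shows
    "(m = i \<longrightarrow> b_elt q l i j \<tau> \<sigma> =
        smulA q (dd q l i j \<tau> \<sigma>)
          (b_elt q i i j \<tau> \<sigma> \<otimes>\<^bsub>Aq q\<^esub>
           polyA q (aw2 (nn (l - i)) (i - j) (i + j) (q powr \<tau>) (q powr \<sigma>) (q^2)) (\<rho> q \<tau> \<sigma>))) \<and>
     (m = j \<longrightarrow> b_elt q l i j \<tau> \<sigma> =
        smulA q (dd q l j i \<sigma> \<tau>)
          (b_elt q j i j \<tau> \<sigma> \<otimes>\<^bsub>Aq q\<^esub>
           polyA q (aw2 (nn (l - j)) (j - i) (i + j) (q powr \<sigma>) (q powr \<tau>) (q^2)) (\<rho> q \<tau> \<sigma>))) \<and>
     (m = - i \<longrightarrow> b_elt q l i j \<tau> \<sigma> =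
        smulA q (dd q l (- i) (- j) (- \<tau>) (- \<sigma>))
          (b_elt q (- i) i j \<tau> \<sigma> \<otimes>\<^bsub>Aq q\<^esub>
           polyA q (aw2 (nn (l + i)) (j - i) (- i - j) (q powr (- \<tau>)) (q powr (- \<sigma>)) (q^2))
             (\<rho> q \<tau> \<sigma>))) \<and>
     (m = - j \<longrightarrow> b_elt q l i j \<tau> \<sigma> =
        smulA q (dd q l (- j) (- i) (- \<sigma>) (- \<tau>))
          (b_elt q (- j) i j \<tau> \<sigma> \<otimes>\<^bsub>Aq q\<^esub>
           polyA q (aw2 (nn (l + j)) (i - j) (- i - j) (q powr (- \<sigma>)) (q powr (- \<tau>)) (q^2))
             (\<rho> q \<tau> \<sigma>)))"
proof -
  interpret quantum q by unfold_locales (use q in auto)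
  have sum_int: "i + j \<in> \<int>" using ij Ints_add[of "i - j" "2 * j"] by (simp add: half_ints_def add.commute)
  have nat: "x \<in> \<nat>" if "x \<in> \<int>" "0 \<le> x" for x :: real using that by (simp add: Nats_altdef2)
  \<comment> \<open>m is one of i, j, -i, -j, and sums and differences of any two of these are
    integers.\<close>
  have m_int: "m - i \<in> \<int>" "m + i \<in> \<int>" "m - j \<in> \<int>" "m + j \<in> \<int>"
  proof -
    have *: "j - i \<in> \<int>" "- (i + j) \<in> \<int>" "- 2 * i \<in> \<int>" "- 2 * j \<in> \<int>" "2 * i \<in> \<int>" "2 * j \<in> \<int>"
      using ij sum_int Ints_minus[OF ij(3)] Ints_minus[OF sum_int] Ints_minus[of "2 * i"] Ints_minus[of "2 * j"]
      by (simp_all add: half_ints_def)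
    have "m = i \<or> m = j \<or> m = - i \<or> m = - j" using m by linarith
    then have "m - i \<in> \<int> \<and> m + i \<in> \<int> \<and> m - j \<in> \<int> \<and> m + j \<in> \<int>"
    proof (elim disjE)
      assume "m = i"
      then have "m - i = 0" "m + i = 2 * i" "m - j = i - j" "m + j = i + j" by simp_all
      then show ?thesis using * ij(3) sum_int by (metis Ints_0)
    next
      assume "m = j"
      then have "m - i = j - i" "m + i = i + j" "m - j = 0" "m + j = 2 * j" by simp_all
      then show ?thesis using * ij(3) sum_int by (metis Ints_0)
    next
      assume "m = - i"
      then have "m - i = - 2 * i" "m + i = 0" "m - j = - (i + j)" "m + j = j - i" by simp_all
      then show ?thesis using * ij(3) sum_int by (metis Ints_0)
    next
      assume "m = - j"
      then have "m - i = - (i + j)" "m + i = i - j" "m - j = - 2 * j" "m + j = 0" by simp_all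
      then show ?thesis using * ij(3) sum_int by (metis Ints_0)
    qed
    then show "m - i \<in> \<int>" "m + i \<in> \<int>" "m - j \<in> \<int>" "m + j \<in> \<int>" by blast+
  qed
  have wm: "i \<in> weights m" "j \<in> weights m"
    using m m_int by (auto simp: weights_def intro!: nat)
  have lm: "l = m + real (nn (l - m))" using l by (auto elim!: Nats_cases)
  have wl: "x \<in> weights l" if "x \<in> weights m" for x
  proof -
    have "l - x = (l - m) + (m - x)" "l + x = (l - m) + (m + x)" by simp_all
    then show ?thesis using that l Nats_add unfolding weights_def by (metis (mono_tags, lifting) mem_Collect_eq)
  qed
  \<comment> \<open>Case (i) for transformed parameters: m is the extreme weight, attached to
    \<tau>', and j' the other weight, attached to \<sigma>'.\<close>
  have main: "b_elt q l i j \<tau> \<sigma> = smulA q (dd q l m j' \<tau>' \<sigma>') (b_elt q m i j \<tau> \<sigma> \<otimes>\<^bsub>Aq q\<^esub>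
      polyA q (aw2 (nn (l - m)) (m - j') (m + j') (q powr \<tau>') (q powr \<sigma>') (q^2)) (\<rho> q \<tau> \<sigma>))"
    if j': "m - j' \<in> \<int>" "m + j' \<in> \<int>" "\<bar>j'\<bar> \<le> m"
      and hal: "\<And>z. al qc (SS \<sigma>) (SS \<tau>) z = al qc (SS \<sigma>') (SS \<tau>') z"
      and hga: "\<And>z. ga qc (SS (\<sigma> + 2*j)) (SS (\<tau> + 2*i)) z = ga qc (SS (\<sigma>' + 2*j')) (SS (\<tau>' + 2*m)) z"
      and hbe: "\<And>Q z. be qc Q (SS \<sigma>) (SS \<tau>) (SS (\<sigma> + 2*j)) (SS (\<tau> + 2*i)) z =
        be qc Q (SS \<sigma>') (SS \<tau>') (SS (\<sigma>' + 2*j')) (SS (\<tau>' + 2*m)) z"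
      and C: "\<And>l N. spin q l N \<Longrightarrow> i \<in> weights l \<Longrightarrow> j \<in> weights l \<Longrightarrow> Cc q l j' \<sigma>' * Cc q l m \<tau>' = Cc q l j \<sigma> * Cc q l i \<tau>"
    for j' \<sigma>' \<tau>'
  proof -
    have "m - j' \<in> \<nat>" "m + j' \<in> \<nat>" using j' by (auto intro!: nat)
    then obtain n1 n2 where n: "m - j' = real n1" "m + j' = real n2" by (auto elim!: Nats_cases)
    have sm: "spin q m (n1 + n2)" by unfold_locales (use n in simp)
    have sl: "spin q l (n1 + n2 + 2 * nn (l - m))"
    proof unfold_locales
      have "2 * l = 2 * m + 2 * real (nn (l - m))" using lm by linarith
      then show "2 * l = real (n1 + n2 + 2 * nn (l - m))" using n by simp
    qed
    have "j' = m - real n1" using n by simp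
    then show ?thesis
      using b_elt_eqI[OF sl sm wl[OF wm(1)] wl[OF wm(2)] wm]
        matrix_element_torus[OF sl sm wl[OF wm(1)] wl[OF wm(2)] wm lm _ hal hga hbe C[OF sl wl[OF wm(1)] wl[OF wm(2)]] C[OF sm wm]]
      by blast
  qed
  have neg: "SS (- x + 2 * - y) = - SS (x + 2 * y)" for x y
    using SS_minus[of "x + 2 * y"] by simp
  show ?thesis
  proof (intro conjI impI)
    assume mi: "m = i"
    show "b_elt q l i j \<tau> \<sigma> = smulA q (dd q l i j \<tau> \<sigma>)
          (b_elt q i i j \<tau> \<sigma> \<otimes>\<^bsub>Aq q\<^esub>
           polyA q (aw2 (nn (l - i)) (i - j) (i + j) (q powr \<tau>) (q powr \<sigma>) (q^2)) (\<rho> q \<tau> \<sigma>))"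
      using main[of j \<sigma> \<tau>] m m_int unfolding mi by simp
  next
    \<comment> \<open>Exchange (\<sigma>, j) with (\<tau>, i).\<close>
    assume mj: "m = j"
    have "b_elt q l i j \<tau> \<sigma> = smulA q (dd q l m i \<sigma> \<tau>) (b_elt q m i j \<tau> \<sigma> \<otimes>\<^bsub>Aq q\<^esub>
      polyA q (aw2 (nn (l - m)) (m - i) (m + i) (q powr \<sigma>) (q powr \<tau>) (q^2)) (\<rho> q \<tau> \<sigma>))"
    proof (rule main)
      show "m - i \<in> \<int>" "m + i \<in> \<int>" "\<bar>i\<bar> \<le> m" using m_int m by simp_all
    qed (simp_all only: mj al_swap[of _ "SS \<sigma>"] ga_swap[of _ "SS (\<sigma> + 2 * j)"] be_swap[of _ _ "SS \<sigma>"], rule mult.commute)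
    then show "b_elt q l i j \<tau> \<sigma> = smulA q (dd q l j i \<sigma> \<tau>)
          (b_elt q j i j \<tau> \<sigma> \<otimes>\<^bsub>Aq q\<^esub>
           polyA q (aw2 (nn (l - j)) (j - i) (i + j) (q powr \<sigma>) (q powr \<tau>) (q^2)) (\<rho> q \<tau> \<sigma>))"
      by (simp only: mj add.commute)
  next
    \<comment> \<open>Negate \<sigma>, \<tau>, i and j.\<close>
    assume mi: "m = - i"
    have "b_elt q l i j \<tau> \<sigma> = smulA q (dd q l m (- j) (- \<tau>) (- \<sigma>)) (b_elt q m i j \<tau> \<sigma> \<otimes>\<^bsub>Aq q\<^esub>
      polyA q (aw2 (nn (l - m)) (m - - j) (m + - j) (q powr - \<tau>) (q powr - \<sigma>) (q^2)) (\<rho> q \<tau> \<sigma>))"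
    proof (rule main)
      show "m - - j \<in> \<int>" "m + - j \<in> \<int>" "\<bar>- j\<bar> \<le> m" using m_int m by simp_all
    qed (simp_all only: mi neg SS_minus radial_neg spin.Cc_neg)
    then show "b_elt q l i j \<tau> \<sigma> = smulA q (dd q l (- i) (- j) (- \<tau>) (- \<sigma>))
          (b_elt q (- i) i j \<tau> \<sigma> \<otimes>\<^bsub>Aq q\<^esub>
           polyA q (aw2 (nn (l + i)) (j - i) (- i - j) (q powr (- \<tau>)) (q powr (- \<sigma>)) (q^2)) (\<rho> q \<tau> \<sigma>))"
      by (simp add: mi)
  next
    \<comment> \<open>Both symmetries together.\<close>
    assume mj: "m = - j"
    have "b_elt q l i j \<tau> \<sigma> = smulA q (dd q l m (- i) (- \<sigma>) (- \<tau>)) (b_elt q m i j \<tau> \<sigma> \<otimes>\<^bsub>Aq q\<^esub>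
      polyA q (aw2 (nn (l - m)) (m - - i) (m + - i) (q powr - \<sigma>) (q powr - \<tau>) (q^2)) (\<rho> q \<tau> \<sigma>))"
    proof (rule main)
      show "m - - i \<in> \<int>" "m + - i \<in> \<int>" "\<bar>- i\<bar> \<le> m" using m_int m by simp_all
    qed (simp_all only: mj neg SS_minus radial_neg spin.Cc_neg al_swap[of _ "SS \<sigma>"] ga_swap[of _ "SS (\<sigma> + 2 * j)"] be_swap[of _ _ "SS \<sigma>"], rule mult.commute)
    then show "b_elt q l i j \<tau> \<sigma> = smulA q (dd q l (- j) (- i) (- \<sigma>) (- \<tau>))
          (b_elt q (- j) i j \<tau> \<sigma> \<otimes>\<^bsub>Aq q\<^esub>
           polyA q (aw2 (nn (l + j)) (i - j) (- i - j) (q powr (- \<sigma>)) (q powr (- \<tau>)) (q^2)) (\<rho> q \<tau> \<sigma>))"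
      by (simp add: mj minus_diff_commute)
  qed
qed

end
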